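(* Up to isomorphism of quivers, there are exactly $4$ non-planar cluster quivers of exceptional finite mutation type, i.e. exactly $4$ non-planar quivers in the union of the mutation-equivalence classes of quivers of the eleven types $E_6,E_7,E_8,E_6^{(1)},E_7^{(1)},E_8^{(1)},E_6^{(1,1)},E_7^{(1,1)},E_8^{(1,1)},X_6,X_7$. All four have genus $1$. Three of them lie in the mutation-equivalence class of $X_6$ and one lies in the mutation-equivalence class of $X_7$. They are the following quivers (all arrows of multiplicity one). Three quivers with vertices $c,a_1,a_2,b_1,b_2,d$, in the class of $X_6$: (A) arrows $c\to b_1$, $c\to b_2$, $a_1\to c$, $a_2\to c$, $d\to c$, $b_1\to d$, $b_2\to d$, $a_1\to b_1$, $a_2\to b_2$, $b_1\to a_2$, $b_2\to a_1$; (B) the opposite quiver of (A), obtained by reversing all its arrows; (C) arrows $a_1\to c$, $a_2\to c$, $c\to d$, $d\to b_1$, $d\to b_2$, $a_1\to b_1$, $b_1\to a_2$, $a_2\to b_2$, $b_2\to a_1$. One quiver with vertices $c,a_1,a_2,a_3,b_1,b_2,b_3$, in the class of $X_7$: (D) arrows $a_i\to c$, $c\to b_i$, $a_i\to b_i$ for $1\le i\le 3$, and $b_i\to a_j$ for all $i\ne j$ in $\{1,2,3\}$.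
   Context: A cluster quiver is a finite quiver without loops and oriented 2-cycles. The quiver mutation $\mu_k$ at a vertex $k$ transforms a cluster quiver $Q$ as follows: (1) for every path $i\to k\to j$ add a new arrow $i\to j$; (2) reverse all arrows incident with $k$; (3) delete all 2-cycles (a maximal collection of disjoint ones). Two cluster quivers are mutation equivalent if one is obtained from the other (up to isomorphism) by a finite sequence of mutations. The genus of a quiver is the genus of its underlying graph (multiple edges and orientation ignored), i.e. the minimal genus of a closed oriented surface on which the graph can be drawn without crossings; a quiver is planar if its genus is $0$. The eleven exceptional types are the mutation classes of the following quivers. - $E_6,E_7,E_8$ (Dynkin) and $E_6^{(1)},E_7^{(1)},E_8^{(1)}$ (affine, also written $\tilde E_6,\tilde E_7,\tilde E_8$): any orientation of the corresponding Dynkin, respectively extended Dynkin, tree (all orientations of a tree are mutation equivalent). - $E_6^{(1,1)},E_7^{(1,1)},E_8^{(1,1)}$: take vertices $u,v$ with two arrows $u\to v$, three vertices $w_1,w_2,w_3$ with arrows $v\to w_i\to u$, and attach to $w_1,w_2,w_3$ linear arms (paths of single arrows, of any orientation) having respectively $(1,1,1)$, $(0,2,2)$, $(0,1,4)$ additional vertices; the resulting quivers have $8,9,10$ vertices and are of types $E_6^{(1,1)},E_7^{(1,1)},E_8^{(1,1)}$, respectively. - $X_7$: vertices $c,a_1,b_1,a_2,b_2,a_3,b_3$, with two arrows $a_i\to b_i$ and single arrows $b_i\to c$, $c\to a_i$ for $i=1,2,3$. - $X_6$: vertices $c,a_1,b_1,a_2,b_2,d$, with two arrows $a_i\to b_i$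 and single arrows $b_i\to c$, $c\to a_i$ for $i=1,2$, and one arrow between $c$ and $d$ (either orientation gives the same mutation class). *)

theory Defs
  imports "HOL-Analysis.Analysis"
begin

section \<open>Quivers and mutation\<close>

text \<open>
  A quiver is given by its vertex set and the number of arrows between any two
  vertices; the arrows themselves carry no names, as everything below is up to isomorphism.
\<close>

record 'a quiver =
  verts :: "'a set"
  arrows :: "'a \<Rightarrow> 'a \<Rightarrow> nat"

definition cluster_quiver :: "'a quiver \<Rightarrow> bool" where
  "cluster_quiver Q \<longleftrightarrow>
     finite (verts Q) \<and>
     (\<forall>i j. 0 < arrows Q i j \<longrightarrow> i \<in> verts Q \<and> j \<in> verts Q) \<and>
     (\<forall>i. arrows Q i i = 0) \<and>
     (\<forall>i j. \<not> (0 < arrows Q i j \<and> 0 < arrows Q j i))"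

definition quiver_iso :: "'a quiver \<Rightarrow> 'b quiver \<Rightarrow> bool"  (infix "\<cong>\<^sub>q" 50) where
  "Q \<cong>\<^sub>q R \<longleftrightarrow>
     (\<exists>f. bij_betw f (verts Q) (verts R) \<and>
          (\<forall>i \<in> verts Q. \<forall>j \<in> verts Q. arrows R (f i) (f j) = arrows Q i j))"

definition opposite :: "'a quiver \<Rightarrow> 'a quiver" where
  "opposite Q = Q\<lparr>arrows := (\<lambda>i j. arrows Q j i)\<rparr>"

definition add_composites :: "'a \<Rightarrow> 'a quiver \<Rightarrow> 'a quiver" where
  "add_composites k Q =
     Q\<lparr>arrows := (\<lambda>i j. arrows Q i j + arrows Q i k * arrows Q k j)\<rparr>"

definition reverse_at :: "'a \<Rightarrow> 'a quiver \<Rightarrow> 'a quiver" where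
  "reverse_at k Q =
     Q\<lparr>arrows := (\<lambda>i j. if i = k \<or> j = k then arrows Q j i else arrows Q i j)\<rparr>"

text \<open>
  A maximal collection of disjoint 2-cycles on \<open>i\<close> and \<open>j\<close> uses up
  \<open>min (arrows Q i j) (arrows Q j i)\<close> arrows in each direction, which is what
  truncated subtraction removes.
\<close>

definition delete_2cycles :: "'a quiver \<Rightarrow> 'a quiver" where
  "delete_2cycles Q = Q\<lparr>arrows := (\<lambda>i j. arrows Q i j - arrows Q j i)\<rparr>"

definition mutate :: "'a \<Rightarrow> 'a quiver \<Rightarrow> 'a quiver" where
  "mutate k Q = delete_2cycles (reverse_at k (add_composites k Q))"

definition mutation_equivalent :: "'a quiver \<Rightarrow> 'b quiver \<Rightarrow> bool" where
  "mutation_equivalent Q R \<longleftrightarrow> (\<exists>ks. set ks \<subseteq> verts Q \<and> fold mutate ks Q \<cong>\<^sub>q R)"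


section \<open>Genus\<close>

definition underlying_edges :: "'a quiver \<Rightarrow> 'a set set" where
  "underlying_edges Q = {{i, j} | i j. 0 < arrows Q i j}"

definition drawable_on :: "'a quiver \<Rightarrow> 'b::topological_space set \<Rightarrow> bool" where
  "drawable_on Q S \<longleftrightarrow>
     (\<exists>(p :: 'a \<Rightarrow> 'b) (\<gamma> :: 'a set \<Rightarrow> real \<Rightarrow> 'b).
        inj_on p (verts Q) \<and> p ` verts Q \<subseteq> S \<and>
        (\<forall>e \<in> underlying_edges Q.
           arc (\<gamma> e) \<and> path_image (\<gamma> e) \<subseteq> S \<and>
           {pathstart (\<gamma> e), pathfinish (\<gamma> e)} = p ` e \<and>
           path_image (\<gamma> e) \<inter> p ` verts Q = p ` e) \<and>
        (\<forall>e \<in> underlying_edges Q. \<forall>e' \<in> underlying_edges Q. e \<noteq> e' \<longrightarrow>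
           path_image (\<gamma> e) \<inter> path_image (\<gamma> e') \<subseteq> p ` verts Q))"

text \<open>
  By the classification of surfaces there is exactly one closed connected oriented surface of
  each genus \<open>g\<close> up to homeomorphism. It is modelled as the boundary of a
  handlebody in 3-space, namely of a rectangular slab through which \<open>g\<close> disjoint
  square holes have been drilled, so that it is a sphere for \<open>g = 0\<close> and a torus
  for \<open>g = 1\<close>.
\<close>

definition drilled_slab :: "nat \<Rightarrow> (real \<times> real \<times> real) set" where
  "drilled_slab g =
     {(x, y, z). 0 \<le> x \<and> x \<le> 2 * real g + 1 \<and> 0 \<le> y \<and> y \<le> 3 \<and> 0 \<le> z \<and> z \<le> 1} -
     (\<Union>i<g. {(x, y, z). 2 * real i + 1 < x \<and> x < 2 * real i + 2 \<and> 1 < y \<and> y < 2})"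

definition closed_surface :: "nat \<Rightarrow> (real \<times> real \<times> real) set" where
  "closed_surface g = frontier (drilled_slab g)"

lemma closed_surface_0_homeomorphic_sphere:
  "closed_surface 0 homeomorphic sphere (0 :: real \<times> real \<times> real) 1"
proof -
  have slab: "drilled_slab 0 = cbox (0, 0, 0) (1, 3, 1)"
    by (auto simp: drilled_slab_def cbox_Pair_eq)
  have ne: "interior (drilled_slab 0) \<noteq> {}"
  proof -
    have "(1/2, 3/2, 1/2) \<in> box (0, 0, 0) ((1, 3, 1) :: real \<times> real \<times> real)"
      by (auto simp: box_def Basis_prod_def)
    then show ?thesis
      unfolding slab interior_cbox by blast
  qed
  show ?thesis
    unfolding closed_surface_def
    using homeomorphic_rel_frontiers_convex_bounded_sets
        [of "drilled_slab 0" "cball (0 :: real \<times> real \<times> real) 1"]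
      ne rel_frontier_nonempty_interior[OF ne]
    by (simp add: slab aff_dim_nonempty_interior aff_dim_cball rel_frontier_cball)
qed

definition genus :: "'a quiver \<Rightarrow> nat" where
  "genus Q = (LEAST g. drawable_on Q (closed_surface g))"

definition planar :: "'a quiver \<Rightarrow> bool" where
  "planar Q \<longleftrightarrow> genus Q = 0"


section \<open>The exceptional types\<close>

definition quiver_of :: "nat \<Rightarrow> (nat \<times> nat) list \<Rightarrow> nat quiver" where
  "quiver_of n as = \<lparr>verts = {..<n}, arrows = (\<lambda>i j. count_list as (i, j))\<rparr>"

definition orientations :: "('a \<times> 'a) list \<Rightarrow> ('a \<times> 'a) list set" where
  "orientations es = {as. list_all2 (\<lambda>(i, j) a. a = (i, j) \<or> a = (j, i)) es as}"

text \<open>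
  The quivers on \<open>{..<n}\<close> with prescribed arrows \<open>as\<close>
  and further edges \<open>es\<close> that may be oriented in any way.
\<close>

definition quivers_with :: "nat \<Rightarrow> (nat \<times> nat) list \<Rightarrow> (nat \<times> nat) list \<Rightarrow> nat quiver set" where
  "quivers_with n as es = {quiver_of n (as @ bs) | bs. bs \<in> orientations es}"

text \<open>
  \<open>E6_1\<close> stands for $E_6^{(1)}$ and \<open>E6_11\<close> for $E_6^{(1,1)}$, etc.
\<close>

datatype exceptional_type =
    E6 | E7 | E8 | E6_1 | E7_1 | E8_1 | E6_11 | E7_11 | E8_11 | X6 | X7

definition elliptic_core :: "(nat \<times> nat) list" where
  "elliptic_core =
     (let u = 0; v = 1; w1 = 2; w2 = 3; w3 = 4
      in [(u, v), (u, v), (v, w1), (w1, u), (v, w2), (w2, u), (v, w3), (w3, u)])"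

definition X_block :: "nat \<Rightarrow> nat \<Rightarrow> nat \<Rightarrow> (nat \<times> nat) list" where
  "X_block c a b = [(a, b), (a, b), (b, c), (c, a)]"

fun initial_quivers :: "exceptional_type \<Rightarrow> nat quiver set" where
  "initial_quivers E6 = quivers_with 6 [] [(0,1), (1,2), (2,3), (3,4), (2,5)]"
| "initial_quivers E7 = quivers_with 7 [] [(0,1), (1,2), (2,3), (3,4), (4,5), (2,6)]"
| "initial_quivers E8 = quivers_with 8 [] [(0,1), (1,2), (2,3), (3,4), (4,5), (5,6), (2,7)]"
| "initial_quivers E6_1 = quivers_with 7 [] [(0,1), (1,2), (2,3), (3,4), (2,5), (5,6)]"
| "initial_quivers E7_1 = quivers_with 8 [] [(0,1), (1,2), (2,3), (3,4), (4,5), (5,6), (3,7)]"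
| "initial_quivers E8_1 =
     quivers_with 9 [] [(0,1), (1,2), (2,3), (3,4), (4,5), (5,6), (6,7), (2,8)]"
| "initial_quivers E6_11 = quivers_with 8 elliptic_core [(2,5), (3,6), (4,7)]"
| "initial_quivers E7_11 = quivers_with 9 elliptic_core [(3,5), (5,6), (4,7), (7,8)]"
| "initial_quivers E8_11 = quivers_with 10 elliptic_core [(3,5), (4,6), (6,7), (7,8), (8,9)]"
| "initial_quivers X6 = quivers_with 6 (X_block 0 1 2 @ X_block 0 3 4) [(0,5)]"
| "initial_quivers X7 = quivers_with 7 (X_block 0 1 2 @ X_block 0 3 4 @ X_block 0 5 6) []"

text \<open>
  Every finite quiver is isomorphic to one whose vertices are natural numbers, so
  counting isomorphism classes of the latter counts all quivers up to isomorphism.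
\<close>

definition mutation_class :: "exceptional_type \<Rightarrow> nat quiver set" where
  "mutation_class T =
     {Q. cluster_quiver Q \<and> (\<exists>S \<in> initial_quivers T. mutation_equivalent S Q)}"

definition nonplanar_exceptional :: "nat quiver set" where
  "nonplanar_exceptional = {Q \<in> (\<Union>T. mutation_class T). \<not> planar Q}"

definition iso_rel :: "(nat quiver \<times> nat quiver) set" where
  "iso_rel = {(Q, R). cluster_quiver Q \<and> cluster_quiver R \<and> Q \<cong>\<^sub>q R}"

definition iso_class :: "nat quiver \<Rightarrow> nat quiver set" where
  "iso_class Q = iso_rel `` {Q}"


section \<open>The non-planar quivers\<close>

definition quiver_A :: "nat quiver" where
  "quiver_A =
     (let c = 0; a1 = 1; a2 = 2; b1 = 3; b2 = 4; d = 5
      in quiver_of 6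
        [(c, b1), (c, b2), (a1, c), (a2, c), (d, c), (b1, d), (b2, d),
         (a1, b1), (a2, b2), (b1, a2), (b2, a1)])"

definition quiver_B :: "nat quiver" where
  "quiver_B = opposite quiver_A"

definition quiver_C :: "nat quiver" where
  "quiver_C =
     (let c = 0; a1 = 1; a2 = 2; b1 = 3; b2 = 4; d = 5
      in quiver_of 6
        [(a1, c), (a2, c), (c, d), (d, b1), (d, b2),
         (a1, b1), (b1, a2), (a2, b2), (b2, a1)])"

definition quiver_D :: "nat quiver" where
  "quiver_D =
     (let c = 0; a1 = 1; a2 = 2; a3 = 3; b1 = 4; b2 = 5; b3 = 6
      in quiver_of 7
        [(a1, c), (a2, c), (a3, c), (c, b1), (c, b2), (c, b3),
         (a1, b1), (a2, b2), (a3, b3),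
         (b1, a2), (b1, a3), (b2, a1), (b2, a3), (b3, a1), (b3, a2)])"

end

theory Submission
  imports Defs
begin

text \<open>
  Only eleven classes have to be searched, and most of them hide in three. Deleting a vertex
  commutes with mutation at the other vertices, and each of the six (affine) Dynkin trees of type
  E is a full subquiver of one of the three elliptic quivers. So every quiver of the nine types E is
  a full subquiver of a quiver in the class of \<open>E6_11\<close>, \<open>E7_11\<close> or \<open>E8_11\<close>; together these
  have some 6300 members. There is one planar graph on 11 vertices, with 26 edges, that contains
  the underlying graphs of all of them. Hence one straight-line drawing (\<open>host_drawing\<close>) shows that
  all nine classes are planar, once it is known which quivers occur in them.

  That knowledge is a finite closure computation. Each elliptic class is stable under reversing all
  arrows and under reversing a single bridge, so it is listed up to these two operations: 1151 words
  in the edges of the host graph, in which a bridge carries no orientation. A word stands for a set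
  of skew-symmetric integer forms. Mutation acts on forms (\<open>skew_of_mutate\<close>) and is computed on
  words symbolically (\<open>matches_mutate\<close>). For every word and every vertex the catalogue names the
  word that the mutated one is isomorphic to, up to sign, and the isomorphism is found by a
  backtracking search (\<open>matching_sound\<close>). Altogether this yields \<open>closed_E_words\<close>. The classes of
  \<open>X6\<close> and \<open>X7\<close> are treated in the same way with five words, of which two are drawn in the host
  graph and the other three are the quivers A (with its opposite B), C and D.

  These four contain the complete bipartite graph K33. That K33 is not drawable on the sphere
  follows from the theorem on theta curves: three arcs between two points cut the plane into three
  faces, each of which is bounded by only two of the arcs, while a further vertex that is joined to
  an inner point of each arc would have to touch all three (\<open>K33_plane_inside\<close>).

  On the other hand the four quivers have at most seven vertices, and the complete graph K7 is
  drawable on the torus: the triangular lattice in the plane, divided by a sublattice of index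
  seven, is a triangulation of the torus with graph K7 (\<open>K7_on_torus\<close>). So their genus is 1.
\<close>

section \<open>Symbolic exchange matrices\<close>

text \<open>
  The vertices of the host graph. Forms on these eleven points contain the quivers of all types,
  the unused points being isolated.
\<close>

datatype node = N0 | N1 | N2 | N3 | N4 | N5 | N6 | N7 | N8 | N9 | N10

text \<open>
  Vectors indexed by the host vertices are kept as constructor terms, so that access, update
  and pointwise operations are single rewrite steps.
\<close>

datatype 'a row = Row 'a 'a 'a 'a 'a 'a 'a 'a 'a 'a 'a

fun sel :: "'a row \<Rightarrow> node \<Rightarrow> 'a" where
  "sel (Row a b c d e f g h i j k) N0 = a"
| "sel (Row a b c d e f g h i j k) N1 = b"
| "sel (Row a b c d e f g h i j k) N2 = c"
| "sel (Row a b c d e f g h i j k) N3 = d"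
| "sel (Row a b c d e f g h i j k) N4 = e"
| "sel (Row a b c d e f g h i j k) N5 = f"
| "sel (Row a b c d e f g h i j k) N6 = g"
| "sel (Row a b c d e f g h i j k) N7 = h"
| "sel (Row a b c d e f g h i j k) N8 = i"
| "sel (Row a b c d e f g h i j k) N9 = j"
| "sel (Row a b c d e f g h i j k) N10 = k"

fun upd :: "node \<Rightarrow> 'a \<Rightarrow> 'a row \<Rightarrow> 'a row" where
  "upd N0 x (Row a b c d e f g h i j k) = Row x b c d e f g h i j k"
| "upd N1 x (Row a b c d e f g h i j k) = Row a x c d e f g h i j k"
| "upd N2 x (Row a b c d e f g h i j k) = Row a b x d e f g h i j k"
| "upd N3 x (Row a b c d e f g h i j k) = Row a b c x e f g h i j k"
| "upd N4 x (Row a b c d e f g h i j k) = Row a b c d x f g h i j k"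
| "upd N5 x (Row a b c d e f g h i j k) = Row a b c d e x g h i j k"
| "upd N6 x (Row a b c d e f g h i j k) = Row a b c d e f x h i j k"
| "upd N7 x (Row a b c d e f g h i j k) = Row a b c d e f g x i j k"
| "upd N8 x (Row a b c d e f g h i j k) = Row a b c d e f g h x j k"
| "upd N9 x (Row a b c d e f g h i j k) = Row a b c d e f g h i x k"
| "upd N10 x (Row a b c d e f g h i j k) = Row a b c d e f g h i j x"

fun map_row :: "('a \<Rightarrow> 'b) \<Rightarrow> 'a row \<Rightarrow> 'b row" where
  "map_row \<phi> (Row a b c d e f g h i j k) =
     Row (\<phi> a) (\<phi> b) (\<phi> c) (\<phi> d) (\<phi> e) (\<phi> f) (\<phi> g) (\<phi> h) (\<phi> i) (\<phi> j) (\<phi> k)"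

fun zip_row :: "('a \<Rightarrow> 'b \<Rightarrow> 'c) \<Rightarrow> 'a row \<Rightarrow> 'b row \<Rightarrow> 'c row" where
  "zip_row \<phi> (Row a b c d e f g h i j k) (Row a' b' c' d' e' f' g' h' i' j' k') =
     Row (\<phi> a a') (\<phi> b b') (\<phi> c c') (\<phi> d d') (\<phi> e e') (\<phi> f f') (\<phi> g g') (\<phi> h h')
       (\<phi> i i') (\<phi> j j') (\<phi> k k')"

lemma sel_upd: "sel (upd n x r) m = (if m = n then x else sel r m)"
  by (cases r; cases n; cases m; simp)

lemma sel_map_row: "sel (map_row \<phi> r) n = \<phi> (sel r n)"
  by (cases r; cases n; simp)

lemma sel_zip_row: "sel (zip_row \<phi> r s) n = \<phi> (sel r n) (sel s n)"
  by (cases r; cases s; cases n; simp)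

definition nodes :: "node list" where
  "nodes = [N0, N1, N2, N3, N4, N5, N6, N7, N8, N9, N10]"

lemma set_nodes: "set nodes = UNIV"
  unfolding nodes_def using node.exhaust by auto

text \<open>
  An entry is what is known about one value of a skew form: the value itself, or that it is 1 or
  -1 (the two orientations of a bridge), or nothing at all. \<open>Bad\<close> absorbs all overflow and all
  operations on unoriented bridges, so that no side conditions arise; since \<open>Bad\<close> allows every
  value and is never accepted in the search below, it can only make a check fail.
\<close>

datatype entry = Zero | Out1 | Out2 | In1 | In2 | Free | Bad

type_synonym matrix = "entry row row"

fun allows :: "entry \<Rightarrow> int \<Rightarrow> bool" where
  "allows Zero x \<longleftrightarrow> x = 0"
| "allows Out1 x \<longleftrightarrow> x = 1"
| "allows Out2 x \<longleftrightarrow> x = 2"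
| "allows In1 x \<longleftrightarrow> x = - 1"
| "allows In2 x \<longleftrightarrow> x = - 2"
| "allows Free x \<longleftrightarrow> x = 1 \<or> x = - 1"
| "allows Bad x \<longleftrightarrow> True"

fun inc :: "entry \<Rightarrow> entry" where
  "inc Zero = Out1" | "inc Out1 = Out2" | "inc Out2 = Bad" | "inc In1 = Zero" | "inc In2 = In1"
| "inc Free = Bad" | "inc Bad = Bad"

fun neg :: "entry \<Rightarrow> entry" where
  "neg Zero = Zero" | "neg Out1 = In1" | "neg Out2 = In2" | "neg In1 = Out1" | "neg In2 = Out2"
| "neg Free = Free" | "neg Bad = Bad"

fun dec :: "entry \<Rightarrow> entry" where
  "dec Zero = In1" | "dec Out1 = Zero" | "dec Out2 = Out1" | "dec In1 = In2" | "dec In2 = Bad"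
| "dec Free = Bad" | "dec Bad = Bad"

fun up :: "entry \<Rightarrow> entry \<Rightarrow> entry" where
  "up b Zero = b" | "up b Out1 = inc b" | "up b Out2 = inc (inc b)" | "up b In1 = b" | "up b In2 = b"
| "up b Free = Bad" | "up b Bad = Bad"

fun down :: "entry \<Rightarrow> entry \<Rightarrow> entry" where
  "down b Zero = b" | "down b Out1 = b" | "down b Out2 = b" | "down b In1 = dec b"
| "down b In2 = dec (dec b)" | "down b Free = Bad" | "down b Bad = Bad"

fun spoil :: "entry \<Rightarrow> entry" where "spoil b = Bad"

text \<open>
  The effect of mutation on row \<open>r\<close> of the matrix: \<open>s\<close> is the row of the mutated vertex and the first
  argument is the entry that links the two.
\<close>

fun through :: "entry \<Rightarrow> entry row \<Rightarrow> entry row \<Rightarrow> entry row" where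
  "through Zero r s = r"
| "through Out1 r s = zip_row up r s"
| "through Out2 r s = zip_row up (zip_row up r s) s"
| "through In1 r s = zip_row down r s"
| "through In2 r s = zip_row down (zip_row down r s) s"
| "through Free r s = map_row spoil r"
| "through Bad r s = map_row spoil r"

fun mutate_row :: "node \<Rightarrow> entry row \<Rightarrow> entry row \<Rightarrow> entry row" where
  "mutate_row k s r = upd k (neg (sel r k)) (through (sel r k) r s)"

fun mutate_matrix :: "node \<Rightarrow> matrix \<Rightarrow> matrix" where
  "mutate_matrix k M = upd k (map_row neg (sel M k)) (map_row (mutate_row k (sel M k)) M)"

datatype letter = Arrow node node | Bridge node node

fun set2 :: "node \<Rightarrow> node \<Rightarrow> entry \<Rightarrow> matrix \<Rightarrow> matrix" where
  "set2 p q x M = upd p (upd q x (sel M p)) M"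

fun add_letter :: "letter \<Rightarrow> matrix \<Rightarrow> matrix" where
  "add_letter (Arrow p q) M =
     set2 q p (dec (sel (sel M q) p)) (set2 p q (inc (sel (sel M p) q)) M)"
| "add_letter (Bridge p q) M = set2 q p Free (set2 p q Free M)"

definition zero_row :: "entry row" where
  "zero_row = Row Zero Zero Zero Zero Zero Zero Zero Zero Zero Zero Zero"

definition zero_matrix :: matrix where
  "zero_matrix = Row zero_row zero_row zero_row zero_row zero_row zero_row zero_row zero_row
     zero_row zero_row zero_row"

fun matrix_of :: "letter list \<Rightarrow> matrix" where
  "matrix_of [] = zero_matrix"
| "matrix_of (a # w) = add_letter a (matrix_of w)"

datatype state = State "node option row" "node list" matrix

fun fits :: "letter \<Rightarrow> entry \<Rightarrow> bool" where
  "fits (Arrow p q) Zero = False" | "fits (Arrow p q) Out1 = True" | "fits (Arrow p q) Out2 = True"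
| "fits (Arrow p q) In1 = False" | "fits (Arrow p q) In2 = False"
| "fits (Arrow p q) Free = False" | "fits (Arrow p q) Bad = False"
| "fits (Bridge p q) Zero = False" | "fits (Bridge p q) Out1 = True" | "fits (Bridge p q) Out2 = False"
| "fits (Bridge p q) In1 = True" | "fits (Bridge p q) In2 = False"
| "fits (Bridge p q) Free = True" | "fits (Bridge p q) Bad = False"

fun remove_letter :: "letter \<Rightarrow> node \<Rightarrow> node \<Rightarrow> matrix \<Rightarrow> matrix" where
  "remove_letter (Arrow p q) x y M =
     set2 y x (inc (sel (sel M y) x)) (set2 x y (dec (sel (sel M x) y)) M)"
| "remove_letter (Bridge p q) x y M = set2 y x Zero (set2 x y Zero M)"

fun assign :: "letter \<Rightarrow> node \<Rightarrow> node \<Rightarrow> node option row \<Rightarrow> node option row" where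
  "assign (Arrow p q) x y \<tau> = upd p (Some x) (upd q (Some y) \<tau>)"
| "assign (Bridge p q) x y \<tau> = upd p (Some x) (upd q (Some y) \<tau>)"

fun without :: "node \<Rightarrow> node list \<Rightarrow> node list" where
  "without x [] = []"
| "without x (y # ys) = (if x = y then ys else y # without x ys)"

fun cands :: "node option \<Rightarrow> node list \<Rightarrow> node list" where
  "cands None us = us"
| "cands (Some x) us = [x]"

fun keep_if :: "bool \<Rightarrow> 'a \<Rightarrow> 'a list \<Rightarrow> 'a list" where
  "keep_if True x xs = x # xs"
| "keep_if False x xs = xs"

fun fitting :: "letter \<Rightarrow> entry row \<Rightarrow> node list \<Rightarrow> node list" where
  "fitting a r [] = []"
| "fitting a r (y # ys) = keep_if (fits a (sel r y)) y (fitting a r ys)"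

fun successors :: "letter \<Rightarrow> node \<Rightarrow> node list \<Rightarrow> state \<Rightarrow> state list \<Rightarrow> state list" where
  "successors a x [] s ss = ss"
| "successors a x (y # ys) (State \<tau> us M) ss =
     State (assign a x y \<tau>) (without x (without y us)) (remove_letter a x y M)
       # successors a x ys (State \<tau> us M) ss"

fun extensions :: "letter \<Rightarrow> node list \<Rightarrow> node list \<Rightarrow> state \<Rightarrow> state list" where
  "extensions a [] ys s = []"
| "extensions a (x # xs) ys (State \<tau> us M) =
     successors a x (fitting a (sel M x) ys) (State \<tau> us M) (extensions a xs ys (State \<tau> us M))"

fun extend :: "letter \<Rightarrow> state \<Rightarrow> state list" where
  "extend (Arrow p q) (State \<tau> us M) =
     extensions (Arrow p q) (cands (sel \<tau> p) us) (cands (sel \<tau> q) us) (State \<tau> us M)"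
| "extend (Bridge p q) (State \<tau> us M) =
     extensions (Bridge p q) (cands (sel \<tau> p) us) (cands (sel \<tau> q) us) (State \<tau> us M)"

fun exhausted :: "state \<Rightarrow> bool" where
  "exhausted (State \<tau> us M) \<longleftrightarrow> M = zero_matrix"

text \<open>
  Depth-first search for an assignment of the vertices of a word to the vertices of a matrix. A
  state holds the partial assignment, the unused matrix vertices and the matrix from which the
  arrows matched so far have been removed. The word is matched if nothing is left of the matrix.
  Words are spelled so that successive letters are adjacent, which keeps the search narrow.
\<close>

fun matching :: "letter list \<Rightarrow> state list \<Rightarrow> bool" where
  "matching w [] = False"
| "matching [] (s # ss) = (if exhausted s then True else matching [] ss)"
| "matching (a # w) (s # ss) = (if matching w (extend a s) then True else matching (a # w) ss)"

datatype target = Target bool node "letter list"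

fun start :: "letter list \<Rightarrow> node \<Rightarrow> node option row" where
  "start (Arrow p q # w) x =
     upd p (Some x) (Row None None None None None None None None None None None)"
| "start (Bridge p q # w) x =
     upd p (Some x) (Row None None None None None None None None None None None)"
| "start [] x = Row None None None None None None None None None None None"

fun hits :: "target \<Rightarrow> matrix \<Rightarrow> bool" where
  "hits (Target False x w) M = matching w [State (start w x) (without x nodes) M]"
| "hits (Target True x w) M = matching w [State (start w x) (without x nodes) (map_row (map_row neg) M)]"

fun is_Free :: "entry \<Rightarrow> bool" where
  "is_Free Zero = False" | "is_Free Out1 = False" | "is_Free Out2 = False" | "is_Free In1 = False"
| "is_Free In2 = False" | "is_Free Free = True" | "is_Free Bad = False"

fun is_Zero :: "entry \<Rightarrow> bool" where
  "is_Zero Zero = True" | "is_Zero Out1 = False" | "is_Zero Out2 = False" | "is_Zero In1 = False"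
| "is_Zero In2 = False" | "is_Zero Free = False" | "is_Zero Bad = False"

fun all_zero :: "entry row \<Rightarrow> node list \<Rightarrow> bool" where
  "all_zero r [] = True"
| "all_zero r (y # ys) = (if is_Zero (sel r y) then all_zero r ys else False)"

text \<open>
  Mutation at a vertex whose only neighbour is at the other end of a bridge just reverses that
  bridge, which an unoriented bridge does not notice.
\<close>

fun idle :: "entry row \<Rightarrow> node list \<Rightarrow> bool" where
  "idle r [] = True"
| "idle r (y # ys) = (if is_Zero (sel r y) then idle r ys
     else if is_Free (sel r y) then all_zero r ys else False)"

text \<open>
  Before a mutation the bridges at the mutated vertex have to be oriented, in all possible ways;
  the other bridges are not affected by it and stay unoriented.
\<close>

fun split_free :: "node list \<Rightarrow> node \<Rightarrow> matrix \<Rightarrow> matrix list" where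
  "split_free [] k M = [M]"
| "split_free (y # ys) k M =
     (if is_Free (sel (sel M k) y)
      then split_free ys k (set2 k y Out1 (set2 y k In1 M)) @ split_free ys k (set2 k y In1 (set2 y k Out1 M))
      else split_free ys k M)"

fun mutate_all :: "node \<Rightarrow> matrix list \<Rightarrow> matrix list" where
  "mutate_all k [] = []"
| "mutate_all k (M # Ms) = mutate_matrix k M # mutate_all k Ms"

fun mutants :: "node list \<Rightarrow> matrix \<Rightarrow> matrix list" where
  "mutants [] M = []"
| "mutants (k # ks) M =
     (if idle (sel M k) nodes then mutants ks M
      else mutate_all k (split_free nodes k M) @ mutants ks M)"

fun all_hit :: "matrix list \<Rightarrow> target list \<Rightarrow> bool" where
  "all_hit [] ts = True"
| "all_hit (M # Ms) [] = False"
| "all_hit (M # Ms) (t # ts) = (if hits t M then all_hit Ms ts else False)"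

definition closed_under :: "letter list \<Rightarrow> target list \<Rightarrow> bool" where
  "closed_under w ts = all_hit (mutants nodes (matrix_of w)) ts"

section \<open>Mutation of skew forms and soundness of the symbolic calculus\<close>

abbreviation entry_of :: "matrix \<Rightarrow> node \<Rightarrow> node \<Rightarrow> entry" where
  "entry_of M i j \<equiv> sel (sel M i) j"

definition skew :: "('a \<Rightarrow> 'a \<Rightarrow> int) \<Rightarrow> bool" where
  "skew S \<longleftrightarrow> (\<forall>i j. S j i = - S i j)"

text \<open>
  A matrix of entries stands for the set of integer forms that match it.
\<close>

definition matches :: "(node \<Rightarrow> node \<Rightarrow> int) \<Rightarrow> matrix \<Rightarrow> bool" where
  "matches S M \<longleftrightarrow> (\<forall>i j. allows (entry_of M i j) (S i j))"

text \<open>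
  Mutation of the exchange matrix, in the form that treats both signs alike.
\<close>

definition mut :: "'a \<Rightarrow> ('a \<Rightarrow> 'a \<Rightarrow> int) \<Rightarrow> 'a \<Rightarrow> 'a \<Rightarrow> int" where
  "mut k S i j =
     (if i = k \<or> j = k then - S i j
      else S i j + max (S i k) 0 * max (S k j) 0 - max (- S i k) 0 * max (- S k j) 0)"

lemma skewD: "skew S \<Longrightarrow> S j i = - S i j"
  unfolding skew_def by blast

lemma skewI: "(\<And>i j. S j i = - S i j) \<Longrightarrow> skew S"
  unfolding skew_def by blast

lemma skew_uminus: "skew S \<Longrightarrow> skew (\<lambda>i j. - S i j)"
  by (rule skewI, erule arg_cong[where f = uminus, OF skewD])

lemma skew_relabel: "skew S \<Longrightarrow> skew (\<lambda>i j. S (\<pi> i) (\<pi> j))"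
  by (rule skewI) (rule skewD)

lemma skew_diag: "skew S \<Longrightarrow> S i i = 0"
  using skewD[of S i i] by simp

lemma skew_mut:
  assumes "skew S" shows "skew (mut k S)"
  unfolding skew_def
proof (intro allI)
  fix i j
  have "S j i = - S i j" "S j k = - S k j" "S k i = - S i k"
    using skewD[OF assms] by blast+
  then show "mut k S j i = - mut k S i j"
    by (simp add: mut_def mult.commute)
qed

lemma mut_uminus: "mut k (\<lambda>i j. - S i j) = (\<lambda>i j. - mut k S i j)"
  by (intro ext) (simp add: mut_def)

lemma mut_relabel:
  assumes "bij \<pi>"
  shows "mut k (\<lambda>i j. S (\<pi> i) (\<pi> j)) = (\<lambda>i j. mut (\<pi> k) S (\<pi> i) (\<pi> j))"
  using assms by (intro ext) (auto simp: mut_def bij_def inj_eq)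

lemma allows_inc: "allows e x \<Longrightarrow> allows (inc e) (x + 1)"
  by (cases e) auto

lemma allows_dec: "allows e x \<Longrightarrow> allows (dec e) (x - 1)"
  by (cases e) auto

lemma allows_neg: "allows e x \<Longrightarrow> allows (neg e) (- x)"
  by (cases e) auto

lemma allows_up:
  assumes b: "allows b x" and c: "allows c y"
  shows "allows (up b c) (x + max y 0)"
proof -
  have 1: "allows (inc b) (x + 1)" by (rule allows_inc[OF b])
  have 2: "allows (inc (inc b)) (x + 2)" using allows_inc[OF 1] by (simp add: add.assoc)
  show ?thesis by (cases c) (use b c 1 2 in simp_all)
qed

lemma allows_down:
  assumes b: "allows b x" and c: "allows c y"
  shows "allows (down b c) (x - max (- y) 0)"
proof -
  have 1: "allows (dec b) (x - 1)" by (rule allows_dec[OF b])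
  have 2: "allows (dec (dec b)) (x - 2)" using allows_dec[OF 1] by simp
  show ?thesis by (cases c) (use b c 1 2 in simp_all)
qed

lemma allows_through:
  assumes a: "allows a z" and b: "allows (sel r j) x" and c: "allows (sel s j) y"
  shows "allows (sel (through a r s) j) (x + max z 0 * max y 0 - max (- z) 0 * max (- y) 0)"
proof -
  define u where "u = max y 0"
  define d where "d = max (- y) 0"
  have 1: "allows (up (sel r j) (sel s j)) (x + u)"
    unfolding u_def by (rule allows_up[OF b c])
  have 2: "allows (up (up (sel r j) (sel s j)) (sel s j)) (x + 2 * u)"
    using allows_up[OF 1 c] unfolding u_def by (simp add: algebra_simps)
  have 3: "allows (down (sel r j) (sel s j)) (x - d)"
    unfolding d_def by (rule allows_down[OF b c])
  have 4: "allows (down (down (sel r j) (sel s j)) (sel s j)) (x - 2 * d)"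
    using allows_down[OF 3 c] unfolding d_def by (simp add: algebra_simps)
  show ?thesis
    unfolding u_def[symmetric] d_def[symmetric]
    by (cases a) (use a b 1 2 3 4 in \<open>simp_all add: sel_zip_row sel_map_row\<close>)
qed

text \<open>
  The symbolic mutation is sound for every matrix because each of its steps over-approximates:
  overflow and unoriented entries only produce \<open>Bad\<close>.
\<close>

lemma matches_mutate:
  assumes "skew S" and M: "matches S M"
  shows "matches (mut k S) (mutate_matrix k M)"
  unfolding matches_def
proof (intro allI)
  fix i j
  have e: "allows (entry_of M i j) (S i j)" for i j
    using M by (simp add: matches_def)
  show "allows (entry_of (mutate_matrix k M) i j) (mut k S i j)"
  proof (cases "i = k \<or> j = k")
    case True
    then show ?thesis
      using allows_neg[OF e[of i j]] by (auto simp: sel_upd sel_map_row mut_def)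
  next
    case False
    then show ?thesis
      using allows_through[OF e[of i k] e[of i j] e[of k j]]
      by (simp add: sel_upd sel_map_row mut_def)
  qed
qed

fun loopless :: "letter \<Rightarrow> bool" where
  "loopless (Arrow p q) \<longleftrightarrow> p \<noteq> q"
| "loopless (Bridge p q) \<longleftrightarrow> p \<noteq> q"

fun tail_of :: "letter \<Rightarrow> node" where
  "tail_of (Arrow p q) = p"
| "tail_of (Bridge p q) = p"

fun head_of :: "letter \<Rightarrow> node" where
  "head_of (Arrow p q) = q"
| "head_of (Bridge p q) = q"

lemma sel_zero_row: "sel zero_row i = Zero"
  unfolding zero_row_def by (cases i) simp_all

lemma entry_of_zero: "entry_of zero_matrix i j = Zero"
  unfolding zero_matrix_def by (cases i) (simp_all add: sel_zero_row)

lemma entry_of_set2: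
  "entry_of (set2 p q x M) i j = (if i = p \<and> j = q then x else entry_of M i j)"
  by (simp add: sel_upd)

lemma entry_of_add_Arrow:
  "p \<noteq> q \<Longrightarrow> entry_of (add_letter (Arrow p q) M) i j =
     (if i = p \<and> j = q then inc (entry_of M i j)
      else if i = q \<and> j = p then dec (entry_of M i j) else entry_of M i j)"
  by (auto simp: sel_upd)

lemma entry_of_add_Bridge:
  "entry_of (add_letter (Bridge p q) M) i j =
     (if i = p \<and> j = q \<or> i = q \<and> j = p then Free else entry_of M i j)"
  by (auto simp: sel_upd)

lemma entry_of_remove_Arrow:
  "x \<noteq> y \<Longrightarrow> entry_of (remove_letter (Arrow p q) x y M) i j =
     (if i = x \<and> j = y then dec (entry_of M i j)
      else if i = y \<and> j = x then inc (entry_of M i j) else entry_of M i j)"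
  by (auto simp: sel_upd)

lemma entry_of_remove_Bridge:
  "entry_of (remove_letter (Bridge p q) x y M) i j =
     (if i = x \<and> j = y \<or> i = y \<and> j = x then Zero else entry_of M i j)"
  by (auto simp: sel_upd)

lemma neg_inc: "neg (inc e) = dec (neg e)" and neg_dec: "neg (dec e) = inc (neg e)"
  by (cases e; simp)+

lemma add_letter_antisym:
  assumes a: "loopless a" and M: "entry_of M j i = neg (entry_of M i j)"
  shows "entry_of (add_letter a M) j i = neg (entry_of (add_letter a M) i j)"
proof (cases a)
  case (Arrow p q)
  with a have pq: "p \<noteq> q" by simp
  consider "i = p \<and> j = q" | "i = q \<and> j = p" | "\<not> (i = p \<and> j = q)" "\<not> (i = q \<and> j = p)"
    by blast
  then show ?thesis
    unfolding Arrow entry_of_add_Arrow[OF pq]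
    by cases (use pq M in \<open>auto simp: neg_inc neg_dec\<close>)
next
  case (Bridge p q)
  show ?thesis
    unfolding Bridge entry_of_add_Bridge
    by (cases "i = p \<and> j = q \<or> i = q \<and> j = p") (use M in auto)
qed

lemma matrix_of_antisym:
  "\<forall>a\<in>set w. loopless a \<Longrightarrow> entry_of (matrix_of w) j i = neg (entry_of (matrix_of w) i j)"
proof (induction w)
  case (Cons a w)
  have "loopless a" and w: "\<forall>a\<in>set w. loopless a"
    using Cons.prems by auto
  then show ?case
    unfolding matrix_of.simps by (intro add_letter_antisym Cons.IH[OF w])
qed (simp only: matrix_of.simps entry_of_zero neg.simps)

fun state_ok :: "state \<Rightarrow> bool" where
  "state_ok (State \<tau> us M) \<longleftrightarrow>
     distinct us \<and> (\<forall>p x. sel \<tau> p = Some x \<longrightarrow> x \<notin> set us) \<and>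
     (\<forall>p q x. sel \<tau> p = Some x \<and> sel \<tau> q = Some x \<longrightarrow> p = q)"

text \<open>
  A partial assignment is extended to all host vertices in an arbitrary bijective way; the
  vertices outside the word are isolated, so it does not matter how.
\<close>

definition completes :: "(node \<Rightarrow> node) \<Rightarrow> node option row \<Rightarrow> bool" where
  "completes \<pi> \<tau> \<longleftrightarrow> bij \<pi> \<and> (\<forall>p x. sel \<tau> p = Some x \<longrightarrow> \<pi> p = x)"

fun solves :: "letter list \<Rightarrow> state \<Rightarrow> bool" where
  "solves w (State \<tau> us M) \<longleftrightarrow>
     (\<forall>S. skew S \<and> matches S M \<longrightarrow>
        (\<exists>\<pi>. completes \<pi> \<tau> \<and> matches (\<lambda>i j. S (\<pi> i) (\<pi> j)) (matrix_of w)))"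

lemma finite_UNIV_node: "finite (UNIV :: node set)"
  unfolding set_nodes[symmetric] by simp

lemma completes_exists:
  assumes "\<forall>p q x. sel \<tau> p = Some x \<and> sel \<tau> q = Some x \<longrightarrow> p = q"
  shows "\<exists>\<pi>. completes \<pi> \<tau>"
proof -
  define D where "D = {p. sel \<tau> p \<noteq> None}"
  define f where "f p = the (sel \<tau> p)" for p
  have inj: "inj_on f D"
  proof (rule inj_onI)
    fix p q assume "p \<in> D" "q \<in> D" and eq: "f p = f q"
    then obtain x y where "sel \<tau> p = Some x" "sel \<tau> q = Some y"
      unfolding D_def by blast
    with eq assms show "p = q"
      unfolding f_def by (metis option.sel)
  qed
  have fin: "finite (X :: node set)" for X
    by (rule finite_subset[OF subset_UNIV finite_UNIV_node])
  have "card (- D) = card (- f ` D)"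
    using card_image[OF inj] by (simp add: Compl_eq_Diff_UNIV card_Diff_subset[OF fin])
  then obtain g where g: "bij_betw g (- D) (- f ` D)"
    using finite_same_card_bij[OF fin fin] by blast
  define \<pi> where "\<pi> p = (if p \<in> D then f p else g p)" for p
  have 1: "bij_betw \<pi> D (f ` D)"
    using inj unfolding \<pi>_def bij_betw_def inj_on_def by auto
  have 2: "bij_betw \<pi> (- D) (- f ` D)"
    using g by (rule bij_betw_cong[THEN iffD1, rotated]) (simp add: \<pi>_def)
  have "bij_betw \<pi> (D \<union> - D) (f ` D \<union> - f ` D)"
    using 1 2 by (rule bij_betw_combine) simp
  then have "bij \<pi>" by simp
  moreover have "\<pi> p = x" if "sel \<tau> p = Some x" for p x
    using that by (simp add: \<pi>_def D_def f_def)
  ultimately show ?thesis unfolding completes_def by blast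
qed

lemma set_fitting: "set (fitting a r ys) = {y \<in> set ys. fits a (sel r y)}"
proof (induction ys)
  case (Cons y ys)
  then show ?case by (cases "fits a (sel r y)") auto
qed simp

lemma set_successors:
  "set (successors a x ys (State \<tau> us M) ss) =
     set ss \<union> (\<lambda>y. State (assign a x y \<tau>) (without x (without y us)) (remove_letter a x y M)) ` set ys"
  by (induction ys) auto

lemma set_extensions:
  "set (extensions a xs ys (State \<tau> us M)) =
     (\<Union>x\<in>set xs. (\<lambda>y. State (assign a x y \<tau>) (without x (without y us)) (remove_letter a x y M))
        ` {y \<in> set ys. fits a (entry_of M x y)})"
  by (induction xs) (auto simp: set_successors set_fitting)

lemma extend_cases:
  assumes "s' \<in> set (extend a (State \<tau> us M))"
  obtains x y where "x \<in> set (cands (sel \<tau> (tail_of a)) us)" "y \<in> set (cands (sel \<tau> (head_of a)) us)"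
    "fits a (entry_of M x y)"
    "s' = State (assign a x y \<tau>) (without x (without y us)) (remove_letter a x y M)"
  using assms by (cases a) (auto simp: set_extensions)

lemma sel_assign:
  "sel (assign a x y \<tau>) p =
     (if p = tail_of a then Some x else if p = head_of a then Some y else sel \<tau> p)"
  by (cases a) (auto simp: sel_upd)

lemma set_without: "distinct us \<Longrightarrow> set (without x us) = set us - {x}"
  by (induction us) auto

lemma distinct_without: "distinct us \<Longrightarrow> distinct (without x us)"
  by (induction us) (auto simp: set_without)

lemma fits_nonzero: "fits a e \<Longrightarrow> allows e z \<Longrightarrow> z \<noteq> 0"
  by (cases a; cases e) auto

lemma cands_cases:
  assumes "x \<in> set (cands t us)"
  shows "t = Some x \<or> t = None \<and> x \<in> set us"
  using assms by (cases t) auto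

text \<open>
  Taking one letter off the word and one arrow off the form are inverse to adding that letter, so
  a solution of the remaining problem solves the given one. The two ends of a letter cannot be
  assigned to the same point, because a skew form vanishes on the diagonal.
\<close>

lemma solves_step:
  assumes s: "state_ok (State \<tau> us M)" and a: "loopless a"
    and s': "s' \<in> set (extend a (State \<tau> us M))"
    and IH: "state_ok s' \<Longrightarrow> solves w s'"
  shows "solves (a # w) (State \<tau> us M)"
  unfolding solves.simps
proof (intro allI impI, elim conjE)
  fix S assume S: "skew S" and M: "matches S M"
  have e: "allows (entry_of M i j) (S i j)" for i j
    using M by (simp add: matches_def)
  from s' obtain x y where x: "x \<in> set (cands (sel \<tau> (tail_of a)) us)"
    and y: "y \<in> set (cands (sel \<tau> (head_of a)) us)"
    and fit: "fits a (entry_of M x y)"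
    and s'_eq: "s' = State (assign a x y \<tau>) (without x (without y us)) (remove_letter a x y M)"
    by (rule extend_cases)
  have "S x y \<noteq> 0"
    using fits_nonzero[OF fit e] .
  then have xy: "x \<noteq> y"
    using skew_diag[OF S] by metis
  have pq: "tail_of a \<noteq> head_of a"
    using a by (cases a) auto
  note xc = cands_cases[OF x] and yc = cands_cases[OF y]
  have "state_ok s'"
    using s xc yc xy pq unfolding s'_eq
    by (auto simp: sel_assign set_without distinct_without split: if_splits)
  then have sol: "solves w s'" by (rule IH)
  have ext: "\<pi> p = z" if "completes \<pi> (assign a x y \<tau>)" "sel \<tau> p = Some z" for \<pi> p z
    using that s xc yc unfolding completes_def sel_assign by (metis option.distinct(1) option.sel)
  have comp: "completes \<pi> \<tau>" and px: "\<pi> (tail_of a) = x" and qy: "\<pi> (head_of a) = y"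
    if "completes \<pi> (assign a x y \<tau>)" for \<pi>
    using that ext[OF that] pq unfolding completes_def by (auto simp: sel_assign)
  show "\<exists>\<pi>. completes \<pi> \<tau> \<and> matches (\<lambda>i j. S (\<pi> i) (\<pi> j)) (matrix_of (a # w))"
  proof (cases a)
    case a_eq: (Arrow p q)
    define S' where "S' i j = (if i = x \<and> j = y then S i j - 1 else if i = y \<and> j = x then S i j + 1
        else S i j)" for i j
    have "skew S'"
      using xy skewD[OF S, of x y] by (intro skewI) (auto simp: S'_def intro: skewD[OF S])
    moreover have "matches S' (remove_letter a x y M)"
      unfolding matches_def a_eq entry_of_remove_Arrow[OF xy]
      using e by (auto simp: S'_def allows_dec allows_inc)
    ultimately obtain \<pi> where \<pi>: "completes \<pi> (assign a x y \<tau>)"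
      and m: "matches (\<lambda>i j. S' (\<pi> i) (\<pi> j)) (matrix_of w)"
      using sol unfolding s'_eq solves.simps by blast
    have inj: "\<pi> i = \<pi> j \<longleftrightarrow> i = j" for i j
      using \<pi> unfolding completes_def bij_def by (simp add: inj_eq)
    have ip: "\<pi> i = x \<longleftrightarrow> i = p" and iq: "\<pi> i = y \<longleftrightarrow> i = q" for i
      using px[OF \<pi>] qy[OF \<pi>] inj[of i p] inj[of i q] unfolding a_eq by simp_all
    have "matches (\<lambda>i j. S (\<pi> i) (\<pi> j)) (matrix_of (a # w))"
      unfolding matches_def
    proof (intro allI)
      fix i j
      have "allows (entry_of (matrix_of w) i j) (S' (\<pi> i) (\<pi> j))"
        using m by (simp add: matches_def)
      moreover have "S' (\<pi> i) (\<pi> j) =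
          (if i = p \<and> j = q then S (\<pi> i) (\<pi> j) - 1
           else if i = q \<and> j = p then S (\<pi> i) (\<pi> j) + 1 else S (\<pi> i) (\<pi> j))"
        unfolding S'_def by (simp only: ip iq)
      moreover have "p \<noteq> q" using pq a_eq by simp
      ultimately show "allows (entry_of (matrix_of (a # w)) i j) (S (\<pi> i) (\<pi> j))"
        using allows_inc[of "entry_of (matrix_of w) i j" "S (\<pi> i) (\<pi> j) - 1"]
          allows_dec[of "entry_of (matrix_of w) i j" "S (\<pi> i) (\<pi> j) + 1"]
        unfolding a_eq matrix_of.simps entry_of_add_Arrow[OF \<open>p \<noteq> q\<close>]
        by (auto split: if_splits)
    qed
    with comp[OF \<pi>] show ?thesis by blast
  next
    case a_eq: (Bridge p q)
    define S' where "S' i j = (if i = x \<and> j = y \<or> i = y \<and> j = x then 0 else S i j)" for i j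
    have "skew S'"
      by (rule skewI) (auto simp: S'_def intro: skewD[OF S])
    moreover have "matches S' (remove_letter a x y M)"
      unfolding matches_def a_eq entry_of_remove_Bridge
      using e by (auto simp: S'_def)
    ultimately obtain \<pi> where \<pi>: "completes \<pi> (assign a x y \<tau>)"
      and m: "matches (\<lambda>i j. S' (\<pi> i) (\<pi> j)) (matrix_of w)"
      using sol unfolding s'_eq solves.simps by blast
    have inj: "\<pi> i = \<pi> j \<longleftrightarrow> i = j" for i j
      using \<pi> unfolding completes_def bij_def by (simp add: inj_eq)
    have one: "S x y = 1 \<or> S x y = - 1"
      using fit e[of x y] unfolding a_eq by (cases "entry_of M x y") auto
    then have one': "S y x = 1 \<or> S y x = - 1"
      using skewD[OF S, of x y] by force
    have ip: "\<pi> i = x \<longleftrightarrow> i = p" and iq: "\<pi> i = y \<longleftrightarrow> i = q" for i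
      using px[OF \<pi>] qy[OF \<pi>] inj[of i p] inj[of i q] unfolding a_eq by simp_all
    have "matches (\<lambda>i j. S (\<pi> i) (\<pi> j)) (matrix_of (a # w))"
      unfolding matches_def
    proof (intro allI)
      fix i j
      have "allows (entry_of (matrix_of w) i j) (S' (\<pi> i) (\<pi> j))"
        using m by (simp add: matches_def)
      then show "allows (entry_of (matrix_of (a # w)) i j) (S (\<pi> i) (\<pi> j))"
        using one one'
        unfolding a_eq matrix_of.simps S'_def entry_of_add_Bridge ip iq
        by (auto simp: ip[symmetric] iq[symmetric] split: if_splits)
    qed
    with comp[OF \<pi>] show ?thesis by blast
  qed
qed

lemma matching_sound:
  "matching w ss \<Longrightarrow> \<forall>a\<in>set w. loopless a \<Longrightarrow> \<exists>s\<in>set ss. state_ok s \<longrightarrow> solves w s"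
proof (induction w ss rule: matching.induct)
  case (2 s ss)
  show ?case
  proof (cases "exhausted s")
    case True
    obtain \<tau> us M where s: "s = State \<tau> us M" by (cases s)
    have "solves [] s" if ok: "state_ok s"
    proof -
      obtain \<pi> where "completes \<pi> \<tau>"
        using completes_exists[of \<tau>] ok unfolding s state_ok.simps by blast
      moreover have "S i j = 0" if "matches S M" for S i j
        using that True unfolding s matches_def by (simp add: entry_of_zero)
      ultimately show ?thesis
        unfolding s by (auto simp: matches_def entry_of_zero)
    qed
    then show ?thesis by auto
  next
    case False
    with 2 show ?thesis by auto
  qed
next
  case (3 a w s ss)
  show ?case
  proof (cases "matching w (extend a s)")
    case True
    with 3 obtain s' where s': "s' \<in> set (extend a s)" and IH: "state_ok s' \<longrightarrow> solves w s'"
      by auto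
    obtain \<tau> us M where s: "s = State \<tau> us M" by (cases s)
    have "solves (a # w) s" if "state_ok s"
      unfolding s
      by (rule solves_step[OF that[unfolded s] _ s'[unfolded s]]) (use IH 3(4) in auto)
    then show ?thesis by auto
  next
    case False
    with 3 show ?thesis by auto
  qed
qed simp

text \<open>
  The form is described by the word up to relabelling and up to reversing all arrows.
\<close>

definition realizes :: "(node \<Rightarrow> node \<Rightarrow> int) \<Rightarrow> letter list \<Rightarrow> bool" where
  "realizes S w \<longleftrightarrow>
     (\<exists>\<pi>. bij \<pi> \<and> (matches (\<lambda>i j. S (\<pi> i) (\<pi> j)) (matrix_of w) \<or>
        matches (\<lambda>i j. - S (\<pi> i) (\<pi> j)) (matrix_of w)))"

fun target_word :: "target \<Rightarrow> letter list" where
  "target_word (Target b x w) = w"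

lemma distinct_nodes: "distinct nodes"
  by (simp add: nodes_def)

lemma hits_sound:
  assumes "hits t M" and loop: "\<forall>a\<in>set (target_word t). loopless a"
    and S: "skew S" and M: "matches S M"
  shows "realizes S (target_word t)"
proof (cases t)
  case t: (Target b x w)
  have none: "sel (Row None None None None None None None None None None None) p = None" for p
    by (cases p) simp_all
  have "sel (start w x) p = Some y \<Longrightarrow> y = x" for p y
    by (cases "(w, x)" rule: start.cases) (auto simp: sel_upd none split: if_splits)
  moreover have "sel (start w x) p = Some y \<Longrightarrow> sel (start w x) q = Some y \<Longrightarrow> p = q" for p q y
    by (cases "(w, x)" rule: start.cases) (auto simp: sel_upd none split: if_splits)
  ultimately have ok: "state_ok (State (start w x) (without x nodes) N)" for N
    by (auto simp: set_without distinct_without distinct_nodes)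
  have "\<exists>\<pi>. bij \<pi> \<and> matches (\<lambda>i j. T (\<pi> i) (\<pi> j)) (matrix_of w)"
    if "matching w [State (start w x) (without x nodes) N]" "skew T" "matches T N" for N T
    using matching_sound[OF that(1)] loop that(2,3) ok[of N] t by (auto simp: completes_def)
  note sol = this
  show ?thesis
  proof (cases b)
    case False
    then show ?thesis
      using sol[OF _ S M] assms(1) t unfolding realizes_def by auto
  next
    case True
    have "skew (\<lambda>i j. - S i j)"
      using S by (rule skew_uminus)
    moreover have "matches (\<lambda>i j. - S i j) (map_row (map_row neg) M)"
      using M by (simp add: matches_def sel_map_row allows_neg)
    ultimately show ?thesis
      using sol[of "map_row (map_row neg) M" "\<lambda>i j. - S i j"] assms(1) t True
      unfolding realizes_def by auto
  qed
qed

text \<open>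
  A form takes a definite value on each bridge, and one of the orientations tried agrees with it.
\<close>

lemma split_free_sound:
  "skew S \<Longrightarrow> matches S M \<Longrightarrow> \<exists>M'\<in>set (split_free ys k M). matches S M'"
proof (induction ys arbitrary: M)
  case (Cons y ys)
  show ?case
  proof (cases "is_Free (entry_of M k y)")
    case True
    have e: "allows (entry_of M i j) (S i j)" for i j
      using Cons.prems by (simp add: matches_def)
    have fr: "entry_of M k y = Free"
      using True by (cases "entry_of M k y") auto
    then have "S k y = 1 \<or> S k y = - 1"
      using e[of k y] by simp
    then consider "S k y = 1" "S y k = - 1" | "S k y = - 1" "S y k = 1"
      using skewD[OF Cons.prems(1), of k y] by force
    then show ?thesis
    proof cases
      case 1
      then have "matches S (set2 k y Out1 (set2 y k In1 M))"
        using e by (simp add: matches_def entry_of_set2 del: set2.simps)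
      with True Cons show ?thesis by (auto simp del: set2.simps)
    next
      case 2
      then have "matches S (set2 k y In1 (set2 y k Out1 M))"
        using e by (simp add: matches_def entry_of_set2 del: set2.simps)
      with True Cons show ?thesis by (auto simp del: set2.simps)
    qed
  qed (use Cons in auto)
qed simp

lemma set_mutate_all: "set (mutate_all k Ms) = mutate_matrix k ` set Ms"
  by (induction Ms) (auto simp del: mutate_matrix.simps)

lemma mutants_sound:
  assumes "skew S" "matches S M" "k \<in> set ks" "\<not> idle (sel M k) nodes"
  shows "\<exists>B\<in>set (mutants ks M). matches (mut k S) B"
proof -
  obtain M' where "M' \<in> set (split_free nodes k M)" "matches S M'"
    using split_free_sound assms(1,2) by blast
  then have "mutate_matrix k M' \<in> mutate_matrix k ` set (split_free nodes k M)"
    and m: "matches (mut k S) (mutate_matrix k M')"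
    using matches_mutate[OF assms(1)] by blast+
  moreover have "mutate_matrix k ` set (split_free nodes k M) \<subseteq> set (mutants ks M)"
    using assms(3,4)
    by (induction ks) (auto simp: set_mutate_all simp del: mutate_matrix.simps)
  ultimately show ?thesis by blast
qed

lemma all_zero_iff: "all_zero r ys \<longleftrightarrow> (\<forall>y\<in>set ys. sel r y = Zero)"
proof (induction ys)
  case (Cons y ys)
  then show ?case by (cases "sel r y") auto
qed simp

lemma idleD:
  "idle r ys \<Longrightarrow> distinct ys \<Longrightarrow>
     (\<forall>y\<in>set ys. sel r y = Zero) \<or>
     (\<exists>z\<in>set ys. sel r z = Free \<and> (\<forall>y\<in>set ys. y \<noteq> z \<longrightarrow> sel r y = Zero))"
proof (induction ys)
  case (Cons y ys)
  then show ?case by (cases "sel r y") (auto simp: all_zero_iff)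
qed simp

text \<open>
  No path passes through a vertex with a single neighbour, so that mutation there only changes
  signs.
\<close>

lemma idle_sound:
  assumes S: "skew S" and M: "matches S M" and idle: "idle (sel M k) nodes"
    and anti: "\<And>i j. entry_of M j i = neg (entry_of M i j)"
  shows "matches (mut k S) M"
proof -
  have e: "allows (entry_of M i j) (S i j)" for i j
    using M by (simp add: matches_def)
  obtain z where z: "\<And>y. y \<noteq> z \<Longrightarrow> entry_of M k y = Zero"
    "entry_of M k z = Zero \<or> entry_of M k z = Free"
    using idleD[OF idle distinct_nodes] set_nodes by blast
  have S0: "S k y = 0" "S y k = 0" if "y \<noteq> z" for y
    using e[of k y] z(1)[OF that] skewD[OF S, of k y] by auto
  have row: "entry_of M k y = Zero \<or> entry_of M k y = Free" for y
    using z by metis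
  have row': "entry_of M y k = Zero \<or> entry_of M y k = Free" for y
    using row[of y] by (metis anti neg.simps(1,6))
  have fl: "allows (entry_of M i j) (- S i j)" if "i = k \<or> j = k" for i j
    using that row[of j] row'[of i] e[of i j] by auto
  have "max (S i k) 0 * max (S k j) 0 - max (- S i k) 0 * max (- S k j) 0 = 0" for i j
  proof (cases "i = z \<and> j = z")
    case True
    then show ?thesis
      using skewD[OF S, of k z] by auto
  qed (use S0 in auto)
  then have "mut k S i j = (if i = k \<or> j = k then - S i j else S i j)" for i j
    unfolding mut_def by (smt (verit))
  then show ?thesis
    unfolding matches_def using e fl by auto
qed

lemma all_hitD: "all_hit Ms ts \<Longrightarrow> B \<in> set Ms \<Longrightarrow> \<exists>t\<in>set ts. hits t B"
  by (induction Ms ts rule: all_hit.induct) (auto split: if_splits)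

lemma realizes_self: "matches S (matrix_of w) \<Longrightarrow> realizes S w"
  unfolding realizes_def by (rule exI[of _ id]) auto

lemma closed_under_sound:
  assumes c: "closed_under w ts" and w: "\<forall>a\<in>set w. loopless a"
    and ts: "\<forall>t\<in>set ts. \<forall>a\<in>set (target_word t). loopless a"
    and S: "skew S" and M: "matches S (matrix_of w)"
  shows "\<exists>w'\<in>insert w (target_word ` set ts). realizes (mut k S) w'"
proof (cases "idle (sel (matrix_of w) k) nodes")
  case True
  then show ?thesis
    using idle_sound[OF S M True] matrix_of_antisym[OF w] realizes_self by blast
next
  case False
  then obtain B where B: "B \<in> set (mutants nodes (matrix_of w))" "matches (mut k S) B"
    using mutants_sound[OF S M] set_nodes by blast
  then obtain t where "t \<in> set ts" "hits t B"
    using c all_hitD unfolding closed_under_def by blast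
  then show ?thesis
    using hits_sound[OF _ _ skew_mut[OF S] B(2)] ts by blast
qed

definition closed_words :: "letter list set \<Rightarrow> bool" where
  "closed_words C \<longleftrightarrow>
     (\<forall>w\<in>C. \<forall>S k. skew S \<and> matches S (matrix_of w) \<longrightarrow> (\<exists>w'\<in>C. realizes (mut k S) w'))"

lemma realizes_relabel:
  assumes "bij \<pi>" "realizes (\<lambda>i j. S (\<pi> i) (\<pi> j)) w"
  shows "realizes S w"
proof -
  obtain \<rho> where "bij \<rho>" "matches (\<lambda>i j. S (\<pi> (\<rho> i)) (\<pi> (\<rho> j))) (matrix_of w) \<or>
      matches (\<lambda>i j. - S (\<pi> (\<rho> i)) (\<pi> (\<rho> j))) (matrix_of w)"
    using assms(2) unfolding realizes_def by blast
  then show ?thesis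
    unfolding realizes_def
    by (intro exI[of _ "\<pi> \<circ> \<rho>"]) (auto simp: bij_comp assms(1))
qed

lemma realizes_uminus: "realizes (\<lambda>i j. - S i j) w \<Longrightarrow> realizes S w"
  unfolding realizes_def by auto

text \<open>
  Mutation commutes with relabelling and with the change of sign, so that closure has to be
  checked on the listed words only.
\<close>

lemma closed_words_mut:
  assumes C: "closed_words C" and w: "w \<in> C" and S: "skew S" and r: "realizes S w"
  shows "\<exists>w'\<in>C. realizes (mut k S) w'"
proof -
  obtain \<pi> where \<pi>: "bij \<pi>" and m: "matches (\<lambda>i j. S (\<pi> i) (\<pi> j)) (matrix_of w) \<or>
      matches (\<lambda>i j. - S (\<pi> i) (\<pi> j)) (matrix_of w)"
    using r unfolding realizes_def by blast
  obtain l where l: "\<pi> l = k"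
    using \<pi> by (metis bij_pointE)
  have sk: "skew (\<lambda>i j. S (\<pi> i) (\<pi> j))" "skew (\<lambda>i j. - S (\<pi> i) (\<pi> j))"
    using skew_relabel[OF S] skew_uminus[OF skew_relabel[OF S]] by blast+
  have eq: "mut l (\<lambda>i j. S (\<pi> i) (\<pi> j)) = (\<lambda>i j. mut k S (\<pi> i) (\<pi> j))"
    using mut_relabel[OF \<pi>] l by metis
  have eq': "mut l (\<lambda>i j. - S (\<pi> i) (\<pi> j)) = (\<lambda>i j. - mut k S (\<pi> i) (\<pi> j))"
    using eq mut_uminus[of l "\<lambda>i j. S (\<pi> i) (\<pi> j)"] by simp
  from m show ?thesis
  proof
    assume "matches (\<lambda>i j. S (\<pi> i) (\<pi> j)) (matrix_of w)"
    then obtain w' where "w' \<in> C" "realizes (\<lambda>i j. mut k S (\<pi> i) (\<pi> j)) w'"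
      using C w sk(1) eq unfolding closed_words_def by metis
    then show ?thesis using realizes_relabel[OF \<pi>] by blast
  next
    assume "matches (\<lambda>i j. - S (\<pi> i) (\<pi> j)) (matrix_of w)"
    then obtain w' where "w' \<in> C" "realizes (\<lambda>i j. - mut k S (\<pi> i) (\<pi> j)) w'"
      using C w sk(2) eq' unfolding closed_words_def by metis
    moreover from this(2) have "realizes (\<lambda>i j. - mut k S i j) w'"
      by (rule realizes_relabel[OF \<pi>])
    ultimately show ?thesis using realizes_uminus by blast
  qed
qed

section \<open>Quivers described by a list of words\<close>

definition skew_of :: "'a quiver \<Rightarrow> 'a \<Rightarrow> 'a \<Rightarrow> int" where
  "skew_of Q i j = int (arrows Q i j) - int (arrows Q j i)"

lemma skew_skew_of: "skew (skew_of Q)"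
  by (rule skewI) (simp add: skew_of_def)

lemma cluster_quiverD:
  assumes "cluster_quiver Q"
  shows "finite (verts Q)" "0 < arrows Q i j \<Longrightarrow> i \<in> verts Q \<and> j \<in> verts Q"
    "arrows Q i i = 0" "arrows Q i j = 0 \<or> arrows Q j i = 0"
  using assms unfolding cluster_quiver_def by auto

lemma arrows_eq_nat_skew_of: "cluster_quiver Q \<Longrightarrow> arrows Q i j = nat (skew_of Q i j)"
  using cluster_quiverD(4)[of Q i j] by (auto simp: skew_of_def)

lemma verts_mutate: "verts (mutate k Q) = verts Q"
  by (simp add: mutate_def delete_2cycles_def reverse_at_def add_composites_def)

lemma arrows_mutate:
  assumes "cluster_quiver Q"
  shows "arrows (mutate k Q) i j =
     (if i = k \<or> j = k then arrows Q j i - arrows Q i j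
      else (arrows Q i j + arrows Q i k * arrows Q k j) - (arrows Q j i + arrows Q j k * arrows Q k i))"
  using cluster_quiverD(3)[OF assms, of k]
  by (auto simp: mutate_def delete_2cycles_def reverse_at_def add_composites_def)

lemma skew_of_mutate:
  assumes Q: "cluster_quiver Q"
  shows "skew_of (mutate k Q) = mut k (skew_of Q)"
proof (intro ext)
  fix i j
  have m: "max (skew_of Q i j) 0 = int (arrows Q i j)" for i j
    using cluster_quiverD(4)[OF Q, of i j] by (auto simp: skew_of_def)
  have m': "max (- skew_of Q i j) 0 = int (arrows Q j i)" for i j
    using m[of j i] skewD[OF skew_skew_of, of Q j i] by simp
  show "skew_of (mutate k Q) i j = mut k (skew_of Q) i j"
  proof (cases "i = k \<or> j = k")
    case True
    then show ?thesis
      unfolding mut_def skew_of_def arrows_mutate[OF Q] by auto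
  next
    case False
    then show ?thesis
      unfolding mut_def m m' unfolding skew_of_def arrows_mutate[OF Q]
      by (simp add: of_nat_diff_if algebra_simps)
  qed
qed

lemma cluster_quiver_mutate:
  assumes Q: "cluster_quiver Q" and k: "k \<in> verts Q"
  shows "cluster_quiver (mutate k Q)"
  unfolding cluster_quiver_def verts_mutate
proof (intro conjI allI impI)
  fix i j
  show "i \<in> verts Q" "j \<in> verts Q" if "0 < arrows (mutate k Q) i j"
  proof -
    have "0 < arrows Q i j \<or> 0 < arrows Q j i \<or> 0 < arrows Q i k \<and> 0 < arrows Q k j"
      using that unfolding arrows_mutate[OF Q]
      by (auto split: if_splits) (metis mult_is_0 neq0_conv not_less_zero)+
    then show "i \<in> verts Q" "j \<in> verts Q"
      using cluster_quiverD(2)[OF Q] by blast+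
  qed
  show "arrows (mutate k Q) i i = 0"
    unfolding arrows_mutate[OF Q] by simp
  show "\<not> (0 < arrows (mutate k Q) i j \<and> 0 < arrows (mutate k Q) j i)"
    unfolding arrows_mutate[OF Q] by auto
qed (use cluster_quiverD(1)[OF Q] in simp)

lemma fold_mutate_invariant:
  assumes "cluster_quiver Q" "P Q" "set ks \<subseteq> verts Q"
    and step: "\<And>Q k. cluster_quiver Q \<Longrightarrow> P Q \<Longrightarrow> k \<in> verts Q \<Longrightarrow> P (mutate k Q)"
  shows "cluster_quiver (fold mutate ks Q) \<and> P (fold mutate ks Q) \<and> verts (fold mutate ks Q) = verts Q"
  using assms(1-3)
proof (induction ks arbitrary: Q)
  case (Cons k ks)
  have "cluster_quiver (mutate k Q)" "P (mutate k Q)" "set ks \<subseteq> verts (mutate k Q)"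
    using Cons.prems cluster_quiver_mutate step by (auto simp: verts_mutate)
  from Cons.IH[OF this] show ?case by (simp add: verts_mutate)
qed simp

text \<open>
  The quiver is a full subquiver of a quiver that is described by one of the words. With \<open>full\<close> the
  latter may have no further non-isolated vertices, so that the two are then the same.
\<close>

definition captured :: "bool \<Rightarrow> letter list set \<Rightarrow> 'a quiver \<Rightarrow> bool" where
  "captured full C Q \<longleftrightarrow>
     (\<exists>f S. inj_on f (verts Q) \<and> skew S \<and> (\<exists>w\<in>C. realizes S w) \<and>
        (\<forall>i\<in>verts Q. \<forall>j\<in>verts Q. skew_of Q i j = S (f i) (f j)) \<and>
        (full \<longrightarrow> (\<forall>x y. S x y \<noteq> 0 \<longrightarrow> x \<in> f ` verts Q)))"

lemma mut_nonzero:
  assumes "mut k S x y \<noteq> 0"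
  shows "\<exists>z. S x z \<noteq> 0"
proof (rule ccontr)
  assume "\<nexists>z. S x z \<noteq> 0"
  then have "S x z = 0" for z by blast
  then show False using assms by (simp add: mut_def split: if_splits)
qed

text \<open>
  Mutation of a full subquiver at one of its vertices is the restriction of the mutation of the
  whole quiver, since the new arrows depend only on arrows between the vertices concerned.
\<close>

lemma captured_mutate:
  assumes C: "closed_words C" and Q: "cluster_quiver Q" and c: "captured full C Q" and k: "k \<in> verts Q"
  shows "captured full C (mutate k Q)"
proof -
  obtain f S w where f: "inj_on f (verts Q)" and S: "skew S" and w: "w \<in> C" "realizes S w"
    and eq: "\<forall>i\<in>verts Q. \<forall>j\<in>verts Q. skew_of Q i j = S (f i) (f j)"
    and full: "full \<longrightarrow> (\<forall>x y. S x y \<noteq> 0 \<longrightarrow> x \<in> f ` verts Q)"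
    using c unfolding captured_def by blast
  have "\<exists>w\<in>C. realizes (mut (f k) S) w"
    by (rule closed_words_mut[OF C w(1) S w(2)])
  moreover have "skew_of (mutate k Q) i j = mut (f k) S (f i) (f j)" if "i \<in> verts Q" "j \<in> verts Q" for i j
    unfolding skew_of_mutate[OF Q] mut_def
    using eq that k inj_on_eq_iff[OF f] by simp
  moreover have "x \<in> f ` verts Q" if "full" "mut (f k) S x y \<noteq> 0" for x y
    using mut_nonzero[OF that(2)] full that(1) by blast
  ultimately show ?thesis
    unfolding captured_def verts_mutate using f skew_mut[OF S] by blast
qed

lemma captured_iso:
  assumes c: "captured full C Q" and iso: "Q \<cong>\<^sub>q R"
  shows "captured full C R"
proof -
  obtain f S where f: "inj_on f (verts Q)" and S: "skew S" "\<exists>w\<in>C. realizes S w"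
    and eq: "\<forall>i\<in>verts Q. \<forall>j\<in>verts Q. skew_of Q i j = S (f i) (f j)"
    and full: "full \<longrightarrow> (\<forall>x y. S x y \<noteq> 0 \<longrightarrow> x \<in> f ` verts Q)"
    using c unfolding captured_def by blast
  obtain h where h: "bij_betw h (verts Q) (verts R)"
    and ar: "\<forall>i\<in>verts Q. \<forall>j\<in>verts Q. arrows R (h i) (h j) = arrows Q i j"
    using iso unfolding quiver_iso_def by blast
  define g where "g = inv_into (verts Q) h"
  have g: "bij_betw g (verts R) (verts Q)"
    unfolding g_def by (rule bij_betw_inv_into[OF h])
  have hg: "h (g i) = i" "g i \<in> verts Q" if "i \<in> verts R" for i
    using that h g unfolding g_def by (auto simp: bij_betw_inv_into_right bij_betw_apply)
  have "inj_on (f \<circ> g) (verts R)"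
    using f g unfolding bij_betw_def by (simp add: comp_inj_on)
  moreover have "skew_of R i j = S ((f \<circ> g) i) ((f \<circ> g) j)" if "i \<in> verts R" "j \<in> verts R" for i j
  proof -
    have "skew_of R i j = skew_of R (h (g i)) (h (g j))" using that hg by simp
    also have "\<dots> = skew_of Q (g i) (g j)"
      unfolding skew_of_def using ar hg(2) that by simp
    finally show ?thesis using eq hg(2) that by simp
  qed
  moreover have "(f \<circ> g) ` verts R = f ` verts Q"
    using g unfolding bij_betw_def by (metis image_comp)
  ultimately show ?thesis
    unfolding captured_def using S full by (intro exI[of _ "f \<circ> g"] exI[of _ S]) auto
qed

lemma captured_mutation_equivalent:
  assumes C: "closed_words C" and Q: "cluster_quiver Q" and c: "captured full C Q"
    and m: "mutation_equivalent Q R"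
  shows "captured full C R" "card (verts R) = card (verts Q)"
proof -
  obtain ks where ks: "set ks \<subseteq> verts Q" and iso: "fold mutate ks Q \<cong>\<^sub>q R"
    using m unfolding mutation_equivalent_def by blast
  have inv: "cluster_quiver (fold mutate ks Q) \<and> captured full C (fold mutate ks Q) \<and>
      verts (fold mutate ks Q) = verts Q"
    by (rule fold_mutate_invariant[where P = "captured full C", OF Q c ks]) (rule captured_mutate[OF C])
  then show "captured full C R"
    using captured_iso iso by blast
  show "card (verts R) = card (verts Q)"
    using iso inv bij_betw_same_card unfolding quiver_iso_def by metis
qed

section \<open>Quivers given by arrow lists\<close>

fun nth_node :: "nat \<Rightarrow> node" where
  "nth_node i = (if i = 0 then N0 else if i = 1 then N1 else if i = 2 then N2 else if i = 3 then N3
     else if i = 4 then N4 else if i = 5 then N5 else if i = 6 then N6 else if i = 7 then N7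
     else if i = 8 then N8 else if i = 9 then N9 else N10)"

fun index :: "node \<Rightarrow> nat" where
  "index N0 = 0" | "index N1 = 1" | "index N2 = 2" | "index N3 = 3" | "index N4 = 4" | "index N5 = 5"
| "index N6 = 6" | "index N7 = 7" | "index N8 = 8" | "index N9 = 9" | "index N10 = 10"

lemma node_index: "nth_node (index x) = x"
  by (cases x) simp_all

lemma index_node:
  assumes "i < 11" shows "index (nth_node i) = i"
proof -
  have "i = 0 \<or> i = 1 \<or> i = 2 \<or> i = 3 \<or> i = 4 \<or> i = 5 \<or> i = 6 \<or> i = 7 \<or> i = 8 \<or> i = 9 \<or> i = 10"
    using assms by presburger
  then show ?thesis by (elim disjE) simp_all
qed

declare nth_node.simps [simp del]

lemma node_eq_iff: "i < 11 \<Longrightarrow> j < 11 \<Longrightarrow> nth_node i = nth_node j \<longleftrightarrow> i = j"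
  using index_node by metis

lemma inj_node: "inj_on nth_node {..<11}"
  by (auto simp: inj_on_def node_eq_iff)

fun oriented :: "nat \<times> nat \<Rightarrow> letter" where
  "oriented (i, j) = Arrow (nth_node i) (nth_node j)"

fun unoriented :: "nat \<times> nat \<Rightarrow> letter" where
  "unoriented (i, j) = Bridge (nth_node i) (nth_node j)"

text \<open>
  The skew form of a quiver that is given by its list of arrows, transported to the host vertices.
\<close>

definition word_form :: "(nat \<times> nat) list \<Rightarrow> node \<Rightarrow> node \<Rightarrow> int" where
  "word_form as x y = int (count_list as (index x, index y)) - int (count_list as (index y, index x))"

definition small_loopless :: "(nat \<times> nat) list \<Rightarrow> bool" where
  "small_loopless as \<longleftrightarrow> (\<forall>(i, j)\<in>set as. i < 11 \<and> j < 11 \<and> i \<noteq> j)"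

lemma skew_word_form: "skew (word_form as)"
  by (rule skewI) (simp add: word_form_def)

lemma word_form_Cons:
  assumes "i < 11" "j < 11" "i \<noteq> j"
  shows "word_form ((i, j) # as) x y = word_form as x y +
     (if x = nth_node i \<and> y = nth_node j then 1 else if x = nth_node j \<and> y = nth_node i then - 1 else 0)"
proof -
  have "nth_node i \<noteq> nth_node j" using assms node_eq_iff by blast
  then show ?thesis
    using assms by (auto simp: word_form_def index_node)
      (metis index_node node_index)+
qed

lemma matches_oriented:
  assumes "matches (word_form bs) (matrix_of w)" "small_loopless as"
  shows "matches (word_form (as @ bs)) (matrix_of (map oriented as @ w))"
  using assms(2)
proof (induction as)
  case Nil
  then show ?case using assms(1) by simp
next
  case (Cons a as)
  obtain i j where a: "a = (i, j)" by (cases a)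
  have ij: "i < 11" "j < 11" "i \<noteq> j" and sm: "small_loopless as"
    using Cons.prems unfolding small_loopless_def a by auto
  have ne: "nth_node i \<noteq> nth_node j" using ij node_eq_iff by blast
  have IH: "allows (entry_of (matrix_of (map oriented as @ w)) x y) (word_form (as @ bs) x y)" for x y
    using Cons.IH[OF sm] unfolding matches_def by blast
  show ?case
    unfolding matches_def
  proof (intro allI)
    fix x y
    have new: "word_form ((a # as) @ bs) x y = word_form (as @ bs) x y +
        (if x = nth_node i \<and> y = nth_node j then 1 else if x = nth_node j \<and> y = nth_node i then - 1 else 0)"
      unfolding a append_Cons by (rule word_form_Cons[OF ij])
    have entry: "entry_of (matrix_of (map oriented (a # as) @ w)) x y =
        (let e = entry_of (matrix_of (map oriented as @ w)) x y
         in if x = nth_node i \<and> y = nth_node j then inc e else if x = nth_node j \<and> y = nth_node i then dec e else e)"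
      unfolding a list.map oriented.simps append_Cons matrix_of.simps entry_of_add_Arrow[OF ne] Let_def ..
    consider "x = nth_node i \<and> y = nth_node j" | "x = nth_node j \<and> y = nth_node i"
      | "\<not> (x = nth_node i \<and> y = nth_node j)" "\<not> (x = nth_node j \<and> y = nth_node i)"
      by blast
    then show "allows (entry_of (matrix_of (map oriented (a # as) @ w)) x y) (word_form ((a # as) @ bs) x y)"
    proof cases
      case 1
      then show ?thesis unfolding new entry Let_def using allows_inc[OF IH[of x y]] by simp
    next
      case 2
      then show ?thesis unfolding new entry Let_def using allows_dec[OF IH[of x y]] ne by simp
    next
      case 3
      then show ?thesis unfolding new entry Let_def using IH[of x y] by (simp only: if_False add_0_right)
    qed
  qed
qed

fun disjoint_edges :: "(nat \<times> nat) list \<Rightarrow> bool" where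
  "disjoint_edges [] = True"
| "disjoint_edges ((i, j) # es) \<longleftrightarrow> (i, j) \<notin> set es \<and> (j, i) \<notin> set es \<and> disjoint_edges es"

lemma orientations_Cons:
  "bs \<in> orientations ((i, j) # es) \<longleftrightarrow>
     (\<exists>cs\<in>orientations es. bs = (i, j) # cs \<or> bs = (j, i) # cs)"
  unfolding orientations_def by (auto simp: list_all2_Cons1)

lemma orientations_Nil: "orientations [] = {[]}"
  unfolding orientations_def by auto

lemma orientations_mem:
  "bs \<in> orientations es \<Longrightarrow> (i, j) \<in> set bs \<Longrightarrow> (i, j) \<in> set es \<or> (j, i) \<in> set es"
proof (induction es arbitrary: bs)
  case (Cons e es)
  obtain p q where e: "e = (p, q)" by (cases e)
  obtain cs where cs: "cs \<in> orientations es" "bs = (p, q) # cs \<or> bs = (q, p) # cs"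
    using Cons.prems(1) unfolding e orientations_Cons by blast
  have "(i, j) \<in> set cs \<Longrightarrow> (i, j) \<in> set es \<or> (j, i) \<in> set es"
    by (rule Cons.IH[OF cs(1)])
  then show ?case
    using cs(2) Cons.prems(2) unfolding e by auto
qed (simp add: orientations_Nil)

lemma matches_unoriented:
  "bs \<in> orientations es \<Longrightarrow> small_loopless es \<Longrightarrow> disjoint_edges es \<Longrightarrow>
   matches (word_form bs) (matrix_of (map unoriented es))"
proof (induction es arbitrary: bs)
  case Nil
  then show ?case
    by (simp add: orientations_Nil matches_def entry_of_zero word_form_def)
next
  case (Cons e es)
  obtain i j where e: "e = (i, j)" by (cases e)
  have ij: "i < 11" "j < 11" "i \<noteq> j" and sm: "small_loopless es"
    using Cons.prems(2) unfolding small_loopless_def e by auto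
  have ne: "nth_node i \<noteq> nth_node j" using ij node_eq_iff by blast
  obtain cs where cs: "cs \<in> orientations es" and bs: "bs = (i, j) # cs \<or> bs = (j, i) # cs"
    using Cons.prems(1) unfolding e orientations_Cons by blast
  have new: "(i, j) \<notin> set cs" "(j, i) \<notin> set cs" and dis: "disjoint_edges es"
    using orientations_mem[OF cs] Cons.prems(3) unfolding e by auto
  have zero: "word_form cs (nth_node i) (nth_node j) = 0" "word_form cs (nth_node j) (nth_node i) = 0"
    using new ij by (simp_all add: word_form_def index_node count_list_0_iff)
  have IH: "allows (entry_of (matrix_of (map unoriented es)) x y) (word_form cs x y)" for x y
    using Cons.IH[OF cs sm dis] unfolding matches_def by blast
  show ?case
    unfolding matches_def
  proof (intro allI)
    fix x y
    have entry: "entry_of (matrix_of (map unoriented (e # es))) x y =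
        (if x = nth_node i \<and> y = nth_node j \<or> x = nth_node j \<and> y = nth_node i then Free
         else entry_of (matrix_of (map unoriented es)) x y)"
      unfolding e list.map unoriented.simps matrix_of.simps entry_of_add_Bridge ..
    show "allows (entry_of (matrix_of (map unoriented (e # es))) x y) (word_form bs x y)"
    proof (cases "x = nth_node i \<and> y = nth_node j \<or> x = nth_node j \<and> y = nth_node i")
      case True
      then show ?thesis
        unfolding entry using bs zero ne
        by (elim disjE conjE) (simp_all add: word_form_Cons ij ij(3)[symmetric])
    next
      case False
      then have "word_form bs x y = word_form cs x y"
        using bs by (elim disjE) (simp_all add: word_form_Cons ij ij(3)[symmetric])
      then show ?thesis
        unfolding entry using False IH[of x y] by (simp only: if_False)
    qed
  qed
qed

lemma verts_quiver_of: "verts (quiver_of n as) = {..<n}"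
  and arrows_quiver_of: "arrows (quiver_of n as) i j = count_list as (i, j)"
  unfolding quiver_of_def by simp_all

lemma skew_of_quiver_of: "i < 11 \<Longrightarrow> j < 11 \<Longrightarrow> skew_of (quiver_of n as) i j = word_form as (nth_node i) (nth_node j)"
  by (simp add: skew_of_def word_form_def arrows_quiver_of index_node)

text \<open>
  Membership of an initial quiver is decided by the same search as closure.
\<close>

lemma captured_quiver_of:
  assumes n: "n \<le> 11" and m: "matches (word_form as) (matrix_of v)" and h: "hits t (matrix_of v)"
    and t: "target_word t \<in> C" "\<forall>a\<in>set (target_word t). loopless a"
    and range: "\<forall>(i, j)\<in>set as. i < n \<and> j < n"
  shows "captured full C (quiver_of n as)"
  unfolding captured_def verts_quiver_of
proof (intro exI[of _ nth_node] exI[of _ "word_form as"] conjI ballI impI allI)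
  show "inj_on nth_node {..<n}"
    using inj_on_subset[OF inj_node] n by auto
  show "skew (word_form as)" by (rule skew_word_form)
  show "\<exists>w\<in>C. realizes (word_form as) w"
    using hits_sound[OF h t(2) skew_word_form m] t(1) by blast
  show "skew_of (quiver_of n as) i j = word_form as (nth_node i) (nth_node j)"
    if "i \<in> {..<n}" "j \<in> {..<n}" for i j
    using that n by (intro skew_of_quiver_of) auto
  show "x \<in> nth_node ` {..<n}" if "word_form as x y \<noteq> 0" for x y
  proof -
    have "(index x, index y) \<in> set as \<or> (index y, index x) \<in> set as"
      using that unfolding word_form_def by (metis count_notin diff_self of_nat_0)
    then have "index x < n" using range by auto
    then show ?thesis using node_index[of x] by (metis imageI lessThan_iff)
  qed
qed

lemma captured_subquiver:
  assumes c: "captured False C Q" and g: "inj_on g (verts R)" "g ` verts R \<subseteq> verts Q"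
    and eq: "\<forall>i\<in>verts R. \<forall>j\<in>verts R. skew_of R i j = skew_of Q (g i) (g j)"
  shows "captured False C R"
proof -
  obtain f S where f: "inj_on f (verts Q)" and S: "skew S" "\<exists>w\<in>C. realizes S w"
    and e: "\<forall>i\<in>verts Q. \<forall>j\<in>verts Q. skew_of Q i j = S (f i) (f j)"
    using c unfolding captured_def by blast
  have "inj_on (f \<circ> g) (verts R)"
    by (rule comp_inj_on[OF g(1) inj_on_subset[OF f g(2)]])
  moreover have "skew_of R i j = S ((f \<circ> g) i) ((f \<circ> g) j)" if "i \<in> verts R" "j \<in> verts R" for i j
    using eq e g(2) that by (auto simp: image_subset_iff)
  ultimately show ?thesis
    unfolding captured_def using S by blast
qed

section \<open>Orientations of a tree\<close>

definition reverse_arrows_at :: "nat \<Rightarrow> (nat \<times> nat) list \<Rightarrow> (nat \<times> nat) list" where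
  "reverse_arrows_at k = map (\<lambda>(i, j). if i = k \<or> j = k then (j, i) else (i, j))"

definition sink_or_source :: "nat \<Rightarrow> (nat \<times> nat) list \<Rightarrow> bool" where
  "sink_or_source k bs \<longleftrightarrow> (\<forall>(i, j)\<in>set bs. i \<noteq> k) \<or> (\<forall>(i, j)\<in>set bs. j \<noteq> k)"

text \<open>
  Mutation at a sink or at a source only reverses the arrows there.
\<close>

definition reflection :: "nat \<Rightarrow> (nat \<times> nat) list \<Rightarrow> (nat \<times> nat) list \<Rightarrow> bool" where
  "reflection n bs cs \<longleftrightarrow> (\<exists>k<n. sink_or_source k bs \<and> cs = reverse_arrows_at k bs)"

lemma count_list_reverse_arrows_at:
  "count_list (reverse_arrows_at k bs) (i, j) =
     (if i = k \<or> j = k then count_list bs (j, i) else count_list bs (i, j))"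
proof -
  define r where "r = (\<lambda>(i, j). if i = k \<or> j = k then (j, i) else (i, j))"
  have inv: "r a = x \<longleftrightarrow> a = r x" for a x
    unfolding r_def by (cases a; cases x) (simp, blast)
  have "count_list (map r bs) x = count_list bs (r x)" for x
    by (induction bs) (simp_all add: inv)
  then show ?thesis
    unfolding reverse_arrows_at_def r_def[symmetric] by (simp add: r_def)
qed

lemma mutate_sink_or_source:
  assumes Q: "cluster_quiver (quiver_of n bs)" and k: "sink_or_source k bs"
  shows "mutate k (quiver_of n bs) = quiver_of n (reverse_arrows_at k bs)"
proof -
  have z: "arrows (quiver_of n bs) i k * arrows (quiver_of n bs) k j = 0" for i j
  proof -
    have "(i, k) \<notin> set bs \<or> (k, j) \<notin> set bs"
      using k unfolding sink_or_source_def by blast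
    then show ?thesis by (auto simp: arrows_quiver_of count_list_0_iff)
  qed
  have "arrows (mutate k (quiver_of n bs)) i j = arrows (quiver_of n (reverse_arrows_at k bs)) i j" for i j
    unfolding arrows_mutate[OF Q] z
    using cluster_quiverD(4)[OF Q, of i j]
    by (auto simp: arrows_quiver_of count_list_reverse_arrows_at)
  then show ?thesis
    using verts_mutate[of k "quiver_of n bs"]
    by (cases "mutate k (quiver_of n bs)") (auto simp: quiver_of_def)
qed

text \<open>
  A tree as built up from the end of the list: each edge attaches its second vertex as a new leaf.
\<close>

fun leaf_tree :: "nat \<Rightarrow> (nat \<times> nat) list \<Rightarrow> bool" where
  "leaf_tree n [] \<longleftrightarrow> True"
| "leaf_tree n ((p, q) # es) \<longleftrightarrow>
     p < n \<and> q < n \<and> p \<noteq> q \<and> (\<forall>(i, j)\<in>set es. i \<noteq> q \<and> j \<noteq> q) \<and> leaf_tree n es"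

text \<open>
  A reflection of the smaller tree is also one of the larger tree, except perhaps at the vertex
  that carries the new leaf. In that case the arrow at the leaf points the wrong way, and it can be
  reversed beforehand by a reflection at the leaf.
\<close>

lemma reflection_lift:
  assumes "(reflection n)\<^sup>*\<^sup>* cs cs'" and pq: "p < n" "q < n" "p \<noteq> q"
    and q: "\<forall>(i, j)\<in>set cs. i \<noteq> q \<and> j \<noteq> q" and b: "b = (p, q) \<or> b = (q, p)"
  shows "(\<forall>(i, j)\<in>set cs'. i \<noteq> q \<and> j \<noteq> q) \<and>
     (\<exists>b'. (b' = (p, q) \<or> b' = (q, p)) \<and> (reflection n)\<^sup>*\<^sup>* (b # cs) (b' # cs'))"
  using assms(1)
proof (induction rule: rtranclp_induct)
  case base
  then show ?case using q b by blast
next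
  case (step ds ds')
  then obtain b' where b': "b' = (p, q) \<or> b' = (q, p)" and r: "(reflection n)\<^sup>*\<^sup>* (b # cs) (b' # ds)"
    and ds: "\<forall>(i, j)\<in>set ds. i \<noteq> q \<and> j \<noteq> q" by blast
  obtain k where k: "k < n" "sink_or_source k ds" "ds' = reverse_arrows_at k ds"
    using step.hyps(2) unfolding reflection_def by blast
  have ds': "\<forall>(i, j)\<in>set ds'. i \<noteq> q \<and> j \<noteq> q"
    using ds unfolding k(3) reverse_arrows_at_def by (fastforce split: if_splits)
  have rq: "reverse_arrows_at q (c # ds) = prod.swap c # ds" "sink_or_source q (c # ds)"
    if "c = (p, q) \<or> c = (q, p)" for c
  proof -
    have "reverse_arrows_at q ds = ds"
      using ds unfolding reverse_arrows_at_def by (induction ds) auto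
    then show "reverse_arrows_at q (c # ds) = prod.swap c # ds"
      using that unfolding reverse_arrows_at_def by auto
    show "sink_or_source q (c # ds)"
      using that ds pq(3) unfolding sink_or_source_def by auto
  qed
  have step1: "\<exists>b''. (b'' = (p, q) \<or> b'' = (q, p)) \<and> reflection n (c # ds) (b'' # ds')"
    if c: "c = (p, q) \<or> c = (q, p)" and s: "sink_or_source k (c # ds)" for c
  proof -
    have "reverse_arrows_at k (c # ds) = hd (reverse_arrows_at k [c]) # ds'"
      unfolding k(3) reverse_arrows_at_def by simp
    moreover have "hd (reverse_arrows_at k [c]) = (p, q) \<or> hd (reverse_arrows_at k [c]) = (q, p)"
      using c unfolding reverse_arrows_at_def by auto
    ultimately show ?thesis
      unfolding reflection_def using k(1) s by metis
  qed
  show ?case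
  proof (cases "sink_or_source k (b' # ds)")
    case True
    obtain b'' where "b'' = (p, q) \<or> b'' = (q, p)" and s: "reflection n (b' # ds) (b'' # ds')"
      using step1[OF b' True] by blast
    moreover have "(reflection n)\<^sup>*\<^sup>* (b # cs) (b'' # ds')"
      by (rule rtranclp.rtrancl_into_rtrancl[OF r s])
    ultimately show ?thesis using ds' by blast
  next
    case False
    have sw: "prod.swap b' = (p, q) \<or> prod.swap b' = (q, p)" using b' by auto
    have "sink_or_source k (prod.swap b' # ds)"
      using False k(2) b' pq(3) unfolding sink_or_source_def by auto
    then obtain b'' where "b'' = (p, q) \<or> b'' = (q, p)"
      and s: "reflection n (prod.swap b' # ds) (b'' # ds')"
      using step1[OF sw] by blast
    moreover have s': "reflection n (b' # ds) (prod.swap b' # ds)"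
      unfolding reflection_def using rq[OF b'] pq(2) by metis
    moreover have "(reflection n)\<^sup>*\<^sup>* (b # cs) (b'' # ds')"
      by (rule rtranclp.rtrancl_into_rtrancl[OF rtranclp.rtrancl_into_rtrancl[OF r s'] s])
    ultimately show ?thesis using ds' by blast
  qed
qed

text \<open>
  Induction on the number of leaves attached: the orientation of the smaller tree is adjusted first,
  and a last reflection at the leaf corrects the remaining edge.
\<close>

lemma tree_orientations_connected:
  "leaf_tree n es \<Longrightarrow> bs \<in> orientations es \<Longrightarrow> cs \<in> orientations es \<Longrightarrow> (reflection n)\<^sup>*\<^sup>* bs cs"
proof (induction es arbitrary: bs cs)
  case Nil
  then show ?case by (simp add: orientations_Nil)
next
  case (Cons e es)
  obtain p q where e: "e = (p, q)" by (cases e)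
  have pq: "p < n" "q < n" "p \<noteq> q" and new: "\<forall>(i, j)\<in>set es. i \<noteq> q \<and> j \<noteq> q" and t: "leaf_tree n es"
    using Cons.prems(1) unfolding e by auto
  obtain b bs' where bs: "bs = b # bs'" "b = (p, q) \<or> b = (q, p)" "bs' \<in> orientations es"
    using Cons.prems(2) unfolding e orientations_Cons by blast
  obtain c cs' where cs: "cs = c # cs'" "c = (p, q) \<or> c = (q, p)" "cs' \<in> orientations es"
    using Cons.prems(3) unfolding e orientations_Cons by blast
  have q: "\<forall>(i, j)\<in>set ds. i \<noteq> q \<and> j \<noteq> q" if "ds \<in> orientations es" for ds
    using orientations_mem[OF that] new by fastforce
  obtain b' where b': "b' = (p, q) \<or> b' = (q, p)" and r: "(reflection n)\<^sup>*\<^sup>* (b # bs') (b' # cs')"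
    using reflection_lift[OF Cons.IH[OF t bs(3) cs(3)] pq q[OF bs(3)] bs(2)] by blast
  show ?case
  proof (cases "b' = c")
    case True
    then show ?thesis using r bs cs by simp
  next
    case False
    have "reverse_arrows_at q cs' = cs'"
      using q[OF cs(3)] unfolding reverse_arrows_at_def by (induction cs') auto
    then have "reverse_arrows_at q (b' # cs') = c # cs'"
      using False b' cs(2) unfolding reverse_arrows_at_def by auto
    moreover have "sink_or_source q (b' # cs')"
      using b' q[OF cs(3)] pq(3) unfolding sink_or_source_def by auto
    ultimately have "reflection n (b' # cs') (c # cs')"
      unfolding reflection_def using pq(2) by metis
    then show ?thesis using r bs cs by simp
  qed
qed

lemma cluster_quiver_of:
  assumes "\<forall>(i, j)\<in>set as. i < n \<and> j < n \<and> i \<noteq> j \<and> (j, i) \<notin> set as"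
  shows "cluster_quiver (quiver_of n as)"
proof -
  have mem: "i < n \<and> j < n \<and> i \<noteq> j \<and> count_list as (j, i) = 0" if "0 < count_list as (i, j)" for i j
  proof -
    have "(i, j) \<in> set as" using that count_notin[of "(i, j)" as] by (metis less_irrefl)
    then show ?thesis using assms count_notin[of "(j, i)" as] by fastforce
  qed
  show ?thesis
    unfolding cluster_quiver_def verts_quiver_of arrows_quiver_of
    using mem by (metis finite_lessThan lessThan_iff neq0_conv)
qed

lemma quiver_of_rev: "quiver_of n (rev as) = quiver_of n as"
  unfolding quiver_of_def by simp

lemma orientations_rev: "bs \<in> orientations es \<Longrightarrow> rev bs \<in> orientations (rev es)"
  unfolding orientations_def by simp

lemma captured_tree:
  assumes C: "closed_words C" and t: "leaf_tree n (rev es)" and bs: "bs \<in> orientations es"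
    and c: "captured False C (quiver_of n bs)" and cl: "cluster_quiver (quiver_of n bs)"
    and cs: "cs \<in> orientations es"
  shows "captured False C (quiver_of n cs) \<and> cluster_quiver (quiver_of n cs)"
proof -
  have "captured False C (quiver_of n (rev cs)) \<and> cluster_quiver (quiver_of n (rev cs))"
    using tree_orientations_connected[OF t orientations_rev[OF bs] orientations_rev[OF cs]]
  proof (induction rule: rtranclp_induct)
    case base
    then show ?case using c cl by (simp add: quiver_of_rev)
  next
    case (step ds ds')
    then obtain k where k: "k < n" "sink_or_source k ds" "ds' = reverse_arrows_at k ds"
      unfolding reflection_def by blast
    have kv: "k \<in> verts (quiver_of n ds)"
      using k(1) by (simp add: verts_quiver_of)
    have "captured False C (mutate k (quiver_of n ds))" "cluster_quiver (mutate k (quiver_of n ds))"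
      using captured_mutate[OF C _ _ kv] cluster_quiver_mutate[OF _ kv] step.IH by blast+
    then show ?case
      using mutate_sink_or_source[OF _ k(2)] step.IH k(3) by simp
  qed
  then show ?thesis by (simp add: quiver_of_rev)
qed

section \<open>The complete bipartite graph K33 is not drawable on the sphere\<close>

text \<open>
  Nine arcs from the points \<open>a i\<close> to the points \<open>b j\<close> that meet only in common ends. This already
  implies that the six points are distinct.
\<close>

definition K33_drawing ::
    "'a::topological_space set \<Rightarrow> (nat \<Rightarrow> 'a) \<Rightarrow> (nat \<Rightarrow> 'a) \<Rightarrow> (nat \<Rightarrow> nat \<Rightarrow> real \<Rightarrow> 'a) \<Rightarrow> bool" where
  "K33_drawing S a b g \<longleftrightarrow>
     (\<forall>i<3. \<forall>j<3. arc (g i j) \<and> path_image (g i j) \<subseteq> S \<and>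
        pathstart (g i j) = a i \<and> pathfinish (g i j) = b j) \<and>
     (\<forall>i<3. \<forall>j<3. \<forall>i'<3. \<forall>j'<3. \<forall>x. (i, j) \<noteq> (i', j') \<longrightarrow>
        x \<in> path_image (g i j) \<longrightarrow> x \<in> path_image (g i' j') \<longrightarrow>
        i = i' \<and> x = a i \<or> j = j' \<and> x = b j)"

context
  fixes S :: "'a::topological_space set" and a b g
  assumes K: "K33_drawing S a b g"
begin

lemma K33_arc: "i < 3 \<Longrightarrow> j < 3 \<Longrightarrow> arc (g i j)"
  and K33_sub: "i < 3 \<Longrightarrow> j < 3 \<Longrightarrow> path_image (g i j) \<subseteq> S"
  and K33_start: "i < 3 \<Longrightarrow> j < 3 \<Longrightarrow> pathstart (g i j) = a i"
  and K33_finish: "i < 3 \<Longrightarrow> j < 3 \<Longrightarrow> pathfinish (g i j) = b j"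
  using K unfolding K33_drawing_def by blast+

lemma K33_meet:
  "x \<in> path_image (g i j) \<Longrightarrow> x \<in> path_image (g i' j') \<Longrightarrow> (i, j) \<noteq> (i', j') \<Longrightarrow>
   i < 3 \<Longrightarrow> j < 3 \<Longrightarrow> i' < 3 \<Longrightarrow> j' < 3 \<Longrightarrow> i = i' \<and> x = a i \<or> j = j' \<and> x = b j"
  using K unfolding K33_drawing_def by blast

lemma K33_a_on: "i < 3 \<Longrightarrow> j < 3 \<Longrightarrow> a i \<in> path_image (g i j)"
  using K33_start pathstart_in_path_image by metis

lemma K33_b_on: "i < 3 \<Longrightarrow> j < 3 \<Longrightarrow> b j \<in> path_image (g i j)"
  using K33_finish pathfinish_in_path_image by metis

lemma K33_a_notin:
  assumes "k < 3" "i < 3" "j < 3" "k \<noteq> i"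
  shows "a k \<notin> path_image (g i j)"
proof
  assume x: "a k \<in> path_image (g i j)"
  obtain j' :: nat where j': "j' < 3" "j' \<noteq> j"
    by (metis less_numeral_extra(3) zero_less_numeral numeral_eq_one_iff one_less_numeral_iff semiring_norm(77) semiring_norm(86))
  show False
    using K33_meet[OF x K33_a_on[OF assms(1) j'(1)]] assms j' by auto
qed

lemma K33_b_notin:
  assumes "k < 3" "i < 3" "j < 3" "k \<noteq> j"
  shows "b k \<notin> path_image (g i j)"
proof
  assume x: "b k \<in> path_image (g i j)"
  obtain i' :: nat where i': "i' < 3" "i' \<noteq> i"
    by (metis less_numeral_extra(3) zero_less_numeral numeral_eq_one_iff one_less_numeral_iff semiring_norm(77) semiring_norm(86))
  show False
    using K33_meet[OF x K33_b_on[OF i'(1) assms(1)]] assms i' by auto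
qed

end

lemma K33_drawing_image:
  assumes K: "K33_drawing S a b g" and f: "continuous_on S f" "inj_on f S"
  shows "K33_drawing (f ` S) (f \<circ> a) (f \<circ> b) (\<lambda>i j. f \<circ> g i j)"
  unfolding K33_drawing_def
proof (intro conjI allI impI)
  fix i j :: nat assume ij: "i < 3" "j < 3"
  have sub: "path_image (g i j) \<subseteq> S" and arc: "arc (g i j)"
    using K33_sub[OF K ij] K33_arc[OF K ij] by auto
  show "arc (f \<circ> g i j)"
    unfolding arc_def
  proof
    show "path (f \<circ> g i j)"
      using arc continuous_on_subset[OF f(1) sub] path_continuous_image arc_imp_path by blast
    show "inj_on (f \<circ> g i j) {0..1}"
      using arc sub inj_on_subset[OF f(2) sub] unfolding arc_def path_image_def
      by (simp add: comp_inj_on)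
  qed
  show "path_image (f \<circ> g i j) \<subseteq> f ` S"
    using sub by (auto simp: path_image_compose)
  show "pathstart (f \<circ> g i j) = (f \<circ> a) i" "pathfinish (f \<circ> g i j) = (f \<circ> b) j"
    using K33_start[OF K ij] K33_finish[OF K ij] by (simp_all add: pathstart_compose pathfinish_compose)
next
  fix i j i' j' :: nat and x
  assume lt: "i < 3" "j < 3" "i' < 3" "j' < 3" and ne: "(i, j) \<noteq> (i', j')"
    and x: "x \<in> path_image (f \<circ> g i j)" "x \<in> path_image (f \<circ> g i' j')"
  from x(1) obtain u where u: "x = f u" "u \<in> path_image (g i j)"
    by (auto simp: path_image_compose)
  from x(2) obtain v where v: "x = f v" "v \<in> path_image (g i' j')"
    by (auto simp: path_image_compose)
  have "u = v"
    using u v K33_sub[OF K lt(1,2)] K33_sub[OF K lt(3,4)] inj_onD[OF f(2)] by blast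
  then show "i = i' \<and> x = (f \<circ> a) i \<or> j = j' \<and> x = (f \<circ> b) j"
    using K33_meet[OF K u(2) _ ne lt] u v by auto
qed

lemma inside_connected:
  assumes "connected C" "C \<inter> J = {}" "x \<in> C" "x \<in> inside J"
  shows "C \<subseteq> inside J"
proof
  fix y assume "y \<in> C"
  then have "connected_component (- J) x y"
    unfolding connected_component_def using assms by blast
  then show "y \<in> inside J"
    using assms(4) inside_same_component by metis
qed

lemma outside_connected:
  assumes "connected C" "C \<inter> J = {}" "x \<in> C" "x \<in> outside J"
  shows "C \<subseteq> outside J"
proof
  fix y assume "y \<in> C"
  then have "connected_component (- J) x y"
    unfolding connected_component_def using assms by blast
  then show "y \<in> outside J"
    using assms(4) outside_same_component by metis
qed

lemma arc_minus_finish: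
  assumes "arc c"
  shows "connected (path_image c - {pathfinish c})" "pathfinish c \<in> closure (path_image c - {pathfinish c})"
    "pathstart c \<in> path_image c - {pathfinish c}"
proof -
  have eq: "path_image c - {pathfinish c} = c ` {0..<1}"
  proof -
    have "inj_on c {0..1}" using assms by (simp add: arc_def)
    then have "c ` ({0..1} - {1}) = c ` {0..1} - c ` {1}"
      by (rule inj_on_image_set_diff) auto
    moreover have "{0..1} - {1} = {0..<1::real}" by auto
    ultimately show ?thesis by (simp add: path_image_def pathfinish_def)
  qed
  have cont: "continuous_on {0..1} c"
    using assms by (simp add: arc_def path_def)
  show "connected (path_image c - {pathfinish c})"
    unfolding eq by (rule connected_continuous_image[OF continuous_on_subset[OF cont]]) auto
  have "c ` closure {0..<1} \<subseteq> closure (c ` {0..<1})"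
    by (rule continuous_image_closure_subset[OF cont]) auto
  then show "pathfinish c \<in> closure (path_image c - {pathfinish c})"
    unfolding eq by (auto simp: image_subset_iff pathfinish_def)
  show "pathstart c \<in> path_image c - {pathfinish c}"
    using arc_distinct_ends[OF assms] pathstart_in_path_image by auto
qed

lemma closure_inside_D:
  fixes J :: "complex set"
  assumes "closed J" "C \<subseteq> inside J" "x \<in> closure C" "x \<notin> J"
  shows "x \<in> inside J"
  using assms closure_inside_subset[OF assms(1)] closure_mono[OF assms(2)] by blast

lemma closure_outside_D:
  fixes J :: "complex set"
  assumes "closed J" "C \<subseteq> outside J" "x \<in> closure C" "x \<notin> J"
  shows "x \<in> outside J"
  using assms closure_outside_subset[OF assms(1)] closure_mono[OF assms(2)] by blast

text \<open>
  For fixed \<open>j\<close> the two edges at \<open>b j\<close> that come from \<open>a 0\<close> and \<open>a 1\<close> form an arc between these two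
  points. The three arcs obtained in this way form a theta curve.
\<close>

lemma K33_theta:
  assumes K: "K33_drawing S a b g" and j: "j < 3"
  obtains c where "arc c" "pathstart c = a 0" "pathfinish c = a 1"
    "path_image c = path_image (g 0 j) \<union> path_image (g 1 j)"
proof -
  define c where "c = g 0 j +++ reversepath (g 1 j)"
  have n3: "(0::nat) < 3" "(1::nat) < 3" by auto
  have jn: "pathfinish (g 0 j) = pathstart (reversepath (g 1 j))"
    using K33_finish[OF K n3(1) j] K33_finish[OF K n3(2) j] by simp
  show thesis
  proof
    show "path_image c = path_image (g 0 j) \<union> path_image (g 1 j)"
      unfolding c_def by (subst path_image_join[OF jn]) simp
    show "arc c"
      unfolding c_def
    proof (rule arc_join)
      show "path_image (g 0 j) \<inter> path_image (reversepath (g 1 j)) \<subseteq> {pathstart (reversepath (g 1 j))}"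
        using K33_meet[OF K _ _ _ n3(1) j n3(2) j] K33_finish[OF K n3(2) j] by auto
    qed (use K33_arc[OF K] j jn in \<open>auto simp: arc_reversepath\<close>)
    show "pathstart c = a 0" "pathfinish c = a 1"
      unfolding c_def using K33_start[OF K n3(1) j] K33_start[OF K n3(2) j] by simp_all
  qed
qed

lemma K33_theta_meet:
  assumes K: "K33_drawing S a b g" and "i < 3" "j < 3" "i \<noteq> j"
  shows "(path_image (g 0 i) \<union> path_image (g 1 i)) \<inter> (path_image (g 0 j) \<union> path_image (g 1 j)) = {a 0, a 1}"
    (is "?C i \<inter> ?C j = _")
proof
  show "?C i \<inter> ?C j \<subseteq> {a 0, a 1}"
  proof
    fix x assume x: "x \<in> ?C i \<inter> ?C j"
    then obtain k l where kl: "k \<in> {0, 1}" "x \<in> path_image (g k i)" "l \<in> {0, 1}" "x \<in> path_image (g l j)"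
      by blast
    then have "k < 3" "l < 3" by auto
    then show "x \<in> {a 0, a 1}"
      using K33_meet[OF K kl(2,4)] kl assms by auto
  qed
  show "{a 0, a 1} \<subseteq> ?C i \<inter> ?C j"
    using K33_a_on[OF K] assms by auto
qed

text \<open>
  The third arc of the theta curve passes inside the closed curve formed by the first two, and so
  it divides the inside into two regions. The point \<open>a 2\<close> lies in one of the three complementary
  regions, and that region has one of the three points \<open>b j\<close> neither in it nor on its boundary. But
  the edge from \<open>a 2\<close> to this point cannot leave the region.
\<close>

lemma K33_plane_inside:
  fixes a b :: "nat \<Rightarrow> complex"
  assumes K: "K33_drawing UNIV a b g"
    and b2: "b 2 \<in> inside (path_image (g 0 0) \<union> path_image (g 1 0) \<union>
                (path_image (g 0 1) \<union> path_image (g 1 1)))"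
  shows False
proof -
  define C where "C j = path_image (g 0 j) \<union> path_image (g 1 j)" for j
  have n3: "(0::nat) < 3" "(1::nat) < 3" "(2::nat) < 3" by auto
  have "\<exists>c. arc c \<and> pathstart c = a 0 \<and> pathfinish c = a 1 \<and> path_image c = C j" if "j < 3" for j
    using K33_theta[OF K that] unfolding C_def by metis
  then obtain c where c: "\<And>j. j < 3 \<Longrightarrow>
      arc (c j) \<and> pathstart (c j) = a 0 \<and> pathfinish (c j) = a 1 \<and> path_image (c j) = C j"
    by metis
  have C: "path_image (c j) = C j" and carc: "simple_path (c j)"
    and cs: "pathstart (c j) = a 0" and cf: "pathfinish (c j) = a 1" if "j < 3" for j
    using c[OF that] arc_imp_simple_path by auto
  have a01: "a 0 \<noteq> a 1"
    using K33_a_notin[OF K, of 0 1 0] K33_a_on[OF K n3(2,1)] by auto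
  have CC: "C i \<inter> C j = {a 0, a 1}" if "i < 3" "j < 3" "i \<noteq> j" for i j
    using K33_theta_meet[OF K that] unfolding C_def .
  have bC: "b i \<notin> C j" if "i < 3" "j < 3" "i \<noteq> j" for i j
    using K33_b_notin[OF K] that unfolding C_def by auto
  have bC': "b j \<in> C j" if "j < 3" for j
    using K33_b_on[OF K] that unfolding C_def by auto
  have closed: "closed (C j)" if "j < 3" for j
    using K33_arc[OF K] that unfolding C_def by (auto intro!: closed_path_image arc_imp_path)
  have b2': "b 2 \<in> inside (C 0 \<union> C 1)"
    using b2 unfolding C_def by simp
  obtain dis: "inside (C 0 \<union> C 2) \<inter> inside (C 1 \<union> C 2) = {}"
    and un: "inside (C 0 \<union> C 2) \<union> inside (C 1 \<union> C 2) \<union> (C 2 - {a 0, a 1}) = inside (C 0 \<union> C 1)"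
  proof (rule split_inside_simple_closed_curve[of "c 0" "a 0" "a 1" "c 1" "c 2"])
    show "path_image (c 2) \<inter> inside (path_image (c 0) \<union> path_image (c 1)) \<noteq> {}"
      using b2' bC'[of 2] C by auto
  qed (use carc cs cf a01 CC C in auto)
  define U where "U j = path_image (g 2 j) - {b j}" for j
  have U: "connected (U j)" "b j \<in> closure (U j)" "a 2 \<in> U j" if "j < 3" for j
    using arc_minus_finish[OF K33_arc[OF K n3(3) that]] K33_finish[OF K n3(3) that] K33_start[OF K n3(3) that]
    unfolding U_def by auto
  have UC: "U i \<inter> C j = {}" if "i < 3" "j < 3" for i j
  proof -
    have False if x: "x \<in> U i" "x \<in> C j" for x
    proof -
      from x(2) consider "x \<in> path_image (g 0 j)" | "x \<in> path_image (g 1 j)"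
        unfolding C_def by blast
      then show False
        using K33_meet[OF K, of x 2 i 0 j] K33_meet[OF K, of x 2 i 1 j] x(1) \<open>i < 3\<close> \<open>j < 3\<close>
        unfolding U_def by cases auto
    qed
    then show ?thesis by blast
  qed
  have a2: "a 2 \<notin> C j" if "j < 3" for j
    using UC[of 0 j] U(3)[of 0] that by auto
  have UC2: "U i \<inter> (C j \<union> C k) = {}" if "i < 3" "j < 3" "k < 3" for i j k
    using UC[OF that(1,2)] UC[OF that(1,3)] by blast
  have n01: "inside (C 0 \<union> C 1) \<inter> (C 0 \<union> C 1) = {}"
    by simp
  consider "a 2 \<in> inside (C 0 \<union> C 2)" | "a 2 \<in> inside (C 1 \<union> C 2)" | "a 2 \<in> outside (C 0 \<union> C 1)"
  proof -
    have "a 2 \<in> inside (C 0 \<union> C 1) \<union> outside (C 0 \<union> C 1)"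
      unfolding inside_Un_outside using a2[OF n3(1)] a2[OF n3(2)] by simp
    then show thesis
      using that un a2[OF n3(3)] by blast
  qed
  then show False
  proof cases
    case 1
    have "U 1 \<subseteq> inside (C 0 \<union> C 2)"
      by (rule inside_connected[OF U(1) UC2 U(3) 1]) auto
    then have "b 1 \<in> inside (C 0 \<union> C 2)"
      by (rule closure_inside_D[rotated]) (use U(2)[of 1] bC[of 1 0] bC[of 1 2] closed[of 0] closed[of 2] in auto)
    then have "b 1 \<in> inside (C 0 \<union> C 1)" using un by blast
    then show False using n01 bC'[OF n3(2)] by blast
  next
    case 2
    have "U 0 \<subseteq> inside (C 1 \<union> C 2)"
      by (rule inside_connected[OF U(1) UC2 U(3) 2]) auto
    then have "b 0 \<in> inside (C 1 \<union> C 2)"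
      by (rule closure_inside_D[rotated]) (use U(2)[of 0] bC[of 0 1] bC[of 0 2] closed[of 1] closed[of 2] in auto)
    then have "b 0 \<in> inside (C 0 \<union> C 1)" using un by blast
    then show False using n01 bC'[OF n3(1)] by blast
  next
    case 3
    have "U 2 \<subseteq> outside (C 0 \<union> C 1)"
      by (rule outside_connected[OF U(1) UC2 U(3) 3]) auto
    then have "b 2 \<in> outside (C 0 \<union> C 1)"
      by (rule closure_outside_D[rotated]) (use U(2)[of 2] bC[of 2 0] bC[of 2 1] closed[of 0] closed[of 1] in auto)
    then show False using b2' inside_Int_outside[of "C 0 \<union> C 1"] by blast
  qed
qed

text \<open>
  Inversion at an inner point of a curve turns its outside into a bounded set, apart from the centre,
  which is the image of infinity.
\<close>

lemma inside_inversion: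
  fixes J :: "complex set"
  assumes J: "compact J" and q: "q \<in> inside J" and x: "x \<in> outside J"
  shows "inverse (x - q) \<in> inside ((\<lambda>z. inverse (z - q)) ` J)"
proof -
  define f where "f z = inverse (z - q)" for z :: complex
  define h where "h w = q + inverse w" for w :: complex
  have hf: "h (f z) = z" for z unfolding h_def f_def by simp
  have fh: "f (h w) = w" for w unfolding h_def f_def by simp
  have qJ: "q \<notin> J" and xJ: "x \<notin> J" using q x by (auto simp: inside_def outside_def)
  have xq: "x \<noteq> q" using q x inside_Int_outside by blast
  have cont: "continuous_on J f"
    unfolding f_def using qJ by (intro continuous_intros) auto
  have cl: "closed (f ` J)"
    by (intro compact_imp_closed compact_continuous_image cont J)
  have fx: "f x \<notin> f ` J" using xJ hf by (metis imageE)
  define K where "K = connected_component_set (- f ` J) (f x)"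
  have K: "open K" "connected K" "f x \<in> K" "K \<subseteq> - f ` J"
    unfolding K_def using cl fx
    by (auto intro: open_connected_component simp: connected_component_subset)
  have K0: "connected (K - {0})"
    by (rule connected_open_delete) (use K in auto)
  have "continuous_on (K - {0}) h"
    unfolding h_def by (intro continuous_intros) auto
  then have conn: "connected (h ` (K - {0}))"
    using K0 by (rule connected_continuous_image)
  have disj: "h ` (K - {0}) \<inter> J = {}"
  proof -
    have False if "w \<in> K" "h w \<in> J" for w
    proof -
      have "f (h w) \<in> f ` J" using that(2) by blast
      then show False using that(1) K(4) unfolding fh by blast
    qed
    then show ?thesis by blast
  qed
  have xin: "x \<in> h ` (K - {0})"
  proof (rule image_eqI[of _ _ "f x"])
    show "x = h (f x)" using hf by simp
    show "f x \<in> K - {0}" using K(3) xq by (simp add: f_def)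
  qed
  have sub: "h ` (K - {0}) \<subseteq> outside J"
    by (rule outside_connected[OF conn disj xin x])
  obtain \<delta> where \<delta>: "\<delta> > 0" "ball q \<delta> \<subseteq> inside J"
    using open_inside[OF compact_imp_closed[OF J]] q open_contains_ball by blast
  have "K \<subseteq> cball 0 (1 / \<delta>)"
  proof
    fix w assume w: "w \<in> K"
    show "w \<in> cball 0 (1 / \<delta>)"
    proof (cases "w = 0")
      case False
      then have "h w \<in> outside J" using w sub by blast
      then have "h w \<notin> ball q \<delta>" using \<delta>(2) inside_Int_outside[of J] by blast
      then have "\<delta> \<le> norm (inverse w)"
        by (simp add: h_def dist_norm)
      then have "\<delta> \<le> 1 / norm w" by (simp add: norm_inverse divide_inverse)
      then have "norm w \<le> 1 / \<delta>"
        using False \<delta>(1) by (simp add: field_simps)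
      then show ?thesis by simp
    qed (use \<delta> in auto)
  qed
  then have "bounded K" using bounded_cball bounded_subset by blast
  then have "f x \<in> inside (f ` J)"
    using fx unfolding inside_def K_def by simp
  then show ?thesis unfolding f_def .
qed

lemma K33_drawing_mono: "K33_drawing S a b g \<Longrightarrow> S \<subseteq> T \<Longrightarrow> K33_drawing T a b g"
  unfolding K33_drawing_def by blast

lemma K33_drawing_avoid:
  "K33_drawing S a b g \<Longrightarrow> (\<And>i j. i < 3 \<Longrightarrow> j < 3 \<Longrightarrow> q \<notin> path_image (g i j)) \<Longrightarrow>
   K33_drawing (S - {q}) a b g"
  unfolding K33_drawing_def by blast

text \<open>
  If the third arc of the theta curve passes outside, then the inside of the closed curve formed by
  the first two contains no point of the drawing at all: any edge that enters it would have to stay.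
  An inversion at such a point moves the third arc inside.
\<close>

lemma K33_not_plane:
  fixes a b :: "nat \<Rightarrow> complex"
  assumes K: "K33_drawing UNIV a b g"
  shows False
proof -
  define J where "J = path_image (g 0 0) \<union> path_image (g 1 0) \<union> (path_image (g 0 1) \<union> path_image (g 1 1))"
  have cJ: "compact J"
    unfolding J_def using K33_arc[OF K] by (intro compact_Un compact_path_image arc_imp_path) auto
  have b2J: "b 2 \<notin> J"
    using K33_b_notin[OF K] unfolding J_def by auto
  have b2: "b 2 \<in> outside J"
    using K33_plane_inside[OF K, folded J_def] b2J inside_Un_outside[of J] by blast
  have a2J: "a 2 \<notin> J"
    using K33_a_notin[OF K] unfolding J_def by auto
  have J_cases: "\<exists>k\<in>{0,1}. \<exists>l\<in>{0,1}. x \<in> path_image (g k l)" if "x \<in> J" for x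
    using that unfolding J_def by blast
  define U where "U j = path_image (g 2 j) - {b j}" for j
  have U: "connected (U j)" "b j \<in> closure (U j)" "a 2 \<in> U j" if "j < 3" for j
    using arc_minus_finish[OF K33_arc[OF K _ that]] K33_finish[OF K _ that] K33_start[OF K _ that]
    unfolding U_def by (auto simp: numeral_3_eq_3)
  have UJ: "U j \<inter> J = {}" if j: "j < 3" for j
  proof -
    have False if x: "x \<in> U j" "x \<in> J" for x
    proof -
      obtain k l where kl: "k \<in> {0,1}" "l \<in> {0,1}" "x \<in> path_image (g k l)"
        using J_cases[OF x(2)] by blast
      then have "k < 3" "l < 3" "k \<noteq> 2" by auto
      then show False
        using K33_meet[OF K _ kl(3), of 2 j] x(1) j unfolding U_def by auto
    qed
    then show ?thesis by blast
  qed
  have "a 2 \<notin> inside J"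
  proof
    assume a2: "a 2 \<in> inside J"
    have "U 2 \<subseteq> inside J"
      by (rule inside_connected[OF U(1) UJ U(3) a2]) auto
    then have "b 2 \<in> inside J"
      by (rule closure_inside_D[rotated]) (use U(2) b2J compact_imp_closed[OF cJ] in auto)
    then show False using b2 inside_Int_outside by blast
  qed
  then have a2: "a 2 \<in> outside J"
    using a2J inside_Un_outside[of J] by blast
  have arcs: "path_image (g i j) \<inter> inside J = {}" if ij: "i < 3" "j < 3" for i j
  proof -
    consider "i = 2" | "i < 2" "j < 2" | "i < 2" "j = 2"
      using ij by linarith
    then show ?thesis
    proof cases
      case 1
      have "U j \<subseteq> outside J"
        by (rule outside_connected[OF U(1) UJ U(3) a2]) (use ij in auto)
      moreover have "b j \<notin> inside J"
      proof (cases "j = 2")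
        case True then show ?thesis using b2 inside_Int_outside by blast
      next
        case False
        then have "j = 0 \<or> j = 1" using ij by auto
        then have "b j \<in> J" using K33_b_on[OF K, of 0 j] ij unfolding J_def by auto
        then show ?thesis using inside_no_overlap[of J] by blast
      qed
      ultimately show ?thesis
        using 1 inside_Int_outside[of J] unfolding U_def by blast
    next
      case 2
      then have "i = 0 \<or> i = 1" "j = 0 \<or> j = 1" by auto
      then have "path_image (g i j) \<subseteq> J" unfolding J_def by auto
      then show ?thesis using inside_no_overlap[of J] by blast
    next
      case 3
      define r where "r = reversepath (g i 2)"
      have r: "arc r" "path_image r = path_image (g i j)" "pathstart r = b 2" "pathfinish r = a i"
        using K33_arc[OF K, of i 2] K33_start[OF K, of i 2] K33_finish[OF K, of i 2] 3
        unfolding r_def by (auto simp: arc_reversepath)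
      have i01: "i = 0 \<or> i = 1" using 3 by auto
      have "(path_image r - {a i}) \<inter> J = {}"
      proof -
        have False if x: "x \<in> path_image r - {a i}" "x \<in> J" for x
        proof -
          obtain k l where kl: "k \<in> {0,1}" "l \<in> {0,1}" "x \<in> path_image (g k l)"
            using J_cases[OF x(2)] by blast
          then have "k < 3" "l < 3" "l \<noteq> 2" by auto
          then show False
            using K33_meet[OF K _ kl(3), of i j] x(1) ij 3 unfolding r(2) by auto
        qed
        then show ?thesis by blast
      qed
      then have "path_image r - {a i} \<subseteq> outside J"
        using outside_connected[OF arc_minus_finish(1)[OF r(1)] _ arc_minus_finish(3)[OF r(1)]] r b2
        by auto
      moreover have "a i \<in> J"
        using K33_a_on[OF K, of i 0] i01 unfolding J_def by auto
      ultimately show ?thesis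
        using inside_Int_outside[of J] inside_no_overlap[of J] unfolding r(2) by blast
    qed
  qed
  obtain q where q: "q \<in> inside J"
  proof -
    obtain c where c: "arc c" "pathstart c = a 0" "pathfinish c = a 1"
        "path_image c = path_image (g 0 0) \<union> path_image (g 1 0)"
      using K33_theta[OF K, of 0] by auto
    obtain d where d: "arc d" "pathstart d = a 0" "pathfinish d = a 1"
        "path_image d = path_image (g 0 1) \<union> path_image (g 1 1)"
      using K33_theta[OF K, of 1] by auto
    have meet: "path_image c \<inter> path_image d = {a 0, a 1}"
      using K33_theta_meet[OF K, of 0 1] c d by auto
    have "simple_path (c +++ reversepath d)"
      by (rule simple_path_join_loop) (use c d meet in \<open>auto simp: arc_reversepath\<close>)
    moreover have "path_image (c +++ reversepath d) = J"
      using c d unfolding J_def by (subst path_image_join) auto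
    ultimately have "inside J \<noteq> {}"
      using Jordan_inside_outside[of "c +++ reversepath d"] c d by auto
    then show thesis using that by blast
  qed
  define f where "f z = inverse (z - q)" for z :: complex
  have K': "K33_drawing (UNIV - {q}) a b g"
    by (rule K33_drawing_avoid[OF K]) (use arcs q in blast)
  have cont: "continuous_on (UNIV - {q}) f"
    unfolding f_def by (intro continuous_intros) auto
  have inj: "inj_on f (UNIV - {q})"
    unfolding f_def inj_on_def by auto
  have "K33_drawing UNIV (f \<circ> a) (f \<circ> b) (\<lambda>i j. f \<circ> g i j)"
    by (rule K33_drawing_mono[OF K33_drawing_image[OF K' cont inj]]) simp
  moreover have "(f \<circ> b) 2 \<in> inside (f ` J)"
    using inside_inversion[OF cJ q b2] unfolding f_def by simp
  ultimately show False
    using K33_plane_inside[of "f \<circ> a" "f \<circ> b" "\<lambda>i j. f \<circ> g i j"]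
    unfolding J_def by (simp add: path_image_compose image_Un)
qed

lemma punctured_sphere_homeomorphic_complex:
  fixes q :: "real \<times> real \<times> real"
  assumes "q \<in> sphere 0 1"
  shows "(sphere 0 1 - {q}) homeomorphic (UNIV :: complex set)"
proof -
  define T where "T = {x :: real \<times> real \<times> real. (1, 0, 0) \<bullet> x = 0}"
  have "(sphere 0 1 - {q}) homeomorphic T"
    unfolding T_def
    by (rule homeomorphic_punctured_sphere_hyperplane) (use assms in \<open>auto simp: zero_prod_def\<close>)
  moreover have "T homeomorphic (UNIV :: complex set)"
  proof (rule homeomorphic_affine_sets)
    show "affine T" unfolding T_def by (rule affine_hyperplane)
    have "aff_dim T = 2"
      unfolding T_def by (subst aff_dim_hyperplane) (auto simp: zero_prod_def)
    then show "aff_dim T = aff_dim (UNIV :: complex set)" by simp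
  qed simp
  ultimately show ?thesis by (rule homeomorphic_trans)
qed

text \<open>
  Arcs have dimension one: if the nine arcs covered the sphere, a nonempty open part of it would
  be covered by a single arc, and invariance of dimension would be violated.
\<close>

lemma K33_drawing_proper:
  fixes a b :: "nat \<Rightarrow> real \<times> real \<times> real"
  assumes K: "K33_drawing (sphere 0 1) a b g"
  obtains q where "q \<in> sphere 0 1" "\<And>i j. i < 3 \<Longrightarrow> j < 3 \<Longrightarrow> q \<notin> path_image (g i j)"
proof (rule ccontr)
  assume "\<not> thesis"
  then have cover: "\<exists>i<3. \<exists>j<3. x \<in> path_image (g i j)" if "x \<in> sphere 0 1" for x
    using that \<open>\<And>q. q \<in> sphere 0 1 \<Longrightarrow> (\<And>i j. i < 3 \<Longrightarrow> j < 3 \<Longrightarrow> q \<notin> path_image (g i j)) \<Longrightarrow> thesis\<close>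
    by blast
  define I where "I = {0..<3::nat} \<times> {0..<3::nat} - {(0, 0)}"
  define R where "R = (\<Union>(i, j)\<in>I. path_image (g i j))"
  define W where "W = sphere 0 1 - R"
  have n3: "(0::nat) < 3" by simp
  have "closed R"
    unfolding R_def
    by (rule closed_UN) (auto simp: I_def intro!: closed_path_image arc_imp_path K33_arc[OF K])
  have a0: "a 0 \<in> sphere 0 1" "a 0 \<in> R"
    using K33_a_on[OF K, of 0 1] K33_sub[OF K, of 0 1] unfolding R_def I_def by auto
  obtain \<phi> \<psi> where h: "homeomorphism (sphere 0 1 - {a 0}) (UNIV :: complex set) \<phi> \<psi>"
    using punctured_sphere_homeomorphic_complex[OF a0(1)] unfolding homeomorphic_def by blast
  obtain k where k: "homeomorphism {0..1} (path_image (g 0 0)) (g 0 0) k"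
    using homeomorphism_arc[OF K33_arc[OF K n3 n3]] .
  have Wsub: "W \<subseteq> sphere 0 1 - {a 0}" and Wg: "W \<subseteq> path_image (g 0 0)"
  proof -
    show "W \<subseteq> sphere 0 1 - {a 0}" using a0 unfolding W_def by blast
    show "W \<subseteq> path_image (g 0 0)"
    proof
      fix x assume x: "x \<in> W"
      then obtain i j where "i < 3" "j < 3" "x \<in> path_image (g i j)"
        using cover unfolding W_def by blast
      then show "x \<in> path_image (g 0 0)"
        using x unfolding W_def R_def I_def by (cases "(i, j) = (0, 0)") auto
    qed
  qed
  have "openin (top_of_set (sphere 0 1 - {a 0})) W"
  proof -
    have "W = (sphere 0 1 - {a 0}) \<inter> - R" using a0 unfolding W_def by blast
    then show ?thesis using \<open>closed R\<close> by (simp add: openin_open_Int open_Compl)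
  qed
  then have op: "open (\<phi> ` W)"
    using homeomorphism_imp_open_map[OF h] by simp
  have "g 0 0 (1/2) \<in> W"
  proof -
    have inj: "inj_on (g 0 0) {0..1}" using K33_arc[OF K n3 n3] by (simp add: arc_def)
    have x: "g 0 0 (1/2) \<in> path_image (g 0 0)" unfolding path_image_def by auto
    have "g 0 0 (1/2) \<noteq> g 0 0 0" "g 0 0 (1/2) \<noteq> g 0 0 1"
      using inj_onD[OF inj, of "1/2" 0] inj_onD[OF inj, of "1/2" 1] by auto
    then have ne: "g 0 0 (1/2) \<noteq> a 0" "g 0 0 (1/2) \<noteq> b 0"
      using K33_start[OF K n3 n3] K33_finish[OF K n3 n3] unfolding pathstart_def pathfinish_def by auto
    have "g 0 0 (1/2) \<notin> R"
    proof
      assume "g 0 0 (1/2) \<in> R"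
      then obtain z where "z \<in> I" "g 0 0 (1/2) \<in> path_image (g (fst z) (snd z))"
        unfolding R_def by auto
      then obtain i j where ij: "i < 3" "j < 3" "(i, j) \<noteq> (0, 0)" "g 0 0 (1/2) \<in> path_image (g i j)"
        unfolding I_def by (cases z) force
      then show False using K33_meet[OF K x ij(4)] ne by auto
    qed
    then show ?thesis using x K33_sub[OF K n3 n3] unfolding W_def by blast
  qed
  then have ne: "\<phi> ` W \<noteq> {}" by blast
  have \<psi>W: "\<psi> ` (\<phi> ` W) = W"
  proof -
    have "\<psi> (\<phi> x) = x" if "x \<in> W" for x
      using h Wsub that unfolding homeomorphism_def by blast
    then show ?thesis by (simp add: image_image)
  qed
  have cont: "continuous_on (\<phi> ` W) (k \<circ> \<psi>)"
  proof (rule continuous_on_compose)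
    show "continuous_on (\<phi> ` W) \<psi>"
      using h unfolding homeomorphism_def by (metis continuous_on_subset subset_UNIV)
    show "continuous_on (\<psi> ` \<phi> ` W) k"
      using k Wg unfolding \<psi>W homeomorphism_def by (metis continuous_on_subset)
  qed
  have "inj_on \<psi> (\<phi> ` W)"
    using h unfolding homeomorphism_def by (metis UNIV_I inj_onI)
  moreover have "inj_on k W"
    using k Wg unfolding homeomorphism_def by (metis inj_onI subset_iff)
  ultimately have inj: "inj_on (k \<circ> \<psi>) (\<phi> ` W)"
    by (simp add: comp_inj_on \<psi>W)
  have "DIM(complex) \<le> DIM(real)"
    by (rule invariance_of_dimension[OF cont op inj ne])
  then show False by simp
qed

lemma K33_not_sphere:
  fixes a b :: "nat \<Rightarrow> real \<times> real \<times> real"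
  assumes K: "K33_drawing (sphere 0 1) a b g"
  shows False
proof -
  obtain q where q: "q \<in> sphere 0 1" "\<And>i j. i < 3 \<Longrightarrow> j < 3 \<Longrightarrow> q \<notin> path_image (g i j)"
    using K33_drawing_proper[OF K] by blast
  obtain \<phi> \<psi> where h: "homeomorphism (sphere 0 1 - {q}) (UNIV :: complex set) \<phi> \<psi>"
    using punctured_sphere_homeomorphic_complex[OF q(1)] unfolding homeomorphic_def by blast
  have "K33_drawing (\<phi> ` (sphere 0 1 - {q})) (\<phi> \<circ> a) (\<phi> \<circ> b) (\<lambda>i j. \<phi> \<circ> g i j)"
  proof (rule K33_drawing_image)
    show "K33_drawing (sphere 0 1 - {q}) a b g"
      by (rule K33_drawing_avoid[OF K q(2)])
    show "continuous_on (sphere 0 1 - {q}) \<phi>"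
      using h unfolding homeomorphism_def by blast
    show "inj_on \<phi> (sphere 0 1 - {q})"
      using h unfolding homeomorphism_def by (metis inj_onI)
  qed
  then show False
    using K33_not_plane K33_drawing_mono[OF _ subset_UNIV] by blast
qed

lemma not_drawable_on_sphere:
  fixes Q :: "'a quiver" and a b :: "nat \<Rightarrow> 'a"
  assumes e: "\<And>i j. i < 3 \<Longrightarrow> j < 3 \<Longrightarrow> {a i, b j} \<in> underlying_edges Q"
    and inj: "inj_on a {..<3}" "inj_on b {..<3}"
    and ab: "\<And>i j. i < 3 \<Longrightarrow> j < 3 \<Longrightarrow> a i \<noteq> b j"
    and V: "\<And>i. i < 3 \<Longrightarrow> a i \<in> verts Q \<and> b i \<in> verts Q"
  shows "\<not> drawable_on Q (closed_surface 0)"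
proof
  assume "drawable_on Q (closed_surface 0)"
  then obtain p \<gamma> where p: "inj_on p (verts Q)"
    and \<gamma>: "\<forall>e\<in>underlying_edges Q.
          arc (\<gamma> e) \<and> path_image (\<gamma> e) \<subseteq> closed_surface 0 \<and>
          {pathstart (\<gamma> e), pathfinish (\<gamma> e)} = p ` e \<and>
          path_image (\<gamma> e) \<inter> p ` verts Q = p ` e"
    and meet: "\<forall>e\<in>underlying_edges Q. \<forall>e'\<in>underlying_edges Q. e \<noteq> e' \<longrightarrow>
           path_image (\<gamma> e) \<inter> path_image (\<gamma> e') \<subseteq> p ` verts Q"
    unfolding drawable_on_def by (elim exE conjE) (rule that; assumption)
  define c where "c i j = \<gamma> {a i, b j}" for i j
  define g where "g i j = (if pathstart (c i j) = p (a i) then c i j else reversepath (c i j))" for i j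
  have c: "arc (c i j)" "path_image (c i j) \<subseteq> closed_surface 0"
      "{pathstart (c i j), pathfinish (c i j)} = {p (a i), p (b j)}"
      "path_image (c i j) \<inter> p ` verts Q = {p (a i), p (b j)}" if "i < 3" "j < 3" for i j
    using bspec[OF \<gamma> e[OF that]] unfolding c_def by simp_all
  have img: "path_image (g i j) = path_image (c i j)" for i j
    unfolding g_def by simp
  have g: "arc (g i j)" "pathstart (g i j) = p (a i)" "pathfinish (g i j) = p (b j)"
    if "i < 3" "j < 3" for i j
    using c(1,3)[OF that] unfolding g_def by (auto simp: arc_reversepath doubleton_eq_iff)
  have "K33_drawing (closed_surface 0) (p \<circ> a) (p \<circ> b) g"
    unfolding K33_drawing_def
  proof (intro conjI allI impI)
    fix i j i' j' :: nat and x
    assume lt: "i < 3" "j < 3" "i' < 3" "j' < 3" and ne: "(i, j) \<noteq> (i', j')"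
      and x: "x \<in> path_image (g i j)" "x \<in> path_image (g i' j')"
    have "{a i, b j} \<noteq> {a i', b j'}"
      using ne lt ab inj_onD[OF inj(1), of i i'] inj_onD[OF inj(2), of j j']
      by (auto simp: doubleton_eq_iff)
    then have "x \<in> p ` verts Q"
      using bspec[OF bspec[OF meet e[OF lt(1,2)]] e[OF lt(3,4)]] x unfolding img c_def by blast
    then have x': "x = p (a i) \<or> x = p (b j)" "x = p (a i') \<or> x = p (b j')"
      using c(4)[OF lt(1,2)] c(4)[OF lt(3,4)] x unfolding img by blast+
    have pa: "i = i'" if "p (a i) = p (a i')"
      using inj_onD[OF p that] inj_onD[OF inj(1)] V lt by auto
    have pb: "j = j'" if "p (b j) = p (b j')"
      using inj_onD[OF p that] inj_onD[OF inj(2)] V lt by auto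
    have pab: "p (a k) \<noteq> p (b l)" if "k < 3" "l < 3" for k l
      using inj_onD[OF p, of "a k" "b l"] V ab that by auto
    show "i = i' \<and> x = (p \<circ> a) i \<or> j = j' \<and> x = (p \<circ> b) j"
      using x' pa pb pab[OF lt(1,4)] pab[OF lt(3,2)] by auto
  qed (use g c img in auto)
  moreover obtain \<phi> \<psi> where h: "homeomorphism (closed_surface 0) (sphere (0 :: real \<times> real \<times> real) 1) \<phi> \<psi>"
    using closed_surface_0_homeomorphic_sphere unfolding homeomorphic_def by blast
  ultimately have "K33_drawing (\<phi> ` closed_surface 0) (\<phi> \<circ> (p \<circ> a)) (\<phi> \<circ> (p \<circ> b)) (\<lambda>i j. \<phi> \<circ> g i j)"
  proof (intro K33_drawing_image)
    show "inj_on \<phi> (closed_surface 0)"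
      using h unfolding homeomorphism_def by (metis inj_onI)
  qed (auto simp: homeomorphism_def)
  then have "K33_drawing (sphere 0 1) (\<phi> \<circ> (p \<circ> a)) (\<phi> \<circ> (p \<circ> b)) (\<lambda>i j. \<phi> \<circ> g i j)"
    using h by (simp add: homeomorphism_def)
  then show False by (rule K33_not_sphere)
qed

section \<open>Straight-line drawings\<close>

text \<open>
  A drawing of an abstract graph, to be shared by all quivers whose underlying graphs embed in it.
\<close>

definition graph_drawing ::
    "'b::topological_space set \<Rightarrow> 'v set \<Rightarrow> 'v set set \<Rightarrow> ('v \<Rightarrow> 'b) \<Rightarrow> ('v set \<Rightarrow> real \<Rightarrow> 'b) \<Rightarrow> bool" where
  "graph_drawing S V E p \<gamma> \<longleftrightarrow>
     inj_on p V \<and> p ` V \<subseteq> S \<and>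
     (\<forall>e\<in>E. arc (\<gamma> e) \<and> path_image (\<gamma> e) \<subseteq> S \<and>
        {pathstart (\<gamma> e), pathfinish (\<gamma> e)} = p ` e \<and> path_image (\<gamma> e) \<inter> p ` V = p ` e) \<and>
     (\<forall>e\<in>E. \<forall>e'\<in>E. e \<noteq> e' \<longrightarrow> path_image (\<gamma> e) \<inter> path_image (\<gamma> e') \<subseteq> p ` V)"

lemma drawable_on_if_graph_drawing:
  assumes G: "graph_drawing S V E p \<gamma>" and Q: "cluster_quiver Q"
    and f: "inj_on f (verts Q)" "f ` verts Q \<subseteq> V"
    and E: "\<And>i j. 0 < arrows Q i j \<Longrightarrow> {f i, f j} \<in> E"
  shows "drawable_on Q S"
proof -
  have sub: "e \<subseteq> verts Q" and im: "f ` e \<in> E" if "e \<in> underlying_edges Q" for e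
    using that Q E unfolding underlying_edges_def cluster_quiver_def by auto
  have p: "inj_on p V" "p ` V \<subseteq> S"
    and \<gamma>: "\<And>e. e \<in> E \<Longrightarrow> arc (\<gamma> e) \<and> path_image (\<gamma> e) \<subseteq> S \<and>
        {pathstart (\<gamma> e), pathfinish (\<gamma> e)} = p ` e \<and> path_image (\<gamma> e) \<inter> p ` V = p ` e"
    and meet: "\<And>e e'. e \<in> E \<Longrightarrow> e' \<in> E \<Longrightarrow> e \<noteq> e' \<Longrightarrow>
        path_image (\<gamma> e) \<inter> path_image (\<gamma> e') \<subseteq> p ` V"
    using G unfolding graph_drawing_def by simp_all
  show ?thesis
    unfolding drawable_on_def
  proof (intro exI[of _ "p \<circ> f"] exI[of _ "\<lambda>e. \<gamma> (f ` e)"] conjI ballI impI)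
    show "inj_on (p \<circ> f) (verts Q)"
      by (rule comp_inj_on[OF f(1) inj_on_subset[OF p(1) f(2)]])
    show "(p \<circ> f) ` verts Q \<subseteq> S"
      using p(2) f(2) by auto
  next
    fix e assume e: "e \<in> underlying_edges Q"
    note g = \<gamma>[OF im[OF e]]
    show "arc (\<gamma> (f ` e))" "path_image (\<gamma> (f ` e)) \<subseteq> S"
      "{pathstart (\<gamma> (f ` e)), pathfinish (\<gamma> (f ` e))} = (p \<circ> f) ` e"
      using g by (simp_all add: image_comp)
    have "(p \<circ> f) ` verts Q \<subseteq> p ` V"
      using f(2) by auto
    then have "path_image (\<gamma> (f ` e)) \<inter> (p \<circ> f) ` verts Q =
        path_image (\<gamma> (f ` e)) \<inter> p ` V \<inter> (p \<circ> f) ` verts Q"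
      by blast
    also have "\<dots> = (p \<circ> f) ` e \<inter> (p \<circ> f) ` verts Q"
      using g by (simp add: image_comp)
    also have "\<dots> = (p \<circ> f) ` e"
      using image_mono[OF sub[OF e]] by (rule Int_absorb2)
    finally show "path_image (\<gamma> (f ` e)) \<inter> (p \<circ> f) ` verts Q = (p \<circ> f) ` e" .
  next
    fix e e' assume e: "e \<in> underlying_edges Q" and e': "e' \<in> underlying_edges Q" and "e \<noteq> e'"
    then have "f ` e \<noteq> f ` e'"
      using inj_on_image_eq_iff[OF f(1) sub sub] by blast
    then have "path_image (\<gamma> (f ` e)) \<inter> path_image (\<gamma> (f ` e')) \<subseteq> p ` V"
      by (rule meet[OF im[OF e] im[OF e']])
    moreover have "path_image (\<gamma> (f ` e)) \<inter> p ` V = (p \<circ> f) ` e"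
      using \<gamma>[OF im[OF e]] by (simp add: image_comp)
    ultimately have "path_image (\<gamma> (f ` e)) \<inter> path_image (\<gamma> (f ` e')) \<subseteq> (p \<circ> f) ` e"
      by blast
    then show "path_image (\<gamma> (f ` e)) \<inter> path_image (\<gamma> (f ` e')) \<subseteq> (p \<circ> f) ` verts Q"
      using image_mono[OF sub[OF e]] by (rule order_trans)
  qed
qed

type_synonym point = "real \<times> real \<times> real"

text \<open>
  Twice the signed area of the triangle, as seen from above: the sign tells on which side of the line
  through \<open>a\<close> and \<open>b\<close> the point \<open>c\<close> lies.
\<close>

definition side :: "point \<Rightarrow> point \<Rightarrow> point \<Rightarrow> real" where
  "side a b c =
     (fst b - fst a) * (fst (snd c) - fst (snd a)) - (fst (snd b) - fst (snd a)) * (fst c - fst a)"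

lemma side_segment: "side a b ((1 - t) *\<^sub>R c + t *\<^sub>R d) = (1 - t) * side a b c + t * side a b d"
  unfolding side_def by (simp add: algebra_simps)

lemma side_self: "side a b a = 0" "side a b b = 0"
  unfolding side_def by simp_all

lemma side_on_segment: "x \<in> closed_segment a b \<Longrightarrow> side a b x = 0"
  unfolding closed_segment_def by (auto simp: side_segment side_self)

lemma segment_one_side:
  assumes "x \<in> closed_segment c d" "side a b x = 0" "side a b c * side a b d > 0"
  shows False
proof -
  obtain t where t: "0 \<le> t" "t \<le> 1" and x: "x = (1 - t) *\<^sub>R c + t *\<^sub>R d"
    using assms(1) unfolding closed_segment_def by auto
  have eq: "(1 - t) * side a b c + t * side a b d = 0"
    using assms(2) unfolding x side_segment .
  consider "side a b c > 0" "side a b d > 0" | "side a b c < 0" "side a b d < 0"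
    using assms(3) by (auto simp: zero_less_mult_iff)
  then show False
  proof cases
    case 1
    then have "0 < (1 - t) * side a b c + t * side a b d"
      using t by (cases "t = 0") (auto intro: add_nonneg_pos)
    then show False using eq by simp
  next
    case 2
    then have "0 > (1 - t) * side a b c + t * side a b d"
      using t by (cases "t = 0") (auto intro!: add_nonpos_neg mult_nonneg_nonpos mult_pos_neg)
    then show False using eq by simp
  qed
qed

lemma segment_shared_end:
  assumes "x \<in> closed_segment c d" "side a b x = 0" "side a b c = 0" "side a b d \<noteq> 0"
  shows "x = c"
proof -
  obtain t where x: "x = (1 - t) *\<^sub>R c + t *\<^sub>R d"
    using assms(1) unfolding closed_segment_def by auto
  have "t * side a b d = 0"
    using assms(2,3) unfolding x side_segment by simp
  then show ?thesis using assms(4) x by simp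
qed

text \<open>
  The orientation of the segment is immaterial, so that one is chosen.
\<close>

definition straight :: "('v \<Rightarrow> point) \<Rightarrow> 'v set \<Rightarrow> real \<Rightarrow> point" where
  "straight p e = (let uv = SOME uv. e = {fst uv, snd uv} in linepath (p (fst uv)) (p (snd uv)))"

lemma straight_cases:
  fixes p :: "'v \<Rightarrow> point"
  assumes "u \<noteq> v"
  obtains "straight p {u, v} = linepath (p u) (p v)" | "straight p {u, v} = linepath (p v) (p u)"
proof -
  define w where "w = (SOME uv :: 'v \<times> 'v. {u, v} = {fst uv, snd uv})"
  have "{u, v} = {fst w, snd w}"
    unfolding w_def by (rule someI[of _ "(u, v)"]) simp
  then have "fst w = u \<and> snd w = v \<or> fst w = v \<and> snd w = u"
    using assms by (auto simp: doubleton_eq_iff)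
  moreover have "straight p {u, v} = linepath (p (fst w)) (p (snd w))"
    unfolding straight_def w_def by (simp add: Let_def)
  ultimately show thesis using that by auto
qed

lemma path_image_straight: "u \<noteq> v \<Longrightarrow> path_image (straight p {u, v}) = closed_segment (p u) (p v)"
  by (rule straight_cases[of u v p]) (auto simp: closed_segment_commute)

text \<open>
  Segments do not cross if one of them lies strictly on one side of the other. For segments with a
  common end it suffices that they are not collinear.
\<close>

lemma straight_line_drawing:
  fixes p :: "'v \<Rightarrow> point"
  assumes inj: "inj_on p V" and S: "convex S" "p ` V \<subseteq> S"
    and E: "\<And>e. e \<in> E \<Longrightarrow> \<exists>u v. u \<in> V \<and> v \<in> V \<and> u \<noteq> v \<and> e = {u, v}"
    and off: "\<And>u v w. {u, v} \<in> E \<Longrightarrow> u \<noteq> v \<Longrightarrow> w \<in> V \<Longrightarrow> w \<noteq> u \<Longrightarrow> w \<noteq> v \<Longrightarrow> side (p u) (p v) (p w) \<noteq> 0"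
    and cross: "\<And>u v s t. {u, v} \<in> E \<Longrightarrow> {s, t} \<in> E \<Longrightarrow> u \<noteq> v \<Longrightarrow> s \<noteq> t \<Longrightarrow> {u, v} \<inter> {s, t} = {} \<Longrightarrow>
       side (p u) (p v) (p s) * side (p u) (p v) (p t) > 0 \<or>
       side (p s) (p t) (p u) * side (p s) (p t) (p v) > 0"
  shows "graph_drawing S V E p (straight p)"
  unfolding graph_drawing_def
proof (intro conjI ballI impI inj S(2))
  fix e assume e: "e \<in> E"
  then obtain u v where uv: "u \<in> V" "v \<in> V" "u \<noteq> v" "e = {u, v}"
    using E by blast
  have ne: "p u \<noteq> p v"
    using inj_onD[OF inj] uv by blast
  show "arc (straight p e)"
    unfolding uv(4) using ne by (rule_tac straight_cases[OF uv(3), of p]) simp_all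
  show "{pathstart (straight p e), pathfinish (straight p e)} = p ` e"
    unfolding uv(4) by (rule straight_cases[OF uv(3), of p]) auto
  show "path_image (straight p e) \<subseteq> S"
    unfolding uv(4) path_image_straight[OF uv(3)]
    by (rule closed_segment_subset) (use uv S in auto)
  show "path_image (straight p e) \<inter> p ` V = p ` e"
  proof
    show "path_image (straight p e) \<inter> p ` V \<subseteq> p ` e"
    proof
      fix x assume x: "x \<in> path_image (straight p e) \<inter> p ` V"
      then obtain w where w: "w \<in> V" "x = p w" by blast
      have "side (p u) (p v) x = 0"
        using x side_on_segment unfolding uv(4) path_image_straight[OF uv(3)] by blast
      then have "w = u \<or> w = v"
        using off[of u v w] e uv w by blast
      then show "x \<in> p ` e" using w uv by blast
    qed
    show "p ` e \<subseteq> path_image (straight p e) \<inter> p ` V"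
      using uv by (auto simp: path_image_straight)
  qed
next
  fix e e' assume e: "e \<in> E" "e' \<in> E" and ne: "e \<noteq> e'"
  obtain u v where uv: "u \<in> V" "v \<in> V" "u \<noteq> v" "e = {u, v}"
    using E e by blast
  obtain s t where st: "s \<in> V" "t \<in> V" "s \<noteq> t" "e' = {s, t}"
    using E e by blast
  show "path_image (straight p e) \<inter> path_image (straight p e') \<subseteq> p ` V"
  proof
    fix x assume "x \<in> path_image (straight p e) \<inter> path_image (straight p e')"
    then have x: "x \<in> closed_segment (p u) (p v)" "x \<in> closed_segment (p s) (p t)"
      unfolding uv(4) st(4) path_image_straight[OF uv(3)] path_image_straight[OF st(3)] by blast+
    then have x': "x \<in> closed_segment (p t) (p s)"
      by (simp add: closed_segment_commute)
    note s0 = side_on_segment[OF x(1)] side_on_segment[OF x(2)]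
    show "x \<in> p ` V"
    proof (cases "{u, v} \<inter> {s, t} = {}")
      case True
      then show ?thesis
        using cross[of u v s t] e uv st segment_one_side[OF x(2) s0(1)] segment_one_side[OF x(1) s0(2)]
        by blast
    next
      case False
      then consider "s \<in> {u, v}" | "t \<in> {u, v}" by blast
      then show ?thesis
      proof cases
        case 1
        then have "t \<noteq> u" "t \<noteq> v" using ne uv st by auto
        then have "x = p s"
          using segment_shared_end[OF x(2) s0(1)] off[of u v t] e uv st 1 side_self[of "p u" "p v"] by auto
        then show ?thesis using st by blast
      next
        case 2
        then have "s \<noteq> u" "s \<noteq> v" using ne uv st by auto
        then have "x = p t"
          using segment_shared_end[OF x' s0(1)] off[of u v s] e uv st 2 side_self[of "p u" "p v"] by auto
        then show ?thesis using st by blast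
      qed
    qed
  qed
qed

definition top_face :: "point set" where
  "top_face = {(x, y, z). 0 \<le> x \<and> x \<le> 1 \<and> 0 \<le> y \<and> y \<le> 1 \<and> z = 1}"

lemma convex_top_face: "convex top_face"
proof -
  have "top_face = cbox 0 1 \<times> cbox 0 1 \<times> {1}"
    unfolding top_face_def by auto
  moreover have "convex (cbox 0 1 \<times> cbox 0 1 \<times> {1} :: point set)"
    by (intro convex_Times convex_box convex_singleton)
  ultimately show ?thesis by metis
qed

lemma top_face_subset: "top_face \<subseteq> closed_surface 0"
proof -
  have slab: "drilled_slab 0 = cbox (0, 0, 0) (1, 3, 1)"
    by (auto simp: drilled_slab_def cbox_Pair_eq)
  have "x \<notin> box (0, 0, 0) (1, 3, 1)" if "x \<in> top_face" for x :: point
  proof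
    assume x: "x \<in> box (0, 0, 0) (1, 3, 1)"
    have "((0, 0, 1) :: point) \<in> Basis"
      by (simp add: Basis_prod_def zero_prod_def)
    then have "x \<bullet> (0, 0, 1) < (1, 3, 1) \<bullet> ((0, 0, 1) :: point)"
      using x unfolding mem_box by blast
    then show False using that unfolding top_face_def by auto
  qed
  moreover have "top_face \<subseteq> cbox (0, 0, 0) (1, 3, 1)"
    unfolding top_face_def by (auto simp: cbox_Pair_eq)
  ultimately show ?thesis
    unfolding closed_surface_def slab frontier_cbox by blast
qed

lemma graph_drawing_mono: "graph_drawing S V E p \<gamma> \<Longrightarrow> S \<subseteq> T \<Longrightarrow> graph_drawing T V E p \<gamma>"
  unfolding graph_drawing_def by (meson order_trans)

section \<open>The complete graph K7 on the torus\<close>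

text \<open>
  The unit circle of the maximum norm, run through with period 1.
\<close>

definition square :: "real \<Rightarrow> real \<times> real" where
  "square t = (1 / max \<bar>cos (2 * pi * t)\<bar> \<bar>sin (2 * pi * t)\<bar>) *\<^sub>R (cos (2 * pi * t), sin (2 * pi * t))"

lemma max_cos_sin_pos: "0 < max \<bar>cos x\<bar> \<bar>sin x :: real\<bar>"
proof (rule ccontr)
  assume "\<not> ?thesis"
  then have "cos x = 0" "sin x = 0" by (auto simp: max_def split: if_splits)
  then show False using sin_cos_squared_add[of x] by simp
qed

lemma sup_norm_square: "max \<bar>fst (square t)\<bar> \<bar>snd (square t)\<bar> = 1"
proof -
  define m where "m = max \<bar>cos (2 * pi * t)\<bar> \<bar>sin (2 * pi * t)\<bar>"
  have m: "0 < m" unfolding m_def by (rule max_cos_sin_pos)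
  have "max \<bar>fst (square t)\<bar> \<bar>snd (square t)\<bar> = max (\<bar>cos (2 * pi * t)\<bar> / m) (\<bar>sin (2 * pi * t)\<bar> / m)"
    unfolding square_def m_def[symmetric] using m by (simp add: abs_mult)
  also have "\<dots> = m / m"
    using m unfolding m_def by (simp add: max_def divide_right_mono)
  finally show ?thesis using m by simp
qed

lemma continuous_square: "continuous_on A square"
  unfolding square_def
  by (intro continuous_intros) (use max_cos_sin_pos in \<open>metis less_irrefl\<close>)

lemma square_eq_iff: "square s = square t \<longleftrightarrow> s - t \<in> \<int>"
proof
  assume eq: "square s = square t"
  define m where "m t = max \<bar>cos (2 * pi * t)\<bar> \<bar>sin (2 * pi * t)\<bar>" for t
  have m: "0 < m t" for t unfolding m_def by (rule max_cos_sin_pos)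
  define r where "r = m s / m t"
  have r: "0 < r" unfolding r_def using m by simp
  have "cos (2 * pi * s) / m s = cos (2 * pi * t) / m t" "sin (2 * pi * s) / m s = sin (2 * pi * t) / m t"
    using eq unfolding square_def m_def[symmetric] by simp_all
  then have c: "cos (2 * pi * s) = r * cos (2 * pi * t)" and d: "sin (2 * pi * s) = r * sin (2 * pi * t)"
    using m[of s] m[of t] unfolding r_def by (simp_all add: field_simps)
  have "1 = r\<^sup>2 * ((cos (2 * pi * t))\<^sup>2 + (sin (2 * pi * t))\<^sup>2)"
    using sin_cos_squared_add2[of "2 * pi * s", symmetric] unfolding c d
    by (simp only: power_mult_distrib distrib_left)
  then have "r\<^sup>2 = 1" by (metis mult.right_neutral sin_cos_squared_add2)
  then have "r = 1" using r by (simp add: power2_eq_1_iff)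
  then have "sin (2 * pi * s) = sin (2 * pi * t) \<and> cos (2 * pi * s) = cos (2 * pi * t)"
    using c d by simp
  then obtain n :: int where "2 * pi * s = 2 * pi * t + 2 * pi * n"
    unfolding sin_cos_eq_iff by auto
  then have "2 * pi * (s - t) = 2 * pi * n" by (simp add: algebra_simps)
  then have "s - t = n" by simp
  then show "s - t \<in> \<int>" by simp
next
  assume "s - t \<in> \<int>"
  then obtain n :: int where "s = t + n"
    by (metis Ints_cases add.commute diff_add_cancel)
  then have "2 * pi * s = 2 * pi * t + 2 * pi * n" by (simp add: algebra_simps)
  then have "sin (2 * pi * s) = sin (2 * pi * t) \<and> cos (2 * pi * s) = cos (2 * pi * t)"
    unfolding sin_cos_eq_iff by auto
  then show "square s = square t" unfolding square_def by simp
qed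

text \<open>
  The drilled slab is a solid torus: it is swept out by a square cross-section that moves around the
  hole at distance 1 from its centre (in the maximum norm). The pair \<open>w\<close> gives the position within the
  cross-section, which is itself a ball of the maximum norm.
\<close>

definition ring_point :: "real \<Rightarrow> real \<times> real \<Rightarrow> point" where
  "ring_point t w =
     (3/2 + (1 + fst w / 2) * fst (square t), 3/2 + (1 + fst w / 2) * snd (square t), 1/2 + snd w / 2)"

lemma ring_point_radius:
  assumes "- 2 < fst w"
  shows "max \<bar>fst (ring_point t w) - 3/2\<bar> \<bar>fst (snd (ring_point t w)) - 3/2\<bar> = 1 + fst w / 2"
proof -
  have r: "0 \<le> 1 + fst w / 2" using assms by simp
  have "max \<bar>fst (ring_point t w) - 3/2\<bar> \<bar>fst (snd (ring_point t w)) - 3/2\<bar> =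
      max ((1 + fst w / 2) * \<bar>fst (square t)\<bar>) ((1 + fst w / 2) * \<bar>snd (square t)\<bar>)"
    unfolding ring_point_def using r by (simp add: abs_mult)
  also have "\<dots> = (1 + fst w / 2) * max \<bar>fst (square t)\<bar> \<bar>snd (square t)\<bar>"
    using r by (simp add: max_mult_distrib_left)
  finally show ?thesis by (simp add: sup_norm_square)
qed

lemma drilled_slab_1:
  "x \<in> drilled_slab 1 \<longleftrightarrow>
     (let r = max \<bar>fst x - 3/2\<bar> \<bar>fst (snd x) - 3/2\<bar>
      in 1/2 \<le> r \<and> r \<le> 3/2 \<and> 0 \<le> snd (snd x) \<and> snd (snd x) \<le> 1)"
  by (cases x) (auto simp: drilled_slab_def Let_def max_def abs_if split: if_splits)

lemma ring_point_in_slab: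
  assumes "- 2 < fst w"
  shows "ring_point t w \<in> drilled_slab 1 \<longleftrightarrow> max \<bar>fst w\<bar> \<bar>snd w\<bar> \<le> 1"
  unfolding drilled_slab_1 ring_point_radius[OF assms] Let_def
  by (auto simp: ring_point_def)

lemma tendsto_ring_point: "(w \<longlongrightarrow> v) F \<Longrightarrow> ((\<lambda>n. ring_point t (w n)) \<longlongrightarrow> ring_point t v) F"
  unfolding ring_point_def by (intro tendsto_intros) auto

definition torus :: "real \<Rightarrow> real \<Rightarrow> point" where
  "torus s t = ring_point s (square t)"

lemma fst_square_gt: "- 2 < fst (square t)"
  using sup_norm_square[of t] by (auto simp: max_def split: if_splits)

text \<open>
  Enlarging the position in the cross-section beyond the unit ball leads out of the slab, so that the
  points on the boundary of the cross-section are limits of points outside.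
\<close>

lemma torus_in_closed_surface: "torus s t \<in> closed_surface 1"
proof -
  have "torus s t \<in> drilled_slab 1"
    unfolding torus_def using ring_point_in_slab[OF fst_square_gt] sup_norm_square by simp
  then have "torus s t \<in> closure (drilled_slab 1)"
    using closure_subset by blast
  moreover have "torus s t \<in> closure (- drilled_slab 1)"
  proof -
    define x where "x n = ring_point s ((1 + 1 / real (n + 2)) *\<^sub>R square t)" for n
    have "x n \<in> - drilled_slab 1" for n
    proof -
      have d: "0 < 1 / real (n + 2)" "1 / real (n + 2) < 1" by auto
      have "\<bar>fst (square t)\<bar> \<le> 1" using sup_norm_square[of t] by (auto simp: max_def split: if_splits)
      then have "- 1 \<le> fst (square t)" by simp
      then have "(1 + 1 / real (n + 2)) * - 1 \<le> (1 + 1 / real (n + 2)) * fst (square t)"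
        by (rule mult_left_mono) (use d in linarith)
      moreover have "- 2 < (1 + 1 / real (n + 2)) * - 1"
        using d(2) by (simp only: mult_minus_right mult_1_right)
      ultimately have "- 2 < (1 + 1 / real (n + 2)) * fst (square t)"
        by (rule less_le_trans[rotated])
      then have f: "- 2 < fst ((1 + 1 / real (n + 2)) *\<^sub>R square t)" by simp
      have "max \<bar>fst ((1 + 1 / real (n + 2)) *\<^sub>R square t)\<bar> \<bar>snd ((1 + 1 / real (n + 2)) *\<^sub>R square t)\<bar>
          = (1 + 1 / real (n + 2)) * max \<bar>fst (square t)\<bar> \<bar>snd (square t)\<bar>"
        using d by (simp add: abs_mult max_mult_distrib_left)
      also have "\<dots> > 1" using d by (simp add: sup_norm_square)
      finally show ?thesis
        unfolding x_def Compl_iff ring_point_in_slab[OF f] not_le .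
    qed
    moreover have "x \<longlonglongrightarrow> torus s t"
    proof -
      have "(\<lambda>n. 1 + 1 / real (n + 2)) \<longlonglongrightarrow> 1 + 0"
        by (intro tendsto_intros LIMSEQ_ignore_initial_segment[OF lim_1_over_n])
      then have "(\<lambda>n. (1 + 1 / real (n + 2)) *\<^sub>R square t) \<longlonglongrightarrow> 1 *\<^sub>R square t"
        by (intro tendsto_intros) simp
      then have "(\<lambda>n. (1 + 1 / real (n + 2)) *\<^sub>R square t) \<longlonglongrightarrow> square t" by simp
      then show ?thesis
        unfolding x_def torus_def by (rule tendsto_ring_point)
    qed
    ultimately show ?thesis
      unfolding closure_sequential by blast
  qed
  ultimately show ?thesis
    unfolding closed_surface_def frontier_closures by blast
qed

lemma torus_eq_iff: "torus s t = torus s' t' \<longleftrightarrow> s - s' \<in> \<int> \<and> t - t' \<in> \<int>"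
proof
  assume eq: "torus s t = torus s' t'"
  have fst: "fst (square t) = fst (square t')"
    using ring_point_radius[OF fst_square_gt, of s t] ring_point_radius[OF fst_square_gt, of s' t'] eq
    unfolding torus_def by simp
  moreover have "snd (square t) = snd (square t')"
    using eq unfolding torus_def ring_point_def by simp
  ultimately have t: "square t = square t'" by (simp add: prod_eq_iff)
  have "1 + fst (square t) / 2 \<noteq> 0" using fst_square_gt[of t] by simp
  then have "square s = square s'"
    using eq fst unfolding torus_def ring_point_def by (simp add: prod_eq_iff)
  then show "s - s' \<in> \<int> \<and> t - t' \<in> \<int>" using t square_eq_iff by blast
next
  assume "s - s' \<in> \<int> \<and> t - t' \<in> \<int>"
  then show "torus s t = torus s' t'"
    unfolding torus_def ring_point_def using square_eq_iff by metis
qed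

lemma continuous_torus:
  assumes "continuous_on A f" "continuous_on A g"
  shows "continuous_on A (\<lambda>x. torus (f x) (g x))"
proof -
  have "continuous_on A (\<lambda>x. square (f x))" "continuous_on A (\<lambda>x. square (g x))"
    using continuous_on_compose2[OF continuous_square assms(1)]
      continuous_on_compose2[OF continuous_square assms(2)] by auto
  then show ?thesis
    unfolding torus_def ring_point_def by (intro continuous_intros) auto
qed

text \<open>
  The torus as the quotient of the plane by the lattice of all integer points with
  \<open>x + 2 * y\<close> divisible by 7, which is spanned by \<open>(7, 0)\<close> and \<open>(- 2, 1)\<close>.
\<close>

definition lattice :: "real \<Rightarrow> real \<Rightarrow> point" where
  "lattice x y = torus ((x + 2 * y) / 7) y"

lemma lattice_eq_iff:
  "lattice x y = lattice x' y' \<longleftrightarrow> (x - x' + 2 * (y - y')) / 7 \<in> \<int> \<and> y - y' \<in> \<int>"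
  unfolding lattice_def torus_eq_iff by (simp add: diff_divide_distrib add_divide_distrib algebra_simps)

lemma lattice_eqD:
  assumes "lattice x y = lattice x' y'"
  shows "x - x' \<in> \<int>" "y - y' \<in> \<int>"
proof -
  have 1: "(x - x' + 2 * (y - y')) / 7 \<in> \<int>" and 2: "y - y' \<in> \<int>"
    using assms unfolding lattice_eq_iff by auto
  have "7 * ((x - x' + 2 * (y - y')) / 7) - 2 * (y - y') \<in> \<int>"
    by (intro Ints_diff Ints_mult Ints_numeral 1 2)
  moreover have "7 * ((x - x' + 2 * (y - y')) / 7) - 2 * (y - y') = x - x'" by argo
  ultimately show "x - x' \<in> \<int>" by metis
  show "y - y' \<in> \<int>" by (rule 2)
qed

text \<open>
  The directions of the triangular lattice are \<open>(1, 0)\<close>, \<open>(0, 1)\<close> and \<open>(1, 1)\<close>. They change the label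
  \<open>x + 2 * y\<close> modulo 7 of an integer point by 1, 2 and 3. Up to sign these are all nonzero residues,
  so that every pair of labels is joined by exactly one edge.
\<close>

definition dx :: "nat \<Rightarrow> real" where "dx d = (if d = 2 then 0 else 1)"
definition dy :: "nat \<Rightarrow> real" where "dy d = (if d = 1 then 0 else 1)"

definition lattice_edge :: "nat \<Rightarrow> nat \<Rightarrow> real \<Rightarrow> point" where
  "lattice_edge v d t = lattice (real v + t * dx d) (t * dy d)"

lemma Ints_between: "(t :: real) \<in> \<int> \<Longrightarrow> 0 < t \<Longrightarrow> t < 1 \<Longrightarrow> False"
  by (metis Ints_cases of_int_0_less_iff of_int_less_1_iff int_one_le_iff_zero_less not_le)

text \<open>
  The direction of an edge can be read off from any of its inner points: exactly one of the
  coordinates \<open>y\<close>, \<open>x\<close> and \<open>x - y\<close> is an integer there.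
\<close>

lemma lattice_edge_interior:
  assumes d: "d \<in> {1, 2, 3}" "f \<in> {1, 2, 3}" and t: "0 < t" "t < 1" and s: "0 \<le> s" "s \<le> 1"
    and eq: "lattice_edge v d t = lattice_edge w f s"
  shows "d = f \<and> t = s"
proof -
  have x: "real v + t * dx d - (real w + s * dx f) \<in> \<int>" and y: "t * dy d - s * dy f \<in> \<int>"
    using lattice_eqD[OF eq[unfolded lattice_edge_def]] by auto
  have "(real v + t * dx d - (real w + s * dx f)) - (of_nat v - of_nat w) \<in> \<int>"
    by (intro Ints_diff x) auto
  then have x': "t * dx d - s * dx f \<in> \<int>" by (simp add: algebra_simps)
  have nt: "t \<notin> \<int>" using Ints_between t by blast
  have ts: "t = s" if "t - s \<in> \<int>"
  proof (rule ccontr)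
    assume "t \<noteq> s"
    then consider "0 < t - s" | "0 < s - t" by linarith
    then show False
    proof cases
      case 1
      then show False using Ints_between[OF that] t s by linarith
    next
      case 2
      have "s - t \<in> \<int>" using that by (metis Ints_minus minus_diff_eq)
      then show False using Ints_between[of "s - t"] 2 t s by linarith
    qed
  qed
  have sum: "t \<in> \<int>" if "t - s \<in> \<int>" "s \<in> \<int>"
    using Ints_add[OF that] by simp
  have ms: "s \<in> \<int>" if "- s \<in> \<int>" using that by simp
  have "d = 1 \<and> dx d = 1 \<and> dy d = 0 \<or> d = 2 \<and> dx d = 0 \<and> dy d = 1 \<or> d = 3 \<and> dx d = 1 \<and> dy d = 1"
    "f = 1 \<and> dx f = 1 \<and> dy f = 0 \<or> f = 2 \<and> dx f = 0 \<and> dy f = 1 \<or> f = 3 \<and> dx f = 1 \<and> dy f = 1"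
    using d by (auto simp: dx_def dy_def)
  then show ?thesis
    using x' y nt by (elim disjE conjE) (auto dest: ts sum ms)
qed

lemma lattice_edge_same:
  assumes "v < 7" "w < 7" "lattice_edge v d t = lattice_edge w d t"
  shows "v = w"
proof -
  have "(real v - real w) / 7 \<in> \<int>"
    using assms(3) unfolding lattice_edge_def lattice_eq_iff by simp
  then obtain n :: int where "(real v - real w) / 7 = n" by (auto elim: Ints_cases)
  then have "real_of_int (int v - int w) = real_of_int (7 * n)" by simp
  then have "int v - int w = 7 * n" by (simp only: of_int_eq_iff)
  then show ?thesis using assms(1,2) by presburger
qed

lemma lattice_edge_end:
  assumes "d \<in> {1, 2, 3}"
  shows "lattice_edge v d 1 = lattice (real ((v + d) mod 7)) 0"
proof -
  have "real v + dx d + 2 * dy d = real (v + d)"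
    using assms unfolding dx_def dy_def by auto
  moreover have "real (v + d) - real ((v + d) mod 7) = 7 * real ((v + d) div 7)"
    by (metis add_diff_cancel_right' div_mult_mod_eq mult.commute of_nat_add of_nat_mult of_nat_numeral)
  ultimately have "(real v + 1 * dx d - real ((v + d) mod 7) + 2 * (1 * dy d - 0)) / 7 = real ((v + d) div 7)"
    by (simp add: algebra_simps)
  moreover have "1 * dy d - 0 \<in> \<int>" unfolding dy_def by simp
  ultimately show ?thesis
    unfolding lattice_edge_def lattice_eq_iff by (metis Ints_of_nat)
qed

lemma lattice_edge_start: "lattice_edge v d 0 = lattice (real v) 0"
  unfolding lattice_edge_def by simp

lemma lattice_vertex_inj: "v < 7 \<Longrightarrow> w < 7 \<Longrightarrow> lattice (real v) 0 = lattice (real w) 0 \<Longrightarrow> v = w"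
  using lattice_edge_same[of v w 1 0] by (simp add: lattice_edge_start)

lemma arc_lattice_edge:
  assumes d: "d \<in> {1, 2, 3}" and v: "v < 7"
  shows "arc (lattice_edge v d)"
  unfolding arc_def path_def
proof
  show "continuous_on {0..1} (lattice_edge v d)"
    unfolding lattice_edge_def[abs_def] lattice_def
    by (intro continuous_torus continuous_intros) auto
  have ends: "lattice_edge v d 0 \<noteq> lattice_edge v d 1"
  proof -
    have "v \<noteq> (v + d) mod 7"
      using d v by (elim insertE emptyE; hypsubst; presburger)
    then show ?thesis
      unfolding lattice_edge_start lattice_edge_end[OF d]
      using lattice_vertex_inj[OF v, of "(v + d) mod 7"] by auto
  qed
  show "inj_on (lattice_edge v d) {0..1}"
  proof (rule inj_onI)
    fix s t :: real assume s: "s \<in> {0..1}" and t: "t \<in> {0..1}"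
      and eq: "lattice_edge v d s = lattice_edge v d t"
    consider "0 < s" "s < 1" | "0 < t" "t < 1" | "s \<in> {0, 1}" "t \<in> {0, 1}"
      using s t by fastforce
    then show "s = t"
    proof cases
      case 1
      then show ?thesis using lattice_edge_interior[OF d d _ _ _ _ eq] t by auto
    next
      case 2
      then show ?thesis using lattice_edge_interior[OF d d _ _ _ _ eq[symmetric]] s by auto
    next
      case 3
      then show ?thesis using ends eq by auto
    qed
  qed
qed

definition K7_edges :: "nat set set" where
  "K7_edges = {{i, j} | i j. i < 7 \<and> j < 7 \<and> i \<noteq> j}"

lemma K7_edge_cases:
  assumes "e \<in> K7_edges"
  shows "\<exists>v d. v < 7 \<and> d \<in> {1, 2, 3} \<and> e = {v, (v + d) mod 7}"
proof -
  obtain i j where ij: "i < 7" "j < 7" "i \<noteq> j" "e = {i, j}"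
    using assms unfolding K7_edges_def by blast
  have "i = 0 \<or> i = 1 \<or> i = 2 \<or> i = 3 \<or> i = 4 \<or> i = 5 \<or> i = 6"
    "j = 0 \<or> j = 1 \<or> j = 2 \<or> j = 3 \<or> j = 4 \<or> j = 5 \<or> j = 6"
    using ij(1,2) by linarith+
  then have "\<exists>d\<in>{1, 2, 3}. (i + d) mod 7 = j \<or> (j + d) mod 7 = i"
    using ij(3) by (elim disjE) simp_all
  then obtain d where "d \<in> {1, 2, 3}" "(i + d) mod 7 = j \<or> (j + d) mod 7 = i" by blast
  then have "e = {i, (i + d) mod 7} \<or> e = {j, (j + d) mod 7}" using ij by blast
  then show ?thesis using ij \<open>d \<in> {1, 2, 3}\<close> by blast
qed

lemma K7_on_torus: "\<exists>p \<gamma>. graph_drawing (closed_surface 1) {..<7} K7_edges p \<gamma>"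
proof -
  define p where "p v = lattice (real v) 0" for v :: nat
  obtain s d where sd: "\<And>e. e \<in> K7_edges \<Longrightarrow> s e < 7 \<and> d e \<in> {1, 2, 3} \<and> e = {s e, (s e + d e) mod 7}"
    using K7_edge_cases by metis
  define \<gamma> where "\<gamma> e = lattice_edge (s e) (d e)" for e
  have inj: "inj_on p {..<7}"
    unfolding p_def inj_on_def using lattice_vertex_inj by auto
  have pe: "p ` e = {p (s e), p ((s e + d e) mod 7)}" if "e \<in> K7_edges" for e
  proof -
    have "e = {s e, (s e + d e) mod 7}" using sd[OF that] by blast
    from arg_cong[OF this, of "(`) p"] show ?thesis by (rule trans) simp
  qed
  have interior: "x \<in> p ` e \<or> (\<exists>t. 0 < t \<and> t < 1 \<and> x = \<gamma> e t)"
    if e: "e \<in> K7_edges" and x: "x \<in> path_image (\<gamma> e)" for e x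
  proof -
    obtain t where t: "0 \<le> t" "t \<le> 1" "x = \<gamma> e t"
      using x unfolding path_image_def by auto
    have de: "d e \<in> {1, 2, 3}"
      using sd[OF e] by blast
    show ?thesis
    proof (cases "t = 0 \<or> t = 1")
      case True
      then have "x \<in> {p (s e), p ((s e + d e) mod 7)}"
        unfolding t(3) \<gamma>_def p_def using lattice_edge_start lattice_edge_end[OF de] by auto
      then show ?thesis unfolding pe[OF e] by blast
    next
      case False
      then have "0 < t" "t < 1" using t(1,2) by auto
      then show ?thesis using t(3) by blast
    qed
  qed
  have pathends: "{pathstart (\<gamma> e), pathfinish (\<gamma> e)} = p ` e" if e: "e \<in> K7_edges" for e
  proof -
    have "d e \<in> {1, 2, 3}" using sd[OF e] by blast
    from lattice_edge_end[OF this, of "s e"] show ?thesis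
      unfolding pe[OF e] \<gamma>_def p_def pathstart_def pathfinish_def by (simp only: lattice_edge_start)
  qed
  have eV: "e \<subseteq> {..<7}" if "e \<in> K7_edges" for e
    using that unfolding K7_edges_def by auto
  have no_vertex: "\<gamma> e t \<noteq> p w" if e: "e \<in> K7_edges" and t: "0 < t" "t < 1" for e t w
  proof
    assume "\<gamma> e t = p w"
    then have "lattice_edge (s e) (d e) t = lattice_edge w 1 0"
      unfolding \<gamma>_def p_def by (simp add: lattice_edge_start)
    then have "t = 0"
      using lattice_edge_interior[of "d e" 1 t 0 "s e" w] conjunct1[OF conjunct2[OF sd[OF e]]] t by simp
    then show False using t by simp
  qed
  have "graph_drawing (closed_surface 1) {..<7} K7_edges p \<gamma>"
    unfolding graph_drawing_def
  proof (intro conjI ballI impI inj)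
    show "p ` {..<7} \<subseteq> closed_surface 1"
      unfolding p_def lattice_def using torus_in_closed_surface by auto
  next
    fix e assume e: "e \<in> K7_edges"
    show "arc (\<gamma> e)"
      unfolding \<gamma>_def by (rule arc_lattice_edge) (use sd[OF e] in blast)+
    show "path_image (\<gamma> e) \<subseteq> closed_surface 1"
      unfolding \<gamma>_def path_image_def lattice_edge_def lattice_def using torus_in_closed_surface by auto
    show "{pathstart (\<gamma> e), pathfinish (\<gamma> e)} = p ` e" by (rule pathends[OF e])
    show "path_image (\<gamma> e) \<inter> p ` {..<7} = p ` e"
    proof
      show "path_image (\<gamma> e) \<inter> p ` {..<7} \<subseteq> p ` e"
      proof
        fix x assume x: "x \<in> path_image (\<gamma> e) \<inter> p ` {..<7}"
        then obtain w where "x = p w" by blast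
        then show "x \<in> p ` e"
          using interior[OF e, of x] no_vertex[OF e, of _ w] x by force
      qed
      have "p ` e \<subseteq> path_image (\<gamma> e)"
        unfolding pathends[OF e, symmetric]
        using pathstart_in_path_image pathfinish_in_path_image by auto
      then show "p ` e \<subseteq> path_image (\<gamma> e) \<inter> p ` {..<7}"
        using image_mono[OF eV[OF e], of p] by blast
    qed
  next
    fix e e' assume e: "e \<in> K7_edges" "e' \<in> K7_edges" and ne: "e \<noteq> e'"
    show "path_image (\<gamma> e) \<inter> path_image (\<gamma> e') \<subseteq> p ` {..<7}"
    proof
      fix x assume x: "x \<in> path_image (\<gamma> e) \<inter> path_image (\<gamma> e')"
      show "x \<in> p ` {..<7}"
      proof (rule ccontr)
        assume "x \<notin> p ` {..<7}"
        then have "x \<notin> p ` e" using eV[OF e(1)] by blast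
        then obtain t where t: "0 < t" "t < 1" "x = \<gamma> e t"
          using interior[OF e(1), of x] x by blast
        obtain u where u: "0 \<le> u" "u \<le> 1" "x = \<gamma> e' u"
          using x unfolding path_image_def by auto
        have eq: "lattice_edge (s e) (d e) t = lattice_edge (s e') (d e') u"
          using t u unfolding \<gamma>_def by simp
        then have du: "d e = d e'" "t = u"
          using lattice_edge_interior[OF _ _ t(1,2) u(1,2) eq]
            conjunct1[OF conjunct2[OF sd[OF e(1)]]] conjunct1[OF conjunct2[OF sd[OF e(2)]]] by blast+
        then have "s e = s e'"
          using lattice_edge_same[of "s e" "s e'"] eq conjunct1[OF sd[OF e(1)]] conjunct1[OF sd[OF e(2)]]
          by metis
        moreover have "e = {s e, (s e + d e) mod 7}" "e' = {s e', (s e' + d e') mod 7}"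
          using sd[OF e(1)] sd[OF e(2)] by blast+
        ultimately show False using du(1) ne by metis
      qed
    qed
  qed
  then show ?thesis by blast
qed

section \<open>The catalogue of tubular quivers\<close>

text \<open>
  The tables are four-way trees that are addressed by the bits of characters.
\<close>

datatype 'a quad = Quad 'a 'a 'a 'a

fun pick :: "bool \<Rightarrow> bool \<Rightarrow> 'a quad \<Rightarrow> 'a" where
  "pick False False (Quad a b c d) = a"
| "pick True False (Quad a b c d) = b"
| "pick False True (Quad a b c d) = c"
| "pick True True (Quad a b c d) = d"

type_synonym catalogue = "string quad quad quad"

text \<open>
  The letters from A to Z stand for the 26 edges of the host graph, as ordered by the lower five bits of
  their codes; the remaining entries are padding. A capital letter is an arrow from the first vertex to
  the second, a small letter is the reverse arrow, and a dash before a letter marks a bridge.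
\<close>

definition host_table :: "(node \<times> node) quad quad \<times> (node \<times> node) quad quad" where
  "host_table = (
   (Quad (Quad (N0, N1) (N0, N1) (N0, N2) (N1, N2))
      (Quad (N1, N3) (N0, N4) (N1, N4) (N2, N4))
      (Quad (N3, N4) (N1, N5) (N2, N5) (N4, N5))
      (Quad (N5, N6) (N0, N7) (N2, N7) (N4, N7))),
   (Quad (Quad (N3, N8) (N4, N8) (N5, N8) (N6, N8))
      (Quad (N1, N9) (N3, N9) (N5, N9) (N8, N9))
      (Quad (N0, N10) (N1, N10) (N4, N10) (N0, N1))
      (Quad (N0, N1) (N0, N1) (N0, N1) (N0, N1))))"

fun half :: "bool \<Rightarrow> 'a \<times> 'a \<Rightarrow> 'a" where
  "half False (a, b) = a"
| "half True (a, b) = b"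

definition host_edge :: "bool \<Rightarrow> bool \<Rightarrow> bool \<Rightarrow> bool \<Rightarrow> bool \<Rightarrow> node \<times> node" where
  "host_edge b0 b1 b2 b3 b4 = pick b0 b1 (pick b2 b3 (half b4 host_table))"

fun arrow :: "bool \<Rightarrow> node \<times> node \<Rightarrow> letter" where
  "arrow False (p, q) = Arrow p q"
| "arrow True (p, q) = Arrow q p"

fun bridge :: "node \<times> node \<Rightarrow> letter" where
  "bridge (p, q) = Bridge p q"

fun letters :: "string \<Rightarrow> letter list" and bridges :: "string \<Rightarrow> letter list" where
  "letters [] = []"
| "letters (Char b0 b1 b2 b3 b4 b5 True b7 # cs) = arrow b5 (host_edge b0 b1 b2 b3 b4) # letters cs"
| "letters (Char True b1 b2 b3 b4 b5 False b7 # cs) = bridges cs"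
| "letters (Char False b1 b2 b3 b4 b5 False b7 # cs) = []"
| "bridges [] = []"
| "bridges (Char b0 b1 b2 b3 b4 b5 b6 b7 # cs) = bridge (host_edge b0 b1 b2 b3 b4) # letters cs"

text \<open>
  A row of the catalogue consists of a word and, after a blank, of three characters for each
  mutation: two for the name of the row that is reached and one that tells where the first vertex of
  that word goes, in lower case if all arrows have to be reversed.
\<close>

fun moves :: "string \<Rightarrow> string" where
  "moves [] = []"
| "moves (Char b0 b1 b2 b3 b4 b5 True b7 # cs) = moves cs"
| "moves (Char True b1 b2 b3 b4 b5 False b7 # cs) = moves cs"
| "moves (Char False b1 b2 b3 b4 b5 False b7 # cs) = cs"

text \<open>
  The row named by the two characters \<open>c\<close> and \<open>d\<close> is in the table for \<open>c\<close>, at the position given by the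
  lower six bits of \<open>d\<close>. Unused positions hold the empty word, which describes the zero form.
\<close>

definition catalogue_A :: catalogue where "catalogue_A =
   Quad (Quad (Quad '''' ''xYAMCneG-H-PsRl JwHL_FJwAAAKOqHPebAAKJbGNlkH[KH[KFVeBYFHaKBRK'' ''KFiOCJbAmtDU-P-S ABABkaG_FEkHKueABCG_CK^HABEOfaOfaABEEBE'' ''yaXeBtVJoN-Q-U CacBmHMwbDNjBvhIBeDBkEHDF^EDRK'')
    (Quad ''pDCbAHeKR-L-W-N C}iC}FCVHCVhAThATHLQgDqDDqeLQJ'' ''-HEfacBxY-JrLS-W AEDAEDEYiErABYgHaDGuIBNgCnCL_JAEdCOI'' ''duTaBchgYzkJ-M-L LRHJ~GGjFMVKB^DGjABXfMBKNtFJLD'' ''vujdTcBaGeyX-M-W LhKBLfAGaEeaENEIOEGSDKOfPtEGVD'')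
    (Quad ''vujTdFnZAMxb-L NmfNmFD_ENoHCLFJvEJvkNodD_kCLf'' ''VJCtFAeb-U-P-Z-M AUfBHjAbFC}aAIFDvCDvCAIFHvFDOfA~EATiANc'' ''xYACbMnoeJi-D-U-Q MLCMefLQfHvkAJKCdeCdeAJKD[IDYFJaFAMFGFF'' ''bCAeFJitDUrP-Z-M DPIG^CImeIIaANcCTaLOICgDIviBzf'')
    (Quad ''HoPfDNCWtBmJV-X PbFL~hQGdB_IEfaL^iMzDEWfFtKJ^K'' ''mNBXyaJi-E-L-S-H EnkEnHAbHAbkAMkPRFPRFAMHAJhAJKAMHNzHNzHAMHBHfBHF'' ''cIjVtDUaBfE-Z-M-P JacLeCGkdHhFAKcHFiCqiMwEBmjAIf'' ''aezXycB-J-M-L-D-Q AOeAbKC}EAakJpBBUcCeAFgBAOBE_FE_GAOBEdB''))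
   (Quad (Quad ''xAYCbEgJirDP-O-L HQeCaBKIDKPdDmiKhiGBGJjGDaIGhK'' ''QpzYdAxCbiJ-L-O DRDFeCBMEMwiE}hG}CLYEMFCCqGAlI'' ''-SRjIcyXBapdzeMo IuEGaeOUdN^HJIINqgHyFOuKINKKAH'' ''nbMxAZFhUt-J-Q B|hJucJMhHQCLsHGyjCWjEsdGgcBuB'')
    (Quad ''-HezXBcayjItV-W-L BUBJpeADJHFdLHIGFGDnEHRDJnFAIa'' ''tyVXaezBJ-H-L-S AIjGbeJaJPMIKdiLeBDnEAUJK_JK_JAUJGFJJsJ'' ''mNBcadEh-T-K-L-S CKDC{JFsEEzbA{AAZDEnhAVHAoGGgGAVHAVHIkGIkIAVHEsC'' ''pUwDtAxYIVHeBmN IAKQXjFzIDWIQHFKFjFzIN{eKSjQNI'')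
    (Quad ''yfaEXCbnM-H-P-R-L AXkAXkGGKAXKIsDArGAXKGPbFrDAXKFVEFVEAXKDuEAXKFJGMgFAXKH[h'' ''-P-UvJTiCAbxYkgEOm EEDIEjJTHAYDD^kD^kAYDIEJEEdF[HKWhBwkHWd'' ''bACFehdiJTv-W-S-M A^fHPCFuAHvfB[aC}AAVDAZCHMdHMdAZCJPCLQD'' ''-WvTiJaBEfHDNm-L LHiM]CGreD_ED~hAqhBkCI|hCLfDeh'')
    (Quad '''' ''SLpdIjNAbxEZgo QPkO|kQPHMmgQ]IO|HMmDPYIPxhPYi'' ''HebDAoMnjItU-W-S AZeMCHFYDC{hEWfHZCOlEA^DGsiGsgA^DPTgEfi'' ''fEaBcNmtwIrjV-H-X G}HKwiAlhCuiHUEGcdAeECDHELFFeH''))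
   (Quad (Quad '''' ''mxYANC-E-H-J-P-T A~cAOaCKJA{BBAhA{HAaHAdKAdKAaHAaHDHhAkKAaHCKHEzC'' ''yXacBgF-O-D-P-J-L EdEAODCKKAIKC_KAbKFuEFuEAbKAMKCFhAbKBZgBZfAbKC_A'' ''dpQFAerkZyuTbC-L JCJPVFJQjJLANqgLdFKGGHrJGzfLRJ'')
    (Quad ''xYACNm-T-J-EHpQ C]kE_dL[jE|BDSiE|HAaHAkKDHhL[KAaHCsK'' ''GHeBUDtAxY-J-P-M OBDKzDE_kFAFOGFDicA_CGJJDhkF]F'' ''QWzudYxAiCbJ-M PjIKrINcFOOELZCHufJYCAnEEmKDKA'' ''PhqzyXeaBcTjv-N IcBEDDNNJFKHBfCLFhQWKBfCMtiJMI'')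
    (Quad ''nbMCAetvDHULSp LgIMGFIRaOkHQ^GFlEPfgNwhKohJEG'' ''jvUwpdabyXhE-S BDICPgLRCNrkGziJ~GPPfJlGKfKHTF'' ''nMbajLtEfKqSDUP BehBeJIgCIgdQBENLDJzGITGNLcITg'' ''xYADBHeNm-T-J-P DidGkDBtKDHeAdKKYkBtIGkBAaECrD'')
    (Quad ''oMafBcjduTv-X-P OJeH_FA_dAQAFvILbFJPcB|fIeFB[A'' ''viTAMnbJCDeH-L-S FzHCkCI[JBkcKCcMOeD_eAmJDWHDWHAmJDgeDxd'' ''RlsWJbetCFAhd-M P{dFSHD[gItDODeCVgMeeAfFLQDJ_c'' ''bnMXzHUatDf-J-Q KPjGkeIkHGgCCreNAHCzIAVJHQcM]D''))
   (Quad (Quad ''HEBjcDIafXymN-L-S IfIEgENJeCkDFNFHBDEpHApDPvEPvEApDLKHIEF'' ''yXaeBcGOnIjrVtw-P FTILBiCidJnEA[dFwaNKDOmKD|dDTJ'' ''-V-UPqhEfaXyMbCn IsiIsiBjDMVKMgJIEDEcFAXKArFBBFBBJArFNJc'' ''OzNJRBXmpda-S FEEHIgIRDG{fMMIIhbOnKIZgJEeNZF'')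
    (Quad ''PhOEmriaBc-X-S IaGIagDhhKQGFACDhCFAhKQgBobBoE'' ''ycJXaBek-M-D-P-S D]BJAFC^FDUDBQgAuKFkeBucAuKBAcA{CAuKDFKDFKAuKEsE'' ''WTPudCvJinAMbOG-Z LpJExeIdICyaI{dPZKIxiLMEFaECqk'' ''PDCnrJiMAbeo-U-Z BmiBSIBVFPVEKxJPWdMsALeCGbDFfI'')
    (Quad ''WRvTaBcjdmOhE-L DeHHKCGIHNIIHRHOTGOaHLGEL}DLHI'' ''-SrPUtkFhAeMCbn CjJHLAGRFEZhKXII_iHCCMabP}DCSJ'' ''hqPOEmBjacIdtV-Z OwDGSHJoFNMcOucQ_FIuiBLHLhJEGb'' ''CFbAeMndh-J-L-X-S FsCEBEAaHGxHCeaAuHAaBA{BM]EBtDA{BA{BE|BE|BA{BAVD'')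
    (Quad ''-SPHGbCfADxYir-M I^dMEGJLKGRFB~EBlKM[aN^GEZGJIA'' ''xmnOEGZCftDUHIV-L CydFohFTfJ[kJjHOVJMfKFIjIrKFaF'' ''jIcaBxEfZ-N-L-H-P AabC_AGFkCFHA~FC]KC]KA~FBUbClAGxkCMgAIK'' ''''))"

definition catalogue_B :: catalogue where "catalogue_B =
   Quad (Quad (Quad '''' ''caByXIjtV-D-E-Q-S FgACMjCpfBAdEsJBACKYKJuIBACAacBACDSGDSIBACAukBQg'' ''SrLpHQfyEXaMCbn PGfPGfJUdFVEOHHArGArFOrdPGDOqk'' ''RpQdIzXacB-N-U EMENpCOEeLEKGzcOJjJCECPhKJHDLK'')
    (Quad ''qPhOEmUBNcatIj-S GhJG|iAiJKiHG|IKjJHJjO{jEKGGBH'' ''rwVJbmOECAtYx-U JkiDSeEDhCMIC]kCMIK~iNRhBpiDrh'' ''ZHyDaXmUtNBirP GmILrkHPEHMfOcfH|HHPEHSkNnhM~J'' ''WQetAoMCbDH-J-L EcGHWfHdhBrJCkJHWfBGIEqIEqIBGIOlhEEfIEC'')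
    (Quad ''PqeDAYx-B-N-U-V DoKAIiC_iBHDIyIIyIBHDJaeGFKAMKCFiBHDDMeDMeBHDJsI'' ''maBNJiXTvduzO-W EZeEgdLgkKtdPQDHLKETCG{fJEeHlF'' ''zXeAMDHCnbUt-Q-J BtJHijDejOGJDidB]jLVDIBCGqHDBJ'' ''yaXcBmJkOQr-H-T CMIC|JGUHJ]iCEDPQkClhJVkB}KLSJ'')
    (Quad ''VJNBmatEOxZDU-W AGjCgELOHNZFLSkAzJDZkGOIHlFG{f'' ''jNmAIeHD-Q-L-W CvdB[FDOdC^hEAHAQFIfjEtgHvDBMFBdHBdHBMF'' ''mNBEafHDyZ-P-J-L FNCBNHGufAEiNJdJyKBNHBNHLcfLcgBNHCnABjC'' ''xYACbfGKnMtUHDRp PBjK}fHsAQLHIDiLkiN|KIAIDwIHwi''))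
   (Quad (Quad ''qPUZyDtEaBc-V-L G~jF[IOlIGPEHZABPIQFAQFABPIIEjLwEGoILKi'' ''-P-S-LkJeBcayX-M D]fE[KEzaAueBAcEhkBqKBQDD}gLsgBQDBQDEiKEiKBQDEsK'' ''ZxAmNGC-D-PslR BWEM~HM~hBWKBREPHEPHkBREAAEBTEBTEJXHIJhIJHAAk'' ''oGBMeacjTvud-X-P GzdKJIIdFAwAGIILLHHhfDaHGhFBqH'')
    (Quad ''kJCAeNm-D-U-W-S EBeFsDFsdEBFBTFG_hG_HBTeH[eH[FDuBBTFBRFBRFBTFBTFIJHIJhBTF'' ''aBcEqPhd-S-U-J-M A~iATFAOaF]GD~FA~cATGAOdF]FD~G'' ''ayXztOmBVJ-L-H AwFBVbMEDIagFEdI^kIMBE^hJ]JB}h'' ''mAxYCNzGf-D-PslR BWKE|AE|cBWEBWhOfCOfaBWHBRCEBCEBCJwCKucKuABRH'')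
    (Quad ''QZrExPDiaUtcB-N GQCIFCPLEMjKEFkAFdCojNGkONJGoE'' ''uWP-R-HeAxYGCnM HmkAEkHmkJyHGCDI]hIwfFJfHaKAAKH[KIJh'' ''UDtaBcgFmN-Q-J-L F|EJaHL[aE_jAbhNbANzIBZDMQEMQEBZDMLAAbh'' ''EBjVhdtcaI-W-S-M LKcHZEGJEBMAAZcEhEEseB[ALzILzGB[AKgIAlE'')
    (Quad '''' ''yXaIBjcnOGeVtwr-H JSHLOiNPeGckQEIBJiCSkOIHEejI_E'' ''dhFGCjKAbZy-L-P-M EFHLiKB^DDIHAFDAFdB^DLikEFgPUA'' ''VtJCAbUDYxzHfQp-S L^CNmIB_aEfIALCGfGQSaQZKJ^gJhA''))
   (Quad (Quad '''' ''mNBehFcdIjtRW-X EJDOIKFmIHudIhDELFJkHHIKGcdMHH'' ''mOEaBchdTuWjvR-Y FHHJeEOudKNAKNJGaFGaEOyDOyCFHI'' ''VJUCtDPAbmOq-Y IVEPaFPafPkIIVHMyFPOFPpiPpHPkD'')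
    (Quad ''dAECZxpRJNm-L NTeLCkLzKLJEBMFHtdH^gK~IDrEBMF'' ''UDtwrVJBaNeozyX JfBAjIH~DJxiJ}KPsiPmiOKFCUHOgE'' ''cyXaBTzevj-H-N-P DUEDoFKiHG]ABfCAgDAgIBfCKgdGhKBqFEnjEsF'' ''UVjBXayIctDZHrwNm ILePJCPukNLJDjEPuDPJcPJFILENLa'')
    (Quad ''WuP-RIjcBayXezG-M EiEEikInIIniE[EIniMNjMNDDfDDfjE[EInI'' ''oGMBeZxAYTud-J-P GLcKZDFQfPIJERJGLCGLcEYdCCCCOD'' ''PqhfaaEBcyX-N-U-V BjDBjDArFIsiDIICOjCQKGGKBjDJUiJUiBjDBNI'' ''cBaNmjIDVtHEf-L-S OMjABaOMhAmjGxjA[IGvhBkCOxAOxABkCB{eD|I'')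
    (Quad ''ydhQEaXrjb-T-L EeFFEKE^JIOdENKA|GJSdEydGVIPFB'' ''rPDiCHeAb-N-X-L AwfCvKDicACHLSgANeFeeCDeCgFClE'' ''zfYcONEmBaIj-RPWu JMDNQDEadEbFEaJNkcNNKNQjCWKKnJEbFL]D'' ''hEOmUBpwatcVr-X PiDCtcFoDC|iEGJIdFJoFDQEAtDJVF''))
   (Quad (Quad ''pwUVItDjcBaXyEmO JBiH|eH^ILCEDzkKTHDzkDAFBEiEXh'' ''oeMGBacjItV-U-P-X IzkCNHFgbGbABqHQWFQWFBqHC}eBQIBfADqbBSH'' ''rVJGPeBatDXy-O I~KFiHBGDM|eHqIO_CNeeJmDCihLjc'' ''jcBaEhdmNTv-L-Q ENHESeENJEeFHjiCShCSHHjGGRDEee'')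
    (Quad ''qPhdFYxeAmNB-J-T BJHMRCKudM]DE|EAkKAkIA{EBueGgC'' ''cBaTyXeoMvj-Q-D GqkHmFI]KD}hDFkFkJBtfAukKYKASH'' ''GbxCYAftUDPrk-S ACjHjCNojCgaCTIMHFNyKNuCNZfHIG'' ''zXeFAbCMnJiQrwV-U LRhGiCJmaKXjGBIG|JAYjE]DGEDFid'')
    (Quad ''xEZbgoNCAiJTvud-Q F^EGZKDmKDCjMcFNgHFRHLXHCacIod'' ''bgEXyadQpRI-U-N EYCGWIK]HNYFEpKJjfFNEKZcIlHH}k'' ''jBIacLfEdpS-Z-M I[CGYDC[iOOFAKcLGIDKACxALHKHFi'' ''upTdQFiveAYx-B-N ETiI|IK^IB{JHecHehB{JEgKIrfDgjBkeC^IIfH'')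
    (Quad ''nCMbAiJeFrDP-L-Z AShELACjDImfKhiLFgNGHCoDAliHcK'' ''ycaXBJLeSq-W-D C^FOnKKQjBVfGqKDBFBKKLafETfDRf'' ''kJHfDCUtbAYx-P-M ETFGqjO[DA|hGqKETfA|ILVEHVdHVA'' ''''))"

definition catalogue_C :: catalogue where "catalogue_C =
   Quad (Quad (Quad '''' ''uPWqoMeDaBcXy-J CAjCAhMjjO}HLikEFJElAKZILfJK]j'' ''caBmdOEKpR-T-Z IcFGMhGqjKQjFADGqKGMCFAfKQKOGI'' ''FAezXmOBN-J-D-L-S CCbGPeFrcG~FFXBCCbCCBBiKGLBCCBCCBERGERICCBGGKCZc'')
    (Quad ''qEfacBRIVtmN-U-L F]DIehBmaHFhDzGKxHCxFA_JKMIDNF'' ''SQkrLeacBJyX-W-D FUgLaaBKGJtgJtkFUkGtgLafBKKGtk'' ''qEXPhyad-U-B-N-V A~CFUKAbiCFKNbENbECFIA~JFUIAbkBHdCFINbBNbBCFIBHa'' ''ljsCPANmEhYx E~gNjHE~iMqBKqEJlfPPDEjgFBFOvF'')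
    (Quad ''viTJCnbAMezYqPh QXFOcHPzhD|ILkFLJDHthD|DPBHOxC'' ''rLSJbxzhAdYCtV Q]EHnGMiEQMIEXGO|GI}II}GDAaHtA'' ''xYAdeFhkBJ-P-N-L FeKCrFKPHDahDlICuiC[BHcIImcHhK'' ''ycNXBam-E-T-J-H-P AbKAbhAVkAaHAakAVHCKKL[HL[HCKKCKKGkbGkCCKKAahAaK'')
    (Quad ''pQEZxuTadBcNm-R HOhItKM^JIKHA[kAHEPAFF}cFcDKVi'' ''rkQJeBXcya-D-U-O BAcBKKF]JDoiCMIBEIBEICMIFUhDzKA~fC^FDOK'' ''bCAMnDeHoUt-V-L-X BqCEhHCNdDtGE[CEvJCNCMNFMNGCNCEMECYGKJG'' ''rLS-JcaBayXEf-H-W COICOIBiKGLeFJJMgiDIJBjfGGKHfGCOiAED''))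
   (Quad (Quad ''-VTudCAbxYEQp-N NFcCPfGoeAiiG~DLiKEFILfIElaBCk'' ''xeFAYIBjcNm-H-L-S CQkCQkBjFIEFEEgLiKKZgCQKJchJchCQKG~FFNF'' ''PWuVtIYJfkgzNoXeM EwhGsDCUhMCAFdAGsiEwAMCAH~DCUA'' ''uTdAhFebCkrPMn-S IBIMFHBsiDDjIgiB]jMbHMAHQBEAyG'')
    (Quad ''phRVIdtFAOmbC-S MwFGfgDKILZFBvHAKdNmiLNINfgMFh'' ''ozyiNJeaBXTvWPu MtDCUhCRDFYfGsDL]dNNhFYfBeDCfD'' ''bACmODHKRp-L-W ADfHhHOOHLHgHFcAnbGIcCucOjjEmE'' ''HfDEamOBcNIjlRs-W ASgFQDMuHNvIPIgNGGEbFGQiKnJBnD'')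
    (Quad ''HDoAMbnxZ-J-L-S C{hGPEGKIOlHFrCC{eCXDIWFI~FCXDCXDMvIMvGCXDDuHFsc'' ''-RwpUtcBahENmO-X DqeDqBExiH}BCNHExIH}eEoFEofCNc'' ''bnMXazfo-J-D-L-S E[hD]cCpdDtIEMHE[KCZCErEEYGCZCCZCInFInFCZCCnHCCb'' ''RqJghdcFaB-U-M-Y FqFD_FBzCBzeCJID_iFqiCJfGrIGrf'')
    (Quad '''' ''yaXEfmBNQHpD-R-U IKKAdkA~ILoENbEMLKA~IHOkBEfDvB'' ''RqJeBcayX-D-O-U AuKB}KEOiGbeC^FK~iK~iC^FCwhB{EGxKCMIBMe'' ''dhAbCG-T-M-J-L-W BHbBHCA~AAbeAbDA~aAbdAbEC_DMLEMLEC_DC_DMLdMLdC_e''))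
   (Quad (Quad '''' ''aIeGjcBXyRdp-M-S FOIJ[eAPKACeKOfMEGJVDBxePtEJ]E'' ''swVltayXBJmzO JJINwgMJGM}eHHeJEEJ{gIZINBHHGI'' ''puTdRyaEZJBNOm LZEJZFL~IEfDOKFMTJPrfJ}KPjIMkf'')
    (Quad ''OEmXBNjyaIctDU-Q QJeJ^iLJDAJkQXEEPANDhPRHAJkLoK'' ''CDHAebpQ-J-L-M-T EnIA{eA{DEniD~ID~iAOAAObCeBOzGOzFCeBDUC'' ''OEmAbCdJlPsuV OgGMvHMveCUgGKHCUIFDhGKEFDEP~G'' ''vJNTCiAmeFdu-Q-X PVeDkIKOdAKHCxaBvfBLHKICNMfBmF'')
    (Quad ''RJNpdBmaFh-X-S DNiDBeDhhD~eF]eKQGOGEGDCDeeJkH'' ''-WuTdhEayXOmKbj AqfCzHJjHCkfKPcEpkBrfGmFOdIDpJ'' ''VJBtaGyXOm-Q-D B|KAyIHVEIQhLhiGMKIBEGqHIuJDRf'' ''dhEaBcyXmNjI-L-S D|iAmKG_KApDHrhJQHCiiCkDOcdOcdCkDHPHBGE'')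
    (Quad ''zXHafDmcNB-Q-J-U A~DClhF]jPKKDBjBKhFfhFUHBmHDiD'' ''yXacBGeMoTjv-U-P IyFD[HEWKCmKKDKKDKCmKHvfKCbDxeQGEHNdEtH'' ''fEaxYBc-H-N-P-R-L CnECnEH[hH[HCnEBNdBNDCnECZdCZDCnEL_FL_GCnECnEAEHAEhCnEGGK'' ''udTcyjIBeZhFmN-L JLDN^HGyJDLhB|HLdANdJOJJNPFBXa''))
   (Quad (Quad ''jBcIaEfyXHD-U-W-S EsCBAkCZdLKEG]EH[fFsDCpFNlFNlFCpFCpFIwGGyFCpFGPa'' ''-HzYfxACbJVtrw-L LSdDieIeAOhDLOKAviOBFAQFANcDOa'' ''OkJmBxYA-L-Q-D CJKCrfCshAkCLskGgBAobD}KDHCEzf'' ''HDtVK-Q-L-AMbn CrFCreK{FK{eEzFAdDIkcEiiEiGIkHEzFAdj'')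
    (Quad ''OZExmbYCAtJVLrwS BobPZhCtiIMcMYbFGIQOgIaGP_iPdg'' ''oeMHADCbirP-V-S K{FA_iCVhIvHCJcKacJ_dIIIJfBJri'' ''xEZmOaBNiJ-T-H-P GJKDzkDkIJaHCvKLCDLCICvKBmFGtFFUFBMbGbb'' ''mNBXzcfaDHtU-P-R FUHIzeC^kPKELaKLMIDgHCwHEuEEuECwHEthKCE'')
    (Quad ''BacdTuirwhE-N-X EgKF~IHcHG{EHIKBzDELJCgiCDEI|D'' ''iCJTvdubAMgo-P-Z DnDDhjDqFPWEL|FAvkA}kFphOBEGbe'' ''mAYxOZETudKbj-P M]ECiIIwIM~HMRDAoDHEdI~jFsBIJH'' ''maBNcOEhdjI-L-S-W AVDC{eCXdEbFC{dA^fFYFC{HNAGNvIC{HCXeC{HL]JL]IC{H'')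
    (Quad ''acBXyJeRHpsl-W BKKKQkIheBofJkgPKdOnKLaeQacDZB'' ''iJNmaBEO-L-T-H-P AOAEhjAZCAIhC}FK{BK{BC}FHhHADBEnGBqgEzf'' ''nbMgEQpdFcTuZxiv HtILWIPNHO|KPSeDwJKmdLkjNTHKHI'' ''''))"

definition catalogue_D :: catalogue where "catalogue_D =
   Quad (Quad (Quad '''' ''jVctIWPDBaEXyOm FnfPvkHAiFLFEgkGeDEgkBpIHeHCIe'' ''xZEhBjacIUt-N-P J]KGxFKVDChjIifGvKCljACkBJJB}F'' ''slIwtVjcaBGeXy-M NBGHHiLbiH]gFyJHUBBxePtEDDKGNC'')
    (Quad ''nMbACJtVFeUrpw-X O]DOifHjDCShFREJSEDCIEyhENEKOF'' ''pduTcyQXEanM-V JPEOIkOJCHPEJQEGzJNPJFbDIHhHTi'' ''yXaeBcJk-DUpw-M JbJJwEK~eIceEieBucFkeDSjE|CAuKAuKJMI'' ''AiJbCMnFeqhP-T-X LCDLzdLzILCiP^DGJHGZDJHiJHDGJH'')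
    (Quad ''hEadyXmBN-P-J-T GrHM]jGkBAkkAdkM]dJuCGkDAaeCrB'' ''-SqPhEfaacBXy-J-U DIGDIGMVKMVkBjdCOIB^CCOdBjIGuI'' ''PSrLDiCJYxbAEgOm KFIDJcKLBIAhItkPADQ^iHwHHNIFlk'' ''bjIAYxVtdpzQ-N AfKFwKQ^IFFJCTCItJBzKLBCIRfHIH'')
    (Quad ''xZEQBacpdIR-N-U ErIGaEGHKK]KLlICojPUCEFkIlhBCF'' ''ZHDUtAxBmN-P-R FzcMLkBHaDvEEDhNzEBHaDMEKSAKSADMEMKCNbB'' ''rjPUctDaBmfEO-S ChfL|eLBICDFACjGcjHIGJBHQEHMMi'' ''kvUhdEaBc-W-S-M DoHLMIAIfBMaFUCEhcCMCDOFDriDrgDOFCqgHRG''))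
   (Quad (Quad ''rPDiUtJNBamOE-Z AKCF{jMsBLeFLDHECKPVeKdkIPiGYj'' ''HGpeBmNRIAVt-L GqhI|DKQhDeDG{IETdIqHDZHBoDOnh'' ''eHpbwATIj-S-N E^fAQIMMINZJLShACEB}fNWgIGFCje'' ''lsR-JGHfDCtUbA-Y EijNldDSiJHIBEjAdaJMGJuFKYABAEBAEDFa'')
    (Quad ''pwUHgrVctDaBXy-L EAeEpAF~AORGAqEJDGKHEIfGI|EGik'' ''beACHuT-J-Y-M-L BfbAuhAuKBfAEOeEOJCeBFgbDUcIcJIcJDUCFgA'' ''NCAmDpeQHYx-R-L EnCEnhG]eFsdFsEDVCP~HP~HDVCG]DDpfDpFGKG'' ''qPhudFeAmYxIVBN JvFOceAmKAWIGedOxdAmKMijLrfPBi'')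
    (Quad ''nCMbADuYxWPqe-V DqbGhEH}EIzcJjKDpJG]DMdJEIFHJe'' ''dhFYexABmNJk-T-W FzFHukEmeAJKG^DD|iDshNcKDYDQXcQXcDYDOMD'' ''vRUpdQoaMcB-X KRfM}cKIePXKLhFEUJC|JJoJBLhDQE'' ''WRvTjcBaXyNm-E-H AnJAnfCmkCmHD[iEPCEPCD[IAJhMUHNcKAJKMUk'')
    (Quad '''' ''NmBaOfEHDxZ-J-L-S AuKCZcIzBG]cFsCBQiD]CHEgI]kD]CD]CJbGJbID]CH[DFrc'' ''yXaBcjIeKGMotVuPW OsiOHKHAHAYdOHkOsDGphAYiKEhObi'' ''ncdTuMaEhxZ-V-P IvkKPkA[FFwAAmiC[HIKHAHEEUcKIK''))
   (Quad (Quad '''' ''nMbCAFedhPquT-X-R LlAIlfMEFCJjD}jFqJAPJKajOwcBSH'' ''puQHTCAbenMYx-R IejKgiH}jG]JLKJDpiIpDMdDEpJLwb'' ''JviTCnudAGOeYx-L ImfF{jMHHKhjKPdMTKOdHLZJDlhHud'')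
    (Quad ''gCEAbJiOmTvwdp-S MEGGaEKtDEZHJIIOUJHyJINDJeII_I'' ''oMeAiqPDuWJbC-S AxJBJjChbA[jIdFEUFDQHGvHQEJKVi'' ''lsRJiCAbeFnMo-P-X LsgD}GErhEYIEreIlDE[EEYIDfdBhi'' ''pwdTvcjyaBX-E-O KIFKRIHrII}HB{iDgIMiIMiIDgIAmkCwIDkHJTi'')
    (Quad ''yXaeBGtJV-M-H-L JtKCyhJpFFgfChjAtCFojIdGAeeEOJ'' ''iCJYbxAEgmO-L-D-Q AkhHiHCqgBmkAefIdHBJkJVHFekClK'' ''meAFBGNdhqPKjRslTu IDgIDGIDJIDhOCaIDjBgFBgAIDHBgD'' ''-S-PUHkIfDtjcaByX CvJDkgDgACgAHlEIfGG^EDkGFLFFLFDkGIrkEgj'')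
    (Quad ''nMbjeAIHDVt-P-Z NMcNMFCJJDcaOwDOweDcBCJhIIeIID'' ''riPDaXyHfmNBG-U LzKBxIAPkFPcISfNThJ_ELbCKaKODI'' ''rwVItjAbnMeo-S-H ATGCyCCyBIxDFTIATDAUAIxGFTEAUF'' ''iJCAbnMxoZ-H-T-P BfBEtFDOKBHEDoFEDDEDIDoFOBbFfFGbBCMfFUf''))
   (Quad (Quad ''pHQDIOmAYxjb-S LQfMefDXCHPhDVFDbiCiGFSKIHCLjD'' ''cfEaBTvjRWmO-X-P CYDDXeCyCHRdADABqhKgIGIdOjHEhH'' ''ZExmACNJtVwr-L NIiNRkLAEDOhEXkEDkBEiBdJDvCDOh'' ''jBcIaxZEfHDNm-Q-S G^dG^KNzDFzfJfaJfBDYDDYkDsFQHhQHhDshFzH'')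
    (Quad ''-S-WudThOGamB-J CNaCZbG]DG]bCZDCNEFXCDtGIbIIbGDtGH}dH}B'' ''cBayXDHe-J-L-S-W DuCDuCCXdCXEAXkAXKDuCEcjEcJDuCDuCHYCHYcDuCDuCJXKJXKDuCBTD'' ''hZdFuTAxBNm-V-P IvcFuJAIKK_kDMEK{jAIKLJCDrCC]K'' ''mxYIBjcVtUDrwGO KkIP]JKEHLykC~IQDKJiDOYkHAhBOD'')
    (Quad ''dcaBTjvmNhE-L-S H{DHWGNcHD|ICmhFwANadDxDPBHPBHDxDJTeAmj'' ''lIswtVcjBaEfzYUp LycKGDLDANUFMsJPwaKkDPVINuAPoD'' ''UVItDjcfBEaOm-W-S CMHLKHMUfLMICvdEthEgDDzDBphBphDzDPQdCDF'' ''koeMrnbCADPtU-X LLCFhIOydOEfKJJPpIFHFLEFFCIPkJ'')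
    (Quad ''-S-QHDAebCTMnJiv DYhCkhKdGBkAAqhF{HHvDIfgD|GCHJCHJD|GDxJ'' ''udWPhEamNcB-R-X DfJI]hBubCrADahJuIHQILsFEihBQf'' ''dTuvjbAEg-Q-M-L GxHJnFJpfCefEOjChcM^DIKgA[iBUB'' ''''))"

definition catalogue_E :: catalogue where "catalogue_E =
   Quad (Quad (Quad '''' ''dpRJCAbEZxY-L-O EOIGXHKgEJnfL}kLYFDTkL{gHRhBMF'' ''KFiOmAbCJ-D-U-W-S EBAA{AA{eBTHEBEABaABEEBEEBCBTEJAHEBEBWHBWHEBEEBEKuAKueEBE'' ''wRIjUdpnOZbAEx NKJI{IMfkDPHIxJOaKPxhFTIPYJPgK'')
    (Quad ''PhqZxoMbnJCAi-T AgDH^FDriDMaDoFFmIKyiBEfDoFNRi'' ''-P-UvKTiyaEXjbMn AYDIsKCQeEEDOsIOsDEEDHrKAYdBGhM|DLRKKfH'' ''mNBcfeHDzYjI-L-P B^DLikGLDBXaJ~gKZfCAHO^KCPGDLh'' ''HoMeUADtbCvRp-X NOCP_FLLHG{CPtCELJHUEIhEAzaBoB'')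
    (Quad ''nMbeACHDpUtRK-S EeIMsbACJPtjF{JGvjH]CQEgNufNWh'' ''uDCWPbAYxMnekr GIJNCHOEeGzdLdDNdHIHHDXHEjJPPf'' ''yivTKFZGjdeBmNwp MbiJiKBaHMAHOYFITkP]JQBFJBhJ|K'' ''tADUEYxZgbPoNjr NCHEQfJOHBDDJlJIUHOKfPmIE~DPPi'')
    (Quad ''jBIacEfdmNuV-X-Q FIHHDFB|JIIeNMFEGBBaHFoFCxAA_E'' ''ozhdYcaBM-P-J-L CZAEvCH}HBCKIzdLKhCNKEMHJFKJFKEMHFNcG~c'' ''eGBcaXyjDPr-M-S NZDNZfBsABsIAGIBlkAGiDDeDDKBlE'' ''rkPDAeCb-N-X-U EAFC^fDUBGDFKQJI|fPKEDhED~fF]h''))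
   (Quad (Quad ''GbAfCzYjtLrQSDU KTJQKAKDAD[GKDkCdFQ[KCdiD[gKTd'' ''HuvJTiWRBaXZymN EKhJ|iNrIO~HJzIK|JOeHITIJOIFjj'' ''slR-JBNmAeFOXz-D ERgNQiEagPnKMhFERgGLBBiKCCBHfICCBInf'' ''EgbcFhUtIVjwr-M-S IgiHgGBsANtAGjIESINtAHghIgAESI'')
    (Quad ''JvuidTnMaXeoz-W B~CB{eGvcNWkB}dI^fBIHDQcQTDKRE'' ''nbOEQXayirLS-V NIGFqHJkgMHgMOcLUGNoKDeKD_cDZH'' ''ZxoMbnAjItVrwUp JeIMZHPaDMXHOWDLPHIqKKtJG{FGOi'' ''jvwphgTdFcNo-M-X EWFEwIEwIEWFCmFEWeA^eOliF[IALdJhFHWaMCI'')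
    (Quad ''LSrWPDtHfaEmBcN DrgN_FKygEuDM{FLMFLMGCIGNhJBph'' ''UtDyaXMbozg-P-J DfJByDHEDIwiErEInDDfJBihCZBAEf'' ''VUrpwHDftCGbAxY-M PwcOSEHBEAyhBIiEycICCA|FIQKDdI'' ''eacBGXyzjI-L-S-P-M BQDBQdCZFCZfCZfCNkCNEE[EDfgDfGE[EE[EBhGBhGE[ECZF'')
    (Quad '''' ''SPrLiJCbAehFMnzX LqgLyKNHgKEhJzKPCDK|DJOkBwKOpd'' ''xZEmOBNJaVt-H-W FekIQkMEIBlDOUFHiFDRcKwIGnJBVc'' ''UtDCAbnMeo-X-J-Q E_jBZjAeeK{AAdfAOCOzJJHDF|CAOC''))
   (Quad (Quad '''' ''uPW-RjGKncaeMXy BnKERdBnkFrFFVEFDdP[KJbdPIdMueFrFMvD'' ''HEDafIOmBjNc-U-W-S EsCGPHFrDHZcKiHFrdC{HGPhEbDBnFBnFEbDEbDKnJCWFEbD'' ''-V-UPhqfyEaXmCN EcFEcFIsiHXIHYeBGCArFDuEEcFOriOriEcFG_K'')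
    (Quad ''AeGC-D-N-K-X-L-P AbkAbKAOcAOAAbhAbHEdAF|CF|CEdAAOaAOCEdAF|AF|AEdC'' ''ebHDCAMnTvJi-L-Q AGfNVFBlHLVAB]hFZHEHJIBeHVeBsE'' ''UtDVJyNZOBaEm-P JPCB_FALcCcJJxIKjfPsIHTfA^fH_f'' ''xAYCbTJivdpw-E-O BIjCxAApFJTiDkhEgKDAfDAfEgKI[CDzKB{II}H'')
    (Quad ''mOEBfactIVj-U-P-X CNKG]fFgADOfEhHLAILADEhHC}aBQiB[ADqCIeF'' ''yaXecBJk-M-RWuP JbdBhICsEDFeBQJDSjLAdQWFLsdD}jBQDJMD'' ''RpvHTeACbMnxY KcJJYCOQDIpFK[EEIFKrIMdFOFECGf'' ''mANCGftxzYDU-V-P EkKLVCEkEABaKuAKeHO[JKucABCKeA'')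
    (Quad ''BXycaekDrPuW-N N]JLfePPfMqCCPjCAJO^KNFCNjKOEe'' ''xzbJAYCidUwQp-M JxJIHcDYfCVJJPKJfkFvjLQFAfELBA'' ''vJCTiYxbAZE-H-P-N CeCAMJDVfFYkEnJMtDMtIEnJMeFLQjC}FBfcAVj'' ''wpUdcBaNmEOKR-X OjhGIjPpfHoJKJjMyHFCJOEECYJPkF''))
   (Quad (Quad ''tCUDYxAbpMnHQe-R HcFDTEByIHEIApHCifFMHPcKDbIJmC'' ''rQjeBoNzXacDUt OrkLxKObDBGIObDOHFOcfOsjBGINnj'' ''gbaTXyzduMo-P-J DfjDLJI]HGyfInDEYDDfjGLcCZBAEF'' ''eHDAmNC-X-J-L-S EbCCpDBABB[aBfAAVDBQIEsEHQgASfEsEEsEJMIJMGEsEAuH'')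
    (Quad ''nMbeACHDPWt-R-L DoHF[HBMcDzjCmEEtHH^HH^HEtHJTHG}iL{HCwh'' ''caBjTvduyXPWmEO OtFHSDEXEK~JCwILrDCwIMiINREH^i'' ''oFNgcdhIjRp-M-T-X EvhN_AN_KEvHLMALMaEMICNfEMiCNDExaExAHxH'' ''njcIaMrfkQpXzUw CRDKDKGsDEWKEwhNnjObDPuAEWKGpH'')
    (Quad ''BeGhJidCruTw-Y-M MyIPpEKxIAviKJhNpAEvECYHGWDKJH'' ''phEdaIRMnbgtV-L IQHFZjBljEZhGNbGncPweHpHDDiOUi'' ''OHmAD-B-Z-J-L-P C}DC}eAaHEzdCrdCrEEzEAViBQgBQGAVKEzECsBCsBEzEAab'' ''sPDilJCgobAM-Z GYGGAHKcgL|FPakNUbKthMsfLgdPWE'')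
    (Quad ''CbAFeMndh-X-JlRs M~HBWdAdDHOHOzGDFHAdHBtDM]EA{BIkIA{B'' ''ivTFgcudpQNoeM-X KmdJDKHBINWFFaANMdFIhIfKF{iAQj'' ''SLJWNBmEOHtDaf JYEMGFMGGPjGCGgEKFO{jCGfJRfMkf'' ''''))"

definition catalogue_F :: catalogue where "catalogue_F =
   Quad (Quad (Quad '''' ''oqRIeMAVtCb-X-L LXIIoCJHcGUCAeEJVgHUECBCGZHAtJ'' ''jrCAYxmNEhPWu JRFN]JO{ELwCNEHNHjMdiHJECGIQAF'' ''lICbARsVteqnMo-X JrKKaJN~HGHGFxHMNJD{INYCIlGEoG'')
    (Quad ''RvWtUDHZxAmBNG NkENQIMhJEaiNNhJGBCfFJGBPLDFKk'' ''oMeBGacdIjLpS-W BlHMsaAsHOSfBVfI^gNidGAGF_hPwG'' ''yaXeOGcBndpIjLS PYIIXKFbgNfhDKELnDOmKQPkNKIMDA'' ''slJCwVtAbEYxZmO JogMZfQOHKAgQ_gCtEOAePiFOukP|E'')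
    (Quad ''updTQrkEaBcNmO-X OwkOwKBbFK]JIlJBbfD{fK]fIlfD{J'' ''uTdivJCygbXoM-P A}eELAKWHPEKOYKE}eN}hG}JJThNae'' ''-RwpU-HfyXaECbnM MgiMgiCOIMVKIsJFQhMueHYEFVEMgIAXKBYj'' ''xeAYHDbCQpMnSLr LAgAgFIbGJbgNlHG]DG]DP~HNdHFDg'')
    (Quad ''BjcaIrXydZFhVtSL N{CFLaHtADAALCGNydDkIDkGQMgMiE'' ''nbMeHCApQuTivYx OwhJDIK]IEpFHBHIpJOdiOFELlAO}f'' ''bCAMyZoeHD-P-J-L BNHHxcJChByFApIHrhHxCFNCKlHKlHFNCEMhCQK'' ''pRdIjAbxYEZOm-S CaBIFIHjHNqGGRDN^hHCHNghMaFN}H''))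
   (Quad (Quad ''eoMxqAYRIDVUtjc H|HOVINEcGmJJjCDmjK[KLWDNYcMdE'' ''tUDPriFQgcnbM-X GQANQHCWJM|aBifFJkIwkGPIKnhI~H'' ''eBGXcayjTvURp-M J{IJ{dMbiMbDDDeHpDBxKDDKBxeHpi'' ''xbjAYImOQTpuH AneAnDMdDDpDDpeMdeGmFKrIGmcQAH'')
    (Quad ''rwVjItAbEnOxZ-P AqKL|CA}kDnILHDIPKECDPlDKddGYH'' ''jcINBmaxOEZ-T-H-P FgbCMjCwFCFFFUFNRDNRIFUFClHCEfCvKDOKDof'' ''fyEaXbCnM-H-PsRl FVeFVeHfGFVEPGFBBFFVENQgEaGAXKAXKJXKMgIFJFAAh'' ''FYxeAdQuWkrJBmN MkjFjDNrkPyCNBDK|dOeJHzfO~JJdf'')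
    (Quad ''cyXBaDHeQp-R-N-L G~IG~iJGeJGDCCcCCCFXCMhIMhIFXCNFcNFCDtG'' ''jIbAxYEZtVnO-U-P EnhFYkMCEFYFCUhCUhFYFA^FC{KKiKPTIKjFGKI'' ''xAYdiCJbuvTEgNo-Q EyhMHHJQDOIhNufMHiMOdHjDEeJNqI'' ''ogMbACYxiJkvT-U-P KiEBPHEtHF[HGpHGpHF[HHZaKfkAYDMzeG|dEWK'')
    (Quad '''' ''-PRqKVtcEBa-M-L CljCDJBUEEOcFgfCMCHRDGUEChjAeI'' ''dAbEgjIxYmORp-U LCKBxKMbeJBjNyjACKQGeH]HIiIIGI'' ''mNBGeAFdhTwprVLS JSEOaHIMDPiEIZGFEhJJGQOGHKJNXC''))
   (Quad (Quad '''' ''OMbnGJvwpCdiTA-Z KtHGWaFqIA}DOPHMZJGYjI}KAvIE}D'' ''jnrbMewxTAYHD FFdLZDDEIOFjK[HGmDKrFOdIN[IPri'' ''ricBaNmPEhZx-U K~IHIJGDFGwJOtFI|FCLDNokJkIOnh'')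
    (Quad ''yctFZKjaBUDrLS KSfCRGMQcNzaMQEQHGPRFPRFNzKKSF'' ''mNBEjvaTcf-Q-X-U AQJE^hFefCJHIuIIBJDieBmfNMFA_E'' ''maFNBgcqWuPhd-V-X L{HHRFGhEGFHCleJ]HAwADoHLTfOTH'' ''amOEBchd-J-X-L-T EhDFUdBqhBADDhhF]gGJDAOBFgBJHFJHGFgBDUC'')
    (Quad ''rjPDcBatUmOEf-X D{FIpiFycLOIIeFIIaOwELbFKaJKcf'' ''-SqPhFeAbCMntUVJ BrFFwcFtGHWiNeiBwfJhFMWhOpDGfG'' ''AMbnCFdhZxJlpsR O{CPfGFWCEQkJRDMzEMGiPbHG|IGEG'' ''vjTcaBEOmXy-Q-D I|FHmfHEELshBuCDFkM]jAukJuEHQE'')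
    (Quad ''xZFAkbChdPrMnuW OTHJOKL}FQVFKKCJiFLykL{HAhHDJf'' ''rVwItjcBaUDeGoM-Z FzIBaHLFkOTHJiDNIKMOjJgHIYiEDD'' ''dahETuXywirbgnM DAdKkIHIHQ^IP]JNyFMJHJBIGwHJEI'' ''ivTJaBudEfmN-X-Q A}dMYcJuEGrJFqjBoCJkHELFI|CDhh''))
   (Quad (Quad ''uDHCWQNeAm-S-J CyaJtHJ[fLpHCydJtJGtjJ[gLpJGth'' ''WPHDtAeCboM-J-X G[JFaCDaHEUIJoINMdC[IKIEIdIFod'' ''jcKGyXaenM-L-S-P EbFCCbEbfAXHJGeKfKFrFMuePIgFrFD]fFrFEaDEaIFrFCXK'' ''NOhmBEZxda-J-L-S A{BCpBHPHDVDD]CAVBFsCCzKMRGFsCFsCM~KM~KFsCBTDCXd'')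
    (Quad ''-SPHEuWfaTvmjcBN HdHNaaFiGHWIHggKWHALAMWHILDGfG'' ''gcFaBDyXtU-J-L-O F|EAZKDvAMLkAbKPRCNbeFuEMQeMQeFuEAbKMLK'' ''uWPrDjcfBaMo-X IpfJRFIYFLYAAlHEmcLFKOjHKgIJYh'' ''tcwjIVaBGeUDls-O DxGDKED_IGiGHwIIXDFihAqdHNEIPd'')
    (Quad ''VUHtDoMeApQCJb-Y GdHNhDNhaFCHGdiN_HQQEPpHPpiFCi'' ''ycXaBTduzOmvj-W KMFFhhHDaGAfOSCDCEIoHICFNXIJSF'' ''iCJDAbHeXzMn-Q-S DYDAmKDMdDsHFmFIvFG^dOMKFzFAWFAWFFzFH{F'' ''xAYCbNJigEovTud-P DPhDccJQeNKiNfHMwaEHHNahD|IE}h'')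
    (Quad ''IAjbExZ-N-L-D-S GJEFucBZkBZEFuBEdCE_kE_EF|cP^EP^EF|BEdB'' ''bCAnMetVIkzXLSrQ LriOmkCLcOmjLrcJvIJvCCLiOtjOtk'' ''pwviTdCJAbnMoe-Z CxAGWCKAIPVEMZJPoKGYDI}KKxIDTH'' ''''))"

definition catalogue_G :: catalogue where "catalogue_G =
   Quad (Quad (Quad '''' ''RpJdCAbMYxoZ-S MMIE{HKAHFykFEEGNcIaGQOgLmFOUd'' ''mNBOEjacIqdhPuT-S APJIFIJ~GKnJBwFNeIM|IISFIUFBDI'' ''taxcUDZgEnM-P-V O[JJLeO[JNJEHaKGuJMVhBYFJyHKeE'')
    (Quad ''lsPkeADbC-O-U EOIEOfJqDFcfKVeKVDFcIChiM^CChF'' ''lRsphdFAebJCzXnM MjGPEHO~KO~gO}KKWKK|FMWKBwHFjA'' ''vJiTaBeXzy-L-S-H A~eGxCAJCMUcOMJFfJATDGFJLocLocGFJAUJBHK'' ''yXaaBcfE-H-P-N-R-L GGKGGKAXKAXkGGKBjiBjIGGKCCCCCcGGKHfGHfFGGKGGKCOFCOfGGKCnE'')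
    (Quad ''maOEBciVuhrP-S IbCDLHOEBFCcDLcFCHOEeNdGNdgO^J'' ''uhWPriFAeMbCn-X EIJEojPWaCVjBSHAxHKafODhDqeKcD'' ''nMbeCFAiJ-T-H-P-X CvHB[bB[ACvfF|BGJHDGADGAGJHAeDAedFgbFgA'' ''-S-WudThoMaKjb FYdCXfJGbCXCFYBJGDDVFGKGCfGCfIGKGLjbLjD'')
    (Quad ''GeBxZYAoMtUD-J-P BihEFJGQdMuKBiHERIBihEreCCCCOd'' ''viTrFAeGBPhNm-L CBJLFgCjDGcdGNBP}EI_FIhDHUDMMf'' ''BcaNeozXIjdVu-Q MOdGMKLgBLXhOkKG[DEyhDCJNiHGAk'' ''WuPvRJTiaBmNxZOE PtkMfkI{IHHDLpjP_dM}DJ[KBLFEVe''))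
   (Quad (Quad ''ZEBcyaDHUt-V-L-S CCaEbJCXAAXkEbjGPEFQCGQGGPEGPENQINQGGPEJGJBPDCpc'' ''BgmNFcDtUiPrQ-X NQKFQJKnHBXEGLdMgaGyjGPICWjIWH'' ''tVJCDAHemN-L-Q A|GGjFA|iHVFAyGFOFFOeAyiBsEHVe'' ''tVIkfrQygXaEb-M-L AzFAzfIOcAGAIOJAzAAzaAGFAGfAGa'')
    (Quad ''jNmvuTAdpFQZx K}CQ^CPbkPjFQCCKLaL~FKbcHkIMGF'' ''dprQkocaBM-X-S BKKKMDF]CKQkFAFF]FKQgFACBKGKMH'' ''mOEahdiTvJB-L-Q LVALVDAGEAGfHijNiCNidHiHBlJBlh'' ''iCJFrQbeAnMHp-Y-U ByDF~HFadJCHKNDGdJIlJGacExDHxI'')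
    (Quad ''-HZoxMAYbCJtV-L EABEAaGtHJWCORGORdJWkJtHJtjGtj'' ''dIpSLjnMbAoe-Z BzFFaeE{IDPgPgGPYIF~IFTEKUcIxI'' ''cBaiEKTvqRmO-X-L BxIBxjDGFFAjDGfBxCBxhFAIFAhFAC'' ''ducBamNjVIEOxZ-Q FqJI_ELGDMYCGNAQOKGnJKtKHKHHLd'')
    (Quad '''' ''HQpDCbAenMxY-R-L EhkBfBDtGD]dCpHG]DFKKFKKG]DDVCDbFDXHJGe'' ''HkJNBemDAxY-T-W DsKAKDIYFJaDDYDDkIFzfI[dG^DN{DN{DG^DKdi'' ''dtWhQEamBN-J-L CkJABEKeJIJdEcGABIG_DPHjPHjG_DBTIJyDNJi''))
   (Quad (Quad '''' ''phsdFcgjIRlbE-M-T N~EBbGDdIARhDLGGWdJCgIlhNpAKvE'' ''IjbAMnxoZ-T-H-P BqFIrJLMDAUhGbBKyiKydGbBCykAwBDoFC^cCvk'' ''UVKqRFtDCAebnM-L OGDIYHIBcGMiJfEB]dQBEBaiDNfA_j'')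
    (Quad ''qhPFUeAMCbnJvi-Y NYCPoIOPjPhJGWFFxJN~FPpJPOHQQD'' ''LSIpdahEyXmNB Q^gDWkI[eDADQ[KN{EKTHI[eKFGQ]G'' ''-SrjIcVwtBaEfmNDHU HggCTiNeiFiGIgiPsGB_HLthNLIFtG'' ''NmBXzfaDHUt-Q-J ImeGkBAoCIkFCrDNvCMRCAVJAShBtJ'')
    (Quad ''jvucdTGOBma-X-P BDDDXEPKHFfHODhNCEMehAPFBSHBfA'' ''dpawTBcmNjvEO-Z KIFBwFHLdDThLyFPEFFwJJTiL{iPVe'' ''huqWPTdCsJRilv-B-O AFFKXEIFEAFiIFcKXcAFBESCAFdGRD'' ''bACtDUeFiJ-N-X-P AodAkKANfDHEGgDGkaL[eAkFDHFCKE'')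
    (Quad ''xbCYATmudPEOqh-J GlKGlKOLJOLhJchJcJIjINxJIjiLII'' ''jKQbEOmpdaXyTu OmfBFIFPDCiJJ_iPchO_iM_HFbJFSH'' ''vJudiTNBamEOZx-Q NMfM[EOSCHDfEyhPqIG[DNWDE^KI^H'' ''qSELZVtyIaBc-U CPdNrCHTGH_GBPIBXIMBkMqAKqDOJc''))
   (Quad (Quad ''oMbgJkiCATvxYWPu NNKQFFH^HF[HNkeP[kD^kF[HPCHEwH'' ''nbMgEXyadpQ-J-T BueI_cB~iDQiCBKJVhMEfCjIBJKB}H'' ''HDfGCUtBeiJ-X-N-L A[gFoEDHELHGHFJJpDHhjIdJIKJC[J'' ''PWuTviaJBmNOEZy HMkCRDEwHA^fCUHL]INniA^fJ}KNkc'')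
    (Quad ''SLqKjCYAxEb-D-W CvKLSjIGGGXJKzBOBBCEgPQKHlCFpg'' ''qEafYxcBPh-S-U-J GuIGuIGCdGCIBNjAEFPUIAEfBNGDIG'' ''xZEhqPadcBjIuW-N NiFBkaQVJDeKLVEOTFEHjDBKMOiETk'' ''VtIUDPYqeAxmGNB HeCHejFceFniFnIPNKPNkPAFFcDQTH'')
    (Quad ''HDfaEiBJNm-Q-L-W GFHA{AA~cHvdDBHD~HKCaBkaC^HGxDHODHODGxD'' ''jBXaycIDEHfPWu-S ASjKYcEraCoFHafMRIIwJNlFCpFGQi'' ''upTdQcBaEmNyX-V BSkHbkBCkIzCAciDEILlaOFeEIfAii'' ''jnvMbuATdoxZ-W OSCCxJLGEAseKMFEGADQCBIhEVEBLf'')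
    (Quad ''BjcaKFRqhdwUls-M JOgFjIBDAF[jMpHL{jNrgJhgBDaBwG'' ''uvJTdiCgbEOmyX-P OBAA_DMzEPfIKoHAQEIGJFIJEthQGe'' ''udThCEAbxY-N-V-L FXCG~jBPeKfhCCCCQKG~JPnKPnKG~JCPGNFcEMe'' ''''))"

definition catalogue_H :: catalogue where "catalogue_H =
   Quad (Quad (Quad '''' ''VtACJNmYzeqhP DAhD^HQMdJTfDwfH^fPBHJTfHthMiF'' ''jcIBaEOmTXyuhd-W E}KEZHJChApFJLCJQHOJFKGHFMFMBK'' ''oZxMYAbdIjpR-S JWFNrCMbEHbdAyGICfFOINBhJ|cIGd'')
    (Quad ''jnIAbMVeoXzdu-Q ELFN^JFybGnjPdkHpDMYcN}jKwjKAJ'' ''WPudhFCYexAbnM-R LsjFkAEYIEpJHahCzkI]KJbjD]dPIj'' ''uPWrJCiDbAFe-M-Z IxjMUCGrICVjANcLBaOhJCDcATjBzf'' ''swVlKEuBadcNm KRICbIPXHKBhPNEOibQTHPDCMoCO]H'')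
    (Quad ''WTSiLvJNmBaxOEZ DCiNUfOPhKthINhMcHCbkGOGOiJMXh'' ''-SPrUDtcjaBfMo FcFJgFDKICxIBvABaFDNIFnCLnEAsh'' ''QwrVEjNmACxY-U MpDNFbBDjM|jKfkDXkJGEPPIFBFLjf'' ''mNBOEjZxIacrwVt-H IdIHbKAxKNiHF_IHiILpFG[JJtKJWh'')
    (Quad ''zOmXBNjacIdRp-S AyGGikIRDG[kJWFBIHI^fNOiOkgORG'' ''VUIDtfHAmYxzBN-P J_EMQDAZeBFeGshLJCLzHAZeK{jIkh'' ''WvRiTAEbgJCYxOm-P LoCItKJhkJneIKHFwADJJQIFCmkL{h'' ''xAYFeBNmhqPtU-V CLjE|EGxKC]kLokGxKK~dLrjOxdLJh''))
   (Quad (Quad ''ncMaIjXyEdh-L-S AZHKCdFsCLKHIzDDECDpgHPHBFHBFHHPHCkDOlh'' ''NBmAxFZhtU-Q-J APhKYkASFJMfD}HIwfKnhEsdAocFkD'' ''-HzeXayBcjTvWR-L F]DJtIDqcOhdAxIFfGKxIEAjATDDOA'' ''UWHtDAeMCbnYxvR QWDEuCJFKJbiMSEIzcBFeIzcPcKP[H'')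
    (Quad ''zQXaIpdBcSL-N OlEL^eJKhPrKDEkHdEGoEAiKEfcONF'' ''ebHoMDCAprtUwV-X MlFINKJrEKMCDCFA_EEGDGMCIuHFAH'' ''pdwTcvjaBEf-S-M CjFNWEJLCJIAB~FGRDEeiNqhI_AM[A'' ''-MNgohUVjcFItwr-X HWAObkObaHWADxFBGdAYaHWaBGjFikFtKEWdHWa'')
    (Quad ''-RPqhEXfyaCmN-U HXFHXFMVkEcfHYENtIMVKHYeEcJKeH'' ''cBaXyeDH-JLSr-W HYCHYCI~gIWGMgiFJJHXJEcjDuCJXKHYcIJK'' ''BcadTuyXGeKjv-P-S JGBHZjB[CMpGH_JBPFF[eHZANkFNkFHZAEbjA^J'' ''xYACeGnM-H-P-R-L JAKCnEJAKH[KNJBJyHH[KD]DCpkH[KAAKAAKH[KAXhH[KHaKBYIH[KBTK'')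
    (Quad '''' ''OnjRbEpdIAYx-U JgiDChHjeLUjNsjF^DNahEHHMOEN}e'' ''nMbCAteDHWPrSL EDFGpHBdeBpHKDEEtHEtHHAhJiFEud'' ''qPgUtDcBaoNmXy-V LwEMzeAlAHZAMzEGoENGiJRIMkIEfj''))
   (Quad (Quad '''' ''xAYeGCMn-HUpw-R HmKAEKHmKGCINJBHEiGykMgiAAKBYFH[KIJH'' ''duTayXBJvimzO-W HKFGzjOIDHChI_JHyFNqiIhCIZDLaC'' ''-VuTdPFqhAebCnM-X EpIIlFCxACJILsiIuHB|IIeiOwcJrC'')
    (Quad ''yXadMPbjqoKh-S FtGNtILRKBGcHggMBhJQkHqfOXKHTB'' ''mafEqBNPDUtyXIV GwFLuKB{jDAIQMHMiJB{jOxDK~DHti'' ''lsR-P-HfaaEcBXy-N HfGHfGFVEFVeHfGJUDJUdHfGERGERfGGKGGKCOiCOIL_F'' ''-SWPudTivJBamNEh GfgHjHESCIgIIFIFtgL^HOoGKsGHdh'')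
    (Quad ''ebACDHPri-N-S-V C}IGraIIICVHANDCJEIeeJPDMeIBSg'' ''tIVYAxbjEZmO-L-H DiEBJhKOKGVJJSCKzEHKKJ]jE^HLSD'' ''duTAviJCbxYEnO-Q DDHBvDHgIMbJQUfMAiH]dFZKBsJFOE'' ''RWJCtDUHNAmxZ K}fP]DK}KGTjITHJdjOeEIThGTDJdD'')
    (Quad ''iJBaTvNmOExZdu-W KOFDkIIYHJ[KGtHORIKREBLFO]DBIH'' ''nbMxCYAzfG-DpUw-R HaHFkcBuCBYjO[IK^hBYjKuAJwCHmhJAHHaH'' ''UpwrQkfIaEmcNjB-Y KlhCIJCIdKlHHxIKlhKlHN_DQQIHxi'' ''bCADUWmOQkv-L H}DH}hOQBNYiEocMdAMdbNYIN]CEoC''))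
   (Quad (Quad ''dIuVjAbnxZOE-Q OIHIoJIChEyHHDFJJJLXHFRHJSHLvJ'' ''kqWuPDYAxJBmO MWkONCMjJBrFMTkO}kOdjHdkPrJJKJ'' ''BacdJuThkFgZy-L-S IzdIrDJykFNfDgAJjKAcCHrAMSAMSAHrACkdEEG'' ''ivUDAYxpHQeoNB BOhBOJJvfBOfBOCJvCJvJQDIJvhQDK'')
    (Quad ''mAeFhdCNtVJLSr CIIPvAFLHHAeBdhC~IIfICHdIfGHeg'' ''viTDJCAbXezPq-N BakDYfIHjOKDDcaMeFIIFJfANCjAfk'' ''oNBeaXyiJ-H-P-L AJhAIHAZcHvHLJDLJIHvHJnfMwbD|ICmkGxhBMF'' ''rPkhgFdcYTuNxmB FwDQ^FJvIMmkOpkOmjQPJDJKLyJBOk'')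
    (Quad ''qKRJebFCAiMn-Y-P-U FNII}JI}jFNiHxiHnDHnJHxIFNIFNiEvIGWeGWF'' ''RpIdajBcXymOz-S LpHNpILvEICFDdHHbDARGP_ENXIIMC'' ''qPDCnMAebzXtUJV HzfKofJRiFWcMzjKpiL~IPCFMkdMGI'' ''fEaDmNcBjvU-W-S MKHDxhDxEFzhKdGFzEKdgH{EQNEQNEH{EIPhIPE'')
    (Quad ''nbMJiCrPDHfzYUt LKIBpiFPFLzaJFjNlKLKIPvEQFeBFI'' ''xmZAQkrCJN-S-D CYGDXDDbiKJGDtGEMKNFBHoGOEkByi'' ''SLrPiDJCuWbAYxHfz PuAQHGBejNLeBeGNLCMxGCRGMxjPuk'' ''''))"

definition catalogue_I :: catalogue where "catalogue_I =
   Quad (Quad (Quad '''' ''oGBeMXjyaIcDtVUwr AWIQZdPuADJdNmeJvDBODLNEKDKJiD'' ''JiBaTExZhdu-P-N KOeImdMHJGckCSKEecFeJBJJACkCjK'' ''jBcIaDtUVyXmOz-W PQdOJCHpeHyFEZEHChN^HLmfFyKKwh'')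
    (Quad ''rVwUhIFtjcNemBXz ObkBOkIDkKEiDjILxKILHPujIDiOpk'' ''beACMohdzYTu-J-L ArGAYfMBKJmDCQKAYFIECOHJOHJIECBPhBGDApJ'' ''qGRKjVctInOyMXa-P GjIGBHFOILRkBXAKWkPyAO~DHgDNrJ'' ''rPhkdczaBXmN-L GtIHChDRKG}IKwhQaBO]HN}hLaKF^F'')
    (Quad ''mbjxrPWuOADYF EmcHuhOdJDEfIpfOZKEIJDpIKrIJKj'' ''jKQEbpdaXy-L-N ELbHhIFhdLZCCuDAKeHuGLLgDlKOOI'' ''mNCAeJk-DUwp-S KuECzHMRiKuAKeEG_hBYjHaFHYBBRFIJhBTF'' ''mNBacxZEhdTu-P-V C]HMeeD~kHNJKCEGrCD_HCLDJkFPKE'')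
    (Quad ''ZyHcaXBuTNmPWvj OXHN|iOpEFtIIDHKpEL~eKbDBgkOoH'' ''hqPurVdaEBcmN-L JtHHyIBVEKxHIaGCtfF_GKAHLaEKwh'' ''ytwIrVpUaXcjBMeoz HUCN~KMPHP_DDdIHHdNXIARDIoHJJH'' ''phEdaRIBctV-L-M IQHOSDGSEBljM[FAGFIQGOSDAGABlc''))
   (Quad (Quad ''rwVjItUDAbenoM-Z IvINaiJghFTEPxIMmHFwfH{IDPiK_F'' ''xbCAYtVIRqfG-M-L EyIIOCNMkCjeIQjM[aEZJKOcE^kMEH'' ''WRJbCAtDHOm-L AsEHLEJYiMFHLYFMDiAhgL}dLGeDKf'' ''nMbeXzACHJiTvupQ PyCDmcPLdGBFNkjNEbJ}HMkdPCFO{k'')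
    (Quad ''vUiDPqJNZyXBam OKIEJjL^IQZJAjEJZIHkIKsHEQIPbj'' ''nCiJMAbXzeTvHuPW O~IKhcO}iGBFNGIMjiMTKMkiO~iEKI'' ''WRUDtJCHbAOm-Y BcELPCLPaBcIBcHOyJOyAOycOydBcF'' ''udTyzXakmOJB-P NvdONCGQDMvII~INvdMukMRdCXFHYK'')
    (Quad ''xYAbCnJirEOWuDP PxHFFKMWENahQIFLUjNKjFwAQPKPEK'' ''rPDiJCtUAbmgOE-Z G^CGcJFvJOBELOIKoHHlCL|FFmiLgj'' ''xZEOmAItVNjwsl HbKMDHLnGAsiF_IOihMXHIqKMoECbK'' ''dahEKjNmyX-T-W AmDLgHBzEMUdNcDEgKOMKG^dI[DGehGehI[DKUK'')
    (Quad '''' ''xAYbCeFMnhdUwp-R D}jBuCErALlABYjMRiJbfHEID]dMue'' ''mOzXBNaJivTdu-Q PVeA|iFEdKAjPwFPiFHLdETcBVcGnJ'' ''XBgyactDUHVwrp-M GMHIqKLlDDdIG[JB]EHbKHVIGqkAyh''))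
   (Quad (Quad '''' ''-SpRdJCYxbAZEOm AtdPWIIMCIohBVcLXDGAFCtEPiFLvE'' ''mOEAdCbJvUpR-S GHEInAInaMNHDtHMNeDtEFKJFKjMhA'' ''RpJdCbAxEZ-T-N CBKAgkDFjDFHAgEJHkDUAJHEOzKDUa'')
    (Quad ''pwUDtHAeMoCb-X-J HKKAvIBSHDeFBoCDiCGrJPKHFqIDhH'' ''jvBuaTdcmOfE-X-P KJIDbdCDhCqIOjHFhJHhfHciAlHEhH'' ''-S-PhUtFOmAbCJi I}GApHBMcE}FDTDDkGJTCD|gIfGHtHHtHIfGB{C'' ''EbghUcFtjIlsWR-M AjHKsGCSdONEKXaHgHPshL^iESAGfh'')
    (Quad ''JVUDtBamyXOz-W NiFNCCBaDAseGMDEGALhhJ|CHbIC|e'' ''pwUDtHAexYmNGB-V NRKLXIDBkKCBOIIMOHF^JJkFOtDLaK'' ''UtDVJbayXnMEg-Q NxDPnHO^HLfJNEhNHdGlHNYhKZJN]D'' ''slR-KhdaEcBNm-T L[HL]GM~JCsDE|AHMhMtgGgFAoFAVHJMGAVH'')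
    (Quad ''-VudTcPNaBmOEhq-X HcFDacGWHByJDfIGahDLiKJfFHFFCF'' ''jcINamBVtfEDU-Q-L GgeAKdIBeB|hJfCDccNPePsiJPcCJh'' ''Rsl-JnMboafXz-D BhFJbgNldIbGJFKBhFEYFErECZCL_GCZCERg'' ''oMezXyaTduBcvj-W FAEKadKwHIaiMEHBxfFyKN^HINKHpE''))
   (Quad (Quad ''upVQHeIAbCnMxY FhjFviOEFDbDOJHFMHIHcEjJNdHMqc'' ''xEZmOAItVNjrwpU I_AJDDQEDIZKMMeQOKEVENWKDQCM}d'' ''xAYCbDfHGtWP-R-L GbAHrAJTAB{aKdGIrKQMFQMGIrKA}KPVFDkgI}G'' ''pHQEfabCMnyX-U-V ArfArfBjdFJFMVKEEJEcfAXKIsIPGFPGJIsIJyk'')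
    (Quad ''dTuvjcaBmyZOE-L CLFHNFAnAL}KJnFDJkOmDDKFLHDNmf'' ''oMeAbCDHirP-X-S ORGARGHcGLSGKODFeCJVfCjEAzaHUE'' ''mNBacyXZFdhIj-U-Q D_cJPaDvkNIJNmeFzHIPHLHJAKkCuH'' ''-SwUpHfDcEBayXIj HQiJuiEYiJjKBYjCzKNlFGyFCpFFQf'')
    (Quad ''wpURIdAjbenMo-Z HFjAvjPWELeCNSAECJKxJPMKDnEGYD'' ''qePDAYxmBN-U-V CmHMLeBHDNDdLoePRDBHDNbeIyIKSdKSdIyIMKC'' ''cdyNXBamEhTu-V-L BqkCweEMeD]DHreIzCHSdHSdIzCHPEGzFDXhKfh'' ''RKqhPgcFdslnyMaX AvgQEhGOFECGPpHL|COPhNhcLOHPag'')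
    (Quad ''pQuviTdEaBc-N-X B{JDTKFkEDQIFcECxAFoDKIiA[hEOd'' ''-S-QzxYAhdtbCVJ KUDHxeIfGEgDFaIF~FLMII}GCIGCIII}GIrJDgF'' ''tUDyzaXBJkOm-P NAjBrFFQCIWIMvJNAjPIjCzhCXFHYk'' ''''))"

definition catalogue_J :: catalogue where "catalogue_J =
   Quad (Quad (Quad '''' ''nCMbAxYGzf-D-P-R-L H[HAuEAukH[hJAHK^hK^HJAHH[hJAHJwCJwCJAHEBCJAHHmHHmhJAHH[H'' ''WRvuiTdaEhgbyXnM BpiOVIDNCQIdEJkF^fLUIFnDJkiQae'' ''ydPaXBmOhqG-S-J GWBPUIAcBHBfFNdGabLihK]gPhDBCH'')
    (Quad ''lRsvUpHgtDcyaXB LYaFMEMZCQ_ANKGDTIMDCE}KIqKPEe'' ''uWQHkrOJmBcaXy BIiAsjJNBO]kPwcAhKFnFQTDQacCbB'' ''wPhFTriAeBNm-L NYJN_CEMDKldInAHSEH|cEMDMNHPnj'' ''DUtHZAxmNGB-V-L HZAGPEFXCFrdKieJGBFDGFDFJGBGKGHJBLwEG]d'')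
    (Quad ''UtDFkJBeAmN-X-Q LADNRjFAhE_DFgEQWiDSJDGEIcHFgE'' ''VJtCbAxYdhz-O-L PFEKvJHVEA|GARGDdEARHDdFA|HHVF'' ''swVludIAheFmNGB HpGPoHKAILmECbIINFPwjOAHF_HMlH'' ''bmCAOkDUvLSp LjbHThOvBOKEHqIJxCPPHOgIMqgIHg'')
    (Quad ''dcJhkgFZyBaTu-L-M AcALlBA|GGCaPUFHVACoJHBJNVAAFD'' ''lsR-JNCDHmAe-X BnDNlDDSGLziAgIIkIEiEASgHQfEsEDFHEsE'' ''ZoxMAYtwVIlsjb OkEOeIP]JJ|COkiNBhNBGJ|cJEeJEI'' ''pUwVDtHyZXamNBJ JOiFlIG|cEKHE]hPCEMGHKLjEQDO{f''))
   (Quad (Quad ''xzYAhdbCiJuT-M-W EfJDEEIveHhEAZKImaAlcLZCEmKMwC'' ''mOEXyaBhdTuiJ-W F{fFZCAceCkFNVJHBFDEEN[EOdiHdh'' ''jbAyZFenMoDuPrW FvJHzfFjEH_FFBFPmjMqEMpJE~iJxj'' ''irPDuWHeAGBNm-S HiJN^hBljB]JFyEDDJHpCKwhF_JOUJ'')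
    (Quad ''emNJVACtDH-L-S IrDAYGEgjIfIEtEFIfGidJTEHAeHAeJTEDxdDge'' ''PhqSEafacByXLr-N JUDJUDPGGBBfHfFJcDBjiBjiJUgLcG'' ''mOEbgjIAxYVt-D-Q KYHN^kMYFCaAFAjBoFDiFIujGqhBKh'' ''qhPurVdFAebCnM-L J]HHCAGXHL{HL}bMlhKKCHLCPQJHKi'')
    (Quad ''yaXBcmFO-J-RPuW JXkJXKMvjMvDDuCFVcJXKOrFOrfJXKFVCHYcHYCDuCBRE'' ''eHDAbCtWJSL-M E~GEjFLgIIReAfFKcFNCDODeFviLbf'' ''qPUVtDIjcNBmayZX CcEN|JJdjPJFNLiITJK}iLtHKbIQSj'' ''xZEOmBNJairPD-S CabA}kL|CHlFFphMYcN}eGOIMcDKtd'')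
    (Quad '''' ''vTiaJByXmzO-L-H FfJDBJCaALXcNiCJWKJtGHijBVBBKh'' ''-SpHwUvifDJCAbYxz JhCCdiKjFJ^gPTgB_cQKaMxJMCKALC'' ''faXyBGmNtDUHIV-P HMFQGcKPFGmjJ}fNmDDmJLZjCuhAnc''))
   (Quad (Quad '''' ''jInYbMxAeo-Q-D-U BZKANfOBDCvKJaFNDHNDHJaFMUFG^FAJKBHhAUF'' ''sRl-JNmBaxOfZEHD DFKInfHScFKkM~KEikI]kHEfD]CAADD]CEag'' ''nMbCaJiEfLrSyX-H JchJchJUHOsGOHdGlKCQkPnkCQkKlh'')
    (Quad ''jIVtFAbxZQpUnM JZdPSEL^IKsdQSeKbDHkIOoHL~FFWe'' ''NGFBemAdhuTivWRls OSDBbGDdIPqCEVHOSDNXCNXIDdCEVG'' ''AXbCiJTvDzeHpQ-N GcJDsiOZHBeKImCMtKCuIHuJLFHEma'' ''maOGBcIjVtrwDU-Z IPdHIKJrAMsFKkINhFH]jFmIL|fKyi'')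
    (Quad ''qomNBfCPDUivJ-X PbiKLeHNaKjjJ^KB_JPTKEWIG|aFiK'' ''UVDItrwcjGBeMoYx FmIEJDPCHFlKNTIKBHDwHKohH^HIAH'' ''ydcXBauTIjhEPq-S APJA}CByiIwGHrJCiGFPILdEDXFM|I'' ''rwVtcNKmaBEZx-L BEiBaIChBFoBJBiIiGEUcFcIIKHC|c'')
    (Quad ''uPWdsyhEXablj EKJLffLqJK|cOFCO}jNHGAiFCGiPrF'' ''aehyXiBJPRqsl-U NGGKZdEpGO}gNHJIEEBwkLwfPIgBrK'' ''jvBuacdTXyez-O-L D~DJneLQDEAdLBFItDHNeAqDATHHva'' ''vRQUpOmEdaBc-X FGJFGfFqfDZfAzAFqJBobDZJAzaBoE''))
   (Quad (Quad ''eHUtDACb-Z-W-N-I AOEATKATkDhHD~hAOeGreGrED~IDhi'' ''rPhoMacj-X-S OnKOnkKQgGDEKQkGDCKQKKQGOnGOng'' ''eaBcGdMojuvTRW-X PcHFCIHUEJgHOjhCuiHcILFkLLHQWF'' ''zQXapd-B-N-R-L AUeAUDBHiJsKMKCMKHJsDBHABHaJsDMKGMKFJsKAUbAUKBHI'')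
    (Quad ''mEOAtYxZVCJb-L-H DhHHRGCEhJ]DIMAMYBHKKGXDKzEFpH'' ''OmEBjaIctVyX-D-Q FoCIwiKYjAShKYKDSHDHCBACFkJD}H'' ''VuIdPqhyXaEbgnM DWILkCAHeIAHHwFPAHHsHPNkF}CKBH'' ''bACMnfGzYx-D-PRls AAHDFEDFkAAhJwCLuKLueJwaAAhJAHJAHBWHHmhHmHAAH'')
    (Quad ''wUpdyaBZEOmNRJ EmCMxfPbkEfDP{HBefJKJPTJPjIJRf'' ''zeYABtDUHmN-J-L HrhK^JGCCBYHBNHK^JJyKPedPedJyKH[JG_KIsh'' ''lsRPqKDfaEjbUtnM PmJPmhKXcKXDP}IE]jAjHEQCE]HEQd'' ''slVwJtNaBmxZEO FRkNskOYBN}iNgIOiJPDGO]IMcHCbg'')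
    (Quad ''HufTEaivWLSMngb IhDEQiHCiEJDMnHQaFP}eJNHMaeKKC'' ''yZEaBDUtmNOVJrw J_cNLfPuEP{kBeDNeFO_cCcIGsDISK'' ''-VtUDypHQXebCnM GBCKXjEFiMueAFCONCAiIPLjO}fLlA'' ''''))"

definition catalogue_K :: catalogue where "catalogue_K =
   Quad (Quad (Quad '''' ''udVIjnbMAxZo-Q F~JARIGAHI^hFGdJJJORIKRJIMCHDF'' ''nbMCAtxZKDUHRp MOiLyKNoJJiFNueQVFQDKOtkHGiJvF'' ''caBEfNmjIxZtV-L-S NbBHPkMUJGxjIKKIiJKCCLrELrEKCCCwKCmhAmj'')
    (Quad ''yXacBeGTvjoMWuP KSjEPBEwHCmKLJiLrePBkCmKIAHH^H'' ''mOEbgxkJCAYVtwrUD OLHKEiDwHE]iOLDKEdPCHKpiD^kIDh'' ''pUwRdIyhaXEmBN DJFOxFOMkOxDQXIAWjOMkLoEGeFPzj'' ''mOEQBXpjuIycdaT KmcDyIPhIHBFAcDN[dK[JLWFOFJLqH'')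
    (Quad ''pQdFTuzgcXbnMvi DTKPcFOtIPoHMlHLyiMDDOmIL}KC~H'' ''qebPCADUiv-N-X GiFDgJAPJNoHDZfCgJFqJI|iD_JPKE'' ''-VUtDCnoPqbeMA-X BSCIeIExjH}ICNCExJBCCIlfEofD{I'' ''bgEafDHpUtwrVnMSL NiEFldJWeFlBJ|bJWJOkHOkgNijJ|D'')
    (Quad ''wpdTvAjbnMhzYx KLdDJFJhiMxfOpfPudGThJOiQZjP{I'' ''jcrWuDPfaEBOm-S GUFFyEOhhCDFLSHHUDG{FPQgOWHMMi'' ''PriuWhFAeMbJnC-Y K]JMZAMZcK]jGWFBbHBbhMyHGWePOH'' ''iJCTvFAebMnud-W-X HlFNqiCgeIBaCabHiHIuHIQdAGjDDH''))
   (Quad (Quad ''UVDItyjcBXaGe-L-O AoeMwaD_kAPkDccJ_CCihNeeCJKMeJ'' ''-SRWICAbueH-M MMIB}hEOJJqAChFAtFCBCDQdC|iGUe'' ''pdTwvjgOAmEb-Z DgINqkKAIETFDZdHGIMOIN}iLaFHlC'' ''tuaPWVJBmOEyX KDeQJbFdCIyfDMCMrHDMCIyfAWdQRK'')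
    (Quad ''mOEBXayDiJuWPr QIFLrIEPFNDIMUCBpJMUCLoCGeDM{E'' ''mAObHDjvT-Q-S I}gI}GKdGI[hGYjGYCPMGI[DKUHQ]FQ]FKUdKdg'' ''rPDkCnbeAMtU-S DBJL}hGDePKfCLiDejNojOteQVGOnH'' ''oMeBGcaTKjvudXy-P M|dNGHFIJGEIKpJMBcIFdMzEAYdFtI'')
    (Quad ''BacdhgFTuPSJLkr-M O~gJzJMBeJ~hBwjAyHNGGNrJGjAIga'' ''yaXcBMeotIjV-Q-D JVKGyfJueHQeDSIJuEAkkBACBuCLsH'' ''vJgEbnMTiaXy-U-Q LiHBiHEFkM|JJmeCQhByjIjDCADNFE'' ''upQdTcoMBayXIj LbeNUDLEeOJFLdHFbIKGHFPEEjEKqj'')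
    (Quad '''' ''uWPDqYgobAMx-J KNDDLJFMFLdiByDFHJCAjJCkLEJOEK'' ''mNBcaEfkIjDUt-P-S NJeB{JJyAO[iHmhNJaJyEABAK^HLueLueK^HJAH'' ''tyVXaezLSrJB-H DvbKyGNDKM{GPzDIPIAUJAUJLocMKG''))
   (Quad (Quad '''' ''duTvcjBaWREfOm-X FCINdeIoiNIhGIiCuiDahDmHFhILAI'' ''HpZwvyTXacjBNm PrdQPFKbdMWHOpiK|IGTeILEJZDJdK'' ''LSpKeFAdMnbC-X EjGPkdE{gOOFFhgLGILLHGIGJYHOjh'')
    (Quad ''-S-QHDAMnbIjxZ D|GIrHAUdOMdFTiDPfH{FKUKKdGPzhPzhKdGG^d'' ''xZGNmCADtU-V-P EkENVjEkKG_hIJHGCJHXFIJhG_HGCd'' ''yaXbMofjKRq-P-U KiBG~iEEDKfKP[KP[KKfKF[cFrFIzbHJcAiFOlC'' ''WRvjcTaBEhd-S-M DbiMpGOBAEADLQdDqCBfaODEFvGB[A'')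
    (Quad ''pdQFeAMtbnIjV-Z LhJPtiAPjDcaLdaIUdB|hLbHOwDNCd'' ''xbZgEjoNYIAVt-U-P BfAKifF[EKiKNNHNNHKiKKfHEbFFYFMpiBDDJGf'' ''jnbEOxZvTYAud-P MeeJhhJ^IP{hOKfEfdNeDBDDFYFLjB'' ''UpwrVItfLSjcBEazY DwELWCMmaOVDJgAFnCDyGQMDNsKO|G'')
    (Quad ''zkXeJBcanODUt-L LcdLIJHnDFNBHnDPvFMSkJckFNBJFh'' ''eGBmNJrCiDPUtyZ MFIMAIKGaE}hOPiOiEOYKC~iMDeNfH'' ''SLrIcjfHDONBmaE-W HQiGQIPIGNAGMubGBHEbFFQdBnDCWD'' ''mXOEgbJyCitUDrP IYIQBkHziG}IMFIO]HOYKJijAhhLNe''))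
   (Quad (Quad ''RqhPJueBTAdFNmYx PCFNEEKWJLqjOYKKEjK|HPyCHzfILF'' ''mBNexAYDHJLSp K|FLfgGoIMkGK[hNEEMjGCGGLqiPrG'' ''lswTDjYAbxHe AffAfIFbGEjfEjIIHdFSkIHEFbgOvC'' ''mNBXayJivDUpZHQ MTiMAhHgHLtIIgELtHJdkITJO~HMWi'')
    (Quad ''dpRIjnAbMxZo-S DdHFaIE{eBIhLpHG[KNWKHHeEVEJ[k'' ''AbCiJmFOK-DUpw-S KuFM]EBthIJFEkHABaKuEIJCHmHBWHKueEBE'' ''KvhuTFidGjWP-S-A-N JICJIcGacGaCPUIPUIPUCGaiGaIPUC'' ''WRvJiTNmaBEOxZ-H A_eIChIoIJShMPIKzEIGkHDfE^KIMc'')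
    (Quad ''mEHfDapBcNrwUVt-L HRGExFAwCIMEIxHPZGOaGF~HLMFCDD'' ''PqhzONXBmaiJ-T QWhEXiQMdK_HGbbJgfEDiK~fGbbLCD'' ''ZOYCxEbAmiJvT-H-L AeeAeFGtJHidKwhKwJHiGJtjJtHGth'' ''bxEZKjAYtDU-L-N E_DCuJLAjHMhC}FDveMtDQWkC}FCsE'')
    (Quad ''PhslziFAXeJbCMn KqHNwHJlhKpGEQIFWeE]GMGgGEIKbI'' ''mNxjIAYVtfzDHWP OCFBOkQZKK}cHkDK}iQSeJZhQCCGTC'' ''rPjDcBamyXEO-U FcIDFkKyhHeHEuCC^fHOkC^fBEiBdF'' ''''))"

definition catalogue_L :: catalogue where "catalogue_L =
   Quad (Quad (Quad '''' ''PWuVItjcfEBamO-X MNIFKhJHDDrDEhHK{eEihLzIEhHKaI'' ''bjxAIYVtdhzPq-N EmAAqjQIkNKIMwFJnCHFiDKCLYcDNC'' ''PqhOmEZxBNJai-T DGbBpJFLCNDFCvKF^BNRDBdcCvKKyD'')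
    (Quad ''oNJBezXiatDUrP NfHNfiDyIDPhDPIDyhMmIMmhPYdPYE'' ''pwTYAxHMobg-J POKBCHOFDK[kPhJD{ILfiK]INYHOQI'' ''-UVkIteAlMowsbC AghGMcFvHB|cFmcJfBNCgJrgNdgPmh'' ''pSdLIcjagEOm-Z BzFG[IKcFLOgLgDPaHG{CAxHIRhOhi'')
    (Quad ''-WtVIcjBadEhmO-L A[iGrECVhIvHATHOMGFTJBzAAxIItI'' ''caBmOEtwqKVUD-L KlDKlhPhCNYiQQBLWGLWgNYIGliQQa'' ''UtDyaZEMbnjK-L CdFNmFDvEHvKHMHCHGKDhBdHHvKHOk'' ''hEBucdaTyXIj-W-S B[aDzCEMeCpFApFHPELKEH|IH|GLKEOJFDbIBPe'')
    (Quad ''oeMBGcajDtUPr-X OFCD{FEGCMsBBSHIIeOweNCEJrEKcJ'' ''-WVjcIfEBaOmud-S DODEvJPMGDzDGbECwHI}GLMIEXGEXILMIAvHKxH'' ''eBGoMXyacTdujIRp N{cNLeL~IQGECTENyJN|JIAHQ^DKoh'' ''mOFACbhdJrtwV-L BLCB]dFhHLGeCqDI{GIYHNIiMFHAKC''))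
   (Quad (Quad ''yXaBcjIVtwslmzO EVIIVGP|ENXHEVEP_EP_INXGQOGQOH'' ''dhFeACbtVJwr-M-S PTGDpiAJeJnAKgiADEEndEmCAnFAZC'' ''oqMeaWRviyXBJ-U BwkLicAcEAFBIFjAiEEEJMjdLqDHdH'' ''-SrPdchkaBoM-X GtfLpABmfDRbHiCCqgBKFIuCBLhKMH'')
    (Quad ''uPWriDCJgEbAOm-Z MUCLXCODHOBEOhJPfJPQHPWEFfhLgd'' ''mOEafcBjLdSvWuT EUGOPHIXdM}hH]iMAhQEHMJIJBHNhJ'' ''cBaEfjItVNmDH-L-Q GVJEkHGVHEeeGvhBJiBJGGvHB~HEeF'' ''jcIdyBXaTuEhqPmO C~IKkHLIIPvCMSJM_KFPEKGHPcKOLJ'')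
    (Quad ''jvTcduBamNxEOZ-W FAKIiFLTKIaIJ]dBxDHpKMYcMlDGNb'' ''WRujgOIcdEma-S AQIORGMMILBiEADFvHIRJJDhPfHOhH'' ''bxYACzJidpQuT-M CcIFbINaEIIAJPKDcKLbeJ_kAfECTA'' ''maNcByX-T-J-EHpQ BZdBZIIkdAdJAdfIkICKKGkCGkbAdkCKKAdH'')
    (Quad '''' ''PuW-RjcIyNBamZOE IkJL]jMvjC{HL]jGsJCUkMvjNvINAJC{HBnK'' ''NjIVduAmFehqP-S ALhMbHHgGL^hHThB_HIgiJdEITJNrJ'' ''Rls-P-HEfaYxBc-N L_FL_FAAhAAHL_FLcFLcgL_FIniInICnECnEAEhAEHHfG''))
   (Quad (Quad '''' ''jvTbAWEgPudmO-Z CwIHbHIMFB}hC|dMoDIiHIGHKRICEh'' ''jBMcaDProftU-X K[jMkFDCfMFIAlHLZhKhHFhIDmHJYh'' ''tUDyaXbEgOnJk-L KlkLckLcJBNkLcJPeFOqHJUKBNkL_J'')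
    (Quad ''RslpJbAdCfGYxuT K]gMfAKhaCoKMjgAcDK[JJjEEIGOdG'' ''idJvTuBamNEO-P-Z ANcANFAwEIxiDPJDPhIxKAwdAUCAUf'' ''wUqeoMBaDcyX-J LfjEldKqhJlhNxHCPHNjKIjICAJLEj'' ''dcGaeBpjISLoM-Z I[CGNAJYHIYgAhHLGIBIgOTHE{iLTi'')
    (Quad ''mAOEZxYduTbjv-W AGJKhFMHdNZDCjcAzJIhcNqDMaFDZE'' ''xYACbmEOdhTu-W-J KZJEFhMBKLRhCQKB^CCPINxICAiJCh'' ''vRWUjbADHmO-S PTgDpIBreKjCLwAGKGHJcQACJKgOlC'' ''gEbCAxYJiNovTduWR MmhQSkM_hOmkNmEJvJBOdNfHCHHC~i'')
    (Quad ''AtUDpHeQMnbCYx-V DaKI_JDLII]KJLCNPjGzjNdHFMHJ~F'' ''mOExZNCATiJvLSW IChNUbJJGGAHQaHPiHMnIPwHMPGOAi'' ''dpiayXeGJBOnvTw PoKNhDOIHNuJHIHFFKMJEQEIOtFIZH'' ''hudTPWyEXaBmN-R HNIHOeGFkC]KCdIGFkKFIKTHIydK_k''))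
   (Quad (Quad ''BEafcTOmUpvjR-S LSGHyFPWiPQdFpAHKFKtDGOeOWGAvH'' ''uWPrhdEaMXybnj E]jNxHMBEKpfKGJOLHJlJLRHKqhOXH'' ''fZaxEBcNmIjVtLrS MrEBFkKTIHOjF}eKCCEuCKCCKDhDWh'' ''wpUdcaBmNhE-X-R DfjHEiFkhCrcHcfKYEASJEihD}FBQf'')
    (Quad ''mXNBycatjIVZUHDpQ MTHNfiKsILthGfiKsHQSFJZIMWHLti'' ''gBFcaTyXZivmNrLS PeKHeIOqAOqKLukK^hOfAK^hJwcPeA'' ''NmACeHDuWKR-S IagIaGOUFHyjHyFHpHOUjPdgPdGHpc'' ''ZGqBxANmtPDU-V H_IBPINFCJGBMpFLjBJmcFBIMqCDbj'')
    (Quad ''uTdyaXhmGNBjrP EqIEqfIDHIDjM_EOLHO_HOLjO_jOXH'' ''jvTcBadeXzNowp KBHE]KOkKKHfGiDHwIDwiFlfDyhNwI'' ''mNBxzfAYHDPri-U DmIDGbB[DH|cNkEBdFHMFB[DLACJMc'' ''nMbCAtDUeHpwrV-L FfHG|fEAeJWIHNfPfgFlEGicEtHPKd'')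
    (Quad ''iCJbAMrPDgotU-Z FTEDNeOjHCyFI{EOViJ[JIYIJghE{D'' ''dhEaTBcjrwmO-L KVfJWcODiNTHEAjFlJKHJIRiAxIItJ'' ''jnMbxvZATFQpdu PJcLNDALdCcFMxfPuEGTFILfJdFHzF'' ''''))"

definition catalogue_M :: catalogue where "catalogue_M =
   Quad (Quad (Quad '''' ''WTivRDCJGfHOnmExZ CSDKmHKsiMabNukMHILUiPSBHjkEJD'' ''zqPhYUtIVCbeA-L LiKKXfHdiAFAKWiLqIO}iGoiIEJHBC'' ''MeoNgXzfYIJkVt-U-P EWkA^kFYFMCACRICRDMCAPRJA^CEWCJ^iJ^IFYb'')
    (Quad ''cDHgBaXytUvpLS IRcOFIMIANOAFFEKHEJDGKmcIZKNwa'' ''-SrwuiTdhaEcB-M A|GDdHDaEBVDE^CCaBIQFIoGOSDGqf'' ''mOAFbChdtWJR-L NZCCSDLbAIRIAQFKmIKoGNThLOHCTf'' ''slwudThEacjBmN E~GAhEOeIE~IK|fHzIFjaGTIJOHOeG'')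
    (Quad ''oENgacyXIjDUVt-Q NMFFZJDcCBaHMAHFZkEUjBvFIBJLhd'' ''pwvidTAbJCXnzO MXJPOiOAKNUCMZJQYDOPKPaIMDJPoK'' ''bnOEahdXyiTuwr O|HO|KFnDQPkPSbNsFLnFLUIPNKCbH'' ''YxABeJVuH-W-S H{KJsDIyDDMfIyfDMDMKkQREQREMKBK_eK_CJsC'')
    (Quad ''OncFtUDaB-J-L-X IyhDMhAJDC]EFufC_HFuAMLEQJAQJAMLEBZDC_H'' ''WuRKFdCAebMn-S KQGGAFDRDDNiLYIGMfAsHIqgQaFKMf'' ''WUHvReoMADtCnb-X QWDLAFMNfIbIBhjN_FCNCJFCCNCFCF'' ''NoeBxYAHDtUwp-V FmkGNbIiIAmiFZkGvkH]CEUhKBiKRC''))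
   (Quad (Quad ''lvsRWPHDtGNBemA KwGINeOUaINJLmjOUIPdHPdgKwhLmE'' ''iAbCJYxtGnOUD-L P^EHMANDHBZEFufMrHFdGFufBZEQJF'' ''UDtAYxZEbjKOm-P BtFNPDGyCCzHM~HGgDI]hIWjFsBIJh'' ''BcaFgdhTukJLZyrS HSCQMIPeDKlaMiALWJHrAHrAOcDOsG'')
    (Quad ''njRMbvWxZFTAudh LtHDcJPsHHqeMTiNeFOKhCcFKsiIUK'' ''njbVOEZxIAt-H-P KCAJaHDzkMUHKTIKTDMUHHFJLTJGFkD[JI[hPMI'' ''yXaEfqPhbCnM-R-U MVkMVkDIFIsJFJFAFCHXFMgDArJGCd'' ''macNBXyZHjvTupQ HqfIXFMWhFtIFiiGEIPbFKbILtHKsi'')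
    (Quad ''tIVjwAbxMnZosl NXHMIEMIIEVINXJHHeIZKEVEIZGHHi'' ''ctVjIDUBaNmxZEO-Q FofJVKOhdG[DLXhCtjHDfJ[dJtKORi'' ''EfaDHUtMpcnvRls JDGKNFMfCFGcPgAF~HMIHPZGFaIEVH'' ''BgXycFahdiTuv-W-M IQfGnHM[aHVAHVJIOCA|iIQkGnIA|h'')
    (Quad '''' ''dFhqPYAxeMbn-T-J A[FCzKKuEE|EBtIDHeDHkA{EFkdAoC'' ''bCAeHIpRwU-O-L D~jD~JGDCD~CCLfCLFCLeCLED~cGDJ'' ''xeQAYMobHpDjIUt LkHLkjLWCOcFOccLWfGmcN[DGmFLxJ''))
   (Quad (Quad '''' ''VUpwrItYAxEZOmbj PtEO~DMAdNBIAyhNOEJ|cFOILhHM}d'' ''vJUiDCnYbAxOE-Q FRKNTjL^DHjDPSBEJkF^eOIhCSKHCD'' ''vTiJlRsWNBamxEZO BxKOVjOVhJ[GBxGHHIJ{EJ[KJ{IHHE'')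
    (Quad ''pRIwUCnAMbYxeH OjkODcHoJDbDFPIPcKFSkDXHEjIFBf'' ''tVIUDjcGeBxY-O-L EnDAJdIKkGhkHuDAneDpeKjkHhKKPD'' ''xYAbCfGHDtUpRvls PWaLdFPEePicECgPVFNUDA}KGOiMZC'' ''WuP-HfEabCXyMn-R FJfFJfCOiArFMVKGQiPIjHYeFJJFVEAXKHah'')
    (Quad ''pQHSrLeBcDayX-N PnKPnkFDgFDFERgERFFXCFXCO^KIbG'' ''pwvjBTcadyXmEO PNEMSICIHHeHDgIDWfDgIEuCFLFHAI'' ''uWPrDJYBxANmek GEJBXICAjM|dLdiIUhHqCLRkKqKPPB'' ''SqeFAdPhLJBxYmN FWcMqDH_GKqHLbGISkIUkE~fHzfCcf'')
    (Quad ''UwprVtIcjBaENOmxZ HUCKHCPfKNOEJWaNBJJJEORDLXFOkd'' ''nbxjAIZEODtVUwr LkeN|kKkdPlIIPIHwjQLILDIPzKA]K'' ''OzXmNBactjVIlsw J|CNweNwIOkEJ|bNOiLmhOkiLmJNOE'' ''krQpdLSzcaXBNm LaDIZGOngOtKIZHOnhHGGHGHLaKOtD''))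
   (Quad (Quad ''-SWPuHeoMTAbnCJi KgIMzHHJBKihG|IPTgLwHO{JJRDHZC'' ''GZxBkrPNmADUt MkFGoFElELwEJRIO}FJKjPLFCGIIpi'' ''rSLjVtIbAnMxEZ LrKMQBMQCNbCLrINbBKSANbBKSFNbC'' ''AbCniJOEDxZPr-U EHhLLIFEkDyHOaKAwDDPHJgIOTIE{e'')
    (Quad ''PhqExZbJvCAiYT-N OzINzfP~FCUJEnJJfAK{CEnJAgiIki'' ''xAYtbDUJgkZMo-P CWFJ~iGLCPIIEajKnjIWjI]hFrbFJi'' ''lRs-JnoZHMbxDA L]iNQGCfINnIEaIL]iI~GIWICXDJXkCXDM~k'' ''PUritDJCbAeF-S-O HvcKPcACjANFCTILBIJPFQGIF{jAQi'')
    (Quad ''lsWPuHfDiCJAbzxY KLfQXiOKfQZaJxjQSKH~GJ^JQCIL~g'' ''mOhAdFpbCRJls-T EoGPZGPZgOyCOydEogExFBcHKNFExi'' ''KvOmGBjcaTXyud-P MpIH_hG}JFjAHzjH_FNrkKWHF[hALE'' ''NmBxADHZKpRsl PxHKTcPMHEXhEXCK_BQ]GPMCK_kKTH'')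
    (Quad ''UDtyXaVbjnMEK-P KWkFQhKZDNEeMjiJjEGBFBrcEEDHJk'' ''nbMeKCAFlVwsud DZgOAhN}iLUhPEDMabIqgCbgQaFGOC'' ''xZEaBdhmNO-JlsR E|BNlBBFHP~BJbIIkIMRFCzKFsCBRDFsCMvi'' ''''))"

definition catalogue_N :: catalogue where "catalogue_N =
   Quad (Quad (Quad '''' ''SrLJiCYxAbEZOn-P AoII~gNviNviNeIC{KKnGL]DNvII~g'' ''lIVtjYwsxbAEZOm DCIFWFPSfHCgMlINgGJNEMaFO]GCbE'' ''vTajBcdxZEpQ-N IhJOTFEKKEIKKhfGhDLLFLFhHujJYF'')
    (Quad ''nMboexjYAItDU-Q MQEQGjLCDJaFKTJN{FCdeIycJaFK_F'' ''ekJBANmrDPYxtU KpIQFCIjjM|dFPdIShO_IOLkKqKFBI'' ''cBaDmXyOHQp-J-S NFcCPgHJhLwAG~dFXCKZIN]GElAH}H'' ''qhPdAGCbuTMnOYx-V JmHKWIB|ICWKKXJBXeH_iIUKPmFPsF'')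
    (Quad ''SLrWPujdbayXEh PmGIjgOLCE]gPcEJmBJlJP[KFBjO_C'' ''WvRTfkAMGnCbxY-L DrhOIIEUKKakFmHNhCLOhNTHIvHAxI'' ''HebUtDAnMYz-J-L ApjK^jHaJGCFBNhK^jNJDOqKOqKNJDH[JG_kArg'' ''wRjpUcdInBaXyGeO ECJNKhOdjF{kLBEQEJIXkAqKFFKJDJ'')
    (Quad ''WtDUsRlIHfaEcjBmN OoHLNiJ}aOpJAjHH~GJZiQZDGfGBge'' ''jcIBaEfDmNtUV-Q-X E}dGnjIQfDlDELFAzaMHHFqjCgjFeH'' ''oNgZjIYxbAEtVuPW AgDNNhGpEKiKP[HBnHCUhKiKPmDFDi'' ''ONBEmZxjcaIltVsw EGFMDHPEBHLgMaFQ_EOAIMlIPiJMnE''))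
   (Quad (Quad ''bCAiDXtUrPHez-N MRCB]iOdKOZJImdNVCCoFLldONfDEK'' ''lRs-VUtDcHEaByZ ERgBnCMvGFVdBncFQCGQFGPEGPEFDIQFANlc'' ''PhqOZNmxBEacjI-T JHiBEjEuHNbHFUFIiFLCDDriFUFEDi'' ''HPfSLrVuTGNamB IxGPZGIxgPZHPZgIxhPgIPgAIxHPZh'')
    (Quad ''nMbCAxYfGIRpH-U BdfMbhNoHJiKC~HDmiNmdMFhNIIL}K'' ''UHGtDfCYvxAbLpS E{gK[ANwaLmcPYgDyIMfKOVFHHgMIA'' ''BactWFQgkJdh-L-M JQhNPfEeFKeJNtFEeaNPAJQGJLjJLI'' ''mbOEgjvwTAdp-S HVIE}HKtDETfDRfEHhN}EOicIqHGnE'')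
    (Quad ''pwUVrjtcIBaXymzO OWDOyAPdDLPJJeIMXIINKHyFFyKF_D'' ''wrTicaBEhPOm-L JFJGdHHoHLIhByEPcJFPeLEEFCHIjh'' ''RJNOBEmpdaZx-S ENkBvhMFHBLFDRBLhKPXGOiDO]GAsE'' ''PDqoUtMAeYxbjI NfKNfkKGJJQhJQJKGhFbiM_kFbIOXH'')
    (Quad '''' ''SLrkPeaDcBXy-N ElaElBFBdFBEIjgIjGNFcNjKNFCHoG'' ''oeMzXyacBjIVtUD-W JVdCoCJSfARIA|HFOjICFPifIoHHDA'' ''MnbGjKhpdFivwT-Y EvCEXAEXhFxIMNaJFfJFEEvCHnAMNH''))
   (Quad (Quad '''' ''OGBmXjIcyatVUD-P IPeLZKFtiN|IIXkF{kH]hQGEDxeFIj'' ''DtUHzAXemBN-P-R KCEFubCFJC]KNRCBZCCFKNbBMrFMrHNbBIyjDME'' ''yaXcBmNDUjv-E-Q AfDAffDxFDxdDYHNcKQ[KQ[KNchDYkI[hD[JI[K'')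
    (Quad ''nbMCAxYDeuPWqKR KafLFkGHFLlACoHEIJOZkFKKIpJPLd'' ''qPhOEmNBJiadTu-S KPfGfgPsgNAJFigGBHBrcJ}FMTJKjJ'' ''ogNEbJiCArYxtPDU LDHLtiN[DF{KCTeNuiN|jLkEFFkKmA'' ''SrLVwtIjAbExYZOm BxePyEQUJFOeBxINBGNBhFOIJ{GJ{h'')
    (Quad ''AdTuWPbCiJvxZEgoN LUIFxiLnAJgJEXHPxhOaKO|HNIII{d'' ''eFBcjItVwrpUNm-X KKKHKEOTHGvHGNCPtHIhBFEdJ]HGVD'' ''yXacBeDklPs-N NjKNjKCGiCGFLffLfIElbN]GElAOQF'' ''gHcDUtNoWyXmaBRv FDFNkhLzIBnkGphHZAQFAHZAISkGsi'')
    (Quad ''bCAFehdyZTu-VRsl InfDSiM~KAAcJMGGyCIwGCpCCpCH|GFKKNQi'' ''pQFdcguTaBNmXy-R LJHB_HAHdIvhJ_ECTiLkIIAfNThItj'' ''NBmeAFhPSWtLI O_DEwdOlDEqgMvHQFGP[GOlDGshBFd'' ''ydpXaRBJeoN-U NTKKIFBvcKBJPNKFciAHIKVdEUHPXJ''))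
   (Quad (Quad ''EgbcFdhpSjLI-M-T OyfOyDHyCHyeBCEExaBCcExAGaIGag'' ''-WtVIjUDbAmYxOEZ KOfAceFZCFOJHVeARiHbdOiFLhHKRh'' ''uTdPhFagBcskJl-M FWdEQIGoGAigG|aHCIMzgKXAIFAL^I'' ''xeFAYhdcIjVuwls H]gPSfJ{gN|KQDDKkCNyKNuEQUjMJG'')
    (Quad ''kHDJgctWQBa-L-M HdHONIESFHXGNVAESFONjHdgAFjAFI'' ''EBjvacTfludRsWYz KBgMAgNfgOijEHgFZdNsKBvADyGLnK'' ''sRliYZOAxEJnbC-P GgIIWgNAgNAgPsDC{KCWHNADL]GIWg'' ''oMgbXCyJilsPD NUbMnGK|DOYKMDaCbeLyKAhhPEKQPK'')
    (Quad ''uTdCAbpYxmQEO-J IjJIjhLqHLqjLiKLikLfEGlKLfdPhI'' ''xehYAFdcjIruwVSL F^aQUJO]gLNIPNcFLdNsKBvEPSFFnD'' ''mOEhadPyXWu-B-J MtjMtIBZjNzHFdHFdHNzkDsjBZIDMHAMHAMHDMk'' ''hpEdamBNIRtVXy LNhQHKG^EFLDQXfNDIG^EAWiGeJPzJ'')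
    (Quad ''uTdpRIjcaByXGmO MmiJZEILiNaENfeNsJLNEBOJQPkOYk'' ''bjmIAOHDuQW-S J[fFOIIGjFIjHDaNWFH]cJ{cM}gKRc'' ''jVtIAbeFnMqPhU-Y FCIINFINjGaDGacFChGdIOyAOyeGdh'' ''''))"

definition catalogue_O :: catalogue where "catalogue_O =
   Quad (Quad (Quad '''' ''OzmXyacBTjvRpU M}eMIIOAdLmfJJINOIFGdQOIP_EPdH'' ''gEbOmJAiCTvud-P-Z JaCAeDKgDLTIIYJCqIG}JGtJCyFDoh'' ''wurdTihCJNzYmAx K}kDjEK}FK}jPJJK}cPJKPJCK}DK}A'')
    (Quad ''ofcMaBDPSrjL-X MdfO{DLTGL}dDmHAnfGhdJYhGIgKgI'' ''OkmbrPCDAVu-S H}eBCjOQCD{eK]CEoCGHCIpHEIcElf'' ''ekArPDbCnMYxtU LLKMDCLEFGzdKGJFMHFbiPcKEjDJlJ'' ''pwUthcEBamO-I-Z OzCGcIBJhChcAedBJCGciChHCBCAeJ'')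
    (Quad ''HfDIjcYxEBNmLrS D^dD^DBBIEqEJchOLGIEFQFeIEFPvE'' ''nGOBeXyacjIduV-Q HpDNIHDEjFZkBaILnDIiHMbjB]KHbH'' ''jBcaIdhMoTuXy-W AlcICKBCkLKHCoFDEEHBFK[IIpEGoh'' ''RpuTdyJNozXeaB HuHITHMxiKjfCcIMTfEKjBeJPjdJKJ'')
    (Quad ''yaXDUtEKVjbwrnM KEKOHHGlELqILWHKEILxINEeOsDNHD'' ''uhEdTaBmNJi-P-S BkeBkbGFJOTJLHGDYJFzHI[EOMJKFcKFcOMJKdg'' ''RphUItZcBxEa-N IWKIgCOgIHqIPshNtCBXEJ~HNPcHTK'' ''vjNTDHAem-Z-P BzhBzJCVCAfhKchKcJAfJCVfIIDIIe''))
   (Quad (Quad ''zXoNgbJiACvTwdp HHiGdhLUKOVKFaEPYiMIII{dKmjO|H'' ''HepASmNCJL-T PkFEjGEjdPkGOEFLEgLEDOEeNjHHoI'' ''-SpdcjRINmBaOEZx IuKDTFLYIMYcGXKHlFKAEQ_EMlGHLK'' ''ftcUDHpwoaMBrV-X EZFJeKOweFEfG{HGnIFyJPtHMEFIOD'')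
    (Quad ''mBNgcFadhuWPkr-X FlCAxKNCCOMHGvJNiBFmJMsDFfHLgF'' ''SLIpdAjbEgOm-W E^HARjGAdEygPFIDdEJSDLvHMPJPqE'' ''PSrLjuVctIaBYzfE OYcFPIPlgKkDL|jJBDNUFA}KMcaOPD'' ''SLrpQHkDZyXacBNm KMBNXFLpIPZGNXCLpAEVGEVHKMEPZH'')
    (Quad ''yaXBmOJklsRdp ILDHdgN[ILxGLqkILdPriLqGHdKPrB'' ''yCDgiJtUXbProM OViEJJKpIFIIKmAJ{HKoHDwhNwHN|j'' ''xYADCuNmPWeqKR JfEJfdNdcNPdNPEIHHNdHP~HIHcOgH'' ''tDUcNmaBXyFZg-P-V GCdB~HGCJK^hHmHGCJEkHHmhK^HGCd'')
    (Quad '''' ''UwprVJNOmEBtaxZ DDKNykKoDJ{DIGHNBDHGENZFHlFJEe'' ''lvsRWiQEacBOm-U MhAEFhElfEFCIjhGHHElIIjCPLbPLE'' ''PSWLtIcaBhEmO NnHOpDQADLxCBrGNEJNHHPrEJ}fGmg''))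
   (Quad (Quad '''' ''xZEOnbJAiCduTvPW QEIPpHF_KMsAKxIECINhAPoKAxIPaI'' ''MnbcjIkfHDUlQspw HWaEqGIDjEqIPBgObhD^gHWhObhEwJ'' ''HDeAMibCJnLxYrS CHKDWePHDPveMSHM_KCkdBFhCkdEqe'')
    (Quad ''WvRjbnMTAeYxHD NKiDcJNPCFMdLdJCiIIHEFbFJQhHqd'' ''rwuTdcjNmaBhXz MGIJNEMGeMGJEQfFWaHkKEQKMGdFWC'' ''wTpdviFhKYAxBNm OfdOxDABdOfDPHIPHJABdLuEOfEBWI'' ''pShLOEmaiBcvU CfHONGJKHBeHONiBecPLEJKcPLbOZJ'')
    (Quad ''maOEgcdjIUwpR-S CqHMYbKMfHFHHRhOjJLGhPZhLTHLYI'' ''wrVJNSLmBxatZEO DDeNuhKmJNWgNqIJ{IHGkNZFHHIIZg'' ''maOEfDPruWcBj-X EojMdiL|COhJIeFCVjJreFvJDqCKcf'' ''nbMACFedhPquWSvL GNEJNHHLgAhHLyDKKCMlhMnHP}bPwJ'')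
    (Quad ''ohqwdTMaBc-J-L CXIEWiLjCHTAHPhA^AOlHNnFNnGOlHBGiKfIBPH'' ''ycXaBjIeGOnldRsp PlGQIAGmkLkeItKF}eFFKHweAqKKHK'' ''ycJaBXeHLSp-W B}KJqIAsBDQfFcgKVIC|BMobQTJPXJ'' ''njbMxAItVUZFhqP NLDQUjHgHHgiNLcILJJdjJdFILfPyc''))
   (Quad (Quad ''uhEBWsdcaNmlIjR ILJHwhO_JNLIE]gPudKbiKLdFiGIDh'' ''njOKbEqRaDUtXy PvfPefLuCNJFLuFLcJBBdPHINJFAAI'' ''ytUDaXeGBOnqRJ EqiOrjOrKEcjOrKBBdPHFPGJEcdJXH'' ''PuWTabEKivjnMXy D^hPGIJcKEEDMSKD^HEqhEEIOLKP[H'')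
    (Quad ''jbmxAYTvgEOudPW EuCKHFLnHFcJKVeF}dKBiPNKIiIMoD'' ''tcjVIrwBaXyzeMoSL AzaBbgPqeARHAzfP_IP_EARGFGiFGe'' ''bAmjOHDlUws PjgKrGPriPjGCGFJKFQACCGiJKiPrF'' ''cfBEamNQiTvHup-X FHIFMcOScDlIDahAzALLhKhHFhDHcf'')
    (Quad ''HUtDfEaIVByXQpmN PAFOfEBkEKFJKFJDWiBkEHeHHOkCHF'' ''caBjdEhmOuTwr-Y D{iNXEP_fMyIPOHNpEN~dIVEBbHPpD'' ''xZEAtVJCbwr-D-N OGIMtEE|jE|FMtkCeCE_EIcFE_kCeC'' ''wTSrLFeAjboMndh ODEFjBJOdP{DPPJBDfE~gFBCMpGISd'')
    (Quad ''oZgNxbECAdiJTvpw MJEQQEMJDKkKCIKA]JPoKNhAC~KOPK'' ''yaXMbogdQpkJUw GEJJ~kCAJJmcIUfHqfFMfMBhJlkMqC'' ''wUprkQdFYJBxAeNm IUKGEHKXcIFDMaBGEjEQHIUkFWBKsJ'' ''''))"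

definition catalogue_P :: catalogue where "catalogue_P =
   Quad (Quad (Quad '''' ''VUHItDGpQABexYmN OxDOxeCLcDJFDJhJvfJvHGwFCLJQVH'' ''nbMeACYzJqPhtV Q[kObiQNJDxJBOiKDhHAFDxJCHJDWh'' ''VUtDCJHbeAMnzXpQ KpFJiKPmKE]IGpFKEFPuCHzIISHJOH'')
    (Quad ''WSULvDjAbYze J{iJ{GQDDQDCHGiJ{KHGKHGeJ{eHGG'' ''yXCbDMgouiJWrP MfeNOIGEJFIIJDjM}JPfJGiENwHIXK'' ''OHmADbjTv-Q-L JIeJIEBlCBldOUcOUJOUhOUDBlHBlj'' ''rviTSLCbAMneGXz BBgOsGBBgJUJBBGIsJPeEIsJFVBOrJ'')
    (Quad ''rQjEbaOnXyDUt OcIPHfOfEG_hOfIPeIOrKOqHG_hBRI'' ''uTdYZAxMogbJk-P KnJJmcBiHEaiMuKCWfI~jHEdFrbMgd'' ''jBRWtIacUDyXHZmN L~EBgCL~iJZjBgFQZIOCDBgkJZDQZe'' ''hdczuTNBaXm-V-P ClEGhHEOAL{hCwHIdHKIKKVdC|cIKH'')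
    (Quad ''hpsRlUvOimaEBc FDHBXEPPCPmcJ~hISgOgIMqIO^JNdg'' ''-S-WUhGvjeCAYx AUFAUdLMiMUFLMIMUdPMGM{GM{IPMGIxkIxKKUF'' ''xYAEbgmOdjTvpw MiIC~KMJDGwDNoKJvdQDFOtFNydHGI'' ''nMbACJiFelshP-T LEIMIHMIhLEiGdDOyFOyeGdgBcHKND''))
   (Quad (Quad ''PrSLjNhEmxCYA O{DElaEKgPLFMjGAidCGGEIgHJEJKG'' ''xEZmONJiACTvRW-H DzkIChLTIKMhQaHBKkJWHBIFGtFLpf'' ''eGxJiACYtUD-Q-S FuAMCkFucAMFCdICdiIycPREFdkFdkPREAMkIyA'' ''CnOGfTDHZmxEwiJr MbIC~iJdHNBjNshNyKMJkMAIQUfP]f'')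
    (Quad ''-SwVrtJdaBEhONm LQDJ^gJhDMpgPTgFYJLjjJxGP{dA^f'' ''kgJBcayZHD-M-L-P JCHDLHKvkGuFJLDJLdKvCDLgJCgB^D'' ''VUtDwrpHfYxAbCG-L AwAAcDGikI^iDPcMfKDyIIrKCgaF~A'' ''goMbJriCAWPDu-Z IxJIaKGIjCyFPZjMfkLpiLTJAweE{J'')
    (Quad ''-SqOwUDmAbjI NZeNZJOnCNodDZcOnfNoHHGcHGFDZF'' ''pSdILAjbxnZOE FFKOPhNUfLDGGYDPoKPlGA]GECIQYD'' ''lsRpUvtDHfcBEaNm OhgMyHPWcCtfNSJKxHPaHMZAAvHOWG'' ''yaXMbjofKRqpwU NNKPnhOsDKfKGpcEaDHSFNHDKfKNnD'')
    (Quad '''' ''jRWtIcdNMFghoxZ EJDDwAHkKJNADwiFncFnCEJdPSEPSb'' ''NBmeADHuPW-I-Z DGEMQEMQeF|EDGBMQBMQbF|bF|BF|e'' ''slIVwtjcyXBaezoM EGFOyjPdhHyAGOjOuKLPJINKCteOAI''))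
   (Quad (Quad '''' ''WTPudCviJbAnXOz EVEBcIQOIE{ePZEPgKI{dMIILGEOaK'' ''mNCAxFZhdpRJls QKAQIDQSHIThJxgALEGTiFjAJhhMWK'' ''xbCAYMntVIeqRsl JrHKHHNYKLWHHSIOFEGmhEpJMdFNHG'')
    (Quad ''mNBGeHDAtPWSLv HDiP_gLvFNXCOACPqCMPGP|FCtgPiE'' ''bxMngZFATivLrS LuEMSJLcILuKOqkJykPHCJykAAhPGI'' ''uWPriDCJbyXEgOm LTJMlHFjAG}ILYEQaCPEKL{hAhhQIF'' ''oZNBxaiJDuWrP MZkPaJMZHGYKNSBPajECJGYhQYIECj'')
    (Quad ''tyaXUmPBOhGq-J GdIJCiKGIKGkJCKGdkNxKLEdLIJLEB'' ''VUwprJtCYZOxbAEm BoCMfdF_DFGDI^ANOELmFIaDN^hPdD'' ''SWtdLJNBmaOhE AfFQCGGTGE~GPjiOKjP{dOvJJxICcG'' ''LKSpdOEmaBNc-X KcFKcdBcCOQDD{fBcHD{DEogOQIEoI'')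
    (Quad ''xZEOnbAjIRdpsl OmKOVhOVdMmHFTEOmGPYIMmDFTIPYE'' ''WTvRjudNbAogExYZ LFkJzHPCEJRdNHINGDBedEKDNNHPLb'' ''UDtwVIqfEamBN-L IjHPndG~AJFdERCQFfP[gG~AJciMha'' ''xAZECbJiOnvTdpw LnDGdKJJIDyHF~IPYIO|HOaKKHFMII''))
   (Quad (Quad ''pdTuvQEajBcmO-Y PpfOaHI{CEohOyCExEGdHBcFFxFD{D'' ''GNHBmeUADWsvRli GnIOujOUEJeIQOGGnCPdHPdGOUJQOH'' ''sPDljYxbAMoK KbiHTIFbdO_GJlKCcdOXGKqKHqEOvG'' ''-SPhqOmEuBjVdacI IgiImbONjGfGNvINeiEfIMTGBehNGH'')
    (Quad ''eXBGcayIjrtVwUp-M MaFGOiKheEHdDCDOSCEGFCaBAGJNiK'' ''UPDqfivCJZbExnM EwJIAJOpjH~KBgDJ}IL~HPCJIDjKLe'' ''faEBcmNXyHDjILSr HtDDAdOqkOcdKlHLWDApDH|IApDOHD'' ''vlsRWUiDHfgabEnM EyeDyeI^EPweJEhEZhJJiLmJFEHOkH'')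
    (Quad ''xEZAIdpRjbgoNUw IXkNhcIXHIPhM{HNhAECJIPKA]IECj'' ''JrQkeBxmNAYFdpuT ISKISkIFcIFDNgJKpiFWaKpFFWBOoJ'' ''mEOhadtVLBJSr CHdQMgN{JQNHK_JMmDKdiQ]EKdgKFe'' ''zoYDPeMAbnSLrj AnfQKKKLBJ}kJxGKjdPjgQACPTgO{D'')
    (Quad ''swlVIudhaEbOn FGgLPEPdcLPaFGIFGcPdgPdHPdIFGH'' ''vlsRWiTufHaEbgnM GMHJzDAyhQBBOkgGMgJ|DJ|dAyGOkH'' ''mNeHQpxACYDSrL MtFMtgFKkM~kM~KDVCDVCFKKOZkCfF'' ''''))"

definition catalogue_Q :: catalogue where "catalogue_Q =
   Quad (Quad (Quad '''' ''bjmOLrSAwUDH P{EFSbO_jP{hFBCLjcOvCFBjLjJO_C'' ''RqKPhuWZJiyCFAbnM CSKKojGcKCSkKoHAjJEJKGckEJkP}B'' ''lswuhjTdcFaByZX PjGQ[KK}iPjgGTfMxiQKEMxFK}FGTI'')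
    (Quad ''jnbvOETAYxwdp DwiDwHNsEPNkPNKHsDKBHKBiNsdPDD'' ''mOEBcfadTuvjlWRs DeDI{iNKHIqGEHgB]DLUHLnEDNIOaD'' ''PUQDtzYriAxBNm NEFGpEBPEPnfOHjH|cBPENkENnCNQH'' ''eGBMocajIDtUVyX-P NDjJ_cALeLNEQIfMwAF^dNaECmKG}j'')
    (Quad ''SLrkQfIGCVtyaXpH DsdH~GAWDQXIN{jN{CQXiFdJAWgDsG'' ''iJCrAbPDYxgEWuOm KTEOmKPbKQGeLBeJBjIXKHNIQ^jPfJ'' ''iCJnDOGtUbXy-L MQfCdFCdfMLAMLkKSBKScMLkMLAMQF'' ''xbYCAJlzfRstWHDU P{KEPJQZDP{ePbdJ^GQCGJ^gQZaPbA'')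
    (Quad ''duTivRWJaBnXGzOe BOdBOKBOIMmdQNDBOhMmhMmIQNHMmK'' ''SLrPWHDtfAYxGCb KygMSAHAaHeGPzkIrKIrKKkGFLeCIG'' ''yXamDNBcgPqrSL QRCPBkPBHAWhAWKH{KH{KPzKQLGPzh'' ''meGNBHADUtwpsVl G[FFGGGAaPaHLPICtgF_GOAGPqCIqH''))
   (Quad (Quad ''xAYEOnCbDJiPsl A]DQPkKbIN|dQ^iMJeHwEFFkIXKNwE'' ''pUwRhslFdIjcgEb-Y FxAO|JO|gLIgQQELIJQQcGdjHnJGdG'' ''mxOYAqRpJBUw QNKMKDKSiMKBKSaKSAKSIQNJMKkMKj'' ''hpwTFdZyXavimJBN QSfLkcB_iQZJJdfJZiK}hLtIMxFPbE'')
    (Quad ''lsRvWUhfjEabyX ETdOngGwKQVGJEbETDHGiOnKJEIHGB'' ''tVIJwrSLgfkzYXeMo HjgOoGNgGNyKNyjPSfPSEHjHNshNsG'' ''krQHpUDtAMbnCxZ GvJFlkKVcFlKGvjKBHKBfKVIQTFPAH'' ''jcIBaGeMoVtuPW-X HSFMNIJHiKyiBqHK{aEiHAgDBqHJrE'')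
    (Quad ''qPhgSKLvcFiTaXy DYjMxgKFIQ[JAWgCHDQHgCdIN{jDYj'' ''lJNBoiaZxsPD MIeMIIMIEPYEPgDMIiPYePYIPgHPYi'' ''hudTFCnZybMXJirw B_IIAhMxiITEKLeQKdK}ANLAQSIPJK'' ''zGfCYbAjDtUQls GeIQCGPBaNcaPBKQXGEPeQXgNcKGef'')
    (Quad '''' ''SLpKHZDAxBNm A]iGeiKUkCIcCIHPzFM{CKUBPziGeF'' ''pSdcLIjBaGeXyoM GedHwGGTGLNEDKEFnFDJdQPkQIfAhH'' ''OEmaNcBZxIjtVLwrS AzaJDGJDkORkAzFNOEFGkORGFGGNOi''))
   (Quad (Quad '''' ''amBcNdPhqXzRKls PQHJ|KMMCPfGLmBIGIJEgM}GC|cJBg'' ''eBGcatMojIV-X-H SHERrHQiEQcJRkHSFdQhHRVDRQJ'' ''VJbAtCDHe-M-P RdDRyDQbAQdjRgIRFfRQFRVIQee'')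
    (Quad ''ycaXBJeRq-H-L QhKSMCQcbRLdSNFRLkRkgSFIQ~I'' ''hEBacdjItV-P-M SBhRRFQpEQ~ERJcRzFR[ERTdQcf'' ''datpQEOmVJBN RxESPfSjHQxDSjHQnfSLDQniQxJ'' ''ebJACiHDtWP-O RxARWEQ~ARzIREHQzESXIRLISNE'')
    (Quad ''yaXBceJk-D-L-M QsHRIHQdKRBeQheRheR[kQbBRTB'' ''acBmdhOE-X-I-Q R[DR[dQbeRhFRBDQpCRhiQbBRBH'' ''PqDRYxeAJBmN QkDRAFRADSIdSfdSIfSEFSRISED'' ''UVhtFeAzXCJbMn QjDQkhSxHRSHSxKRSKSkDRoJSkF'')
    (Quad ''RKqEgbbACnMtDU QlDSwiQlDQtFSwjQtDSrAQtDQtF'' ''fcaBEaXy-J-L-H-P QmCQmCQ|EQ|eQmCQtDQtIQmCQ|CQ|cQmEQtFQtGQmCQvC'' ''pHQoeMnbjDAvT RFFSoIShIRddQniSQdSmCQfdRHJ'' ''wUpdiKQEamNB SDJRahR_JRsdRaCSvCR_JRsISWJ''))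
   (Quad (Quad ''GFBAexYhd-I-M-Q QeDQedQeCQecQiAQiEQeKQekQiB'' ''xYAMogbHD-J-L SbBQ}HSHFSBhSYCRrHQqKRuDRuDQqKRYhRKK'' ''yXamfEODHQptUCG ScIRpcSnCScHRpCRtdRtaRtARtD'' ''mBNaDfOEHxZ-P-J QhKQ}kSHdSakSaKSHCQhkQ}KS^C'')
    (Quad ''PqhfaaEBcXy-J-L QtDQtDRmIRmdQmCRMKQtDQlDQlDQtDQmCS_D'' ''HEBjIfDacyX-P-L RTDRhcQ}kSBKSaKQ}kSBKSaKSGc'' ''fcBEaxY-J-L-H-P QvCQvCQ}kQ}KQvCS_DS_IQvEQ}kQ}KQvES_FS_GQvCQmC'' ''MacndFhgJuTRq S]aSTFSJISXiRiJREJQzdQzfRjB'')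
    (Quad ''vJiTdaBpQEOmN RgJRNJRiHSRhShJRdFSEeRHjQfD'' ''jIcBaDHEfNOm-P-L RTDSGCS^FRRdRDHS^DRRfRDHSGc'' ''EMgbnFcjIVtdpQ QgASDHQ{aR}fSVHRnhQwdSpiQwf'' ''njMbIATYxeHu QzhRgHRyCSCFSfJSTJR{FRZHSEj'')
    (Quad ''FzeXAOmBN-D-P-J Q|bSGbS^CRYKR]KQ|BRmIRmDQ|BQ|bQmBQ}k'' ''zfXaoMnb-J-D-P RIHQshQucR_FQqFQ}KRsCRsCQ}KRIEQvHQ|b'' ''jvbeHATD-W-N QefQeFRnHQgJQddQdESAFQgcRni'' ''''))"

definition catalogue_R :: catalogue where "catalogue_R =
   Quad (Quad (Quad '''' ''qRhdItVcEBa-N RYdRGIRXIQjASBdRRFSGIR^iSZD'' ''HDCOAmb-I-X-Q RViQhkQhFRVISMCQiASFCSFcQib'' ''mxNYAjIfkz-D-P RvCRQCRQhRrERCHSsCSsCRCcRKFRvERrkRKC'')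
    (Quad ''mBNcaIjOEdhqP-L RVGRGCRlIQyFRDdRHgSQDRUhRdF'' ''okgNJvTiCudbyX R}kRtKRtaQwAQgESjHQwkQgjR}A'' ''rPDiAJbCeFXz-N SAkSbASeDQnKRJfQciRLkRbIRxf'' ''qEgbRJvxTYCAi-U RlkRAIRnIRRaRDESKKSViSxKRfK'')
    (Quad ''tIVDjAbnMeoHQp RJcRocSxjRRFSQFRDhRXCQxjQnI'' ''BXycaJgFkZ-L-D-P Q}KQhKQhaQ}ERIARwFRwFRIAQ}cRraRrKQ}a'' ''jBcaIxZfEDtUV-N SFKSBFRHdSCFRFjQeaRnkRVDRgD'' ''RqJNemCA-D-U RCIRyDRydRCERKFSWISWIRKFQqeQqFSgFR_I'')
    (Quad ''mNBcadEhTuiv-Q R[HSHEQdfRFjR}cSpfRnhQgEQdh'' ''xYAFemNBcIj-H-P RMKRMKQtFRMKSwDSwIRMKR^HR^fRYkRYKSYE'' ''mBNacdyXTujvFhZ QxHRtJRNhRiESkKRoERpESoHShH'' ''WRKeAtoMHDbC SSaSOASEJSTFSOaSIcSEfSUDSIH''))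
   (Quad (Quad ''nMbeAFCJKiqR-D-U SYBRxARxcSYBRPHStDStJRPHSYBSYBSbCSbE'' ''pdQFeAbCMn-J-X RyCRCDRVKRnHSAFR[hSFhQcIQbC'' ''HDoeMAUtnCbiJ-L QeCRRcRUEQydRGhRHJSRHRAERdf'' ''vTiJCgYObEmAxRq SIJSIhSkHSJHSJjQkHReHQkiSiH'')
    (Quad ''NCAmeDH-J-X-P QyCQuCRhEQeeRVIQehRVFQhEQhH'' ''ZxMoADHUtbn-J RRDSGDR|ERXHS^DRDeR]KSZKSak'' ''-UvjBcaTfEZx-N RBfRQKRDHSaHRTJQbJRJFRbdQcK'' ''HEfDaIXyjcBmN-P QgDRgERsdRtCSDISYESHDSBKR^H'')
    (Quad ''kZxHDAJBtUmN SVFRAFRUERlHRHHSUkSmFSEDSCf'' ''ycBXaMDeoH-J-L RYkR]KRAdRlhRMKQ|CRYKRqGRqFRYKSgDQqh'' ''njMbeHIADtUxY R}CR}dSHCSHdRtDRtcQ{jQ{HS[F'' ''maDNcBHfEtU-J-X RrKSahQiASFfRLHQhhSAHQeHRQd'')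
    (Quad '''' ''ycXaBeDHpQ-J-L RYKRYkRUbRUAQ|cQ|CR]KSvFSvGR]KSgDR_I'' ''okMebhCdAITu-W RmHSKHRlHRMfSKCRWJRAhSIHSUF'' ''beKVHuATC-P-S Q}FQ}fRKASaFSafRrER]FR_CQoCQoCR_CRrj''))
   (Quad (Quad '''' ''UtDayXFZiKmNJB RajR}jRwCRrKRuFSlHSsHRrKQoH'' ''WTRviJCFzXAbe-N SFKRvISdISQeRVkSFIRFIRViRFK'' ''mBNacEfjIHDVUtpw SxiSqHSxISxhSQaSQCSoISoHSxH'')
    (Quad ''jBIacENmOdQp-L QcIRfISZaRRiRfDQxGQngSZaRDH'' ''xbYCAEgTmOkvJirQ SnCSnCR~HSnCSnCRSKRSJRSIRSH'' ''jgcFTvQupdbE-M ShHShhRkIRdaRdARdARGIRGfRda'' ''viTCJdpbAFeQ-M QxJQ{JRWASXIRzfSNAQcIRJCRxE'')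
    (Quad ''yXacBgFhd-Q-M-I QieSFdQuaRhdRTAQhkQiaSFkQhd'' ''qEfaPDcBmNUjv SEjQwJSkARNHQxHSViSjISOaSxH'' ''eMftnGCJVqDP QwiSODSOFQwjSOAQwhQwFQwAQwD'' ''nCDUtpwbAMHe-K QbARfIQdiQbdR}ER}eRniRnHQdH'')
    (Quad ''qPhzXOmdaNB-J RDHR^IS[HRXBS^CRGbRYkSZkSHC'' ''tAUDFemONBzX-J RmdR^JRqJSvDQ|BRmdQtDQ|BRsc'' ''nbMCAeiDHPr-Z RQIRGHQ~aRJdQzcS]HRLhSXIRki'' ''uvhdFiTeAzXCbJMn SRJSfHRHhSVjRHkSVjRNKQkDRNH''))
   (Quad (Quad ''vJTiCFudhZNAxm SuAQrHSPFSjJSPDSjJRNHR~DRNK'' ''qEMPhfaXyInbj RqdSvDRmIRYKSIISwDSSERYKRuf'' ''yaXmZFNBKiJ-D-P RrcQbDR[ERIERrKRaDRaIRrKQqHSbFRCCR_H'' ''tUDIkHAemBN-W RWjRwJQ}FS_CRwJRmcQ}FQoIRuD'')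
    (Quad ''cdhuTaBEXyIjmN REJRNERueRWDQrERZJSfHSTESIH'' ''qHemNBDAIRVt RtaSlJQqJRqcRaCRsFQqJScISWF'' ''mANCFeiJQr-D-U RCIRbhRbHRCFRvISqHSqHRvIRCARCHSbESbC'' ''jGKbzxCYfAtDU-L RsfSNFRsfRIaRsFRajRaDRIaRsF'')
    (Quad ''eFAdtpQCbJV-M QfDR{dRPFQgARgDQgARFiRFfRgJ'' ''NmBadpEQOxZ-J RQISBKQ{FSeISaKQcDRKISHCSZk'' ''jBcIayXdZFhVt-M SfcSRHRzfQgARgjQeKQeCRgdQgA'' ''PDqeAYxbjTv RxeRxJQ{CQ{dQ{ESeDSeJQ{jSLC'')
    (Quad ''uTVrLSHQAebC RUJRUeSmBSdGSQBRUeSmFRUJSQi'' ''AiCJbgkoNTvduxY RkHRajRZEQzeSNEShKS]dRLkREH'' ''bjmAIVudOFpQ RpAReCSkJRpDRpeRpfSkISkHSkC'' ''''))"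

definition catalogue_S :: catalogue where "catalogue_S =
   Quad (Quad (Quad '''' ''beKACHDRp-T-M RFIRQiRQFRFfQ~CR[cR[CSFcSFC'' ''yaXEBchduTIj-L QecRJKQqjQuFRWFSfCSCERyFRAe'' ''jnbMxAYIeQHpD SpKRJFSaKSHdSBKSDISeFQ{HRXf'')
    (Quad ''pHQDAeCbnMxYJi QzdQzEQoIRWdRWESCFSChSTDSUK'' ''lsvjTbAYxQE RijSZCQ{kQjGQxkS[ERXJROISLG'' ''uTdhEaMbgn-I-P RhhR[fRJERBeRbHQbdRQcSAJQdH'' ''EHKUtiaDcB-N-W Q|aQyCRUERAAQ|dQycQucRUERAD'')
    (Quad ''NOmBEZxaqPhd-J QbCRWCRZFSCbQsHRLBQqIRyCRlI'' ''vTiJRBayXqeMo RSJRqJRtBR^JSJJROESnCQjiS[I'' ''rQkJgVbECtAxYDU SUCSJiQwKSOaSIIRSKSViSKKSxi'' ''qKRGjIcaeByXtV-U R^KR^ISXIR^iR^kRGiSJKSJiRGK'')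
    (Quad ''mAbOqDPjUv QfiR{ISEiQfCSmCSmHSEjSECSEH'' ''QrjcEa-P-X-N QdKQdkRBEQdHQdhRBFRBBQdDQdd'' ''huTdviGCYxAb-O QdfRwERgfRgKR}AR}jQgeQdKQgE'' ''ACbeFJdhPqVuMn ROFRjBSiHSiHROJSJiRiHRiiSJH''))
   (Quad (Quad ''rwTiudFhOAmCbJ RpEStDQfAQfeRpaRpJSoHSoiRpf'' ''psRlhOdIjcmBaE RHGRbgR|DRchRDCRHHQnhQngRDC'' ''vTiudJNBamEhxZ RoJRzERRESVJRRCSVJQxkQjDQxh'' ''eFAqYxPhtBJV SSESSERqdSgCROFSvDSgCRqISWF'')
    (Quad ''PDCqAebYxJinM QwCQwcSWIRtcRtCQ{HQ{fSDIROI'' ''HDeAoMCbtwrVK SvCSJHRXCSDISJcR^cRXhROIR^H'' ''rPdJNmBAFkehxY SViRXIRGiSRIQzDRoiRiiSJiShh'' ''lidsahQEmBN STISsIRKISSaSsGRuiQoGRKIRuF'')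
    (Quad ''riPDHeACmN-Z RgCSKhQgERgfQwIQwhQgeRnHRni'' ''HDCbeAoMKi-P-S S_CRPCQqHRWIRWiRPCRMfQqcSYDScCScCSYD'' ''xMbnAToZuH-J RdcRADSmDSEDRldRdcSgBRUERyc'' ''dhaMoqKRbjXy SxKRlISIISIkSxiRlkRZKSEiSEK'')
    (Quad '''' ''xbYACDjrHQGfUt RnjSsISxIRnKSxfR}AR}dQwJQwk'' ''NmBaXOfzHD-J-P QyCQ|BRlfRUARUeRlIQycQ|hQsH'' ''NmBaDfHEKi-P-S SYDS_CQvARsiRsIS_CQtCQvDS_CSrBSrBS_C''))
   (Quad (Quad '''' ''xamNBOEZdhuT-J R[kQuBSCHSdFQsHRVFR_JRyCRUe'' ''eQFAbCnMJri-D-U QqHRFhRFHQqhSbESlHSlHSbERrFRreRvHRPH'' ''beKCiAMoDHPuW SrBStIRuCQrHStISwjRuhSYDSYD'')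
    (Quad ''SPLrDiABGHetU SaJRbCSeERbcSajSaJSeISajR|B'' ''vTDYjxbAeHpQ RFFRFfSCJRydRyESdFR{DSCcSmC'' ''nMcaIjXyTduEh RzdRoKSBKSBKRtDQ{JRtCQ{FQje'' ''PDcaBeqXy-J-L SgBSgISZkSZKRYkRYKSgDSSCSSCSgDR]KRKD'')
    (Quad ''njbMxAIRdpFZh SoHR}CRfKQxHQnHRNHSjISxiSVi'' ''WPuTdhaEvcjBNm SOeSiESOFSOaRSIRSHSkFSkESOC'' ''phwOTFdmAvjb RphREIShCQfCQffShfRiIRihRpI'' ''hpEBcadjwTvmN RiIRSFRiiRNHQkfQkER~ESiHRNh'')
    (Quad ''mBNEcfajItDUqR RuiSoIRuISbFRajRaDSqHStDSbF'' ''bajTrduQhMo QnJSZhRXiSZHQnjR|ASeIRXCSLB'' ''bxYAmOEIKjqRVt ReHSwJQrHSwIReHSIKSIjSIiSIH'' ''mNBcaDIjEfHtVWP ShHSlIShhRNhQnHQnhSPHRcHRNH''))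
   (Quad (Quad ''pHQGJNemBfDCiTv RLiSCISCJRLjSCHRLhQzfQzaQzd'' ''rQeJCFAiNmDUt SsERcHSsIRvISsHSsCSlHSlIRvH'' ''cGDtUqaeBRKnM SrAScDSrHS_FScFS_DQlDS_DS_F'' ''NmjxAYIzfkDUt SqCS]ERaDRCcSWCSqERajRCHSWH'')
    (Quad ''UDtcfNEBamjkIrQ ScHSPHScIRPHScHScISlISlHRPH'' ''dPFqhyZxERKmOGnj RpiRpcRpbRpHSuARpKRpDRpaRpF'' ''UtDacBmNjEKRq RqdSUHRqJR]HRmdRmJQoISSBR]H'' ''PqhFeAmcNBIjxY SwDSwDQlDRMKSnKRqdRqIRMKScF'')
    (Quad ''mNBacfEHjTvuWR S[DS]DQkASJhRHhRGDShiRiDRcH'' ''gBaccFIj-L-H-M S{ES{eSyASyAS{AS{aS{AS{a'' ''beACFJivTudh-Y TFcTDATDcTFATFeTFATFcTFD'' ''jIcgFAbxY-L-H SyES{eS{eTBkTGFTBkTGETKE'')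
    (Quad ''eqARImjN-D TFcTEATEfS}ES}cTFES}iS}H'' ''rQjEbxIYA-N TCkTKCTIHS~cTBKTCkTGCS|B'' ''AbCYxGfDHtJV S}fTHFTEbTEBS}fTHFTDaTEB'' ''''))"

definition catalogue_T :: catalogue where "catalogue_T =
   Quad (Quad (Quad '''' ''iKFzAXeCbJMn-D TBKTEBTFhTGBTGBTBhTCKTCH'' ''xAYIBJNmke-H TAFS{eS{eTHdTDBTAfS}CS}B'' ''jIcBaENOmdh-X TIHTCdTCfS}dTAHTCfTFDS}e'')
    (Quad ''gjBVtFIcahdyX TBDSzDTJDS~fTBKTBKS~eS~e'' ''CbAGhdJVtxY S|DTAKS~eS~ETIKTIfS~FTJD'' ''iJdhONamEB-X THhTAkSzBTFdTCDTFfTCFS|D'' ''JrBXyaiQek-N TABS{cTHITHkS{CTAeS}iS}K'')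
    (Quad ''nOGfCbAiJTvxY TGAS~KTFjTBkTGFS~FTIKTIh'' ''xAYbCGfnOJVt S}JTCFTCjS}fTHkTEBTHHTEc'' ''AdmNChGJtV TEBTDaTDETEBTEcTEcTEcTEB'' ''gFcBaJVt-H-M S}fS}JTKATKAS}fS}JS{aS{A'')
    (Quad '''' '''' '''' ''''))
   (Quad (Quad '''' '''' '''' '''')
    (Quad '''' '''' '''' '''')
    (Quad '''' '''' '''' '''')
    (Quad '''' '''' '''' ''''))
   (Quad (Quad '''' '''' '''' '''')
    (Quad '''' '''' '''' '''')
    (Quad '''' '''' '''' '''')
    (Quad '''' '''' '''' ''''))
   (Quad (Quad '''' '''' '''' '''')
    (Quad '''' '''' '''' '''')
    (Quad '''' '''' '''' '''')
    (Quad '''' '''' '''' ''''))"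

definition catalogue_of :: "char \<Rightarrow> catalogue" where
  "catalogue_of c =
    (if c = CHR ''A'' then catalogue_A
     else if c = CHR ''B'' then catalogue_B
     else if c = CHR ''C'' then catalogue_C
     else if c = CHR ''D'' then catalogue_D
     else if c = CHR ''E'' then catalogue_E
     else if c = CHR ''F'' then catalogue_F
     else if c = CHR ''G'' then catalogue_G
     else if c = CHR ''H'' then catalogue_H
     else if c = CHR ''I'' then catalogue_I
     else if c = CHR ''J'' then catalogue_J
     else if c = CHR ''K'' then catalogue_K
     else if c = CHR ''L'' then catalogue_L
     else if c = CHR ''M'' then catalogue_M
     else if c = CHR ''N'' then catalogue_N
     else if c = CHR ''O'' then catalogue_O
     else if c = CHR ''P'' then catalogue_P
     else if c = CHR ''Q'' then catalogue_Q
     else if c = CHR ''R'' then catalogue_R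
     else if c = CHR ''S'' then catalogue_S
     else catalogue_T)"

lemma catalogue_of_simps:
  "catalogue_of (CHR ''A'') = catalogue_A"
  "catalogue_of (CHR ''B'') = catalogue_B"
  "catalogue_of (CHR ''C'') = catalogue_C"
  "catalogue_of (CHR ''D'') = catalogue_D"
  "catalogue_of (CHR ''E'') = catalogue_E"
  "catalogue_of (CHR ''F'') = catalogue_F"
  "catalogue_of (CHR ''G'') = catalogue_G"
  "catalogue_of (CHR ''H'') = catalogue_H"
  "catalogue_of (CHR ''I'') = catalogue_I"
  "catalogue_of (CHR ''J'') = catalogue_J"
  "catalogue_of (CHR ''K'') = catalogue_K"
  "catalogue_of (CHR ''L'') = catalogue_L"
  "catalogue_of (CHR ''M'') = catalogue_M"
  "catalogue_of (CHR ''N'') = catalogue_N"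
  "catalogue_of (CHR ''O'') = catalogue_O"
  "catalogue_of (CHR ''P'') = catalogue_P"
  "catalogue_of (CHR ''Q'') = catalogue_Q"
  "catalogue_of (CHR ''R'') = catalogue_R"
  "catalogue_of (CHR ''S'') = catalogue_S"
  "catalogue_of (CHR ''T'') = catalogue_T"
  by (simp_all add: catalogue_of_def)

fun pick_char :: "char \<Rightarrow> catalogue \<Rightarrow> string" where
  "pick_char (Char b0 b1 b2 b3 b4 b5 b6 b7) c = pick b0 b1 (pick b2 b3 (pick b4 b5 c))"

definition hint_table :: "node quad quad" where
  "hint_table = Quad (Quad N0 N0 N1 N2) (Quad N3 N4 N5 N6) (Quad N7 N8 N9 N10) (Quad N0 N0 N0 N0)"

fun decode_target :: "char \<Rightarrow> letter list \<Rightarrow> target" where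
  "decode_target (Char b0 b1 b2 b3 b4 b5 b6 b7) w = Target b5 (pick b0 b1 (pick b2 b3 hint_table)) w"

fun targets :: "string \<Rightarrow> target list" where
  "targets [] = []"
| "targets [c] = []"
| "targets [c, d] = []"
| "targets (c # d # h # cs) =
     decode_target h (letters (pick_char d (catalogue_of c))) # targets cs"

definition closed_row :: "string \<Rightarrow> bool" where
  "closed_row s \<longleftrightarrow> closed_under (letters s) (targets (moves s))"

fun closed_rows1 :: "string quad \<Rightarrow> bool" where
  "closed_rows1 (Quad a b c d) = (closed_row a \<and> closed_row b \<and> closed_row c \<and> closed_row d)"
fun closed_rows2 :: "string quad quad \<Rightarrow> bool" where
  "closed_rows2 (Quad a b c d) = (closed_rows1 a \<and> closed_rows1 b \<and> closed_rows1 c \<and> closed_rows1 d)"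
fun closed_rows3 :: "catalogue \<Rightarrow> bool" where
  "closed_rows3 (Quad a b c d) = (closed_rows2 a \<and> closed_rows2 b \<and> closed_rows2 c \<and> closed_rows2 d)"

text \<open>
  As a congruence rule this keeps rewriting from entering the tables, of which only the selected
  row is ever evaluated.
\<close>

lemma Quad_cong: "Quad a b c d = Quad a b c d" by (rule refl)

lemmas eval_simps =
  closed_row_def closed_under_def closed_rows1.simps closed_rows2.simps closed_rows3.simps letters.simps bridges.simps moves.simps targets.simps decode_target.simps
  pick.simps half.simps host_table_def host_edge_def arrow.simps bridge.simps catalogue_of_simps pick_char.simps
  hint_table_def sel.simps upd.simps map_row.simps zip_row.simps nodes_def inc.simps neg.simps dec.simps
  up.simps down.simps spoil.simps through.simps mutate_row.simps mutate_matrix.simps set2.simps add_letter.simps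
  zero_row_def zero_matrix_def matrix_of.simps fits.simps remove_letter.simps assign.simps without.simps
  cands.simps keep_if.simps fitting.simps successors.simps extensions.simps extend.simps exhausted.simps matching.simps start.simps hits.simps
  is_Free.simps is_Zero.simps all_zero.simps idle.simps split_free.simps mutate_all.simps
  mutants.simps all_hit.simps append.simps if_True if_False refl simp_thms node.simps entry.simps row.inject

section \<open>The host graph\<close>

definition host_edges :: "(node \<times> node) list" where
  "host_edges = [(N0, N1), (N0, N2), (N1, N2), (N1, N3), (N0, N4), (N1, N4), (N2, N4), (N3, N4), (N1, N5),
     (N2, N5), (N4, N5), (N5, N6), (N0, N7), (N2, N7), (N4, N7), (N3, N8), (N4, N8), (N5, N8),
     (N6, N8), (N1, N9), (N3, N9), (N5, N9), (N8, N9), (N0, N10), (N1, N10), (N4, N10)]"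

lemma host_edge_in: "host_edge b0 b1 b2 b3 b4 \<in> set host_edges"
  unfolding host_edge_def host_table_def host_edges_def
  by (cases b0; cases b1; cases b2; cases b3; cases b4; simp)

definition host_letter :: "letter \<Rightarrow> bool" where
  "host_letter a \<longleftrightarrow> (tail_of a, head_of a) \<in> set host_edges \<or> (head_of a, tail_of a) \<in> set host_edges"

lemma host_letter_loopless: "host_letter a \<Longrightarrow> loopless a"
  unfolding host_letter_def host_edges_def by (cases a) auto

lemma host_letter_simps:
  "host_letter (arrow b e) \<longleftrightarrow> e \<in> set host_edges \<or> prod.swap e \<in> set host_edges"
  "host_letter (bridge e) \<longleftrightarrow> e \<in> set host_edges \<or> prod.swap e \<in> set host_edges"
  by (cases e; cases b; auto simp: host_letter_def)+

lemma host_letters: "\<forall>a\<in>set (letters s). host_letter a" "\<forall>a\<in>set (bridges s). host_letter a"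
  by (induction s rule: letters_bridges.induct) (auto simp: host_letter_simps host_edge_in)

fun host_point :: "node \<Rightarrow> int \<times> int" where
  "host_point N0 = (3, 2)" | "host_point N1 = (2, 3)" | "host_point N2 = (7, 1)"
| "host_point N3 = (1, 5)" | "host_point N4 = (1, 0)" | "host_point N5 = (10, 0)"
| "host_point N6 = (9, 6)" | "host_point N7 = (5, 1)" | "host_point N8 = (0, 9)"
| "host_point N9 = (6, 3)" | "host_point N10 = (2, 2)"

fun turn :: "int \<times> int \<Rightarrow> int \<times> int \<Rightarrow> int \<times> int \<Rightarrow> int" where
  "turn (a, b) (c, d) (e, f) = (c - a) * (f - b) - (d - b) * (e - a)"

definition place :: "node \<Rightarrow> point" where
  "place x = (of_int (fst (host_point x)) / 10, of_int (snd (host_point x)) / 10, 1)"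

lemma side_place: "side (place u) (place v) (place w) = of_int (turn (host_point u) (host_point v) (host_point w)) / 100"
  unfolding side_def place_def
  by (cases "host_point u"; cases "host_point v"; cases "host_point w") (simp add: field_simps)

lemma side_swap: "side b a c = - side a b c"
  unfolding side_def by (simp add: algebra_simps)

text \<open>
  All conditions on the drawing are about signs of determinants of integer points.
\<close>

definition general_position :: bool where
  "general_position \<longleftrightarrow>
     list_all (\<lambda>(u, v). list_all (\<lambda>w. w = u \<or> w = v \<or> turn (host_point u) (host_point v) (host_point w) \<noteq> 0) nodes)
       host_edges \<and>
     list_all (\<lambda>(u, v). list_all (\<lambda>(s, t).
         u = s \<or> u = t \<or> v = s \<or> v = t \<or>
         0 < turn (host_point u) (host_point v) (host_point s) * turn (host_point u) (host_point v) (host_point t) \<or>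
         0 < turn (host_point s) (host_point t) (host_point u) * turn (host_point s) (host_point t) (host_point v))
       host_edges) host_edges"

lemma general_position: general_position
  by code_simp

lemma place_off:
  assumes "(u, v) \<in> set host_edges" "w \<noteq> u" "w \<noteq> v"
  shows "side (place u) (place v) (place w) \<noteq> 0"
  using general_position assms set_nodes unfolding general_position_def list_all_iff side_place
  by fastforce

lemma place_cross:
  assumes "(u, v) \<in> set host_edges" "(s, t) \<in> set host_edges" "{u, v} \<inter> {s, t} = {}"
  shows "side (place u) (place v) (place s) * side (place u) (place v) (place t) > 0 \<or>
       side (place s) (place t) (place u) * side (place s) (place t) (place v) > 0"
proof -
  have "\<forall>(u, v)\<in>set host_edges. \<forall>(s, t)\<in>set host_edges. u = s \<or> u = t \<or> v = s \<or> v = t \<or>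
         0 < turn (host_point u) (host_point v) (host_point s) * turn (host_point u) (host_point v) (host_point t) \<or>
         0 < turn (host_point s) (host_point t) (host_point u) * turn (host_point s) (host_point t) (host_point v)"
    using general_position unfolding general_position_def list_all_iff by (rule conjunct2)
  from bspec[OF bspec[OF this assms(1), unfolded split_conv] assms(2), unfolded split_conv]
  have "0 < turn (host_point u) (host_point v) (host_point s) * turn (host_point u) (host_point v) (host_point t) \<or>
         0 < turn (host_point s) (host_point t) (host_point u) * turn (host_point s) (host_point t) (host_point v)"
    using assms(3) by blast
  then show ?thesis
    unfolding side_place times_divide_times_eq of_int_mult[symmetric] by (simp only: zero_less_divide_iff of_int_0_less_iff) simp
qed

definition host_graph :: "node set set" where
  "host_graph = (\<lambda>(u, v). {u, v}) ` set host_edges"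

lemma host_graph_iff: "{u, v} \<in> host_graph \<longleftrightarrow> (u, v) \<in> set host_edges \<or> (v, u) \<in> set host_edges"
  unfolding host_graph_def by (auto simp: doubleton_eq_iff image_iff split: prod.splits)

lemma inj_place: "inj place"
  unfolding inj_def place_def
proof (intro allI impI)
  fix x y assume "(real_of_int (fst (host_point x)) / 10, real_of_int (snd (host_point x)) / 10, 1 :: real) =
    (of_int (fst (host_point y)) / 10, of_int (snd (host_point y)) / 10, 1)"
  then have "host_point x = host_point y" by (simp add: prod_eq_iff)
  then show "x = y" by (cases x; cases y; simp)
qed

text \<open>
  The drawing lies in the top face of the slab, which is part of the sphere.
\<close>

lemma host_drawing: "graph_drawing (closed_surface 0) UNIV host_graph place (straight place)"
proof (rule graph_drawing_mono[OF _ top_face_subset], rule straight_line_drawing)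
  show "inj_on place UNIV" by (rule inj_place)
  show "convex top_face" by (rule convex_top_face)
  show "place ` UNIV \<subseteq> top_face"
  proof
    fix z assume "z \<in> place ` UNIV"
    then obtain x where "z = place x" by blast
    then show "z \<in> top_face" unfolding place_def top_face_def by (cases x) simp_all
  qed
  show "\<exists>u v. u \<in> UNIV \<and> v \<in> UNIV \<and> u \<noteq> v \<and> e = {u, v}" if "e \<in> host_graph" for e
  proof -
    have "\<forall>(u, v)\<in>set host_edges. u \<noteq> v" unfolding host_edges_def by simp
    then show ?thesis using that unfolding host_graph_def by fastforce
  qed
  show "side (place u) (place v) (place w) \<noteq> 0"
    if "{u, v} \<in> host_graph" "w \<noteq> u" "w \<noteq> v" for u v w
    using that place_off[of u v w] place_off[of v u w] side_swap[of "place v" "place u" "place w"]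
    unfolding host_graph_iff by auto
  show "side (place u) (place v) (place s) * side (place u) (place v) (place t) > 0 \<or>
       side (place s) (place t) (place u) * side (place s) (place t) (place v) > 0"
    if "{u, v} \<in> host_graph" "{s, t} \<in> host_graph" "{u, v} \<inter> {s, t} = {}" for u v s t
  proof -
    have d: "{v, u} \<inter> {s, t} = {}" "{u, v} \<inter> {t, s} = {}" "{v, u} \<inter> {t, s} = {}" using that(3) by auto
    have sw: "side (place v) (place u) (place s) * side (place v) (place u) (place t) =
        side (place u) (place v) (place s) * side (place u) (place v) (place t)" for u v s t
      using side_swap by (metis minus_mult_minus)
    from that(1,2) show ?thesis
      unfolding host_graph_iff
      using place_cross[OF _ _ that(3)] place_cross[OF _ _ d(1)] place_cross[OF _ _ d(2)] place_cross[OF _ _ d(3)]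
        sw[of u v s t] sw[of s t u v] sw[of t s u v]
      by (metis mult.commute)
  qed
qed

lemma entry_nonzero_edge:
  "entry_of (matrix_of w) i j \<noteq> Zero \<Longrightarrow> \<exists>a\<in>set w. {i, j} = {tail_of a, head_of a}"
proof (induction w)
  case Nil
  then show ?case by (simp add: entry_of_zero)
next
  case (Cons a w)
  show ?case
  proof (cases "{i, j} = {tail_of a, head_of a}")
    case True
    then show ?thesis by auto
  next
    case False
    then have "entry_of (add_letter a (matrix_of w)) i j = entry_of (matrix_of w) i j"
      by (cases a) (auto simp: sel_upd)
    then show ?thesis using Cons by auto
  qed
qed

text \<open>
  The relabelling is absorbed into the embedding, so that only the sign remains.
\<close>

lemma captured_word:
  assumes "captured full C Q"
  obtains w f T where "w \<in> C" "inj_on f (verts Q)" "skew T" "matches T (matrix_of w)"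
    "(\<forall>i\<in>verts Q. \<forall>j\<in>verts Q. skew_of Q i j = T (f i) (f j)) \<or>
     (\<forall>i\<in>verts Q. \<forall>j\<in>verts Q. skew_of Q i j = - T (f i) (f j))"
    "full \<Longrightarrow> \<forall>x y. T x y \<noteq> 0 \<longrightarrow> x \<in> f ` verts Q"
proof -
  obtain f S w where f: "inj_on f (verts Q)" and S: "skew S" and w: "w \<in> C" "realizes S w"
    and eq: "\<forall>i\<in>verts Q. \<forall>j\<in>verts Q. skew_of Q i j = S (f i) (f j)"
    and full: "full \<longrightarrow> (\<forall>x y. S x y \<noteq> 0 \<longrightarrow> x \<in> f ` verts Q)"
    using assms unfolding captured_def by blast
  obtain \<pi> where \<pi>: "bij \<pi>" and m: "matches (\<lambda>i j. S (\<pi> i) (\<pi> j)) (matrix_of w) \<or>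
        matches (\<lambda>i j. - S (\<pi> i) (\<pi> j)) (matrix_of w)"
    using w(2) unfolding realizes_def by blast
  define g where "g = inv \<pi> \<circ> f"
  have pg: "\<pi> (g i) = f i" for i
    unfolding g_def using \<pi> by (simp add: bij_def surj_f_inv_f)
  have g: "inj_on g (verts Q)"
    unfolding g_def using f bij_imp_bij_inv[OF \<pi>] by (metis bij_def comp_inj_on inj_on_subset subset_UNIV)
  have sk: "skew (\<lambda>i j. S (\<pi> i) (\<pi> j))" by (rule skew_relabel[OF S])
  have img: "x \<in> g ` verts Q" if "full" "S (\<pi> x) (\<pi> y) \<noteq> 0" for x y
  proof -
    have "\<pi> x \<in> f ` verts Q" using full that by blast
    then obtain i where "i \<in> verts Q" "\<pi> x = f i" by blast
    then have "x = g i" using pg[of i] \<pi> by (metis bij_pointE)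
    then show ?thesis using \<open>i \<in> verts Q\<close> by blast
  qed
  from m show thesis
  proof
    assume "matches (\<lambda>i j. S (\<pi> i) (\<pi> j)) (matrix_of w)"
    then show thesis
      using that[of w g "\<lambda>i j. S (\<pi> i) (\<pi> j)"] w(1) g sk eq img by (simp add: pg)
  next
    assume "matches (\<lambda>i j. - S (\<pi> i) (\<pi> j)) (matrix_of w)"
    then show thesis
      using that[of w g "\<lambda>i j. - S (\<pi> i) (\<pi> j)"] w(1) g skew_uminus[OF sk] eq img by (simp add: pg)
  qed
qed

lemma matches_host_drawable:
  assumes Q: "cluster_quiver Q" and w: "\<forall>a\<in>set w. host_letter a" and f: "inj_on f (verts Q)"
    and T: "matches T (matrix_of w)"
    and eq: "(\<forall>i\<in>verts Q. \<forall>j\<in>verts Q. skew_of Q i j = T (f i) (f j)) \<or>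
       (\<forall>i\<in>verts Q. \<forall>j\<in>verts Q. skew_of Q i j = - T (f i) (f j))"
  shows "drawable_on Q (closed_surface 0)"
proof (rule drawable_on_if_graph_drawing[OF host_drawing Q f subset_UNIV])
  fix i j assume a: "0 < arrows Q i j"
  then have ij: "i \<in> verts Q" "j \<in> verts Q" using cluster_quiverD(2)[OF Q] by blast+
  have "skew_of Q i j \<noteq> 0" using a arrows_eq_nat_skew_of[OF Q, of i j] by auto
  then have "T (f i) (f j) \<noteq> 0" using eq ij by fastforce
  moreover have "allows (entry_of (matrix_of w) (f i) (f j)) (T (f i) (f j))"
    using T unfolding matches_def by blast
  ultimately have "entry_of (matrix_of w) (f i) (f j) \<noteq> Zero" by auto
  then obtain a where "a \<in> set w" "{f i, f j} = {tail_of a, head_of a}"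
    using entry_nonzero_edge by blast
  then show "{f i, f j} \<in> host_graph"
    using w unfolding host_letter_def host_graph_iff by (auto simp: doubleton_eq_iff)
qed

lemma captured_host_drawable:
  assumes Q: "cluster_quiver Q" and C: "\<forall>w\<in>C. \<forall>a\<in>set w. host_letter a" and c: "captured full C Q"
  shows "drawable_on Q (closed_surface 0)"
  by (rule captured_word[OF c]) (use matches_host_drawable[OF Q] C in blast)

section \<open>Genus and isomorphism\<close>

text \<open>
  As the genus is defined by a least number, the drawings on the sphere and on the torus and the
  impossibility of the former determine it.
\<close>

lemma genus_0: "drawable_on Q (closed_surface 0) \<Longrightarrow> genus Q = 0"
  unfolding genus_def by (rule Least_equality) auto

lemma drawable_on_torus:
  assumes Q: "cluster_quiver Q" and c: "card (verts Q) \<le> 7"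
  shows "drawable_on Q (closed_surface 1)"
proof -
  obtain p \<gamma> where G: "graph_drawing (closed_surface 1) {..<7} K7_edges p \<gamma>"
    using K7_on_torus by blast
  obtain f where f: "bij_betw f (verts Q) {0..<card (verts Q)}"
    using ex_bij_betw_finite_nat[OF cluster_quiverD(1)[OF Q]] by blast
  have inj: "inj_on f (verts Q)" and im: "f ` verts Q \<subseteq> {..<7}"
    using f c unfolding bij_betw_def by auto
  show ?thesis
  proof (rule drawable_on_if_graph_drawing[OF G Q inj im])
    fix i j assume a: "0 < arrows Q i j"
    then have ij: "i \<in> verts Q" "j \<in> verts Q" "i \<noteq> j"
      using cluster_quiverD(2,3)[OF Q] by (blast, blast, metis less_irrefl)
    then have "f i < 7" "f j < 7" "f i \<noteq> f j"
      using im inj_onD[OF inj] by auto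
    then show "{f i, f j} \<in> K7_edges" unfolding K7_edges_def by blast
  qed
qed

lemma genus_1:
  assumes "drawable_on Q (closed_surface 1)" "\<not> drawable_on Q (closed_surface 0)"
  shows "genus Q = 1"
  unfolding genus_def
proof (rule Least_equality)
  fix g assume "drawable_on Q (closed_surface g)"
  then show "1 \<le> g" using assms(2) by (cases g) auto
qed (rule assms(1))

text \<open>
  The two lists are the sides of a complete bipartite graph K33.
\<close>

lemma quiver_of_not_drawable:
  assumes e: "\<forall>i\<in>set xs. \<forall>j\<in>set ys. 0 < arrows Q i j \<or> 0 < arrows Q j i"
    and V: "set xs \<union> set ys \<subseteq> verts Q"
    and d: "distinct xs" "distinct ys" "length xs = 3" "length ys = 3" "set xs \<inter> set ys = {}"
  shows "\<not> drawable_on Q (closed_surface 0)"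
proof (rule not_drawable_on_sphere[of "\<lambda>i. xs ! i" "\<lambda>i. ys ! i"])
  have mem: "xs ! i \<in> set xs" "ys ! i \<in> set ys" if "i < 3" for i
    using that d(3,4) by auto
  show "{xs ! i, ys ! j} \<in> underlying_edges Q" if "i < 3" "j < 3" for i j
  proof -
    have "0 < arrows Q (xs ! i) (ys ! j) \<or> 0 < arrows Q (ys ! j) (xs ! i)"
      using bspec[OF bspec[OF e mem(1)[OF that(1)]] mem(2)[OF that(2)]] .
    then show ?thesis
    proof
      assume "0 < arrows Q (xs ! i) (ys ! j)"
      then show ?thesis unfolding underlying_edges_def by blast
    next
      assume "0 < arrows Q (ys ! j) (xs ! i)"
      then have "{ys ! j, xs ! i} \<in> underlying_edges Q" unfolding underlying_edges_def by blast
      then show ?thesis by (simp only: insert_commute)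
    qed
  qed
  show "inj_on (\<lambda>i. xs ! i) {..<3}" "inj_on (\<lambda>i. ys ! i) {..<3}"
    using d by (auto simp: inj_on_def nth_eq_iff_index_eq)
  show "xs ! i \<noteq> ys ! j" if "i < 3" "j < 3" for i j
    using mem(1)[OF that(1)] mem(2)[OF that(2)] d(5) by (metis disjoint_iff)
  show "xs ! i \<in> verts Q \<and> ys ! i \<in> verts Q" if "i < 3" for i
    using mem[OF that] V by blast
qed

lemma quiver_iso_refl: "Q \<cong>\<^sub>q Q"
  unfolding quiver_iso_def by (rule exI[of _ id]) auto

lemma quiver_iso_sym:
  assumes "Q \<cong>\<^sub>q R" shows "R \<cong>\<^sub>q Q"
proof -
  obtain h where h: "bij_betw h (verts Q) (verts R)"
    and ar: "\<forall>i\<in>verts Q. \<forall>j\<in>verts Q. arrows R (h i) (h j) = arrows Q i j"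
    using assms unfolding quiver_iso_def by blast
  define g where "g = inv_into (verts Q) h"
  have g: "bij_betw g (verts R) (verts Q)"
    unfolding g_def by (rule bij_betw_inv_into[OF h])
  have hg: "h (g i) = i" "g i \<in> verts Q" if "i \<in> verts R" for i
    using that h g unfolding g_def by (auto simp: bij_betw_inv_into_right bij_betw_apply)
  have "arrows Q (g i) (g j) = arrows R i j" if "i \<in> verts R" "j \<in> verts R" for i j
    using ar[rule_format, OF hg(2)[OF that(1)] hg(2)[OF that(2)]] hg that by simp
  then show ?thesis unfolding quiver_iso_def using g by blast
qed

lemma quiver_iso_trans:
  assumes "Q \<cong>\<^sub>q R" "R \<cong>\<^sub>q T" shows "Q \<cong>\<^sub>q T"
proof -
  obtain h where h: "bij_betw h (verts Q) (verts R)"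
    and ar: "\<forall>i\<in>verts Q. \<forall>j\<in>verts Q. arrows R (h i) (h j) = arrows Q i j"
    using assms(1) unfolding quiver_iso_def by blast
  obtain k where k: "bij_betw k (verts R) (verts T)"
    and ak: "\<forall>i\<in>verts R. \<forall>j\<in>verts R. arrows T (k i) (k j) = arrows R i j"
    using assms(2) unfolding quiver_iso_def by blast
  have "bij_betw (k \<circ> h) (verts Q) (verts T)" by (rule bij_betw_trans[OF h k])
  moreover have "arrows T ((k \<circ> h) i) ((k \<circ> h) j) = arrows Q i j" if "i \<in> verts Q" "j \<in> verts Q" for i j
    using ar ak that bij_betw_apply[OF h] by simp
  ultimately show ?thesis unfolding quiver_iso_def by blast
qed

lemma iso_class_eq:
  assumes "cluster_quiver Q" "cluster_quiver R" "Q \<cong>\<^sub>q R"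
  shows "iso_class Q = iso_class R"
  using assms quiver_iso_sym quiver_iso_trans unfolding iso_class_def iso_rel_def
  by (auto simp: Image_def) blast+

lemma iso_class_neq:
  assumes "cluster_quiver Q" "cluster_quiver R" "\<not> Q \<cong>\<^sub>q R"
  shows "iso_class Q \<noteq> iso_class R"
proof
  assume "iso_class Q = iso_class R"
  moreover have "R \<in> iso_class R"
    using assms(2) quiver_iso_refl unfolding iso_class_def iso_rel_def by auto
  ultimately have "R \<in> iso_class Q" by simp
  then show False using assms(3) unfolding iso_class_def iso_rel_def by auto
qed

lemma cluster_quiver_opposite: "cluster_quiver Q \<Longrightarrow> cluster_quiver (opposite Q)"
  unfolding cluster_quiver_def opposite_def by auto

lemma quiver_iso_by_list:
  assumes V: "verts Q = {..<n}" "verts R = {..<n}" and p: "length p = n" "set p = {..<n}"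
    and ar: "list_all (\<lambda>i. list_all (\<lambda>j. arrows R (p ! i) (p ! j) = arrows Q i j) [0..<n]) [0..<n]"
  shows "Q \<cong>\<^sub>q R"
  unfolding quiver_iso_def
proof (intro exI[of _ "\<lambda>i. p ! i"] conjI)
  have "distinct p" using p by (metis card_distinct card_lessThan)
  then show "bij_betw ((!) p) (verts Q) (verts R)"
    unfolding V p(2)[symmetric] by (rule bij_betw_nth) (use p V in auto)
  show "\<forall>i\<in>verts Q. \<forall>j\<in>verts Q. arrows R (p ! i) (p ! j) = arrows Q i j"
    using ar unfolding V list_all_iff by auto
qed

text \<open>
  A word without bridges determines its form. If the number of vertices is right and none of the
  vertices of the word is isolated, then the embedding is bijective, and so it is an isomorphism of
  quivers.
\<close>

lemma captured_exact_iso: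
  assumes Q: "cluster_quiver Q" "card (verts Q) = n" and n: "n \<le> 11" and R: "cluster_quiver (quiver_of n as)"
    and occurs: "\<forall>i<n. \<exists>j. (i, j) \<in> set as \<or> (j, i) \<in> set as"
    and f: "inj_on f (verts Q)" and T: "matches T (matrix_of (map oriented as))"
    and eq: "(\<forall>i\<in>verts Q. \<forall>j\<in>verts Q. skew_of Q i j = T (f i) (f j)) \<or>
       (\<forall>i\<in>verts Q. \<forall>j\<in>verts Q. skew_of Q i j = - T (f i) (f j))"
    and full: "\<forall>x y. T x y \<noteq> 0 \<longrightarrow> x \<in> f ` verts Q"
    and definite: "\<forall>x y. entry_of (matrix_of (map oriented as)) x y \<noteq> Free \<and>
       entry_of (matrix_of (map oriented as)) x y \<noteq> Bad"
  shows "Q \<cong>\<^sub>q quiver_of n as \<or> Q \<cong>\<^sub>q opposite (quiver_of n as)"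
proof -
  have small: "i < n \<and> j < n \<and> i \<noteq> j \<and> (j, i) \<notin> set as" if "(i, j) \<in> set as" for i j
  proof -
    have "0 < arrows (quiver_of n as) i j"
      using that unfolding arrows_quiver_of by (metis count_list_0_iff neq0_conv)
    then show ?thesis
      using cluster_quiverD(2)[OF R, of i j] cluster_quiverD(4)[OF R, of i j] cluster_quiverD(3)[OF R, of i]
      by (auto simp: verts_quiver_of arrows_quiver_of count_list_0_iff)
  qed
  have sm: "small_loopless as"
    unfolding small_loopless_def using small n by fastforce
  have "matches (word_form []) (matrix_of [])"
    by (simp add: matches_def word_form_def entry_of_zero)
  from matches_oriented[OF this sm] have W: "matches (word_form as) (matrix_of (map oriented as))"
    by simp
  have same: "allows e x \<Longrightarrow> allows e y \<Longrightarrow> e \<noteq> Free \<Longrightarrow> e \<noteq> Bad \<Longrightarrow> x = y" for e x y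
    by (cases e) auto
  have T_eq: "T x y = word_form as x y" for x y
    using same T W definite unfolding matches_def by blast
  have "nth_node ` {..<n} \<subseteq> f ` verts Q"
  proof
    fix x assume "x \<in> nth_node ` {..<n}"
    then obtain i where i: "i < n" "x = nth_node i" by blast
    then obtain j where j: "(i, j) \<in> set as \<or> (j, i) \<in> set as" using occurs by blast
    then have "j < n" using small by blast
    then have "word_form as x (nth_node j) \<noteq> 0"
      using j i n small[of i j] small[of j i] unfolding word_form_def
      by (auto simp: index_node count_list_0_iff)
    then show "x \<in> f ` verts Q" using full T_eq by metis
  qed
  moreover have "card (f ` verts Q) = card (nth_node ` {..<n})"
    using card_image[OF f] Q(2) card_image[OF inj_on_subset[OF inj_node, of "{..<n}"]] n by simp
  ultimately have img: "f ` verts Q = nth_node ` {..<n}"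
    using cluster_quiverD(1)[OF Q(1)] by (metis card_subset_eq finite_imageI)
  define h where "h = index \<circ> f"
  have "inj_on index (f ` verts Q)" using node_index by (metis inj_onI)
  then have "inj_on h (verts Q)" unfolding h_def using f by (simp add: comp_inj_on)
  moreover have "h ` verts Q = {..<n}"
  proof -
    have "h ` verts Q = index ` nth_node ` {..<n}" unfolding h_def img[symmetric] by (rule image_comp[symmetric])
    also have "\<dots> = {..<n}" using n by (force simp: image_image index_node)
    finally show ?thesis .
  qed
  ultimately have h: "bij_betw h (verts Q) {..<n}" unfolding bij_betw_def by blast
  have wf: "word_form as (f i) (f j) = skew_of (quiver_of n as) (h i) (h j)" for i j
    unfolding word_form_def skew_of_def arrows_quiver_of h_def by simp
  have op: "skew_of (opposite R) i j = - skew_of R i j" for R :: "nat quiver" and i j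
    unfolding skew_of_def opposite_def by simp
  have iso: "Q \<cong>\<^sub>q R" if "verts R = {..<n}" "cluster_quiver R"
    "\<forall>i\<in>verts Q. \<forall>j\<in>verts Q. skew_of Q i j = skew_of R (h i) (h j)" for R :: "nat quiver"
    unfolding quiver_iso_def that(1)
    using h that(3) arrows_eq_nat_skew_of[OF Q(1)] arrows_eq_nat_skew_of[OF that(2)]
    by (intro exI[of _ h]) simp
  from eq show ?thesis
  proof
    assume "\<forall>i\<in>verts Q. \<forall>j\<in>verts Q. skew_of Q i j = T (f i) (f j)"
    then have "Q \<cong>\<^sub>q quiver_of n as"
      using iso[OF verts_quiver_of R] unfolding T_eq wf by blast
    then show ?thesis ..
  next
    assume "\<forall>i\<in>verts Q. \<forall>j\<in>verts Q. skew_of Q i j = - T (f i) (f j)"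
    then have "Q \<cong>\<^sub>q opposite (quiver_of n as)"
      using iso[of "opposite (quiver_of n as)"] cluster_quiver_opposite[OF R] op
      unfolding T_eq wf by (simp add: opposite_def verts_quiver_of)
    then show ?thesis ..
  qed
qed

section \<open>The catalogue is closed under mutation\<close>

lemmas catalogue_defs = catalogue_A_def catalogue_B_def catalogue_C_def catalogue_D_def catalogue_E_def catalogue_F_def catalogue_G_def catalogue_H_def catalogue_I_def catalogue_J_def catalogue_K_def catalogue_L_def catalogue_M_def catalogue_N_def catalogue_O_def catalogue_P_def catalogue_Q_def catalogue_R_def catalogue_S_def catalogue_T_def

lemma closed_catalogue_A: "closed_rows3 catalogue_A"
  by (simp only: eval_simps catalogue_defs cong: if_weak_cong Quad_cong)

lemma closed_catalogue_B: "closed_rows3 catalogue_B"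
  by (simp only: eval_simps catalogue_defs cong: if_weak_cong Quad_cong)

lemma closed_catalogue_C: "closed_rows3 catalogue_C"
  by (simp only: eval_simps catalogue_defs cong: if_weak_cong Quad_cong)

lemma closed_catalogue_D: "closed_rows3 catalogue_D"
  by (simp only: eval_simps catalogue_defs cong: if_weak_cong Quad_cong)

lemma closed_catalogue_E: "closed_rows3 catalogue_E"
  by (simp only: eval_simps catalogue_defs cong: if_weak_cong Quad_cong)

lemma closed_catalogue_F: "closed_rows3 catalogue_F"
  by (simp only: eval_simps catalogue_defs cong: if_weak_cong Quad_cong)

lemma closed_catalogue_G: "closed_rows3 catalogue_G"
  by (simp only: eval_simps catalogue_defs cong: if_weak_cong Quad_cong)

lemma closed_catalogue_H: "closed_rows3 catalogue_H"
  by (simp only: eval_simps catalogue_defs cong: if_weak_cong Quad_cong)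

lemma closed_catalogue_I: "closed_rows3 catalogue_I"
  by (simp only: eval_simps catalogue_defs cong: if_weak_cong Quad_cong)

lemma closed_catalogue_J: "closed_rows3 catalogue_J"
  by (simp only: eval_simps catalogue_defs cong: if_weak_cong Quad_cong)

lemma closed_catalogue_K: "closed_rows3 catalogue_K"
  by (simp only: eval_simps catalogue_defs cong: if_weak_cong Quad_cong)

lemma closed_catalogue_L: "closed_rows3 catalogue_L"
  by (simp only: eval_simps catalogue_defs cong: if_weak_cong Quad_cong)

lemma closed_catalogue_M: "closed_rows3 catalogue_M"
  by (simp only: eval_simps catalogue_defs cong: if_weak_cong Quad_cong)

lemma closed_catalogue_N: "closed_rows3 catalogue_N"
  by (simp only: eval_simps catalogue_defs cong: if_weak_cong Quad_cong)

lemma closed_catalogue_O: "closed_rows3 catalogue_O"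
  by (simp only: eval_simps catalogue_defs cong: if_weak_cong Quad_cong)

lemma closed_catalogue_P: "closed_rows3 catalogue_P"
  by (simp only: eval_simps catalogue_defs cong: if_weak_cong Quad_cong)

lemma closed_catalogue_Q: "closed_rows3 catalogue_Q"
  by (simp only: eval_simps catalogue_defs cong: if_weak_cong Quad_cong)

lemma closed_catalogue_R: "closed_rows3 catalogue_R"
  by (simp only: eval_simps catalogue_defs cong: if_weak_cong Quad_cong)

lemma closed_catalogue_S: "closed_rows3 catalogue_S"
  by (simp only: eval_simps catalogue_defs cong: if_weak_cong Quad_cong)

lemma closed_catalogue_T: "closed_rows3 catalogue_T"
  by (simp only: eval_simps catalogue_defs cong: if_weak_cong Quad_cong)

lemmas closed_catalogues =
  closed_catalogue_A closed_catalogue_B closed_catalogue_C closed_catalogue_D closed_catalogue_E closed_catalogue_F closed_catalogue_G closed_catalogue_H closed_catalogue_I closed_catalogue_J closed_catalogue_K closed_catalogue_L closed_catalogue_M closed_catalogue_N closed_catalogue_O closed_catalogue_P closed_catalogue_Q closed_catalogue_R closed_catalogue_S closed_catalogue_T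

definition rows :: "string set" where
  "rows = {pick_char c (catalogue_of d) | c d. True}"

lemma closed_rows1_pick: "closed_rows1 q \<Longrightarrow> closed_row (pick a b q)"
  by (cases q; cases a; cases b; simp)

lemma closed_rows2_pick: "closed_rows2 q \<Longrightarrow> closed_rows1 (pick a b q)"
  by (cases q; cases a; cases b; simp)

lemma closed_rows3_pick: "closed_rows3 q \<Longrightarrow> closed_rows2 (pick a b q)"
  by (cases q; cases a; cases b; simp)

lemma closed_catalogue_of: "closed_rows3 (catalogue_of d)"
  unfolding catalogue_of_def using closed_catalogues by (simp split: if_split)

lemma closed_row_mem:
  assumes "s \<in> rows" shows "closed_row s"
proof -
  obtain c d where s: "s = pick_char c (catalogue_of d)"
    using assms unfolding rows_def by blast
  obtain b0 b1 b2 b3 b4 b5 b6 b7 where c: "c = Char b0 b1 b2 b3 b4 b5 b6 b7" by (cases c)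
  show ?thesis
    unfolding s c pick_char.simps by (intro closed_rows1_pick closed_rows2_pick closed_rows3_pick closed_catalogue_of)
qed

definition E_words :: "letter list set" where
  "E_words = letters ` rows"

lemma pick_E_words: "letters (pick_char c (catalogue_of d)) \<in> E_words"
  unfolding E_words_def rows_def by blast

lemma target_word_decode_target: "target_word (decode_target c w) = w"
  by (cases c) simp

lemma targets_E_words: "t \<in> set (targets s) \<Longrightarrow> target_word t \<in> E_words"
  by (induction s rule: targets.induct) (auto simp: target_word_decode_target pick_E_words)

lemma E_words_host: "w \<in> E_words \<Longrightarrow> a \<in> set w \<Longrightarrow> host_letter a"
  unfolding E_words_def using host_letters(1) by blast

lemma closed_words_if_closed_under:
  assumes "\<And>w. w \<in> C \<Longrightarrow> \<exists>ts. closed_under w ts \<and> (\<forall>t\<in>set ts. target_word t \<in> C)"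
    and loop: "\<And>w a. w \<in> C \<Longrightarrow> a \<in> set w \<Longrightarrow> loopless a"
  shows "closed_words C"
  unfolding closed_words_def
proof (intro ballI allI impI, elim conjE)
  fix w S k assume w: "w \<in> C" and S: "skew S" "matches S (matrix_of w)"
  obtain ts where ts: "closed_under w ts" "\<forall>t\<in>set ts. target_word t \<in> C"
    using assms(1)[OF w] by blast
  have "\<exists>w'\<in>insert w (target_word ` set ts). realizes (mut k S) w'"
    by (rule closed_under_sound[OF ts(1) _ _ S]) (use loop w ts(2) in blast)+
  then show "\<exists>w'\<in>C. realizes (mut k S) w'"
    using w ts(2) by blast
qed

lemma closed_E_words: "closed_words E_words"
proof (rule closed_words_if_closed_under)
  fix w assume "w \<in> E_words"
  then obtain s where s: "s \<in> rows" "w = letters s" unfolding E_words_def by blast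
  then have "closed_under w (targets (moves s))" using closed_row_mem unfolding closed_row_def by blast
  then show "\<exists>ts. closed_under w ts \<and> (\<forall>t\<in>set ts. target_word t \<in> E_words)"
    using targets_E_words by blast
qed (use E_words_host host_letter_loopless in blast)

section \<open>The initial quivers of the nine types E\<close>

lemma node_numeral: "nth_node 0 = N0" "nth_node 1 = N1" "nth_node 2 = N2" "nth_node 3 = N3" "nth_node 4 = N4" "nth_node 5 = N5"
  "nth_node 6 = N6" "nth_node 7 = N7" "nth_node 8 = N8" "nth_node 9 = N9" "nth_node 10 = N10"
  by (simp_all add: nth_node.simps)

lemmas init_simps = elliptic_core_def X_block_def Let_def list.map oriented.simps unoriented.simps node_numeral

lemma hit_E6_11:
  "hits (Target False N2 (letters (pick_char (CHR ''y'') (catalogue_of (CHR ''S'')))))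
     (matrix_of (map oriented elliptic_core @ map unoriented [(2,5), (3,6), (4,7)]))"
  by (simp only: init_simps eval_simps catalogue_defs cong: if_weak_cong Quad_cong)

lemma hit_E7_11:
  "hits (Target False N3 (letters (pick_char (CHR ''m'') (catalogue_of (CHR ''Q'')))))
     (matrix_of (map oriented elliptic_core @ map unoriented [(3,5), (5,6), (4,7), (7,8)]))"
  by (simp only: init_simps eval_simps catalogue_defs cong: if_weak_cong Quad_cong)

lemma hit_E8_11:
  "hits (Target False N2 (letters (pick_char (CHR ''G'') (catalogue_of (CHR ''G'')))))
     (matrix_of (map oriented elliptic_core @ map unoriented [(3,5), (4,6), (6,7), (7,8), (8,9)]))"
  by (simp only: init_simps eval_simps catalogue_defs cong: if_weak_cong Quad_cong)

lemma orientations_no_reverse: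
  "bs \<in> orientations es \<Longrightarrow> disjoint_edges es \<Longrightarrow> \<forall>(i, j)\<in>set es. i \<noteq> j \<Longrightarrow>
     (i, j) \<in> set bs \<Longrightarrow> (j, i) \<notin> set bs"
proof (induction es arbitrary: bs)
  case (Cons e es)
  obtain p q where e: "e = (p, q)" by (cases e)
  obtain cs where cs: "cs \<in> orientations es" "bs = (p, q) # cs \<or> bs = (q, p) # cs"
    using Cons.prems(1) unfolding e orientations_Cons by blast
  have new: "(p, q) \<notin> set cs" "(q, p) \<notin> set cs" and dis: "disjoint_edges es" and ne: "p \<noteq> q"
    using orientations_mem[OF cs(1)] Cons.prems(2,3) unfolding e by auto
  have "(i, j) \<in> set cs \<Longrightarrow> (j, i) \<notin> set cs"
    using Cons.IH[OF cs(1) dis] Cons.prems(3) by auto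
  then show ?case
    using cs(2) Cons.prems(4) new ne by auto
qed (simp add: orientations_Nil)

definition wellformed :: "nat \<Rightarrow> (nat \<times> nat) list \<Rightarrow> (nat \<times> nat) list \<Rightarrow> bool" where
  "wellformed n as es \<longleftrightarrow> n \<le> 11 \<and> disjoint_edges es \<and>
     (\<forall>(i, j)\<in>set as. i < n \<and> j < n \<and> i \<noteq> j \<and> (j, i) \<notin> set as) \<and>
     (\<forall>(i, j)\<in>set es. i < n \<and> j < n \<and> i \<noteq> j \<and> (i, j) \<notin> set as \<and> (j, i) \<notin> set as)"

lemma wellformed_range:
  assumes w: "wellformed n as es" and bs: "bs \<in> orientations es" and ij: "(i, j) \<in> set (as @ bs)"
  shows "i < n \<and> j < n \<and> i \<noteq> j \<and> (j, i) \<notin> set (as @ bs)"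
proof -
  have es: "i < n \<and> j < n \<and> i \<noteq> j \<and> (i, j) \<notin> set as \<and> (j, i) \<notin> set as" if "(i, j) \<in> set bs" for i j
    using orientations_mem[OF bs that] w unfolding wellformed_def by fastforce
  have as: "i < n \<and> j < n \<and> i \<noteq> j \<and> (j, i) \<notin> set as" if "(i, j) \<in> set as" for i j
    using that w unfolding wellformed_def by fastforce
  have bb: "(i, j) \<in> set bs \<Longrightarrow> (j, i) \<notin> set bs" for i j
    by (rule orientations_no_reverse[OF bs]) (use w in \<open>auto simp: wellformed_def\<close>)
  from ij consider "(i, j) \<in> set as" | "(i, j) \<in> set bs" by auto
  then show ?thesis
  proof cases
    case 1
    then show ?thesis using as[OF 1] es[of j i] by auto
  next
    case 2
    then show ?thesis using es[OF 2] bb[OF 2] by auto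
  qed
qed

lemma initial_captured:
  assumes w: "wellformed n as es" and Q: "Q \<in> quivers_with n as es"
    and h: "hits t (matrix_of (map oriented as @ map unoriented es))"
    and t: "target_word t \<in> C" "\<forall>a\<in>set (target_word t). loopless a"
  shows "cluster_quiver Q \<and> captured full C Q \<and> card (verts Q) = n"
proof -
  obtain bs where bs: "bs \<in> orientations es" and Q: "Q = quiver_of n (as @ bs)"
    using Q unfolding quivers_with_def by blast
  have sm: "small_loopless as" "small_loopless es"
    using w unfolding wellformed_def small_loopless_def by fastforce+
  have m: "matches (word_form (as @ bs)) (matrix_of (map oriented as @ map unoriented es))"
    by (rule matches_oriented[OF matches_unoriented[OF bs sm(2)] sm(1)]) (use w in \<open>auto simp: wellformed_def\<close>)
  have n: "n \<le> 11" using w by (simp add: wellformed_def)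
  have range: "\<forall>(i, j)\<in>set (as @ bs). i < n \<and> j < n \<and> i \<noteq> j \<and> (j, i) \<notin> set (as @ bs)"
    using wellformed_range[OF w bs] by blast
  then have "\<forall>(i, j)\<in>set (as @ bs). i < n \<and> j < n"
    by blast
  then have "captured full C Q"
    unfolding Q by (rule captured_quiver_of[OF n m h t])
  moreover have "cluster_quiver Q"
    unfolding Q by (rule cluster_quiver_of[OF range])
  ultimately show ?thesis unfolding Q verts_quiver_of by simp
qed

lemma E_target:
  assumes "w = letters (pick_char c (catalogue_of d))"
  shows "target_word (Target b x w) \<in> E_words" "\<forall>a\<in>set (target_word (Target b x w)). loopless a"
proof -
  show *: "target_word (Target b x w) \<in> E_words"
    using assms pick_E_words by simp
  show "\<forall>a\<in>set (target_word (Target b x w)). loopless a"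
    using E_words_host[OF *] host_letter_loopless by blast
qed

lemma wellformed_E:
  "wellformed 8 elliptic_core [(2,5), (3,6), (4,7)]"
  "wellformed 9 elliptic_core [(3,5), (5,6), (4,7), (7,8)]"
  "wellformed 10 elliptic_core [(3,5), (4,6), (6,7), (7,8), (8,9)]"
  by (simp_all add: wellformed_def elliptic_core_def Let_def)

text \<open>
  The arms of the elliptic quivers consist of bridges, so that a single word covers all orientations.
\<close>

lemma captured_elliptic:
  "Q \<in> initial_quivers E6_11 \<Longrightarrow> cluster_quiver Q \<and> captured False E_words Q"
  "Q \<in> initial_quivers E7_11 \<Longrightarrow> cluster_quiver Q \<and> captured False E_words Q"
  "Q \<in> initial_quivers E8_11 \<Longrightarrow> cluster_quiver Q \<and> captured False E_words Q"
  using initial_captured[OF wellformed_E(1) _ hit_E6_11 E_target[OF refl]]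
    initial_captured[OF wellformed_E(2) _ hit_E7_11 E_target[OF refl]]
    initial_captured[OF wellformed_E(3) _ hit_E8_11 E_target[OF refl]]
  by auto

lemma mem_quivers_with: "bs \<in> orientations es \<Longrightarrow> quiver_of n (as @ bs) \<in> quivers_with n as es"
  unfolding quivers_with_def by blast

text \<open>
  One orientation of the tree is found as a full subquiver of an elliptic quiver; all the others are
  reached from it by reflections.
\<close>

lemma captured_tree_type:
  assumes t: "leaf_tree n (rev es)" and bs: "bs \<in> orientations es"
    and cl: "cluster_quiver (quiver_of n bs)"
    and E: "captured False E_words (quiver_of m cs)"
    and g: "length g = n" "distinct g" "set g \<subseteq> {..<m}"
    and eq: "list_all (\<lambda>i. list_all (\<lambda>j. count_list bs (i, j) = count_list cs (g ! i, g ! j)) [0..<n]) [0..<n]"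
    and Q: "Q \<in> quivers_with n [] es"
  shows "cluster_quiver Q \<and> captured False E_words Q"
proof -
  have "captured False E_words (quiver_of n bs)"
  proof (rule captured_subquiver[OF E])
    show "inj_on (\<lambda>i. g ! i) (verts (quiver_of n bs))"
      using g by (auto simp: verts_quiver_of inj_on_def nth_eq_iff_index_eq)
    show "(\<lambda>i. g ! i) ` verts (quiver_of n bs) \<subseteq> verts (quiver_of m cs)"
      using g nth_mem unfolding verts_quiver_of by fastforce
    show "\<forall>i\<in>verts (quiver_of n bs). \<forall>j\<in>verts (quiver_of n bs).
        skew_of (quiver_of n bs) i j = skew_of (quiver_of m cs) (g ! i) (g ! j)"
      using eq unfolding verts_quiver_of skew_of_def arrows_quiver_of list_all_iff by auto
  qed
  from captured_tree[OF closed_E_words t bs this cl] show ?thesis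
    using Q unfolding quivers_with_def by auto
qed

lemma in_orientations: "bs \<in> orientations es \<longleftrightarrow> list_all2 (\<lambda>(i, j) a. a = (i, j) \<or> a = (j, i)) es bs"
  unfolding orientations_def by simp

lemma E8_11_example: "captured False E_words (quiver_of 10 (elliptic_core @ [(3,5), (4,6), (6,7), (7,8), (8,9)]))"
  and E7_11_example: "captured False E_words (quiver_of 9 (elliptic_core @ [(3,5), (5,6), (4,7), (7,8)]))"
  and E6_11_example: "captured False E_words (quiver_of 8 (elliptic_core @ [(2,5), (3,6), (4,7)]))"
  by (rule captured_elliptic(3)[THEN conjunct2] captured_elliptic(2)[THEN conjunct2] captured_elliptic(1)[THEN conjunct2],
      simp add: mem_quivers_with in_orientations)+

text \<open>
  Without the vertex \<open>u\<close> an elliptic quiver is a star with three arms, of lengths (2, 2, 2), (1, 3, 3) and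
  (1, 2, 5), which are the extended Dynkin trees. The lists tell where the vertices of the tree go.
\<close>

lemma captured_trees:
  "Q \<in> initial_quivers E6 \<Longrightarrow> cluster_quiver Q \<and> captured False E_words Q"
  "Q \<in> initial_quivers E7 \<Longrightarrow> cluster_quiver Q \<and> captured False E_words Q"
  "Q \<in> initial_quivers E8 \<Longrightarrow> cluster_quiver Q \<and> captured False E_words Q"
  "Q \<in> initial_quivers E6_1 \<Longrightarrow> cluster_quiver Q \<and> captured False E_words Q"
  "Q \<in> initial_quivers E7_1 \<Longrightarrow> cluster_quiver Q \<and> captured False E_words Q"
  "Q \<in> initial_quivers E8_1 \<Longrightarrow> cluster_quiver Q \<and> captured False E_words Q"
proof -
  show "Q \<in> initial_quivers E6 \<Longrightarrow> cluster_quiver Q \<and> captured False E_words Q"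
    by (rule captured_tree_type[OF _ _ _ E8_11_example, of _ _ "[(1,0), (2,1), (2,3), (3,4), (2,5)]" "[5, 3, 1, 4, 6, 2]"])
      (simp_all add: in_orientations cluster_quiver_of elliptic_core_def Let_def upt_rec)
  show "Q \<in> initial_quivers E7 \<Longrightarrow> cluster_quiver Q \<and> captured False E_words Q"
    by (rule captured_tree_type[OF _ _ _ E8_11_example, of _ _ "[(1,0), (2,1), (2,3), (3,4), (4,5), (2,6)]" "[5, 3, 1, 4, 6, 7, 2]"])
      (simp_all add: in_orientations cluster_quiver_of elliptic_core_def Let_def upt_rec)
  show "Q \<in> initial_quivers E8 \<Longrightarrow> cluster_quiver Q \<and> captured False E_words Q"
    by (rule captured_tree_type[OF _ _ _ E8_11_example, of _ _ "[(1,0), (2,1), (2,3), (3,4), (4,5), (5,6), (2,7)]" "[5, 3, 1, 4, 6, 7, 8, 2]"])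
      (simp_all add: in_orientations cluster_quiver_of elliptic_core_def Let_def upt_rec)
  show "Q \<in> initial_quivers E8_1 \<Longrightarrow> cluster_quiver Q \<and> captured False E_words Q"
    by (rule captured_tree_type[OF _ _ _ E8_11_example, of _ _ "[(1,0), (2,1), (2,3), (3,4), (4,5), (5,6), (6,7), (2,8)]" "[5, 3, 1, 4, 6, 7, 8, 9, 2]"])
      (simp_all add: in_orientations cluster_quiver_of elliptic_core_def Let_def upt_rec)
  show "Q \<in> initial_quivers E6_1 \<Longrightarrow> cluster_quiver Q \<and> captured False E_words Q"
    by (rule captured_tree_type[OF _ _ _ E6_11_example, of _ _ "[(1,0), (2,1), (2,3), (3,4), (2,5), (5,6)]" "[5, 2, 1, 3, 6, 4, 7]"])
      (simp_all add: in_orientations cluster_quiver_of elliptic_core_def Let_def upt_rec)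
  show "Q \<in> initial_quivers E7_1 \<Longrightarrow> cluster_quiver Q \<and> captured False E_words Q"
    by (rule captured_tree_type[OF _ _ _ E7_11_example, of _ _ "[(1,0), (2,1), (3,2), (3,4), (4,5), (5,6), (3,7)]" "[6, 5, 3, 1, 4, 7, 8, 2]"])
      (simp_all add: in_orientations cluster_quiver_of elliptic_core_def Let_def upt_rec)
qed

section \<open>The mutation classes X6 and X7\<close>

definition arrows_A :: "(nat \<times> nat) list" where
  "arrows_A = [(0,3), (0,4), (1,0), (2,0), (5,0), (3,5), (4,5), (1,3), (2,4), (3,2), (4,1)]"
definition arrows_C :: "(nat \<times> nat) list" where
  "arrows_C = [(1,0), (2,0), (0,5), (5,3), (5,4), (1,3), (3,2), (2,4), (4,1)]"
definition arrows_D :: "(nat \<times> nat) list" where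
  "arrows_D = [(1,0), (2,0), (3,0), (0,4), (0,5), (0,6), (1,4), (2,5), (3,6),
     (4,2), (4,3), (5,1), (5,3), (6,1), (6,2)]"

lemma quivers_ACD: "quiver_A = quiver_of 6 arrows_A" "quiver_C = quiver_of 6 arrows_C"
  "quiver_D = quiver_of 7 arrows_D"
  unfolding quiver_A_def quiver_C_def quiver_D_def arrows_A_def arrows_C_def arrows_D_def Let_def
  by (auto simp: quiver_of_def fun_eq_iff)

definition word_X6 :: "letter list" where
  "word_X6 = [Arrow N1 N2, Arrow N1 N2, Arrow N0 N1, Arrow N2 N0, Arrow N7 N0, Arrow N4 N7, Arrow N0 N4,
     Arrow N4 N7, Bridge N0 N10]"
definition word_X7 :: "letter list" where
  "word_X7 = [Arrow N1 N3, Arrow N1 N0, Arrow N4 N1, Arrow N3 N4, Arrow N3 N4, Arrow N9 N1, Arrow N5 N9,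
     Arrow N5 N9, Arrow N1 N5, Arrow N2 N1, Arrow N0 N2, Arrow N0 N2]"

abbreviation "word_A \<equiv> map oriented arrows_A"
abbreviation "word_C \<equiv> map oriented arrows_C"
abbreviation "word_D \<equiv> map oriented arrows_D"

lemmas X_simps = word_X6_def word_X7_def arrows_A_def arrows_C_def arrows_D_def init_simps eval_simps

lemma closed_X6:
  "closed_under word_X6 [Target False N0 word_A, Target True N0 word_A, Target False N2 word_X6,
     Target False N2 word_X6, Target False N1 word_X6, Target False N1 word_X6]"
  by (simp only: X_simps cong: if_weak_cong)

lemma closed_A:
  "closed_under word_A [Target False N1 word_X6, Target True N3 word_A, Target True N4 word_A,
     Target True N1 word_A, Target True N2 word_A, Target False N1 word_C]"
  by (simp only: X_simps cong: if_weak_cong)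

lemma closed_C:
  "closed_under word_C [Target True N5 word_A, Target False N4 word_A, Target False N3 word_A,
     Target True N2 word_A, Target True N1 word_A, Target False N0 word_A]"
  by (simp only: X_simps cong: if_weak_cong)

lemma closed_X7:
  "closed_under word_X7 [Target False N1 word_X7, Target False N0 word_D, Target False N1 word_X7,
     Target False N1 word_X7, Target False N1 word_X7, Target False N1 word_X7, Target False N1 word_X7]"
  by (simp only: X_simps cong: if_weak_cong)

lemma closed_D:
  "closed_under word_D [Target False N0 word_X7, Target False N0 word_D, Target False N6 word_D,
     Target False N5 word_D, Target True N0 word_D, Target True N3 word_D, Target True N2 word_D]"
  by (simp only: X_simps cong: if_weak_cong)

lemma loopless_X: "\<forall>a\<in>set word_X6. loopless a" "\<forall>a\<in>set word_X7. loopless a"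
  "\<forall>a\<in>set word_A. loopless a" "\<forall>a\<in>set word_C. loopless a" "\<forall>a\<in>set word_D. loopless a"
  by (simp_all add: word_X6_def word_X7_def arrows_A_def arrows_C_def arrows_D_def nth_node.simps)

lemma closed_X6_words: "closed_words {word_X6, word_A, word_C}"
  by (rule closed_words_if_closed_under) (use closed_X6 closed_A closed_C loopless_X in \<open>fastforce+\<close>)

lemma closed_X7_words: "closed_words {word_X7, word_D}"
  by (rule closed_words_if_closed_under) (use closed_X7 closed_D loopless_X in \<open>fastforce+\<close>)

lemma hit_X6: "hits (Target False N1 word_X6) (matrix_of (map oriented (X_block 0 1 2 @ X_block 0 3 4) @ map unoriented [(0,5)]))"
  by (simp only: X_simps cong: if_weak_cong)

lemma hit_X7: "hits (Target False N0 word_X7)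
   (matrix_of (map oriented (X_block 0 1 2 @ X_block 0 3 4 @ X_block 0 5 6) @ map unoriented []))"
  by (simp only: X_simps cong: if_weak_cong)

lemma wellformed_X: "wellformed 6 (X_block 0 1 2 @ X_block 0 3 4) [(0,5)]"
  "wellformed 7 (X_block 0 1 2 @ X_block 0 3 4 @ X_block 0 5 6) []"
  by (simp_all add: wellformed_def X_block_def)

lemma captured_X:
  "Q \<in> initial_quivers X6 \<Longrightarrow> cluster_quiver Q \<and> captured True {word_X6, word_A, word_C} Q \<and> card (verts Q) = 6"
  "Q \<in> initial_quivers X7 \<Longrightarrow> cluster_quiver Q \<and> captured True {word_X7, word_D} Q \<and> card (verts Q) = 7"
  using initial_captured[OF wellformed_X(1) _ hit_X6, of Q "{word_X6, word_A, word_C}" True] loopless_X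
    initial_captured[OF wellformed_X(2) _ hit_X7, of Q "{word_X7, word_D}" True]
  by auto

lemma host_X: "\<forall>a\<in>set word_X6. host_letter a" "\<forall>a\<in>set word_X7. host_letter a"
  by (simp_all add: word_X6_def word_X7_def host_letter_def host_edges_def)

lemma cluster_ACD: "cluster_quiver quiver_A" "cluster_quiver quiver_B" "cluster_quiver quiver_C" "cluster_quiver quiver_D"
proof -
  show "cluster_quiver quiver_A" "cluster_quiver quiver_C" "cluster_quiver quiver_D"
    unfolding quivers_ACD arrows_A_def arrows_C_def arrows_D_def by (rule cluster_quiver_of, simp)+
  then show "cluster_quiver quiver_B" unfolding quiver_B_def by (intro cluster_quiver_opposite)
qed

fun is_definite :: "entry \<Rightarrow> bool" where
  "is_definite Free = False" | "is_definite Bad = False" | "is_definite Zero = True"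
| "is_definite Out1 = True" | "is_definite Out2 = True" | "is_definite In1 = True" | "is_definite In2 = True"

lemma definite_ACD:
  "\<forall>x y. entry_of (matrix_of word_A) x y \<noteq> Free \<and> entry_of (matrix_of word_A) x y \<noteq> Bad"
  "\<forall>x y. entry_of (matrix_of word_C) x y \<noteq> Free \<and> entry_of (matrix_of word_C) x y \<noteq> Bad"
  "\<forall>x y. entry_of (matrix_of word_D) x y \<noteq> Free \<and> entry_of (matrix_of word_D) x y \<noteq> Bad"
proof -
  have "list_all (\<lambda>x. list_all (\<lambda>y. is_definite (entry_of (matrix_of w) x y)) nodes) nodes \<Longrightarrow>
     \<forall>x y. entry_of (matrix_of w) x y \<noteq> Free \<and> entry_of (matrix_of w) x y \<noteq> Bad" for w
    unfolding list_all_iff set_nodes by (metis UNIV_I is_definite.simps(1,2))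
  note * = this
  show "\<forall>x y. entry_of (matrix_of word_A) x y \<noteq> Free \<and> entry_of (matrix_of word_A) x y \<noteq> Bad"
    "\<forall>x y. entry_of (matrix_of word_C) x y \<noteq> Free \<and> entry_of (matrix_of word_C) x y \<noteq> Bad"
    "\<forall>x y. entry_of (matrix_of word_D) x y \<noteq> Free \<and> entry_of (matrix_of word_D) x y \<noteq> Bad"
    by (rule *, code_simp)+
qed

lemma occurs_ACD:
  "\<forall>i<6. \<exists>j. (i, j) \<in> set arrows_A \<or> (j, i) \<in> set arrows_A"
  "\<forall>i<6. \<exists>j. (i, j) \<in> set arrows_C \<or> (j, i) \<in> set arrows_C"
  "\<forall>i<7. \<exists>j. (i, j) \<in> set arrows_D \<or> (j, i) \<in> set arrows_D"
proof -
  have list: "\<forall>i<n. \<exists>j. (i, j) \<in> set as \<or> (j, i) \<in> set as"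
    if "list_all (\<lambda>i. list_ex (\<lambda>(p, q). p = i \<or> q = i) as) [0..<n]"
    for n and as :: "(nat \<times> nat) list"
    using that unfolding list_all_iff list_ex_iff by fastforce
  show "\<forall>i<6. \<exists>j. (i, j) \<in> set arrows_A \<or> (j, i) \<in> set arrows_A"
    "\<forall>i<6. \<exists>j. (i, j) \<in> set arrows_C \<or> (j, i) \<in> set arrows_C"
    "\<forall>i<7. \<exists>j. (i, j) \<in> set arrows_D \<or> (j, i) \<in> set arrows_D"
    by (rule list, code_simp)+
qed

lemma opposite_C: "opposite quiver_C \<cong>\<^sub>q quiver_C"
  by (rule quiver_iso_by_list[of _ 6 _ "[1, 0, 3, 2, 5, 4]"])
    (auto simp: opposite_def quivers_ACD verts_quiver_of arrows_quiver_of arrows_C_def upt_rec)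

lemma opposite_D: "opposite quiver_D \<cong>\<^sub>q quiver_D"
  by (rule quiver_iso_by_list[of _ 7 _ "[0, 4, 5, 6, 1, 2, 3]"])
    (auto simp: opposite_def quivers_ACD verts_quiver_of arrows_quiver_of arrows_D_def upt_rec)

section \<open>The non-planar quivers\<close>

lemma E_class_drawable:
  assumes "T \<notin> {X6, X7}" "Q \<in> mutation_class T"
  shows "drawable_on Q (closed_surface 0)"
proof -
  obtain S where S: "S \<in> initial_quivers T" "mutation_equivalent S Q" and Q: "cluster_quiver Q"
    using assms(2) unfolding mutation_class_def by blast
  have "cluster_quiver S \<and> captured False E_words S"
    using assms(1) S(1) captured_trees captured_elliptic by (cases T) blast+
  then have "captured False E_words Q"
    using captured_mutation_equivalent(1)[OF closed_E_words _ _ S(2)] by blast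
  then show ?thesis
    using captured_host_drawable[OF Q] E_words_host by blast
qed

lemma X6_class_cases:
  assumes "Q \<in> mutation_class X6"
  shows "drawable_on Q (closed_surface 0) \<or> Q \<cong>\<^sub>q quiver_A \<or> Q \<cong>\<^sub>q quiver_B \<or> Q \<cong>\<^sub>q quiver_C"
proof -
  obtain S where S: "S \<in> initial_quivers X6" "mutation_equivalent S Q" and Q: "cluster_quiver Q"
    using assms unfolding mutation_class_def by blast
  note cS = captured_X(1)[OF S(1)]
  have c: "captured True {word_X6, word_A, word_C} Q" and card: "card (verts Q) = 6"
    using captured_mutation_equivalent[OF closed_X6_words _ _ S(2)] cS by auto
  obtain w f T where w: "w \<in> {word_X6, word_A, word_C}" and f: "inj_on f (verts Q)"
    and T: "matches T (matrix_of w)"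
    and eq: "(\<forall>i\<in>verts Q. \<forall>j\<in>verts Q. skew_of Q i j = T (f i) (f j)) \<or>
     (\<forall>i\<in>verts Q. \<forall>j\<in>verts Q. skew_of Q i j = - T (f i) (f j))"
    and full: "\<forall>x y. T x y \<noteq> 0 \<longrightarrow> x \<in> f ` verts Q"
    by (rule captured_word[OF c]) blast
  from w consider "w = word_X6" | "w = word_A" | "w = word_C" by blast
  then show ?thesis
  proof cases
    case 1
    then show ?thesis using matches_host_drawable[OF Q _ f T eq] host_X(1) by blast
  next
    case 2
    have "Q \<cong>\<^sub>q quiver_A \<or> Q \<cong>\<^sub>q opposite quiver_A"
      unfolding quivers_ACD
      by (rule captured_exact_iso[OF Q card _ _ occurs_ACD(1) f T[unfolded 2] eq full definite_ACD(1)])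
        (use cluster_ACD(1) in \<open>simp_all add: quivers_ACD\<close>)
    then show ?thesis unfolding quiver_B_def by blast
  next
    case 3
    have "Q \<cong>\<^sub>q quiver_C \<or> Q \<cong>\<^sub>q opposite quiver_C"
      unfolding quivers_ACD
      by (rule captured_exact_iso[OF Q card _ _ occurs_ACD(2) f T[unfolded 3] eq full definite_ACD(2)])
        (use cluster_ACD(3) in \<open>simp_all add: quivers_ACD\<close>)
    then show ?thesis using quiver_iso_trans[OF _ opposite_C] by blast
  qed
qed

lemma X7_class_cases:
  assumes "Q \<in> mutation_class X7"
  shows "drawable_on Q (closed_surface 0) \<or> Q \<cong>\<^sub>q quiver_D"
proof -
  obtain S where S: "S \<in> initial_quivers X7" "mutation_equivalent S Q" and Q: "cluster_quiver Q"
    using assms unfolding mutation_class_def by blast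
  note cS = captured_X(2)[OF S(1)]
  have c: "captured True {word_X7, word_D} Q" and card: "card (verts Q) = 7"
    using captured_mutation_equivalent[OF closed_X7_words _ _ S(2)] cS by auto
  obtain w f T where w: "w \<in> {word_X7, word_D}" and f: "inj_on f (verts Q)"
    and T: "matches T (matrix_of w)"
    and eq: "(\<forall>i\<in>verts Q. \<forall>j\<in>verts Q. skew_of Q i j = T (f i) (f j)) \<or>
     (\<forall>i\<in>verts Q. \<forall>j\<in>verts Q. skew_of Q i j = - T (f i) (f j))"
    and full: "\<forall>x y. T x y \<noteq> 0 \<longrightarrow> x \<in> f ` verts Q"
    by (rule captured_word[OF c]) blast
  from w consider "w = word_X7" | "w = word_D" by blast
  then show ?thesis
  proof cases
    case 1
    then show ?thesis using matches_host_drawable[OF Q _ f T eq] host_X(2) by blast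
  next
    case 2
    have "Q \<cong>\<^sub>q quiver_D \<or> Q \<cong>\<^sub>q opposite quiver_D"
      unfolding quivers_ACD
      by (rule captured_exact_iso[OF Q card _ _ occurs_ACD(3) f T[unfolded 2] eq full definite_ACD(3)])
        (use cluster_ACD(4) in \<open>simp_all add: quivers_ACD\<close>)
    then show ?thesis using quiver_iso_trans[OF _ opposite_D] by blast
  qed
qed

lemma nondrawable_ABCD:
  "\<not> drawable_on quiver_A (closed_surface 0)" "\<not> drawable_on quiver_B (closed_surface 0)"
  "\<not> drawable_on quiver_C (closed_surface 0)" "\<not> drawable_on quiver_D (closed_surface 0)"
proof -
  show "\<not> drawable_on quiver_A (closed_surface 0)"
    by (rule quiver_of_not_drawable[of "[0, 3, 4]" "[1, 2, 5]"])
      (simp_all add: quivers_ACD verts_quiver_of arrows_quiver_of arrows_A_def)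
  show "\<not> drawable_on quiver_B (closed_surface 0)"
    by (rule quiver_of_not_drawable[of "[0, 3, 4]" "[1, 2, 5]"])
      (simp_all add: quiver_B_def opposite_def quivers_ACD verts_quiver_of arrows_quiver_of arrows_A_def)
  show "\<not> drawable_on quiver_C (closed_surface 0)"
    by (rule quiver_of_not_drawable[of "[0, 3, 4]" "[1, 2, 5]"])
      (simp_all add: quivers_ACD verts_quiver_of arrows_quiver_of arrows_C_def)
  show "\<not> drawable_on quiver_D (closed_surface 0)"
    by (rule quiver_of_not_drawable[of "[1, 2, 3]" "[4, 5, 6]"])
      (simp_all add: quivers_ACD verts_quiver_of arrows_quiver_of arrows_D_def)
qed

lemma mutation_equivalent_by_list:
  assumes "list_all (\<lambda>i. list_all (\<lambda>j. arrows R (p ! i) (p ! j) =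
      arrows (fold mutate ks (quiver_of n as)) i j) [0..<n]) [0..<n]"
    and "set ks \<subseteq> {..<n}" "length p = n" "set p = {..<n}" "verts R = {..<n}"
  shows "mutation_equivalent (quiver_of n as) R"
proof -
  have "verts (fold mutate ks Q) = verts Q" for Q :: "nat quiver"
    by (induction ks arbitrary: Q) (simp_all add: verts_mutate)
  then show ?thesis
    unfolding mutation_equivalent_def
    using assms by (intro exI[of _ ks] conjI quiver_iso_by_list[of _ n _ p]) (auto simp: verts_quiver_of)
qed

lemma ABC_in_X6: "quiver_A \<in> mutation_class X6" "quiver_B \<in> mutation_class X6" "quiver_C \<in> mutation_class X6"
  and D_in_X7: "quiver_D \<in> mutation_class X7"
proof -
  have i: "quiver_of 6 (X_block 0 1 2 @ X_block 0 3 4 @ [(0,5)]) \<in> initial_quivers X6"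
    "quiver_of 6 (X_block 0 1 2 @ X_block 0 3 4 @ [(5,0)]) \<in> initial_quivers X6"
    "quiver_of 7 (X_block 0 1 2 @ X_block 0 3 4 @ X_block 0 5 6) \<in> initial_quivers X7"
    using mem_quivers_with[of "[(0,5)]" "[(0,5)]" 6 "X_block 0 1 2 @ X_block 0 3 4"]
      mem_quivers_with[of "[(5,0)]" "[(0,5)]" 6 "X_block 0 1 2 @ X_block 0 3 4"]
      mem_quivers_with[of "[]" "[]" 7 "X_block 0 1 2 @ X_block 0 3 4 @ X_block 0 5 6"]
    by (simp_all add: in_orientations)
  have "mutation_equivalent (quiver_of 6 (X_block 0 1 2 @ X_block 0 3 4 @ [(0,5)])) quiver_A"
    by (rule mutation_equivalent_by_list[of _ "[0, 1, 3, 2, 4, 5]" "[0]"], code_simp)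
      (auto simp: quivers_ACD verts_quiver_of)
  then show "quiver_A \<in> mutation_class X6"
    using i(1) cluster_ACD unfolding mutation_class_def by blast
  have "mutation_equivalent (quiver_of 6 (X_block 0 1 2 @ X_block 0 3 4 @ [(5,0)])) quiver_B"
    by (rule mutation_equivalent_by_list[of _ "[0, 3, 1, 4, 2, 5]" "[0]"], code_simp)
      (auto simp: quiver_B_def opposite_def quivers_ACD verts_quiver_of)
  then show "quiver_B \<in> mutation_class X6"
    using i(2) cluster_ACD unfolding mutation_class_def by blast
  have "mutation_equivalent (quiver_of 6 (X_block 0 1 2 @ X_block 0 3 4 @ [(0,5)])) quiver_C"
    by (rule mutation_equivalent_by_list[of _ "[0, 1, 3, 2, 4, 5]" "[0, 5]"], code_simp)
      (auto simp: quivers_ACD verts_quiver_of)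
  then show "quiver_C \<in> mutation_class X6"
    using i(1) cluster_ACD unfolding mutation_class_def by blast
  have "mutation_equivalent (quiver_of 7 (X_block 0 1 2 @ X_block 0 3 4 @ X_block 0 5 6)) quiver_D"
    by (rule mutation_equivalent_by_list[of _ "[0, 1, 4, 2, 5, 3, 6]" "[0]"], code_simp)
      (auto simp: quivers_ACD verts_quiver_of)
  then show "quiver_D \<in> mutation_class X7"
    using i(3) cluster_ACD unfolding mutation_class_def by blast
qed

text \<open>
  The pair of in-degree and out-degree of a vertex, counting neighbours, tells the three quivers of
  class \<open>X6\<close> apart.
\<close>

definition has_vertex :: "nat \<Rightarrow> nat \<Rightarrow> 'a quiver \<Rightarrow> bool" where
  "has_vertex m n Q \<longleftrightarrow>
     (\<exists>v\<in>verts Q. card {i \<in> verts Q. 0 < arrows Q i v} = m \<and> card {i \<in> verts Q. 0 < arrows Q v i} = n)"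

lemma has_vertex_iso:
  assumes iso: "Q \<cong>\<^sub>q R" and h: "has_vertex m n Q"
  shows "has_vertex m n R"
proof -
  obtain h where h: "bij_betw h (verts Q) (verts R)"
    and ar: "\<forall>i\<in>verts Q. \<forall>j\<in>verts Q. arrows R (h i) (h j) = arrows Q i j"
    using iso unfolding quiver_iso_def by blast
  obtain v where v: "v \<in> verts Q" "card {i \<in> verts Q. 0 < arrows Q i v} = m" "card {i \<in> verts Q. 0 < arrows Q v i} = n"
    using \<open>has_vertex m n Q\<close> unfolding has_vertex_def by blast
  have inj: "inj_on h (verts Q)" and im: "h ` verts Q = verts R" using h unfolding bij_betw_def by auto
  have "{i \<in> verts R. 0 < arrows R i (h v)} = h ` {i \<in> verts Q. 0 < arrows Q i v}"
    "{i \<in> verts R. 0 < arrows R (h v) i} = h ` {i \<in> verts Q. 0 < arrows Q v i}"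
    using ar v(1) unfolding im[symmetric] by auto
  moreover have "inj_on h {i \<in> verts Q. P i}" for P
    by (rule inj_on_subset[OF inj]) auto
  ultimately have "card {i \<in> verts R. 0 < arrows R i (h v)} = m" "card {i \<in> verts R. 0 < arrows R (h v) i} = n"
    using v(2,3) by (simp_all add: card_image)
  then show ?thesis
    unfolding has_vertex_def using v(1) im by blast
qed

lemma card_filter: "card {i \<in> {..<n}. P i} = length (filter P [0..<n])"
proof -
  have "{i \<in> {..<n}. P i} = set (filter P [0..<n])" by auto
  then show ?thesis by (metis distinct_card distinct_filter distinct_upt)
qed

lemma has_vertex_list:
  assumes "verts Q = {..<k}"
  shows "has_vertex m n Q \<longleftrightarrow>
     (\<exists>v\<in>set [0..<k]. length (filter (\<lambda>i. 0 < arrows Q i v) [0..<k]) = m \<and>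
        length (filter (\<lambda>i. 0 < arrows Q v i) [0..<k]) = n)"
  unfolding has_vertex_def assms card_filter by auto

lemma vertices_ABC:
  "has_vertex 3 2 quiver_A" "\<not> has_vertex 3 2 quiver_B" "\<not> has_vertex 3 2 quiver_C"
  "has_vertex 2 3 quiver_B" "\<not> has_vertex 2 3 quiver_C"
  by (simp_all add: has_vertex_list[of _ 6] quiver_B_def opposite_def quivers_ACD verts_quiver_of
      arrows_quiver_of arrows_A_def arrows_C_def upt_rec)

lemma not_iso_ABCD: "\<not> quiver_A \<cong>\<^sub>q quiver_B" "\<not> quiver_A \<cong>\<^sub>q quiver_C" "\<not> quiver_B \<cong>\<^sub>q quiver_C"
  using has_vertex_iso vertices_ABC by blast+

lemma card_verts_ABCD: "card (verts quiver_A) = 6" "card (verts quiver_B) = 6" "card (verts quiver_C) = 6"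
  "card (verts quiver_D) = 7"
  by (simp_all add: quiver_B_def opposite_def quivers_ACD verts_quiver_of)

lemma card_verts_iso: "Q \<cong>\<^sub>q R \<Longrightarrow> card (verts Q) = card (verts R)"
  unfolding quiver_iso_def using bij_betw_same_card by blast

theorem proposition3p1:
  shows "card (nonplanar_exceptional // iso_rel) = 4
    \<and> (\<forall>Q \<in> nonplanar_exceptional. genus Q = 1)
    \<and> card ((nonplanar_exceptional \<inter> mutation_class X6) // iso_rel) = 3
    \<and> card ((nonplanar_exceptional \<inter> mutation_class X7) // iso_rel) = 1
    \<and> nonplanar_exceptional // iso_rel =
        {iso_class quiver_A, iso_class quiver_B, iso_class quiver_C, iso_class quiver_D}
    \<and> {quiver_A, quiver_B, quiver_C} \<subseteq> mutation_class X6
    \<and> quiver_D \<in> mutation_class X7"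
proof -
  have cl: "cluster_quiver Q" if "Q \<in> nonplanar_exceptional" for Q
    using that unfolding nonplanar_exceptional_def mutation_class_def by blast
  have not0: "\<not> drawable_on Q (closed_surface 0)" if "Q \<in> nonplanar_exceptional" for Q
    using that genus_0[of Q] unfolding nonplanar_exceptional_def planar_def by auto
  have X6: "Q \<cong>\<^sub>q quiver_A \<or> Q \<cong>\<^sub>q quiver_B \<or> Q \<cong>\<^sub>q quiver_C"
    if "Q \<in> nonplanar_exceptional" "Q \<in> mutation_class X6" for Q
    using X6_class_cases[OF that(2)] not0[OF that(1)] by blast
  have X7: "Q \<cong>\<^sub>q quiver_D" if "Q \<in> nonplanar_exceptional" "Q \<in> mutation_class X7" for Q
    using X7_class_cases[OF that(2)] not0[OF that(1)] by blast
  have XX: "Q \<in> mutation_class X6 \<or> Q \<in> mutation_class X7" if Q: "Q \<in> nonplanar_exceptional" for Q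
  proof -
    obtain T where "Q \<in> mutation_class T" using Q unfolding nonplanar_exceptional_def by blast
    then show ?thesis using E_class_drawable[of T Q] not0[OF Q] by (cases "T \<in> {X6, X7}") auto
  qed
  have torus: "drawable_on R (closed_surface 1)" if "cluster_quiver R" "card (verts R) = 6 \<or> card (verts R) = 7"
    for R :: "nat quiver"
    using drawable_on_torus[OF that(1)] that(2) by auto
  have genus: "genus Q = 1" if Q: "Q \<in> nonplanar_exceptional" for Q
  proof (rule genus_1[OF torus[OF cl[OF Q]] not0[OF Q]])
    show "card (verts Q) = 6 \<or> card (verts Q) = 7"
      using XX[OF Q] X6[OF Q] X7[OF Q] card_verts_iso card_verts_ABCD by metis
  qed
  have ne: "quiver_A \<in> nonplanar_exceptional" "quiver_B \<in> nonplanar_exceptional"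
    "quiver_C \<in> nonplanar_exceptional" "quiver_D \<in> nonplanar_exceptional"
    using ABC_in_X6 D_in_X7 genus_1[OF torus] nondrawable_ABCD cluster_ACD card_verts_ABCD
    unfolding nonplanar_exceptional_def planar_def by auto
  have quot: "A // iso_rel = iso_class ` A" for A
    unfolding quotient_def iso_class_def by auto
  have cls: "iso_class Q = iso_class R" if "Q \<in> nonplanar_exceptional" "Q \<cong>\<^sub>q R" "cluster_quiver R" for Q R
    using iso_class_eq[OF cl[OF that(1)] that(3,2)] .
  have D7: "quiver_D \<notin> mutation_class X6"
    using X6[OF ne(4)] card_verts_iso card_verts_ABCD by force
  have ABC7: "R \<notin> mutation_class X7" if "R \<in> nonplanar_exceptional" "card (verts R) = 6" for R
    using X7[OF that(1)] that(2) card_verts_iso card_verts_ABCD by force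
  have q6: "(nonplanar_exceptional \<inter> mutation_class X6) // iso_rel =
      {iso_class quiver_A, iso_class quiver_B, iso_class quiver_C}"
  proof
    show "(nonplanar_exceptional \<inter> mutation_class X6) // iso_rel \<subseteq>
      {iso_class quiver_A, iso_class quiver_B, iso_class quiver_C}"
      unfolding quot using X6 cls cluster_ACD by blast
    show "{iso_class quiver_A, iso_class quiver_B, iso_class quiver_C} \<subseteq>
      (nonplanar_exceptional \<inter> mutation_class X6) // iso_rel"
      unfolding quot using ne ABC_in_X6 by blast
  qed
  have q7: "(nonplanar_exceptional \<inter> mutation_class X7) // iso_rel = {iso_class quiver_D}"
  proof
    show "(nonplanar_exceptional \<inter> mutation_class X7) // iso_rel \<subseteq> {iso_class quiver_D}"
      unfolding quot using X7 cls cluster_ACD by blast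
    show "{iso_class quiver_D} \<subseteq> (nonplanar_exceptional \<inter> mutation_class X7) // iso_rel"
      unfolding quot using ne D_in_X7 by blast
  qed
  have q: "nonplanar_exceptional // iso_rel =
      {iso_class quiver_A, iso_class quiver_B, iso_class quiver_C, iso_class quiver_D}"
  proof -
    have "nonplanar_exceptional =
        nonplanar_exceptional \<inter> mutation_class X6 \<union> nonplanar_exceptional \<inter> mutation_class X7"
      using XX by blast
    then have "nonplanar_exceptional // iso_rel =
        (nonplanar_exceptional \<inter> mutation_class X6) // iso_rel \<union>
        (nonplanar_exceptional \<inter> mutation_class X7) // iso_rel"
      unfolding quot by (metis image_Un)
    then show ?thesis unfolding q6 q7 by auto
  qed
  have d: "iso_class quiver_A \<noteq> iso_class quiver_B" "iso_class quiver_A \<noteq> iso_class quiver_C"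
    "iso_class quiver_B \<noteq> iso_class quiver_C"
    using iso_class_neq cluster_ACD not_iso_ABCD by blast+
  have dD: "iso_class R \<noteq> iso_class quiver_D" if "cluster_quiver R" "card (verts R) = 6" for R
    using iso_class_neq[OF that(1) cluster_ACD(4)] card_verts_iso card_verts_ABCD(4) that(2) by fastforce
  have "card (nonplanar_exceptional // iso_rel) = 4"
    unfolding q using d dD cluster_ACD card_verts_ABCD by simp
  moreover have "card ((nonplanar_exceptional \<inter> mutation_class X6) // iso_rel) = 3"
    unfolding q6 using d by simp
  ultimately show ?thesis
    using genus q7 q ABC_in_X6 D_in_X7 by simp
qed

end
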